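(* Let $\epsilon,\epsilon',\delta>0$, $k=\lceil\log_{1.5}(1/\epsilon)\rceil$ and $r=\tfrac{2k}{k+1}\in[1,2)$. Let $O^{(\mathrm{unk})}=\sum_{P\in\{I,X,Y,Z\}^{\otimes n}}\alpha_P P$ be an unknown $n$-qubit observable and $\mathcal{D}$ an arbitrary (unknown) distribution over $n$-qubit states that is invariant under single-qubit Clifford gates. From training data $\{\rho_\ell,\mathrm{tr}(O^{(\mathrm{unk})}\rho_\ell)\}_{\ell=1}^N$ of size $$N=\log(n/\delta)\,\min\left(2^{\mathcal{O}\left(\log(\frac1\epsilon)\left(\log\log(\frac1\epsilon)+\log(\frac1{\epsilon'})\right)\right)},\,2^{\mathcal{O}(\log(\frac1\epsilon)\log(n))}\right),$$ where the $\rho_\ell$ are sampled independently from $\mathcal{D}$, we can learn a function $h(\rho)$ such that $$\mathbb{E}_{\rho\sim\mathcal{D}}\left|h(\rho)-\mathrm{tr}(O^{(\mathrm{unk})}\rho)\right|^2\le(\epsilon+\epsilon')\,\|O^{(\mathrm{unk})}\|^2+\epsilon'\,\|O^{(\mathrm{unk},k)}\|^r\,\|O^{(\mathrm{unk})}\|^{2-r}$$ with probability at least $1-\delta$. The training and prediction time of $h(\rho)$ are $\mathcal{O}(Nn^k)$.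
   Context: $\{I,X,Y,Z\}^{\otimes n}$ is the set of $n$-qubit Pauli observables $P=P_1\otimes\cdots\otimes P_n$; $|P|$ is the number of $i$ with $P_i\neq I$. $\|\cdot\|$ is the spectral norm. The weight-$k$ truncation of $O^{(\mathrm{unk})}$ is $O^{(\mathrm{unk},k)}=\sum_{P:|P|\le k}\alpha_P P$. $\mathcal{D}$ is invariant under single-qubit Clifford gates if for every single-qubit Clifford gate $U$ acting on any one qubit, $U\rho U^\dagger$ has the same distribution as $\rho\sim\mathcal{D}$. The algorithm does not know $O^{(\mathrm{unk})}$, its norm, or $\mathcal{D}$; it accesses states (training states and the state $\rho$ on which it predicts) through the values $\mathrm{tr}(P\rho)$ for low-weight Pauli observables $P$. The $\mathcal{O}(\cdot)$ notation is asymptotic, for $\epsilon,\epsilon'$ small (bounded away from $1$, e.g. at most $1/4$) and $n\ge2$. *)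

theory Defs
  imports
    "HOL-Probability.Probability"
    "Jordan_Normal_Form.Schur_Decomposition"
begin

section \<open>Matrices\<close>

definition mtrace :: "complex mat \<Rightarrow> complex" where
  "mtrace A = (\<Sum>i<dim_row A. A $$ (i, i))"

definition hermitian_mat :: "complex mat \<Rightarrow> bool" where
  "hermitian_mat A \<longleftrightarrow> mat_adjoint A = A"

definition unitary_mat :: "complex mat \<Rightarrow> bool" where
  "unitary_mat U \<longleftrightarrow> U * mat_adjoint U = 1\<^sub>m (dim_row U) \<and> mat_adjoint U * U = 1\<^sub>m (dim_row U)"

definition euclidean_norm :: "complex vec \<Rightarrow> real" where
  "euclidean_norm v = sqrt (Re (v \<bullet>c v))"

definition spectral_norm :: "complex mat \<Rightarrow> real" where
  "spectral_norm A =
     (SUP v\<in>{v \<in> carrier_vec (dim_col A). euclidean_norm v = 1}. euclidean_norm (A *\<^sub>v v))"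

definition kronecker :: "complex mat \<Rightarrow> complex mat \<Rightarrow> complex mat" where
  "kronecker A B = mat (dim_row A * dim_row B) (dim_col A * dim_col B)
     (\<lambda>(i, j). A $$ (i div dim_row B, j div dim_col B) * B $$ (i mod dim_row B, j mod dim_col B))"

definition tensor_prod :: "complex mat list \<Rightarrow> complex mat" where
  "tensor_prod As = foldr kronecker As (1\<^sub>m 1)"

section \<open>Pauli observables\<close>

datatype pauli = PI | PX | PY | PZ

fun pauli1 :: "pauli \<Rightarrow> complex mat" where
  "pauli1 PI = 1\<^sub>m 2"
| "pauli1 PX = mat_of_rows_list 2 [[0, 1], [1, 0]]"
| "pauli1 PY = mat_of_rows_list 2 [[0, - \<i>], [\<i>, 0]]"
| "pauli1 PZ = mat_of_rows_list 2 [[1, 0], [0, - 1]]"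

definition pauli_strings :: "nat \<Rightarrow> pauli list set" where
  "pauli_strings n = {P. length P = n}"

definition pauli_mat :: "pauli list \<Rightarrow> complex mat" where
  "pauli_mat P = tensor_prod (map pauli1 P)"

definition pauli_weight :: "pauli list \<Rightarrow> nat" where
  "pauli_weight P = length (filter (\<lambda>p. p \<noteq> PI) P)"

definition pauli_combination :: "nat \<Rightarrow> pauli list set \<Rightarrow> (pauli list \<Rightarrow> real) \<Rightarrow> complex mat" where
  "pauli_combination n S \<alpha> =
     mat (2 ^ n) (2 ^ n) (\<lambda>ij. \<Sum>P\<in>S. complex_of_real (\<alpha> P) * pauli_mat P $$ ij)"

text \<open>
  The Pauli strings form a real basis of the Hermitian matrices, so every observable is
  \<^term>\<open>observable n \<alpha>\<close> for exactly one family of real coefficients on \<^term>\<open>pauli_strings n\<close>.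
\<close>

definition observable :: "nat \<Rightarrow> (pauli list \<Rightarrow> real) \<Rightarrow> complex mat" where
  "observable n \<alpha> = pauli_combination n (pauli_strings n) \<alpha>"

definition truncated_observable :: "nat \<Rightarrow> nat \<Rightarrow> (pauli list \<Rightarrow> real) \<Rightarrow> complex mat" where
  "truncated_observable n k \<alpha> =
     pauli_combination n {P \<in> pauli_strings n. pauli_weight P \<le> k} \<alpha>"

section \<open>Distributions over states\<close>

definition states :: "nat \<Rightarrow> complex mat set" where
  "states n = {\<rho> \<in> carrier_mat (2 ^ n) (2 ^ n).
     hermitian_mat \<rho> \<and> (\<forall>v\<in>carrier_vec (2 ^ n). 0 \<le> Re ((\<rho> *\<^sub>v v) \<bullet>c v)) \<and> mtrace \<rho> = 1}"

text \<open>
  Type \<^typ>\<open>complex mat\<close> carries no topology; this is the Borel \<open>\<sigma>\<close>-algebra that the states inherit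
  from the space of \<open>2\<^sup>n \<times> 2\<^sup>n\<close> arrays of complex numbers.
\<close>

definition state_space :: "nat \<Rightarrow> complex mat measure" where
  "state_space n = (let I = {..<2 ^ n} \<times> {..<2 ^ n} in
     vimage_algebra (states n) (\<lambda>\<rho>. \<lambda>ij\<in>I. \<rho> $$ ij) (\<Pi>\<^sub>M ij\<in>I. borel))"

definition state_distribution :: "nat \<Rightarrow> complex mat measure \<Rightarrow> bool" where
  "state_distribution n D \<longleftrightarrow> prob_space D \<and> sets D = sets (state_space n)"

text \<open>
  For a real-valued trace (a product of two Hermitian matrices), taking \<^term>\<open>Re\<close> only changes the
  type.
\<close>

definition expval :: "complex mat \<Rightarrow> complex mat \<Rightarrow> real" where
  "expval A \<rho> = Re (mtrace (A * \<rho>))"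

text \<open>The normaliser of the one-qubit Pauli group \<open>{\<i>\<^sup>m \<sigma>}\<close> in the unitary group.\<close>

definition clifford1 :: "complex mat \<Rightarrow> bool" where
  "clifford1 U \<longleftrightarrow> U \<in> carrier_mat 2 2 \<and> unitary_mat U \<and>
     (\<forall>p. \<exists>m::nat. \<exists>q. U * pauli1 p * mat_adjoint U = (\<i> ^ m) \<cdot>\<^sub>m pauli1 q)"

definition on_qubit :: "nat \<Rightarrow> nat \<Rightarrow> complex mat \<Rightarrow> complex mat" where
  "on_qubit n i U = tensor_prod ((replicate n (1\<^sub>m 2))[i := U])"

definition clifford1_invariant :: "nat \<Rightarrow> complex mat measure \<Rightarrow> bool" where
  "clifford1_invariant n D \<longleftrightarrow>
     (\<forall>i<n. \<forall>U. clifford1 U \<longrightarrow>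
        distr D D (\<lambda>\<rho>. on_qubit n i U * \<rho> * mat_adjoint (on_qubit n i U)) = D)"

section \<open>Computational model\<close>

text \<open>
  Running time is counted on a real RAM: while-programs over countably many arrays of natural
  numbers and countably many arrays of reals, with exact real arithmetic but no rounding
  instruction. Every executed assignment and every evaluated test costs one step. The expressions in
  a program are fixed with the program, hence each step performs a number of primitive operations
  that is bounded by a constant of the program.

  The only access to states is through the expression \<open>RPauli a l\<close>: its value is the expectation
  value, in state number \<open>l\<close>, of the Pauli string whose letter at qubit \<open>i\<close> is coded by cell \<open>i\<close> of
  the natural-number array \<open>a\<close>. So the array acts as a query tape. The expression \<open>RLabel l\<close> reads the
  label of state number \<open>l\<close>.
\<close>

datatype nexp =
    NConst nat
  | NGet nat nexp
  | NAdd nexp nexp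
  | NSub nexp nexp

datatype rexp =
    ROfNat nexp
  | RGet nat nexp
  | RAdd rexp rexp
  | RSub rexp rexp
  | RMul rexp rexp
  | RDiv rexp rexp
  | RLabel nexp
  | RPauli nat nexp

datatype bexp =
    NLess nexp nexp
  | RLess rexp rexp
  | BNot bexp
  | BAnd bexp bexp

datatype com =
    Skip
  | NSet nat nexp nexp
  | RSet nat nexp rexp
  | Seq com com
  | Cond bexp com com
  | While bexp com

record memory =
  narr :: "nat \<Rightarrow> nat \<Rightarrow> nat"
  rarr :: "nat \<Rightarrow> nat \<Rightarrow> real"

record environment =
  num_qubits :: nat
  label_of :: "nat \<Rightarrow> real"
  pauli_of :: "nat \<Rightarrow> pauli list \<Rightarrow> real"

definition decode_pauli :: "nat \<Rightarrow> pauli" where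
  "decode_pauli c = (if c = 0 then PI else if c = 1 then PX else if c = 2 then PY else PZ)"

fun nval :: "memory \<Rightarrow> nexp \<Rightarrow> nat" where
  "nval s (NConst c) = c"
| "nval s (NGet a e) = narr s a (nval s e)"
| "nval s (NAdd e f) = nval s e + nval s f"
| "nval s (NSub e f) = nval s e - nval s f"

fun rval :: "environment \<Rightarrow> memory \<Rightarrow> rexp \<Rightarrow> real" where
  "rval E s (ROfNat e) = real (nval s e)"
| "rval E s (RGet a e) = rarr s a (nval s e)"
| "rval E s (RAdd x y) = rval E s x + rval E s y"
| "rval E s (RSub x y) = rval E s x - rval E s y"
| "rval E s (RMul x y) = rval E s x * rval E s y"
| "rval E s (RDiv x y) = rval E s x / rval E s y"
| "rval E s (RLabel e) = label_of E (nval s e)"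
| "rval E s (RPauli a e) =
     pauli_of E (nval s e) (map (\<lambda>i. decode_pauli (narr s a i)) [0..<num_qubits E])"

fun bval :: "environment \<Rightarrow> memory \<Rightarrow> bexp \<Rightarrow> bool" where
  "bval E s (NLess e f) \<longleftrightarrow> nval s e < nval s f"
| "bval E s (RLess x y) \<longleftrightarrow> rval E s x < rval E s y"
| "bval E s (BNot b) \<longleftrightarrow> \<not> bval E s b"
| "bval E s (BAnd b c) \<longleftrightarrow> bval E s b \<and> bval E s c"

text \<open>\<open>exec E c s t s'\<close>: from memory \<open>s\<close>, program \<open>c\<close> halts after \<open>t\<close> steps in memory \<open>s'\<close>.\<close>

inductive exec :: "environment \<Rightarrow> com \<Rightarrow> memory \<Rightarrow> nat \<Rightarrow> memory \<Rightarrow> bool" for E where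
  Skip: "exec E Skip s 0 s"
| NSet: "exec E (NSet a i e) s 1
     (s\<lparr>narr := (narr s)(a := (narr s a)(nval s i := nval s e))\<rparr>)"
| RSet: "exec E (RSet a i e) s 1
     (s\<lparr>rarr := (rarr s)(a := (rarr s a)(nval s i := rval E s e))\<rparr>)"
| Seq: "exec E c s t s' \<Longrightarrow> exec E d s' u s'' \<Longrightarrow> exec E (Seq c d) s (t + u) s''"
| CondTrue: "bval E s b \<Longrightarrow> exec E c s t s' \<Longrightarrow> exec E (Cond b c d) s (1 + t) s'"
| CondFalse: "\<not> bval E s b \<Longrightarrow> exec E d s t s' \<Longrightarrow> exec E (Cond b c d) s (1 + t) s'"
| WhileFalse: "\<not> bval E s b \<Longrightarrow> exec E (While b c) s 1 s"
| WhileTrue: "bval E s b \<Longrightarrow> exec E c s t s' \<Longrightarrow> exec E (While b c) s' u s'' \<Longrightarrow>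
     exec E (While b c) s (1 + t + u) s''"

section \<open>Learning from labelled states\<close>

text \<open>
  Only expectation values of Pauli observables of weight at most \<open>k\<close> are accessible; all other
  queries return \<open>0\<close>.
\<close>

definition training_env :: "nat \<Rightarrow> nat \<Rightarrow> complex mat \<Rightarrow> nat \<Rightarrow> (nat \<Rightarrow> complex mat) \<Rightarrow> environment"
where
  "training_env n k Obs N \<omega> =
     \<lparr>num_qubits = n,
      label_of = (\<lambda>l. if l < N then expval Obs (\<omega> l) else 0),
      pauli_of = (\<lambda>l P. if l < N \<and> pauli_weight P \<le> k then expval (pauli_mat P) (\<omega> l) else 0)\<rparr>"

definition prediction_env :: "nat \<Rightarrow> nat \<Rightarrow> complex mat \<Rightarrow> environment" where
  "prediction_env n k \<rho> =
     \<lparr>num_qubits = n,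
      label_of = (\<lambda>l. 0),
      pauli_of = (\<lambda>l P. if pauli_weight P \<le> k then expval (pauli_mat P) \<rho> else 0)\<rparr>"

definition initial_memory :: "nat \<Rightarrow> nat \<Rightarrow> real \<Rightarrow> real \<Rightarrow> real \<Rightarrow> memory" where
  "initial_memory n N \<epsilon> \<epsilon>' \<delta> =
     \<lparr>narr = (\<lambda>a i. if a = 0 then (if i = 0 then n else if i = 1 then N else 0) else 0),
      rarr = (\<lambda>a i. if a = 0
        then (if i = 0 then \<epsilon> else if i = 1 then \<epsilon>' else if i = 2 then \<delta> else 0) else 0)\<rparr>"

definition output_of :: "memory \<Rightarrow> real" where
  "output_of s = rarr s 0 0"

text \<open>
  \<open>h\<close> is the function learned from the training states \<open>\<omega> 0, \<dots>, \<omega> (N - 1)\<close>: the memory left by the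
  training program is the learned model, from which the prediction program computes \<open>h \<rho>\<close>; each of
  the two runs takes at most \<open>T\<close> steps.
\<close>

definition learns ::
  "com \<Rightarrow> com \<Rightarrow> nat \<Rightarrow> nat \<Rightarrow> nat \<Rightarrow> real \<Rightarrow> real \<Rightarrow> real \<Rightarrow> complex mat \<Rightarrow> (nat \<Rightarrow> complex mat) \<Rightarrow>
   real \<Rightarrow> (complex mat \<Rightarrow> real) \<Rightarrow> bool" where
  "learns train pred n k N \<epsilon> \<epsilon>' \<delta> Obs \<omega> T h \<longleftrightarrow>
     (\<exists>t model. exec (training_env n k Obs N \<omega>) train (initial_memory n N \<epsilon> \<epsilon>' \<delta>) t model \<and>
        real t \<le> T \<and>
        (\<forall>\<rho>\<in>states n. \<exists>u s. exec (prediction_env n k \<rho>) pred model u s \<and>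
           real u \<le> T \<and> output_of s = h \<rho>))"

definition cutoff_weight :: "real \<Rightarrow> nat" where
  "cutoff_weight \<epsilon> = nat \<lceil>log 1.5 (1 / \<epsilon>)\<rceil>"

text \<open>
  \<open>C1\<close> and \<open>C2\<close> are the constants hidden in the two exponents. The size is rounded up to a positive
  integer; the maximum with \<open>1\<close> matters only for \<open>\<delta> > 1\<close>, where the logarithm may be negative.
\<close>

definition sample_size :: "real \<Rightarrow> real \<Rightarrow> nat \<Rightarrow> real \<Rightarrow> real \<Rightarrow> real \<Rightarrow> nat" where
  "sample_size C1 C2 n \<epsilon> \<epsilon>' \<delta> =
     max 1 (nat \<lceil>ln (real n / \<delta>) *
       min (2 powr (C1 * (ln (1 / \<epsilon>) * (ln (ln (1 / \<epsilon>)) + ln (1 / \<epsilon>')))))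
           (2 powr (C2 * (ln (1 / \<epsilon>) * ln (real n))))\<rceil>)"

end

theory Submission
  imports Defs
begin

text \<open>
  For an invariant distribution, the expectation values of distinct Pauli strings are uncorrelated, and
  the second moment \<open>x\<^sub>P\<close> of string \<open>P\<close> depends only on its support. Since a state on \<open>m\<close> qubits has
  purity at most \<open>1\<close>, this moment is at most \<open>(2/3)\<^sup>m\<close> with \<open>m = \<bar>P\<bar>\<close>. Hence a combination of Pauli strings
  with coefficients \<open>c\<^sub>P\<close> has error \<open>\<Sum> (c\<^sub>P - \<alpha>\<^sub>P)\<^sup>2 x\<^sub>P\<close>, and strings of weight above \<open>K\<close> or
  with small \<open>x\<^sub>P\<close> may be ignored because \<open>\<Sum> \<alpha>\<^sub>P\<^sup>2 \<le> \<parallel>O\<parallel>\<^sup>2\<close>.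

  For the others, the learner estimates \<open>x\<^sub>P\<close> and \<open>\<alpha>\<^sub>P x\<^sub>P\<close> by sample averages, whose accuracy is
  controlled by Hoeffding's inequality, and keeps the \<open>J\<close> strings for which the latter is largest, so that
  the discarded coefficients have size \<open>O(J\<^bsup>-1/2\<^esup>)\<close>. That the sum of their squares is small is where the
  norm of the truncation enters: evaluated on product states whose Bloch vectors have entries
  \<open>\<plusminus>1/\<surd>3\<close>, the truncation is a bounded polynomial of degree \<open>k\<close> on the cube. The sum of the absolute
  values of its partial derivatives at any point is a linear coefficient of a bounded univariate
  polynomial, so by hypercontractivity the square roots of the influences have a bounded sum, and all but few
  letters have negligible influence. Few letters form few strings of weight at most \<open>K\<close>.

  The strings are enumerated by breadth-first search; each one is stored as a pointer to the string
  obtained by deleting its last letter, so that it can be written to the query tape in \<open>O(K)\<close> steps.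
\<close>

text \<open>The learner does not know the norm of the observable, so coefficients cannot be compared
  with a threshold; keeping a fixed number \<open>J\<close> of strings makes the error scale with
  the norm by itself. The weight cutoff is
  \<open>K = cutoff_weight (max \<epsilon> \<epsilon>')\<close> rather than \<open>k\<close>.
  Heavier strings then cost at most \<open>max \<epsilon> \<epsilon>'\<close> times the squared
  norm, which \<open>\<epsilon> + \<epsilon>'\<close> covers, while the exponent of the cap
  \<open>(1/(\<epsilon> \<epsilon>'))^(25 (K+1))\<close> on \<open>J\<close> yields the product of
  the two logarithms. With \<open>k\<close> it would contain the square of
  \<open>ln (1/\<epsilon>)\<close>, which the sample size does not allow for large \<epsilon>'. The
  influences are still those of the truncation at \<open>k\<close>; their loss \<open>26^k\<close>
  is only polynomial in \<open>1/\<epsilon>\<close>. The exponent \<open>r\<close> arises from the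
  influence threshold: it is proportional to the power \<open>2/(k+1)\<close> of a norm ratio, for
  which letters of small influence and the few remaining strings obey the same bound.\<close>

section \<open>Adjoints and traces of matrix products\<close>

lemma dim_mat_adjoint [simp]:
  "dim_row (mat_adjoint A) = dim_col A" "dim_col (mat_adjoint A) = dim_row A"
  by (simp_all add: mat_adjoint_def)

lemma index_mat_adjoint [simp]:
  fixes A :: "complex mat"
  assumes "i < dim_col A" "j < dim_row A"
  shows "mat_adjoint A $$ (i, j) = cnj (A $$ (j, i))"
  using assms by (simp add: mat_adjoint_def mat_of_rows_def)

lemma mat_adjoint_carrier [simp]: "A \<in> carrier_mat m n \<Longrightarrow> mat_adjoint A \<in> carrier_mat n m"
  by (intro carrier_matI) auto

lemma index_mult:
  assumes "A \<in> carrier_mat n m" "B \<in> carrier_mat m l" "i < n" "j < l"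
  shows "(A * B) $$ (i, j) = (\<Sum>k<m. A $$ (i, k) * B $$ (k, j))"
  using assms by (auto simp: scalar_prod_def atLeast0LessThan intro!: sum.cong)

lemma mat_adjoint_mult:
  fixes A B :: "complex mat"
  assumes "A \<in> carrier_mat n m" "B \<in> carrier_mat m l"
  shows "mat_adjoint (A * B) = mat_adjoint B * mat_adjoint A"
proof (rule eq_matI)
  fix i j assume "i < dim_row (mat_adjoint B * mat_adjoint A)" "j < dim_col (mat_adjoint B * mat_adjoint A)"
  then have ij: "i < l" "j < n" using assms by auto
  have "mat_adjoint (A * B) $$ (i, j) = (\<Sum>k<m. cnj (A $$ (j, k) * B $$ (k, i)))"
    using ij assms by (simp add: index_mult[of A n m B l] del: index_mult_mat(1))
  also have "\<dots> = (mat_adjoint B * mat_adjoint A) $$ (i, j)"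
    using ij assms by (subst index_mult[of _ l m _ n]) (auto intro!: sum.cong simp: mult.commute)
  finally show "mat_adjoint (A * B) $$ (i, j) = (mat_adjoint B * mat_adjoint A) $$ (i, j)" .
qed (use assms in auto)

lemma mat_adjoint_adjoint [simp]: "mat_adjoint (mat_adjoint (A :: complex mat)) = A"
  by (rule eq_matI) auto

lemma mtrace_mult:
  assumes "A \<in> carrier_mat n m" "B \<in> carrier_mat m n"
  shows "mtrace (A * B) = (\<Sum>i<n. \<Sum>j<m. A $$ (i, j) * B $$ (j, i))"
proof -
  have "mtrace (A * B) = (\<Sum>i<n. (A * B) $$ (i, i))"
    using assms by (simp add: mtrace_def)
  also have "\<dots> = (\<Sum>i<n. \<Sum>j<m. A $$ (i, j) * B $$ (j, i))"
    using assms by (intro sum.cong refl index_mult[of A n m B n]) auto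
  finally show ?thesis .
qed

lemma mtrace_mult_commute:
  assumes "A \<in> carrier_mat n m" "B \<in> carrier_mat m n"
  shows "mtrace (A * B) = mtrace (B * A)"
  unfolding mtrace_mult[OF assms] mtrace_mult[OF assms(2,1)]
  by (subst sum.swap) (simp add: mult.commute)

section \<open>Tensor products\<close>

lemma dim_kronecker [simp]:
  "dim_row (kronecker A B) = dim_row A * dim_row B" "dim_col (kronecker A B) = dim_col A * dim_col B"
  by (simp_all add: kronecker_def)

lemma index_kronecker:
  assumes "i < dim_row A * dim_row B" "j < dim_col A * dim_col B"
  shows "kronecker A B $$ (i, j) =
    A $$ (i div dim_row B, j div dim_col B) * B $$ (i mod dim_row B, j mod dim_col B)"
  using assms by (simp add: kronecker_def)

lemma kronecker_carrier [simp]: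
  "A \<in> carrier_mat a b \<Longrightarrow> B \<in> carrier_mat c d \<Longrightarrow> kronecker A B \<in> carrier_mat (a * c) (b * d)"
  by (intro carrier_matI) auto

lemma div_mod_less_mult: "i < a * b \<Longrightarrow> i div b < a \<and> i mod b < (b::nat)"
  by (metis less_mult_imp_div_less mod_less_divisor mult_0_right not_less_zero zero_less_iff_neq_zero)

lemma kronecker_mult:
  assumes "A \<in> carrier_mat a a" "B \<in> carrier_mat b b" "C \<in> carrier_mat a a" "D \<in> carrier_mat b b"
  shows "kronecker A B * kronecker C D = kronecker (A * C) (B * D)"
proof (rule eq_matI)
  fix i j assume "i < dim_row (kronecker (A * C) (B * D))" "j < dim_col (kronecker (A * C) (B * D))"
  then have ij: "i < a * b" "j < a * b" using assms by auto
  note i' = div_mod_less_mult[OF ij(1)] note j' = div_mod_less_mult[OF ij(2)]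
  have "(kronecker A B * kronecker C D) $$ (i, j) =
      (\<Sum>k<a * b. kronecker A B $$ (i, k) * kronecker C D $$ (k, j))"
    using ij assms by (intro index_mult[of _ "a * b" "a * b" _ "a * b"]) auto
  also have "\<dots> = (\<Sum>k<a. \<Sum>l<b. kronecker A B $$ (i, l + k * b) * kronecker C D $$ (l + k * b, j))"
    by (rule sum_mult_product)
  also have "\<dots> = (\<Sum>k<a. \<Sum>l<b. (A $$ (i div b, k) * C $$ (k, j div b)) * (B $$ (i mod b, l) * D $$ (l, j mod b)))"
  proof (intro sum.cong refl)
    fix k l assume kl: "k \<in> {..<a}" "l \<in> {..<b}"
    then have "l + k * b < Suc k * b" by simp
    also have "Suc k * b \<le> a * b" using kl by (intro mult_right_mono) auto
    finally have "l + k * b < a * b" .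
    then show "kronecker A B $$ (i, l + k * b) * kronecker C D $$ (l + k * b, j) =
       (A $$ (i div b, k) * C $$ (k, j div b)) * (B $$ (i mod b, l) * D $$ (l, j mod b))"
      using assms ij kl by (simp add: index_kronecker)
  qed
  also have "\<dots> = (A * C) $$ (i div b, j div b) * (B * D) $$ (i mod b, j mod b)"
    using assms i' j' index_mult[of A a a C a "i div b" "j div b"] index_mult[of B b b D b "i mod b" "j mod b"]
    by (simp add: sum_product del: index_mult_mat)
  also have "\<dots> = kronecker (A * C) (B * D) $$ (i, j)"
    using assms ij by (simp add: index_kronecker)
  finally show "(kronecker A B * kronecker C D) $$ (i, j) = kronecker (A * C) (B * D) $$ (i, j)" .
qed (use assms in auto)

lemma kronecker_adjoint: "mat_adjoint (kronecker A B) = kronecker (mat_adjoint A) (mat_adjoint B)"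
proof (rule eq_matI)
  fix i j assume "i < dim_row (kronecker (mat_adjoint A) (mat_adjoint B))"
    "j < dim_col (kronecker (mat_adjoint A) (mat_adjoint B))"
  then have "i < dim_col A * dim_col B" "j < dim_row A * dim_row B" by auto
  then show "mat_adjoint (kronecker A B) $$ (i, j) = kronecker (mat_adjoint A) (mat_adjoint B) $$ (i, j)"
    using div_mod_less_mult[of i "dim_col A" "dim_col B"] div_mod_less_mult[of j "dim_row A" "dim_row B"]
    by (simp add: index_kronecker)
qed auto

lemma mtrace_kronecker:
  assumes "A \<in> carrier_mat a a" "B \<in> carrier_mat b b"
  shows "mtrace (kronecker A B) = mtrace A * mtrace B"
proof -
  have "mtrace (kronecker A B) = (\<Sum>k<a. \<Sum>l<b. kronecker A B $$ (l + k * b, l + k * b))"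
    using assms by (simp add: mtrace_def sum_mult_product)
  also have "\<dots> = (\<Sum>k<a. \<Sum>l<b. A $$ (k, k) * B $$ (l, l))"
  proof (intro sum.cong refl)
    fix k l assume kl: "k \<in> {..<a}" "l \<in> {..<b}"
    then have "l + k * b < Suc k * b" by simp
    also have "Suc k * b \<le> a * b" using kl by (intro mult_right_mono) auto
    finally have "l + k * b < a * b" .
    then show "kronecker A B $$ (l + k * b, l + k * b) = A $$ (k, k) * B $$ (l, l)"
      using assms kl by (simp add: index_kronecker)
  qed
  finally show ?thesis using assms by (simp add: mtrace_def sum_product)
qed

lemma kronecker_smult_left: "kronecker (c \<cdot>\<^sub>m A) B = c \<cdot>\<^sub>m kronecker A B"
  by (rule eq_matI) (use div_mod_less_mult in \<open>auto simp: index_kronecker\<close>)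

lemma kronecker_smult_right: "kronecker A (c \<cdot>\<^sub>m B) = c \<cdot>\<^sub>m kronecker A B"
proof (rule eq_matI)
  fix i j assume "i < dim_row (c \<cdot>\<^sub>m kronecker A B)" "j < dim_col (c \<cdot>\<^sub>m kronecker A B)"
  then have "i < dim_row A * dim_row B" "j < dim_col A * dim_col B" by auto
  then show "kronecker A (c \<cdot>\<^sub>m B) $$ (i, j) = (c \<cdot>\<^sub>m kronecker A B) $$ (i, j)"
    using div_mod_less_mult[of i "dim_row A" "dim_row B"] div_mod_less_mult[of j "dim_col A" "dim_col B"]
    by (auto simp: index_kronecker)
qed auto

lemma kronecker_one: "kronecker (1\<^sub>m a) (1\<^sub>m b) = 1\<^sub>m (a * b)"
proof (rule eq_matI)
  fix i j assume "i < dim_row (1\<^sub>m (a * b) :: complex mat)" "j < dim_col (1\<^sub>m (a * b) :: complex mat)"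
  then have "i < a * b" "j < a * b" by auto
  moreover have "i = j \<longleftrightarrow> i div b = j div b \<and> i mod b = j mod b"
    by (metis div_mult_mod_eq)
  ultimately show "kronecker (1\<^sub>m a) (1\<^sub>m b) $$ (i, j) = 1\<^sub>m (a * b) $$ (i, j)"
    using div_mod_less_mult[of i a b] div_mod_less_mult[of j a b]
    by (auto simp: index_kronecker)
qed auto

lemma tensor_prod_simps [simp]:
  "tensor_prod [] = 1\<^sub>m 1" "tensor_prod (A # As) = kronecker A (tensor_prod As)"
  by (simp_all add: tensor_prod_def)

lemma tensor_prod_carrier:
  "set As \<subseteq> carrier_mat 2 2 \<Longrightarrow> tensor_prod As \<in> carrier_mat (2 ^ length As) (2 ^ length As)"
  by (induction As) (auto intro!: kronecker_carrier)

lemma tensor_prod_mult: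
  assumes "length As = length Bs" "set As \<subseteq> carrier_mat 2 2" "set Bs \<subseteq> carrier_mat 2 2"
  shows "tensor_prod As * tensor_prod Bs = tensor_prod (map2 (*) As Bs)"
  using assms
proof (induction As Bs rule: list_induct2)
  case (Cons A As B Bs)
  have "tensor_prod Bs \<in> carrier_mat (2 ^ length As) (2 ^ length As)"
    using Cons by (simp add: tensor_prod_carrier)
  then show ?case using Cons tensor_prod_carrier[of As]
    by (simp add: kronecker_mult[of _ 2 _ "2 ^ length As"])
qed simp

lemma tensor_prod_adjoint: "mat_adjoint (tensor_prod As) = tensor_prod (map mat_adjoint As)"
  by (induction As) (auto simp: kronecker_adjoint intro: eq_matI)

lemma mtrace_tensor_prod:
  "set As \<subseteq> carrier_mat 2 2 \<Longrightarrow> mtrace (tensor_prod As) = prod_list (map mtrace As)"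
proof (induction As)
  case (Cons A As)
  then show ?case using tensor_prod_carrier[of As]
    by (simp add: mtrace_kronecker[of _ 2 _ "2 ^ length As"])
qed (simp add: mtrace_def)

text \<open>Carries the sign that a gate on one qubit produces out of a Pauli string.\<close>

lemma tensor_prod_smult_update:
  "i < length As \<Longrightarrow> tensor_prod (As[i := c \<cdot>\<^sub>m A]) = c \<cdot>\<^sub>m tensor_prod (As[i := A])"
proof (induction As arbitrary: i)
  case (Cons B As)
  then show ?case
    by (cases i) (simp_all add: kronecker_smult_left kronecker_smult_right)
qed simp

lemma tensor_prod_one: "tensor_prod (replicate n (1\<^sub>m 2)) = 1\<^sub>m (2 ^ n)"
  by (induction n) (auto simp: kronecker_one)

section \<open>Norms\<close>

lemma cscalar_prod_self:
  "Re (v \<bullet>c v) = (\<Sum>i<dim_vec v. (cmod (v $ i))\<^sup>2)"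
  unfolding cmod_power2 by (simp add: scalar_prod_def atLeast0LessThan power2_eq_square)

lemma euclidean_norm_nonneg [simp]: "0 \<le> euclidean_norm v"
  by (simp add: euclidean_norm_def cscalar_prod_self sum_nonneg)

lemma euclidean_norm_sq: "(euclidean_norm v)\<^sup>2 = (\<Sum>i<dim_vec v. (cmod (v $ i))\<^sup>2)"
  by (simp add: euclidean_norm_def cscalar_prod_self sum_nonneg)

lemma norm_sum_prod_le:
  fixes f g :: "'a \<Rightarrow> complex"
  shows "(cmod (\<Sum>i\<in>I. f i * g i))\<^sup>2 \<le> (\<Sum>i\<in>I. (cmod (f i))\<^sup>2) * (\<Sum>i\<in>I. (cmod (g i))\<^sup>2)"
proof -
  have "cmod (\<Sum>i\<in>I. f i * g i) \<le> (\<Sum>i\<in>I. cmod (f i) * cmod (g i))"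
    by (rule order_trans[OF norm_sum]) (simp add: norm_mult)
  then have "(cmod (\<Sum>i\<in>I. f i * g i))\<^sup>2 \<le> (\<Sum>i\<in>I. cmod (f i) * cmod (g i))\<^sup>2"
    by (intro power_mono) auto
  also have "\<dots> \<le> (\<Sum>i\<in>I. (cmod (f i))\<^sup>2) * (\<Sum>i\<in>I. (cmod (g i))\<^sup>2)"
    by (rule Cauchy_Schwarz_ineq_sum)
  finally show ?thesis .
qed

text \<open>Cauchy-Schwarz in every row. This crude Frobenius bound shows that the supremum in
  \<open>spectral_norm\<close> is taken over a bounded set, and that a vector of norm zero is mapped
  to a vector of norm zero.\<close>

lemma euclidean_norm_mult_le:
  "(euclidean_norm (A *\<^sub>v v))\<^sup>2 \<le>
     (\<Sum>i<dim_row A. \<Sum>j<dim_vec v. (cmod (A $$ (i, j)))\<^sup>2) * (euclidean_norm v)\<^sup>2"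
  if "dim_vec v = dim_col A"
proof -
  have "(cmod ((A *\<^sub>v v) $ i))\<^sup>2 \<le> (\<Sum>j<dim_vec v. (cmod (A $$ (i, j)))\<^sup>2) * (euclidean_norm v)\<^sup>2"
    if "i < dim_row A" for i
    using norm_sum_prod_le[of "\<lambda>j. A $$ (i, j)" "\<lambda>j. v $ j" "{..<dim_vec v}"] that \<open>dim_vec v = dim_col A\<close>
    by (simp add: scalar_prod_def atLeast0LessThan euclidean_norm_sq)
  then show ?thesis
    unfolding euclidean_norm_sq[of "A *\<^sub>v v"] sum_distrib_right by (auto intro!: sum_mono)
qed

lemma euclidean_norm_smult: "euclidean_norm (c \<cdot>\<^sub>v v) = cmod c * euclidean_norm v"
proof -
  have "(euclidean_norm (c \<cdot>\<^sub>v v))\<^sup>2 = (cmod c * euclidean_norm v)\<^sup>2"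
    by (simp add: euclidean_norm_sq norm_mult power_mult_distrib sum_distrib_left)
  then show ?thesis by simp
qed

lemma spectral_norm_bound:
  assumes "v \<in> carrier_vec (dim_col A)"
  shows "euclidean_norm (A *\<^sub>v v) \<le> spectral_norm A * euclidean_norm v"
proof (cases "euclidean_norm v = 0")
  case True
  have "(euclidean_norm (A *\<^sub>v v))\<^sup>2 \<le> 0"
    using euclidean_norm_mult_le[of v A] assms True by simp
  then show ?thesis using True by simp
next
  case False
  define c where "c = complex_of_real (1 / euclidean_norm v)"
  define S where "S = {v \<in> carrier_vec (dim_col A). euclidean_norm v = 1}"
  have pos: "0 < euclidean_norm v" using False euclidean_norm_nonneg[of v] by linarith
  then have cS: "c \<cdot>\<^sub>v v \<in> S" and cn: "cmod c = 1 / euclidean_norm v"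
    using assms False by (auto simp: S_def euclidean_norm_smult c_def norm_divide)
  have bdd: "bdd_above ((\<lambda>v. euclidean_norm (A *\<^sub>v v)) ` S)"
  proof (intro bdd_aboveI2)
    fix v assume "v \<in> S"
    then have "(euclidean_norm (A *\<^sub>v v))\<^sup>2 \<le> (\<Sum>i<dim_row A. \<Sum>j<dim_col A. (cmod (A $$ (i, j)))\<^sup>2)"
      using euclidean_norm_mult_le[of v A] by (auto simp: S_def)
    then show "euclidean_norm (A *\<^sub>v v) \<le> sqrt (\<Sum>i<dim_row A. \<Sum>j<dim_col A. (cmod (A $$ (i, j)))\<^sup>2)"
      by (rule real_le_rsqrt)
  qed
  have "cmod c * euclidean_norm (A *\<^sub>v v) = euclidean_norm (A *\<^sub>v (c \<cdot>\<^sub>v v))"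
    using assms by (subst mult_mat_vec) (auto simp: euclidean_norm_smult)
  also have "\<dots> \<le> spectral_norm A"
    unfolding spectral_norm_def using cSUP_upper[OF cS bdd] by (simp add: S_def)
  finally show ?thesis using pos by (simp add: cn field_simps)
qed

lemma euclidean_norm_unit_vec: "j < m \<Longrightarrow> euclidean_norm (unit_vec m j) = 1"
proof -
  assume j: "j < m"
  have "(euclidean_norm (unit_vec m j))\<^sup>2 = (\<Sum>i<m. if i = j then 1 else 0)"
    unfolding euclidean_norm_sq using j by (intro sum.cong) (auto simp: unit_vec_def)
  then have "(euclidean_norm (unit_vec m j))\<^sup>2 = 1\<^sup>2" using j by simp
  then show ?thesis by (rule power2_eq_imp_eq) auto
qed

text \<open>A positive dimension provides a unit vector; otherwise the supremum would range over the
  empty set.\<close>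

lemma spectral_norm_nonneg:
  assumes "0 < dim_col A"
  shows "0 \<le> spectral_norm A"
proof -
  have "euclidean_norm (unit_vec (dim_col A) 0) = 1"
    using assms by (rule euclidean_norm_unit_vec)
  moreover have "0 \<le> euclidean_norm (A *\<^sub>v unit_vec (dim_col A) 0)" by simp
  ultimately show ?thesis
    using spectral_norm_bound[of "unit_vec (dim_col A) 0" A] by (simp del: euclidean_norm_nonneg)
qed

text \<open>Cauchy-Schwarz. It is stated for entries and a function \<open>g\<close> instead of a
  vector because it is applied to the rank-one summands of a state, which come as functions.\<close>

lemma inner_spectral_bound:
  fixes A :: "complex mat" and g :: "nat \<Rightarrow> complex"
  assumes "A \<in> carrier_mat m m"
  shows "cmod (\<Sum>a<m. \<Sum>b<m. A $$ (a, b) * g b * cnj (g a)) \<le> spectral_norm A * (\<Sum>a<m. (cmod (g a))\<^sup>2)"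
proof (cases "m = 0")
  case False
  define v where "v = vec m g"
  have e: "(euclidean_norm v)\<^sup>2 = (\<Sum>a<m. (cmod (g a))\<^sup>2)" by (simp add: v_def euclidean_norm_sq)
  have "(\<Sum>a<m. \<Sum>b<m. A $$ (a, b) * g b * cnj (g a)) = (\<Sum>a<m. (A *\<^sub>v v) $ a * cnj (g a))"
    using assms by (auto intro!: sum.cong simp: scalar_prod_def atLeast0LessThan v_def sum_distrib_right)
  then have "(cmod (\<Sum>a<m. \<Sum>b<m. A $$ (a, b) * g b * cnj (g a)))\<^sup>2 \<le>
    (\<Sum>a<m. (cmod ((A *\<^sub>v v) $ a))\<^sup>2) * (\<Sum>a<m. (cmod (g a))\<^sup>2)"
    using norm_sum_prod_le[of "\<lambda>a. (A *\<^sub>v v) $ a" "\<lambda>a. cnj (g a)" "{..<m}"] by simp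
  also have "\<dots> = (euclidean_norm (A *\<^sub>v v) * euclidean_norm v)\<^sup>2"
    using assms e by (simp add: power_mult_distrib euclidean_norm_sq)
  finally have "cmod (\<Sum>a<m. \<Sum>b<m. A $$ (a, b) * g b * cnj (g a)) \<le> euclidean_norm (A *\<^sub>v v) * euclidean_norm v"
    by (rule power2_le_imp_le) simp
  also have "\<dots> \<le> (spectral_norm A * euclidean_norm v) * euclidean_norm v"
    using assms by (intro mult_right_mono spectral_norm_bound) (auto simp: v_def)
  also have "\<dots> = spectral_norm A * (\<Sum>a<m. (cmod (g a))\<^sup>2)"
    unfolding e[symmetric] by (simp add: power2_eq_square)
  finally show ?thesis .
qed simp

text \<open>Every column is the image of a unit vector and hence has norm at most
  \<open>spectral_norm A\<close>.\<close>

lemma frobenius_le_spectral: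
  assumes "A \<in> carrier_mat m m"
  shows "(\<Sum>i<m. \<Sum>j<m. (cmod (A $$ (i, j)))\<^sup>2) \<le> real m * (spectral_norm A)\<^sup>2"
proof -
  have "(\<Sum>i<m. (cmod (A $$ (i, j)))\<^sup>2) \<le> (spectral_norm A)\<^sup>2" if j: "j < m" for j
  proof -
    have A: "A *\<^sub>v unit_vec m j = col A j" using assms j
      by (intro eq_vecI) (auto simp: scalar_prod_right_unit)
    have "euclidean_norm (unit_vec m j) = 1"
      using j by (rule euclidean_norm_unit_vec)
    then have "euclidean_norm (col A j) \<le> spectral_norm A"
      using spectral_norm_bound[of "unit_vec m j" A] assms A by auto
    then have "(euclidean_norm (col A j))\<^sup>2 \<le> (spectral_norm A)\<^sup>2" by (intro power_mono) auto
    then show ?thesis using assms j by (simp add: euclidean_norm_sq)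
  qed
  then have "(\<Sum>j<m. \<Sum>i<m. (cmod (A $$ (i, j)))\<^sup>2) \<le> (\<Sum>j<m. (spectral_norm A)\<^sup>2)"
    by (intro sum_mono) auto
  then show ?thesis by (subst sum.swap) simp
qed

section \<open>Pauli strings\<close>

lemma pauli1_carrier [simp]: "pauli1 p \<in> carrier_mat 2 2"
  by (cases p) (auto simp: mat_of_rows_list_def numeral_2_eq_2)

lemma pauli1_dim [simp]: "dim_row (pauli1 p) = 2" "dim_col (pauli1 p) = 2"
  using pauli1_carrier[of p] by (rule carrier_matD)+

lemma less_2_cases': "(i::nat) < 2 \<longleftrightarrow> i = 0 \<or> i = 1"
  by auto

lemma mat2_eqI:
  assumes "A \<in> carrier_mat 2 2" "B \<in> carrier_mat 2 2"
    "A $$ (0,0) = B $$ (0,0)" "A $$ (0,1) = B $$ (0,1)" "A $$ (1,0) = B $$ (1,0)" "A $$ (1,1) = B $$ (1,1)"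
  shows "A = B"
  by (rule eq_matI) (use assms in \<open>auto simp: less_2_cases'\<close>)

lemma index_mult2:
  assumes "A \<in> carrier_mat 2 2" "B \<in> carrier_mat 2 2" "i < 2" "j < 2"
  shows "(A * B) $$ (i, j) = A $$ (i, 0) * B $$ (0, j) + A $$ (i, 1) * B $$ (1, j)"
  using assms by (simp add: index_mult[of A 2 2 B 2] numeral_2_eq_2 del: index_mult_mat(1))

lemma pauli1_entries [simp]:
  "pauli1 PX $$ (0,0) = 0" "pauli1 PX $$ (0,Suc 0) = 1" "pauli1 PX $$ (Suc 0,0) = 1" "pauli1 PX $$ (Suc 0,Suc 0) = 0"
  "pauli1 PY $$ (0,0) = 0" "pauli1 PY $$ (0,Suc 0) = -\<i>" "pauli1 PY $$ (Suc 0,0) = \<i>" "pauli1 PY $$ (Suc 0,Suc 0) = 0"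
  "pauli1 PZ $$ (0,0) = 1" "pauli1 PZ $$ (0,Suc 0) = 0" "pauli1 PZ $$ (Suc 0,0) = 0" "pauli1 PZ $$ (Suc 0,Suc 0) = -1"
  by (simp_all add: mat_of_rows_list_def)

declare pauli1.simps(2-4) [simp del]

lemma pauli1_adjoint [simp]: "mat_adjoint (pauli1 p) = pauli1 p"
  by (rule mat2_eqI; (cases p; simp)?)

lemma pauli1_mult_carrier [simp]: "pauli1 p * pauli1 q \<in> carrier_mat 2 2"
  by (rule mult_carrier_mat[of _ 2 2]) simp_all

lemma pauli1_entries_PI [simp]:
  "pauli1 PI $$ (0,0) = 1" "pauli1 PI $$ (0,Suc 0) = 0" "pauli1 PI $$ (Suc 0,0) = 0" "pauli1 PI $$ (Suc 0,Suc 0) = 1"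
  by simp_all

lemmas pauli1_mult_entries =
  index_mult2[OF pauli1_carrier pauli1_carrier]
  index_mult2[OF pauli1_mult_carrier pauli1_carrier]

lemma pauli1_square: "pauli1 p * pauli1 p = 1\<^sub>m 2"
  by (rule mat2_eqI, simp, simp, simp_all only: pauli1_mult_entries zero_less_numeral one_less_numeral_iff semiring_norm)
     (cases p; simp)+

text \<open>The commutation sign: two Pauli letters anticommute exactly if they are distinct and
  neither is the identity.\<close>

definition pauli_sign :: "pauli \<Rightarrow> pauli \<Rightarrow> complex" where
  "pauli_sign s p = (if s = PI \<or> p = PI \<or> s = p then 1 else -1)"

lemma pauli1_conj: "pauli1 s * pauli1 p * pauli1 s = pauli_sign s p \<cdot>\<^sub>m pauli1 p"
  by (rule mat2_eqI, rule mult_carrier_mat[of _ 2 2], simp, simp, simp,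
      simp_all only: pauli1_mult_entries zero_less_numeral one_less_numeral_iff semiring_norm)
     (cases s; cases p; simp add: pauli_sign_def del: pauli1.simps)+

lemma mtrace2: "A \<in> carrier_mat 2 2 \<Longrightarrow> mtrace A = A $$ (0,0) + A $$ (1,1)"
  by (simp add: mtrace_def numeral_2_eq_2)

lemma mtrace_pauli1_mult: "mtrace (pauli1 p * pauli1 q) = (if p = q then 2 else 0)"
  by (subst mtrace2, simp, simp only: pauli1_mult_entries zero_less_numeral one_less_numeral_iff semiring_norm)
     (cases p; cases q; simp del: pauli1.simps)

lemma finite_pauli_strings [simp]: "finite (pauli_strings n)"
proof -
  have U: "(UNIV :: pauli set) = {PI, PX, PY, PZ}" using pauli.exhaust by auto
  have "finite (UNIV :: pauli set)" unfolding U by simp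
  from finite_lists_length_eq[OF this, of n] show ?thesis by (simp add: pauli_strings_def)
qed

lemma UNIV_pauli: "(UNIV :: pauli set) = {PI, PX, PY, PZ}" using pauli.exhaust by auto

lemma set_map_pauli1: "set (map pauli1 P) \<subseteq> carrier_mat 2 2" by auto

lemma pauli_mat_carrier: "pauli_mat P \<in> carrier_mat (2 ^ length P) (2 ^ length P)"
  unfolding pauli_mat_def using tensor_prod_carrier[OF set_map_pauli1[of P]] by simp

lemma mtrace_pauli_mat_mult:
  assumes "length P = length Q"
  shows "mtrace (pauli_mat P * pauli_mat Q) = (if P = Q then 2 ^ length P else 0)"
proof -
  have "pauli_mat P * pauli_mat Q = tensor_prod (map2 (*) (map pauli1 P) (map pauli1 Q))"
    unfolding pauli_mat_def using assms by (intro tensor_prod_mult) auto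
  moreover have "set (map2 (*) (map pauli1 P) (map pauli1 Q)) \<subseteq> carrier_mat 2 2"
  proof
    fix M assume "M \<in> set (map2 (*) (map pauli1 P) (map pauli1 Q))"
    then obtain p q where "M = pauli1 p * pauli1 q" by (auto simp: zip_map_map)
    then show "M \<in> carrier_mat 2 2" by (auto intro: mult_carrier_mat[of _ 2 2])
  qed
  ultimately have "mtrace (pauli_mat P * pauli_mat Q) = prod_list (map2 (\<lambda>p q. mtrace (pauli1 p * pauli1 q)) P Q)"
    by (simp add: mtrace_tensor_prod zip_map_map map_map comp_def case_prod_unfold)
  also have "\<dots> = (if P = Q then 2 ^ length P else 0)"
    using assms by (induction P Q rule: list_induct2) (auto simp: mtrace_pauli1_mult)
  finally show ?thesis .
qed

lemma pauli_mat_adjoint: "mat_adjoint (pauli_mat P) = pauli_mat P"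
  unfolding pauli_mat_def tensor_prod_adjoint by (simp add: comp_def)

lemma pauli_mat_cnj:
  assumes "i < 2 ^ length P" "j < 2 ^ length P"
  shows "cnj (pauli_mat P $$ (i, j)) = pauli_mat P $$ (j, i)"
  using arg_cong[OF pauli_mat_adjoint[of P], of "\<lambda>A. A $$ (j, i)"] assms pauli_mat_carrier[of P]
  by auto

lemma pauli_combination_carrier [simp]: "pauli_combination n S \<alpha> \<in> carrier_mat (2 ^ n) (2 ^ n)"
  by (simp add: pauli_combination_def)

lemma expval_pauli_combination:
  assumes "S \<subseteq> pauli_strings n" "X \<in> carrier_mat (2 ^ n) (2 ^ n)"
  shows "expval (pauli_combination n S \<alpha>) X = (\<Sum>P\<in>S. \<alpha> P * expval (pauli_mat P) X)"
proof -
  have c: "pauli_mat P \<in> carrier_mat (2 ^ n) (2 ^ n)" if "P \<in> S" for P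
    using that assms pauli_mat_carrier[of P] by (auto simp: pauli_strings_def)
  have "mtrace (pauli_combination n S \<alpha> * X) =
      (\<Sum>i<2^n. \<Sum>j<2^n. (\<Sum>P\<in>S. complex_of_real (\<alpha> P) * pauli_mat P $$ (i, j) * X $$ (j, i)))"
    using assms by (simp add: mtrace_mult[of _ "2^n" "2^n"] sum_distrib_right) (simp add: pauli_combination_def sum_distrib_right)
  also have "\<dots> = (\<Sum>i<2^n. \<Sum>P\<in>S. \<Sum>j<2^n. complex_of_real (\<alpha> P) * pauli_mat P $$ (i, j) * X $$ (j, i))"
    by (intro sum.cong refl sum.swap)
  also have "\<dots> = (\<Sum>P\<in>S. \<Sum>i<2^n. \<Sum>j<2^n. complex_of_real (\<alpha> P) * pauli_mat P $$ (i, j) * X $$ (j, i))"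
    by (rule sum.swap)
  also have "\<dots> = (\<Sum>P\<in>S. complex_of_real (\<alpha> P) * mtrace (pauli_mat P * X))"
    using assms by (intro sum.cong refl) (simp add: mtrace_mult[OF c] sum_distrib_left mult.assoc)
  finally show ?thesis by (simp add: expval_def)
qed

lemma sum_swap4:
  "(\<Sum>i\<in>A. \<Sum>j\<in>B. \<Sum>P\<in>C. \<Sum>Q\<in>D. F i j P Q) = (\<Sum>P\<in>C. \<Sum>Q\<in>D. \<Sum>i\<in>A. \<Sum>j\<in>B. F i j P Q)"
proof -
  have "(\<Sum>i\<in>A. \<Sum>j\<in>B. \<Sum>P\<in>C. \<Sum>Q\<in>D. F i j P Q) = (\<Sum>i\<in>A. \<Sum>P\<in>C. \<Sum>j\<in>B. \<Sum>Q\<in>D. F i j P Q)"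
    by (intro sum.cong refl sum.swap)
  also have "\<dots> = (\<Sum>P\<in>C. \<Sum>i\<in>A. \<Sum>j\<in>B. \<Sum>Q\<in>D. F i j P Q)" by (rule sum.swap)
  also have "\<dots> = (\<Sum>P\<in>C. \<Sum>i\<in>A. \<Sum>Q\<in>D. \<Sum>j\<in>B. F i j P Q)" by (intro sum.cong refl sum.swap)
  also have "\<dots> = (\<Sum>P\<in>C. \<Sum>Q\<in>D. \<Sum>i\<in>A. \<Sum>j\<in>B. F i j P Q)" by (intro sum.cong refl sum.swap)
  finally show ?thesis .
qed

text \<open>Trace orthogonality of Pauli strings makes the squared Frobenius norm equal to
  \<open>2^n\<close> times the sum of squares. The same factor appears when the squared Frobenius
  norm is bounded by the squared spectral norm, and it cancels.\<close>

lemma sum_squares_le_spectral: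
  assumes "S \<subseteq> pauli_strings n"
  shows "(\<Sum>P\<in>S. (\<alpha> P)\<^sup>2) \<le> (spectral_norm (pauli_combination n S \<alpha>))\<^sup>2"
proof -
  let ?A = "pauli_combination n S \<alpha>" and ?m = "2 ^ n :: nat"
  have fin: "finite S" by (rule finite_subset[OF assms finite_pauli_strings])
  have len: "length P = n" if "P \<in> S" for P using that assms by (auto simp: pauli_strings_def)
  have c: "pauli_mat P \<in> carrier_mat ?m ?m" if "P \<in> S" for P using len[OF that] pauli_mat_carrier[of P] by simp
  have entry: "?A $$ (i, j) = (\<Sum>P\<in>S. complex_of_real (\<alpha> P) * pauli_mat P $$ (i, j))" if "i < ?m" "j < ?m" for i j
    using that by (simp add: pauli_combination_def)
  have "complex_of_real (\<Sum>i<?m. \<Sum>j<?m. (cmod (?A $$ (i, j)))\<^sup>2) = (\<Sum>i<?m. \<Sum>j<?m. ?A $$ (i, j) * cnj (?A $$ (i, j)))"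
    by (simp only: of_real_sum complex_norm_square)
  also have "\<dots> = (\<Sum>i<?m. \<Sum>j<?m. \<Sum>P\<in>S. \<Sum>Q\<in>S. complex_of_real (\<alpha> P * \<alpha> Q) * (pauli_mat P $$ (i, j) * pauli_mat Q $$ (j, i)))"
    by (intro sum.cong refl) (auto simp: entry sum_product pauli_mat_cnj len mult_ac intro!: sum.cong)
  also have "\<dots> = (\<Sum>P\<in>S. \<Sum>Q\<in>S. \<Sum>i<?m. \<Sum>j<?m. complex_of_real (\<alpha> P * \<alpha> Q) * (pauli_mat P $$ (i, j) * pauli_mat Q $$ (j, i)))"
  proof -
    have "(\<Sum>i<?m. \<Sum>j<?m. \<Sum>P\<in>S. \<Sum>Q\<in>S. F i j P Q) = (\<Sum>P\<in>S. \<Sum>Q\<in>S. \<Sum>i<?m. \<Sum>j<?m. F i j P Q)" for F :: "_ \<Rightarrow> _ \<Rightarrow> _ \<Rightarrow> _ \<Rightarrow> complex"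
      by (rule sum_swap4)
    then show ?thesis .
  qed
  also have "\<dots> = (\<Sum>P\<in>S. \<Sum>Q\<in>S. complex_of_real (\<alpha> P * \<alpha> Q) * mtrace (pauli_mat P * pauli_mat Q))"
    by (intro sum.cong refl) (simp only: mtrace_mult[OF c c] sum_distrib_left)
  also have "\<dots> = (\<Sum>P\<in>S. \<Sum>Q\<in>S. if P = Q then complex_of_real (\<alpha> P * \<alpha> Q * 2 ^ n) else 0)"
    by (intro sum.cong refl) (simp add: mtrace_pauli_mat_mult len)
  also have "\<dots> = complex_of_real (\<Sum>P\<in>S. (\<alpha> P)\<^sup>2 * 2 ^ n)"
    using fin by (simp add: power2_eq_square)
  finally have "(\<Sum>P\<in>S. (\<alpha> P)\<^sup>2) * 2 ^ n = (\<Sum>i<?m. \<Sum>j<?m. (cmod (?A $$ (i, j)))\<^sup>2)"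
    by (simp only: of_real_eq_iff sum_distrib_right)
  also have "\<dots> \<le> real ?m * (spectral_norm ?A)\<^sup>2" by (rule frobenius_le_spectral) simp
  finally show ?thesis by (simp add: mult.commute)
qed

section \<open>States\<close>

text \<open>A positive semidefinite matrix, indexed by an arbitrary set so that an induction can
  remove one index without renumbering.\<close>

definition psd_kernel :: "'a set \<Rightarrow> ('a \<Rightarrow> 'a \<Rightarrow> complex) \<Rightarrow> bool" where
  "psd_kernel I f \<longleftrightarrow> (\<forall>a\<in>I. \<forall>b\<in>I. f b a = cnj (f a b)) \<and>
     (\<forall>g. 0 \<le> Re (\<Sum>a\<in>I. \<Sum>b\<in>I. cnj (g a) * f a b * g b))"

lemma psd_kernel_form_insert:
  assumes "finite I" "j \<notin> I" "\<And>a. a \<in> I \<Longrightarrow> f a j = cnj (f j a)"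
  shows "(\<Sum>a\<in>insert j I. \<Sum>b\<in>insert j I. cnj (g a) * f a b * g b) =
    cnj (g j) * f j j * g j + cnj (g j) * (\<Sum>b\<in>I. f j b * g b) + cnj (\<Sum>b\<in>I. f j b * g b) * g j
      + (\<Sum>a\<in>I. \<Sum>b\<in>I. cnj (g a) * f a b * g b)"
proof -
  have "(\<Sum>a\<in>I. cnj (g a) * f a j * g j) = cnj (\<Sum>b\<in>I. f j b * g b) * g j"
    by (simp add: assms(3) sum_distrib_left sum_distrib_right mult_ac)
  then show ?thesis using assms(1,2)
    by (simp add: sum.distrib sum_distrib_left mult.assoc)
qed

text \<open>Symmetric Gaussian elimination, one index at a time.\<close>

lemma psd_kernel_rank_one_sum:
  assumes "finite I" "psd_kernel I f"
  shows "\<exists>h. \<forall>a\<in>I. \<forall>b\<in>I. f a b = (\<Sum>j\<in>I. h j a * cnj (h j b))"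
  using assms
proof (induction I arbitrary: f rule: finite_induct)
  case (insert j I)
  have herm: "f b a = cnj (f a b)" if "a \<in> insert j I" "b \<in> insert j I" for a b
    using insert.prems that by (auto simp: psd_kernel_def)
  have pos: "0 \<le> Re (cnj (g j) * f j j * g j + cnj (g j) * (\<Sum>b\<in>I. f j b * g b)
      + cnj (\<Sum>b\<in>I. f j b * g b) * g j + (\<Sum>a\<in>I. \<Sum>b\<in>I. cnj (g a) * f a b * g b))" for g
  proof -
    have "0 \<le> Re (\<Sum>a\<in>insert j I. \<Sum>b\<in>insert j I. cnj (g a) * f a b * g b)"
      using insert.prems unfolding psd_kernel_def by blast
    moreover have "f a j = cnj (f j a)" if "a \<in> I" for a using that by (intro herm) auto
    note psd_kernel_form_insert[OF insert.hyps(1,2), of f g, OF this]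
    ultimately show ?thesis by (simp only:)
  qed
  define d where "d = Re (f j j)"
  have d: "f j j = complex_of_real d"
    using herm[of j j] by (simp add: d_def complex_eq_iff)
  have "0 \<le> d" using pos[of "\<lambda>x. if x = j then 1 else 0"] insert.hyps
    by (simp add: d sum.neutral if_distrib cong: if_cong)
  show ?case
  proof (cases "d = 0")
    case True
    have zero: "f j a = 0" if a: "a \<in> I" for a
    proof (rule ccontr)
      assume "f j a \<noteq> 0"
      then have c: "0 < (cmod (f j a))\<^sup>2" by simp
      \<comment> \<open>A zero pivot forces a zero row: at the test vector with entry
        \<open>- N * f j a\<close> at \<open>j\<close> and \<open>1\<close> at \<open>a\<close>, the
        form is \<open>f a a\<close> minus \<open>2 N\<close> times the squared modulus of
        \<open>f j a\<close>, which is negative for large \<open>N\<close>.\<close>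
      obtain N :: nat where N: "Re (f a a) / (cmod (f j a))\<^sup>2 < real N" using reals_Archimedean2 by blast
      define g where "g x = (if x = j then - of_nat N * f j a else if x = a then 1 else 0)" for x
      have ja: "j \<noteq> a" using a insert.hyps by auto
      have 1: "(\<Sum>b\<in>I. f j b * g b) = f j a"
      proof -
        have "(\<Sum>b\<in>I. f j b * g b) = (\<Sum>b\<in>I. if b = a then f j a else 0)"
          using insert.hyps by (intro sum.cong) (auto simp: g_def)
        then show ?thesis using a insert.hyps by simp
      qed
      have 2: "(\<Sum>x\<in>I. \<Sum>b\<in>I. cnj (g x) * f x b * g b) = f a a"
      proof -
        have "(\<Sum>x\<in>I. \<Sum>b\<in>I. cnj (g x) * f x b * g b) = (\<Sum>x\<in>I. \<Sum>b\<in>I. if b = a then (if x = a then f a a else 0) else 0)"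
          using insert.hyps by (intro sum.cong) (auto simp: g_def)
        then show ?thesis using a insert.hyps by simp
      qed
      have "0 \<le> Re (- of_nat N * (cnj (f j a) * f j a) - of_nat N * (cnj (f j a) * f j a) + f a a)"
        using pos[of g] unfolding 1 2 d True by (simp add: g_def mult_ac)
      also have "cnj (f j a) * f j a = complex_of_real ((cmod (f j a))\<^sup>2)"
        by (simp only: complex_norm_square mult.commute)
      finally have "2 * real N * (cmod (f j a))\<^sup>2 \<le> Re (f a a)" by simp
      moreover have "Re (f a a) < real N * (cmod (f j a))\<^sup>2" using N c by (simp add: divide_less_eq)
      moreover have "0 \<le> real N * (cmod (f j a))\<^sup>2" by simp
      ultimately show False by linarith
    qed
    have "psd_kernel I f"
      unfolding psd_kernel_def
    proof (intro conjI allI ballI)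
      fix g show "0 \<le> Re (\<Sum>a\<in>I. \<Sum>b\<in>I. cnj (g a) * f a b * g b)"
        using pos[of g] by (simp add: zero d True)
    qed (use herm in blast)
    from insert.IH[OF this] obtain h where h: "\<And>a b. a \<in> I \<Longrightarrow> b \<in> I \<Longrightarrow> f a b = (\<Sum>i\<in>I. h i a * cnj (h i b))"
      by blast
    define h' where "h' i a = (if i = j \<or> a = j then 0 else h i a)" for i a
    have "f a b = (\<Sum>i\<in>insert j I. h' i a * cnj (h' i b))" if ab: "a \<in> insert j I" "b \<in> insert j I" for a b
    proof (cases "a = j \<or> b = j")
      case True
      have "f a b = 0"
      proof (cases "a = j")
        case True
        then show ?thesis using zero ab d \<open>d = 0\<close> by (cases "b = j") auto
      next
        case False
        then have "b = j" "a \<in> I" using True ab by auto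
        then show ?thesis using zero[of a] herm[of j a] by auto
      qed
      then show ?thesis using True by (auto simp: h'_def intro!: sum.neutral[symmetric])
    next
      case False
      then have "f a b = (\<Sum>i\<in>I. h' i a * cnj (h' i b))"
        using ab insert.hyps by (subst h) (auto simp: h'_def intro!: sum.cong)
      then show ?thesis using insert.hyps by (simp add: h'_def)
    qed
    then show ?thesis by blast
  next
    case False
    then have dpos: "0 < d" using \<open>0 \<le> d\<close> by simp
    \<comment> \<open>The Schur complement of the pivot.\<close>
    define f' where "f' a b = f a b - f a j * f j b / complex_of_real d" for a b
    have "psd_kernel I f'"
      unfolding psd_kernel_def
    proof (intro conjI allI ballI)
      fix a b assume "a \<in> I" "b \<in> I"
      then show "f' b a = cnj (f' a b)"
        using herm[of a b] herm[of a j] herm[of b j] herm[of j b] herm[of j a] by (simp add: f'_def mult.commute)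
    next
      fix g
      define s where "s = (\<Sum>b\<in>I. f j b * g b)"
      \<comment> \<open>Extends \<open>g\<close> to the pivot by the value that minimises the form;
        the form of \<open>f\<close> at \<open>g'\<close> is then that of \<open>f'\<close> at
        \<open>g\<close>.\<close>
      define g' where "g' x = (if x = j then - s / complex_of_real d else g x)" for x
      have s': "(\<Sum>a\<in>I. cnj (g a) * f a j) = cnj s"
        unfolding s_def cnj_sum
      proof (intro sum.cong refl)
        fix a assume "a \<in> I"
        then show "cnj (g a) * f a j = cnj (f j a * g a)" using herm[of j a] by simp
      qed
      have "(\<Sum>a\<in>I. \<Sum>b\<in>I. cnj (g a) * f' a b * g b)
        = (\<Sum>a\<in>I. \<Sum>b\<in>I. cnj (g a) * f a b * g b) - (\<Sum>a\<in>I. \<Sum>b\<in>I. (cnj (g a) * f a j) * (f j b * g b)) / complex_of_real d"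
        by (simp add: f'_def algebra_simps sum_subtractf sum_divide_distrib)
      also have "(\<Sum>a\<in>I. \<Sum>b\<in>I. (cnj (g a) * f a j) * (f j b * g b)) = cnj s * s"
        unfolding s'[symmetric] unfolding s_def sum_product ..
      finally have e: "(\<Sum>a\<in>I. \<Sum>b\<in>I. cnj (g a) * f' a b * g b) = (\<Sum>a\<in>I. \<Sum>b\<in>I. cnj (g a) * f a b * g b) - cnj s * s / complex_of_real d" .
      have g'I: "g' x = g x" if "x \<in> I" for x using that insert.hyps by (auto simp: g'_def)
      have "(\<Sum>b\<in>I. f j b * g' b) = s" unfolding s_def using g'I by (intro sum.cong) auto
      moreover have "(\<Sum>a\<in>I. \<Sum>b\<in>I. cnj (g' a) * f a b * g' b) = (\<Sum>a\<in>I. \<Sum>b\<in>I. cnj (g a) * f a b * g b)"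
        using g'I by (intro sum.cong) auto
      moreover have "g' j = - s / complex_of_real d" by (simp add: g'_def)
      ultimately have "0 \<le> Re (cnj (- s / complex_of_real d) * complex_of_real d * (- s / complex_of_real d) + cnj (- s / complex_of_real d) * s
          + cnj s * (- s / complex_of_real d) + (\<Sum>a\<in>I. \<Sum>b\<in>I. cnj (g a) * f a b * g b))"
        using pos[of g'] by (simp only: d)
      also have "cnj (- s / complex_of_real d) * complex_of_real d * (- s / complex_of_real d) + cnj (- s / complex_of_real d) * s
          + cnj s * (- s / complex_of_real d) = - (cnj s * s / complex_of_real d)"
        using dpos by (simp add: field_simps)
      finally show "0 \<le> Re (\<Sum>a\<in>I. \<Sum>b\<in>I. cnj (g a) * f' a b * g b)" unfolding e by simp
    qed
    from insert.IH[OF this] obtain h where h: "\<And>a b. a \<in> I \<Longrightarrow> b \<in> I \<Longrightarrow> f' a b = (\<Sum>i\<in>I. h i a * cnj (h i b))"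
      by blast
    \<comment> \<open>The new rank-one term is the pivot column divided by the square root of the
      pivot. It alone restores row and column \<open>j\<close>, so the old terms are set to zero
      there.\<close>
    define h' where "h' i a = (if i = j then f a j / complex_of_real (sqrt d) else if a = j then 0 else h i a)" for i a
    have sq: "complex_of_real (sqrt d) * complex_of_real (sqrt d) = complex_of_real d"
      using dpos by (simp flip: of_real_mult)
    have "f a b = (\<Sum>i\<in>insert j I. h' i a * cnj (h' i b))" if ab: "a \<in> insert j I" "b \<in> insert j I" for a b
    proof -
      have 1: "(\<Sum>i\<in>insert j I. h' i a * cnj (h' i b)) = f a j * f j b / complex_of_real d + (\<Sum>i\<in>I. h' i a * cnj (h' i b))"
        using insert.hyps herm[of b j] ab sq by (simp add: h'_def)
      show ?thesis
      proof (cases "a = j \<or> b = j")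
        case True
        then have "(\<Sum>i\<in>I. h' i a * cnj (h' i b)) = 0"
          using insert.hyps by (intro sum.neutral) (auto simp: h'_def)
        then show ?thesis using True 1 d dpos by auto
      next
        case False
        then have "(\<Sum>i\<in>I. h' i a * cnj (h' i b)) = f' a b"
          using insert.hyps ab by (subst h) (auto simp: h'_def intro!: sum.cong)
        then show ?thesis unfolding 1 by (simp add: f'_def)
      qed
    qed
    then show ?thesis by blast
  qed
qed simp

lemma cscalar_mult_vec:
  assumes "A \<in> carrier_mat m m" "v \<in> carrier_vec m"
  shows "(A *\<^sub>v v) \<bullet>c v = (\<Sum>a<m. \<Sum>b<m. cnj (v $ a) * A $$ (a, b) * v $ b)"
  using assms by (auto simp: scalar_prod_def atLeast0LessThan sum_distrib_right sum_distrib_left mult_ac intro!: sum.cong)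

text \<open>A state is a mixture of unnormalised pure states \<open>h j\<close>; their squared norms
  sum to the trace and act as probabilities. Both the norm bound on expectation values and the bound
  on entries use this form.\<close>

lemma state_rank_one_sum:
  assumes "\<rho> \<in> states n"
  obtains h :: "nat \<Rightarrow> nat \<Rightarrow> complex" where "\<And>a b. a < 2^n \<Longrightarrow> b < 2^n \<Longrightarrow> \<rho> $$ (a, b) = (\<Sum>j<2^n. h j a * cnj (h j b))"
    and "(\<Sum>j<2^n. \<Sum>a<2^n. (cmod (h j a))\<^sup>2) = 1"
proof -
  let ?m = "2 ^ n :: nat"
  have c: "\<rho> \<in> carrier_mat ?m ?m" and herm: "mat_adjoint \<rho> = \<rho>" and tr: "mtrace \<rho> = 1"
    and pos: "\<And>v. v \<in> carrier_vec ?m \<Longrightarrow> 0 \<le> Re ((\<rho> *\<^sub>v v) \<bullet>c v)"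
    using assms by (auto simp: states_def hermitian_mat_def)
  have "psd_kernel {..<?m} (\<lambda>a b. \<rho> $$ (a, b))"
    unfolding psd_kernel_def
  proof (intro conjI ballI allI)
    fix a b assume "a \<in> {..<?m}" "b \<in> {..<?m}"
    then show "\<rho> $$ (b, a) = cnj (\<rho> $$ (a, b))"
      using arg_cong[OF herm, of "\<lambda>A. A $$ (b, a)"] c by simp
  next
    fix g :: "nat \<Rightarrow> complex"
    show "0 \<le> Re (\<Sum>a<?m. \<Sum>b<?m. cnj (g a) * \<rho> $$ (a, b) * g b)"
      using pos[of "vec ?m g"] cscalar_mult_vec[OF c, of "vec ?m g"] by simp
  qed
  from psd_kernel_rank_one_sum[OF _ this] obtain h
    where h: "\<And>a b. a < ?m \<Longrightarrow> b < ?m \<Longrightarrow> \<rho> $$ (a, b) = (\<Sum>j<?m. h j a * cnj (h j b))" by auto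
  have "complex_of_real (\<Sum>a<?m. \<Sum>j<?m. (cmod (h j a))\<^sup>2) = (\<Sum>a<?m. \<rho> $$ (a, a))"
    unfolding of_real_sum by (intro sum.cong refl) (simp add: h complex_norm_square del: of_real_power)
  also have "\<dots> = 1" using tr c by (simp add: mtrace_def)
  finally have "(\<Sum>j<?m. \<Sum>a<?m. (cmod (h j a))\<^sup>2) = 1"
    by (subst sum.swap) (simp only: of_real_eq_1_iff)
  then show ?thesis using that[OF h] by blast
qed

text \<open>Each rank-one term contributes at most \<open>spectral_norm A\<close> times its squared
  norm, and the squared norms sum to one.\<close>

lemma expval_le_spectral_norm:
  assumes "A \<in> carrier_mat (2^n) (2^n)" "\<rho> \<in> states n"
  shows "\<bar>expval A \<rho>\<bar> \<le> spectral_norm A"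
proof -
  let ?m = "2 ^ n :: nat"
  obtain h where h: "\<And>a b. a < ?m \<Longrightarrow> b < ?m \<Longrightarrow> \<rho> $$ (a, b) = (\<Sum>j<?m. h j a * cnj (h j b))"
    and tr: "(\<Sum>j<?m. \<Sum>a<?m. (cmod (h j a))\<^sup>2) = 1"
    using state_rank_one_sum[OF assms(2)] by blast
  have c: "\<rho> \<in> carrier_mat ?m ?m" using assms by (simp add: states_def)
  have "mtrace (A * \<rho>) = (\<Sum>a<?m. \<Sum>b<?m. \<Sum>j<?m. A $$ (a, b) * h j b * cnj (h j a))"
    unfolding mtrace_mult[OF assms(1) c] by (intro sum.cong refl) (simp add: h sum_distrib_left mult.assoc)
  also have "\<dots> = (\<Sum>a<?m. \<Sum>j<?m. \<Sum>b<?m. A $$ (a, b) * h j b * cnj (h j a))"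
    by (intro sum.cong refl sum.swap)
  also have "\<dots> = (\<Sum>j<?m. \<Sum>a<?m. \<Sum>b<?m. A $$ (a, b) * h j b * cnj (h j a))"
    by (rule sum.swap)
  finally have "cmod (mtrace (A * \<rho>)) \<le> (\<Sum>j<?m. cmod (\<Sum>a<?m. \<Sum>b<?m. A $$ (a, b) * h j b * cnj (h j a)))"
    by (simp only: norm_sum)
  also have "\<dots> \<le> (\<Sum>j<?m. spectral_norm A * (\<Sum>a<?m. (cmod (h j a))\<^sup>2))"
    by (intro sum_mono inner_spectral_bound assms)
  also have "\<dots> = spectral_norm A" unfolding sum_distrib_left[symmetric] tr by simp
  finally show ?thesis using abs_Re_le_cmod[of "mtrace (A * \<rho>)"] by (simp add: expval_def)
qed

text \<open>Nonnegativity of the two-by-two minors: Cauchy-Schwarz for the \<open>a\<close>-th and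
  the \<open>b\<close>-th entries of the rank-one terms.\<close>

lemma state_entry_le:
  assumes "\<rho> \<in> states n" "a < 2^n" "b < 2^n"
  shows "(cmod (\<rho> $$ (a, b)))\<^sup>2 \<le> Re (\<rho> $$ (a, a)) * Re (\<rho> $$ (b, b))"
    and "0 \<le> Re (\<rho> $$ (a, a))"
proof -
  obtain h :: "nat \<Rightarrow> nat \<Rightarrow> complex"
    where h: "\<And>a b. a < 2^n \<Longrightarrow> b < 2^n \<Longrightarrow> \<rho> $$ (a, b) = (\<Sum>j<2^n. h j a * cnj (h j b))"
    and "(\<Sum>j<2^n. \<Sum>a<2^n. (cmod (h j a))\<^sup>2) = 1"
    using state_rank_one_sum[OF assms(1)] by blast
  have diag: "Re (\<rho> $$ (a, a)) = (\<Sum>j<2^n. (cmod (h j a))\<^sup>2)" if "a < 2^n" for a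
  proof -
    have "\<rho> $$ (a, a) = complex_of_real (\<Sum>j<2^n. (cmod (h j a))\<^sup>2)"
      using that by (simp add: h complex_norm_square del: of_real_power)
    then show ?thesis by simp
  qed
  show "(cmod (\<rho> $$ (a, b)))\<^sup>2 \<le> Re (\<rho> $$ (a, a)) * Re (\<rho> $$ (b, b))"
    unfolding diag[OF assms(2)] diag[OF assms(3)] h[OF assms(2,3)]
    using norm_sum_prod_le[of "\<lambda>j. h j a" "\<lambda>j. cnj (h j b)" "{..<2^n}"] by (simp only: complex_mod_cnj)
  show "0 \<le> Re (\<rho> $$ (a, a))" unfolding diag[OF assms(2)] by (simp add: sum_nonneg)
qed

lemma inner_adjoint:
  fixes A :: "complex mat"
  assumes "A \<in> carrier_mat m m" "x \<in> carrier_vec m" "v \<in> carrier_vec m"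
  shows "(A *\<^sub>v x) \<bullet>c v = x \<bullet>c (mat_adjoint A *\<^sub>v v)"
proof -
  have "(A *\<^sub>v x) \<bullet>c v = (\<Sum>a<m. \<Sum>b<m. A $$ (a, b) * x $ b * cnj (v $ a))"
    using assms by (auto simp: scalar_prod_def atLeast0LessThan sum_distrib_right intro!: sum.cong)
  also have "\<dots> = (\<Sum>b<m. \<Sum>a<m. A $$ (a, b) * x $ b * cnj (v $ a))" by (rule sum.swap)
  also have "\<dots> = x \<bullet>c (mat_adjoint A *\<^sub>v v)"
    using assms by (auto simp: scalar_prod_def atLeast0LessThan sum_distrib_left mult_ac intro!: sum.cong)
  finally show ?thesis .
qed

text \<open>Makes conjugation by a gate a map of the state space into itself, as its measurability
  requires.\<close>

lemma conj_unitary_states: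
  assumes "U \<in> carrier_mat (2^n) (2^n)" "mat_adjoint U * U = 1\<^sub>m (2^n)" "\<rho> \<in> states n"
  shows "U * \<rho> * mat_adjoint U \<in> states n"
proof -
  let ?m = "2 ^ n :: nat"
  have c: "\<rho> \<in> carrier_mat ?m ?m" and herm: "mat_adjoint \<rho> = \<rho>" and tr: "mtrace \<rho> = 1"
    and pos: "\<And>v. v \<in> carrier_vec ?m \<Longrightarrow> 0 \<le> Re ((\<rho> *\<^sub>v v) \<bullet>c v)"
    using assms by (auto simp: states_def hermitian_mat_def)
  have U': "mat_adjoint U \<in> carrier_mat ?m ?m" using assms by simp
  have Ur: "U * \<rho> \<in> carrier_mat ?m ?m" using assms c by (auto intro: mult_carrier_mat)
  have "mat_adjoint (U * \<rho> * mat_adjoint U) = U * \<rho> * mat_adjoint U"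
    using assms c U' Ur herm by (simp add: mat_adjoint_mult[of _ ?m ?m _ ?m] assoc_mult_mat[of _ ?m ?m _ ?m _ ?m])
  moreover have "mtrace (U * \<rho> * mat_adjoint U) = 1"
  proof -
    have "mtrace (U * \<rho> * mat_adjoint U) = mtrace (mat_adjoint U * (U * \<rho>))"
      by (rule mtrace_mult_commute[OF Ur U'])
    also have "mat_adjoint U * (U * \<rho>) = \<rho>"
      using assms c U' by (simp add: assoc_mult_mat[symmetric, of _ ?m ?m _ ?m _ ?m])
    finally show ?thesis using tr by simp
  qed
  moreover have "0 \<le> Re ((U * \<rho> * mat_adjoint U *\<^sub>v v) \<bullet>c v)" if v: "v \<in> carrier_vec ?m" for v
  proof -
    have w: "mat_adjoint U *\<^sub>v v \<in> carrier_vec ?m" using U' v by (rule mult_mat_vec_carrier)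
    have "U * \<rho> * mat_adjoint U *\<^sub>v v = U *\<^sub>v (\<rho> *\<^sub>v (mat_adjoint U *\<^sub>v v))"
      using assms(1) c U' Ur v w by (simp add: assoc_mult_mat_vec[of _ ?m ?m _ ?m])
    then have "(U * \<rho> * mat_adjoint U *\<^sub>v v) \<bullet>c v = (\<rho> *\<^sub>v (mat_adjoint U *\<^sub>v v)) \<bullet>c (mat_adjoint U *\<^sub>v v)"
      using inner_adjoint[OF assms(1) mult_mat_vec_carrier[OF c w] v] by simp
    then show ?thesis using pos[OF w] by simp
  qed
  moreover have "U * \<rho> * mat_adjoint U \<in> carrier_mat ?m ?m" using Ur U' by (rule mult_carrier_mat)
  ultimately show ?thesis by (simp add: states_def hermitian_mat_def)
qed

lemma spectral_norm_unitary_le: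
  assumes "U \<in> carrier_mat m m" "mat_adjoint U * U = 1\<^sub>m m" "0 < m"
  shows "spectral_norm U \<le> 1"
  unfolding spectral_norm_def
proof (rule cSUP_least)
  have "unit_vec m 0 \<in> {v \<in> carrier_vec (dim_col U). euclidean_norm v = 1}"
    using assms euclidean_norm_unit_vec[of 0 m] by auto
  then show "{v \<in> carrier_vec (dim_col U). euclidean_norm v = 1} \<noteq> {}" by blast
  fix v assume "v \<in> {v \<in> carrier_vec (dim_col U). euclidean_norm v = 1}"
  then have v: "v \<in> carrier_vec m" "euclidean_norm v = 1" using assms by auto
  have "(U *\<^sub>v v) \<bullet>c (U *\<^sub>v v) = v \<bullet>c (mat_adjoint U *\<^sub>v (U *\<^sub>v v))"
    using assms v by (intro inner_adjoint) auto
  also have "mat_adjoint U *\<^sub>v (U *\<^sub>v v) = v"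
    using assms v by (simp add: assoc_mult_mat_vec[symmetric, of _ m m _ m])
  finally show "euclidean_norm (U *\<^sub>v v) \<le> 1" using v by (simp add: euclidean_norm_def)
qed

lemma pauli_mat_square: "pauli_mat P * pauli_mat P = 1\<^sub>m (2 ^ length P)"
proof -
  have "pauli_mat P * pauli_mat P = tensor_prod (map2 (*) (map pauli1 P) (map pauli1 P))"
    unfolding pauli_mat_def by (intro tensor_prod_mult) auto
  also have "map2 (*) (map pauli1 P) (map pauli1 P) = replicate (length P) (1\<^sub>m 2)"
    by (induction P) (auto simp: pauli1_square)
  finally show ?thesis by (simp add: tensor_prod_one)
qed

text \<open>A Pauli string is Hermitian with square one, hence unitary, so its spectral norm is at
  most one.\<close>

lemma expval_pauli_le:
  assumes "length P = n" "\<rho> \<in> states n"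
  shows "\<bar>expval (pauli_mat P) \<rho>\<bar> \<le> 1"
proof -
  have c: "pauli_mat P \<in> carrier_mat (2^n) (2^n)" using pauli_mat_carrier[of P] assms by simp
  have "spectral_norm (pauli_mat P) \<le> 1"
    using pauli_mat_square[of P] assms by (intro spectral_norm_unitary_le[OF c]) (simp_all add: pauli_mat_adjoint)
  with expval_le_spectral_norm[OF c assms(2)] show ?thesis by simp
qed

section \<open>Purity of reduced states\<close>

text \<open>The list of booleans marks a set of qubits. Lists make the set of strings a product over
  the first qubit and the rest, in step with the Kronecker product.\<close>

definition supported_on :: "bool list \<Rightarrow> pauli list set" where
  "supported_on S = {P. list_all2 (\<lambda>p s. p \<noteq> PI \<longrightarrow> s) P S}"

lemma supported_on_simps [simp]:
  "supported_on [] = {[]}"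
  "supported_on (s # S) = (\<lambda>(p, P). p # P) ` ((if s then UNIV else {PI}) \<times> supported_on S)"
  by (auto simp: supported_on_def list_all2_Cons2 image_iff)

lemma length_supported_on: "P \<in> supported_on S \<Longrightarrow> length P = length S"
  by (auto simp: supported_on_def dest: list_all2_lengthD)

lemma finite_UNIV_pauli: "finite (UNIV :: pauli set)"
  by (simp add: UNIV_pauli)

lemma finite_supported_on [simp]: "finite (supported_on S)"
  by (induction S) (auto simp: finite_UNIV_pauli)

text \<open>The entries of the sum of \<open>P \<otimes> P\<close> over the strings supported on
  \<open>S\<close>. On each marked qubit the sum over the four letters is twice the swap operator,
  so up to a power of two this operator exchanges two copies of the marked qubits.\<close>

definition pauli_kernel :: "bool list \<Rightarrow> nat \<Rightarrow> nat \<Rightarrow> nat \<Rightarrow> nat \<Rightarrow> complex" where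
  "pauli_kernel S i j k l = (\<Sum>P\<in>supported_on S. pauli_mat P $$ (i, j) * pauli_mat P $$ (k, l))"

lemma pauli_mat_Cons_entry:
  assumes "i < 2 ^ Suc n" "j < 2 ^ Suc n" "length P = n"
  shows "pauli_mat (p # P) $$ (i, j) = pauli1 p $$ (i div 2 ^ n, j div 2 ^ n) * pauli_mat P $$ (i mod 2 ^ n, j mod 2 ^ n)"
proof -
  have "pauli_mat P \<in> carrier_mat (2 ^ n) (2 ^ n)" using pauli_mat_carrier[of P] assms by simp
  moreover have "pauli_mat (p # P) = kronecker (pauli1 p) (pauli_mat P)" by (simp add: pauli_mat_def)
  ultimately show ?thesis using assms by (simp add: index_kronecker)
qed

text \<open>Twice the swap of two qubits if \<open>s\<close>, the identity otherwise;
  \<open>i, k\<close> are the row indices and \<open>j, l\<close> the column indices of the two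
  copies.\<close>

definition site_kernel :: "bool \<Rightarrow> nat \<Rightarrow> nat \<Rightarrow> nat \<Rightarrow> nat \<Rightarrow> real" where
  "site_kernel s i j k l = (if s then 2 * of_bool (i = l \<and> j = k) else of_bool (i = j \<and> k = l))"

lemma site_kernel_nonneg: "0 \<le> site_kernel s i j k l"
  unfolding site_kernel_def by (cases s) simp_all

lemma site_kernel_eq:
  assumes "i < 2" "j < 2" "k < 2" "l < 2"
  shows "(\<Sum>p\<in>(if s then UNIV else {PI}). pauli1 p $$ (i, j) * pauli1 p $$ (k, l)) = complex_of_real (site_kernel s i j k l)"
proof -
  have "i = 0 \<or> i = 1" "j = 0 \<or> j = 1" "k = 0 \<or> k = 1" "l = 0 \<or> l = 1" using assms by auto
  then show ?thesis
    by (elim disjE; simp add: UNIV_pauli site_kernel_def del: pauli1.simps)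
qed

lemma pauli_kernel_Cons:
  assumes "i < 2 ^ Suc n" "j < 2 ^ Suc n" "k < 2 ^ Suc n" "l < 2 ^ Suc n" "length S = n"
  shows "pauli_kernel (s # S) i j k l =
    complex_of_real (site_kernel s (i div 2^n) (j div 2^n) (k div 2^n) (l div 2^n)) *
    pauli_kernel S (i mod 2^n) (j mod 2^n) (k mod 2^n) (l mod 2^n)"
proof -
  have lt: "x div 2 ^ n < 2" if "x < 2 ^ Suc n" for x :: nat using that by (simp add: less_mult_imp_div_less)
  have "pauli_kernel (s # S) i j k l =
    (\<Sum>(p, P)\<in>(if s then UNIV else {PI}) \<times> supported_on S. pauli_mat (p # P) $$ (i, j) * pauli_mat (p # P) $$ (k, l))"
    unfolding pauli_kernel_def supported_on_simps
    by (subst sum.reindex) (auto simp: inj_on_def case_prod_unfold)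
  also have "\<dots> = (\<Sum>(p, P)\<in>(if s then UNIV else {PI}) \<times> supported_on S.
      (pauli1 p $$ (i div 2^n, j div 2^n) * pauli1 p $$ (k div 2^n, l div 2^n)) *
      (pauli_mat P $$ (i mod 2^n, j mod 2^n) * pauli_mat P $$ (k mod 2^n, l mod 2^n)))"
    using assms length_supported_on
    by (intro sum.cong refl) (auto simp: pauli_mat_Cons_entry simp del: pauli1.simps)
  also have "\<dots> = (\<Sum>p\<in>(if s then UNIV else {PI}). pauli1 p $$ (i div 2^n, j div 2^n) * pauli1 p $$ (k div 2^n, l div 2^n)) *
      pauli_kernel S (i mod 2^n) (j mod 2^n) (k mod 2^n) (l mod 2^n)"
    unfolding pauli_kernel_def sum_product by (simp add: sum.cartesian_product del: pauli1.simps)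
  finally show ?thesis using assms by (simp only: site_kernel_eq lt)
qed

lemma pauli_kernel_Nil: "pauli_kernel [] 0 0 0 0 = 1"
  by (simp add: pauli_kernel_def pauli_mat_def)

text \<open>A product of nonnegative site kernels. Nonnegativity lets the triangle inequality act on
  the entries of the state alone.\<close>

lemma pauli_kernel_nonneg:
  assumes "i < 2 ^ length S" "j < 2 ^ length S" "k < 2 ^ length S" "l < 2 ^ length S"
  shows "pauli_kernel S i j k l = complex_of_real (Re (pauli_kernel S i j k l)) \<and> 0 \<le> Re (pauli_kernel S i j k l)"
  using assms
proof (induction S arbitrary: i j k l)
  case Nil
  then show ?case by (simp add: pauli_kernel_Nil)
next
  case (Cons s S)
  let ?m = "2 ^ length S :: nat"
  define w where "w = site_kernel s (i div ?m) (j div ?m) (k div ?m) (l div ?m)"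
  have w: "0 \<le> w" unfolding w_def by (rule site_kernel_nonneg)
  have e: "pauli_kernel (s # S) i j k l = complex_of_real w * pauli_kernel S (i mod ?m) (j mod ?m) (k mod ?m) (l mod ?m)"
    unfolding w_def by (rule pauli_kernel_Cons) (use Cons.prems in simp_all)
  have "pauli_kernel S (i mod ?m) (j mod ?m) (k mod ?m) (l mod ?m) =
      complex_of_real (Re (pauli_kernel S (i mod ?m) (j mod ?m) (k mod ?m) (l mod ?m))) \<and>
      0 \<le> Re (pauli_kernel S (i mod ?m) (j mod ?m) (k mod ?m) (l mod ?m))"
    by (rule Cons.IH) simp_all
  then obtain r where r: "pauli_kernel S (i mod ?m) (j mod ?m) (k mod ?m) (l mod ?m) = complex_of_real r" "0 \<le> r"
    by blast
  show ?case unfolding e r using w r(2) by simp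
qed

lemma sum_pow_Suc:
  "(\<Sum>i<2 ^ Suc n. F i) = (\<Sum>a<2. \<Sum>b<2 ^ n. F (b + a * 2 ^ n))" for F :: "nat \<Rightarrow> 'a::comm_monoid_add"
  using sum_mult_product[of F 2 "2 ^ n"] by simp

lemma sum_div_mod:
  fixes G :: "nat \<Rightarrow> nat \<Rightarrow> 'a::comm_monoid_add"
  shows "(\<Sum>i<2 ^ Suc n. G (i div 2 ^ n) (i mod 2 ^ n)) = (\<Sum>a<2. \<Sum>b<2 ^ n. G a b)"
  unfolding sum_pow_Suc by (intro sum.cong refl) simp

lemma sum_div_mod2:
  fixes G :: "nat \<Rightarrow> nat \<Rightarrow> real" and H :: "nat \<Rightarrow> nat \<Rightarrow> real"
  shows "(\<Sum>i<2 ^ Suc n. \<Sum>j<2 ^ Suc n. G (i div 2^n) (j div 2^n) * H (i mod 2^n) (j mod 2^n))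
    = (\<Sum>i<2. \<Sum>j<2. G i j) * (\<Sum>i<2^n. \<Sum>j<2^n. H i j)"
proof -
  have "(\<Sum>i<2 ^ Suc n. \<Sum>j<2 ^ Suc n. G (i div 2^n) (j div 2^n) * H (i mod 2^n) (j mod 2^n))
    = (\<Sum>a<2. \<Sum>b<2^n. \<Sum>j<2 ^ Suc n. G a (j div 2^n) * H b (j mod 2^n))"
    by (rule sum_div_mod)
  also have "\<dots> = (\<Sum>a<2. \<Sum>b<2^n. \<Sum>c<2. \<Sum>d<2^n. G a c * H b d)"
  proof (rule sum.cong[OF refl], rule sum.cong[OF refl])
    fix a b :: nat
    show "(\<Sum>j<2 ^ Suc n. G a (j div 2^n) * H b (j mod 2^n)) = (\<Sum>c<2. \<Sum>d<2^n. G a c * H b d)"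
      by (rule sum_div_mod)
  qed
  also have "\<dots> = (\<Sum>a<2. \<Sum>c<2. \<Sum>b<2^n. \<Sum>d<2^n. G a c * H b d)"
    by (intro sum.cong refl sum.swap)
  also have "\<dots> = (\<Sum>i<2. \<Sum>j<2. G i j) * (\<Sum>i<2^n. \<Sum>j<2^n. H i j)"
  proof -
    have "(\<Sum>b<2^n. \<Sum>d<2^n. G a c * H b d) = G a c * (\<Sum>i<2^n. \<Sum>j<2^n. H i j)" for a c
      by (simp add: sum_distrib_left)
    then show ?thesis by (simp add: sum_distrib_right)
  qed
  finally show ?thesis .
qed

text \<open>Row sums: a swap is a permutation matrix, so each marked qubit contributes
  \<open>2\<close> and each other qubit \<open>1\<close>.\<close>

lemma pauli_kernel_sum_jl:
  assumes "i < 2 ^ length S" "k < 2 ^ length S"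
  shows "(\<Sum>j<2 ^ length S. \<Sum>l<2 ^ length S. Re (pauli_kernel S i j k l)) = 2 ^ length (filter id S)"
  using assms
proof (induction S arbitrary: i k)
  case Nil
  then show ?case by (simp add: pauli_kernel_Nil)
next
  case (Cons s S)
  let ?n = "length S" let ?m = "2 ^ length S :: nat"
  have lt: "x div ?m < 2" if "x < 2 ^ Suc ?n" for x :: nat using that by (simp add: less_mult_imp_div_less)
  have "(\<Sum>j<2 ^ length (s # S). \<Sum>l<2 ^ length (s # S). Re (pauli_kernel (s # S) i j k l)) =
    (\<Sum>j<2 ^ Suc ?n. \<Sum>l<2 ^ Suc ?n. site_kernel s (i div ?m) (j div ?m) (k div ?m) (l div ?m) *
        Re (pauli_kernel S (i mod ?m) (j mod ?m) (k mod ?m) (l mod ?m)))"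
    using Cons.prems by (intro sum.cong) (auto simp: pauli_kernel_Cons)
  also have "\<dots> = (\<Sum>j<2. \<Sum>l<2. site_kernel s (i div ?m) j (k div ?m) l) *
      (\<Sum>j<2^?n. \<Sum>l<2^?n. Re (pauli_kernel S (i mod ?m) j (k mod ?m) l))"
    by (rule sum_div_mod2)
  also have "(\<Sum>j<2::nat. \<Sum>l<2::nat. site_kernel s (i div ?m) j (k div ?m) l) = (if s then 2 else 1)"
    using lt[of i] lt[of k] Cons.prems by (auto simp: less_2_cases' numeral_2_eq_2 site_kernel_def)
  finally show ?case using Cons.IH[of "i mod ?m" "k mod ?m"] by simp
qed

lemma pauli_kernel_sum_ik:
  assumes "j < 2 ^ length S" "l < 2 ^ length S"
  shows "(\<Sum>i<2 ^ length S. \<Sum>k<2 ^ length S. Re (pauli_kernel S i j k l)) = 2 ^ length (filter id S)"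
  using assms
proof (induction S arbitrary: j l)
  case Nil
  then show ?case by (simp add: pauli_kernel_Nil)
next
  case (Cons s S)
  let ?n = "length S" let ?m = "2 ^ length S :: nat"
  have lt: "x div ?m < 2" if "x < 2 ^ Suc ?n" for x :: nat using that by (simp add: less_mult_imp_div_less)
  have "(\<Sum>i<2 ^ length (s # S). \<Sum>k<2 ^ length (s # S). Re (pauli_kernel (s # S) i j k l)) =
    (\<Sum>i<2 ^ Suc ?n. \<Sum>k<2 ^ Suc ?n. site_kernel s (i div ?m) (j div ?m) (k div ?m) (l div ?m) *
        Re (pauli_kernel S (i mod ?m) (j mod ?m) (k mod ?m) (l mod ?m)))"
    using Cons.prems by (intro sum.cong) (auto simp: pauli_kernel_Cons)
  also have "\<dots> = (\<Sum>i<2. \<Sum>k<2. site_kernel s i (j div ?m) k (l div ?m)) *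
      (\<Sum>i<2^?n. \<Sum>k<2^?n. Re (pauli_kernel S i (j mod ?m) k (l mod ?m)))"
    by (rule sum_div_mod2)
  also have "(\<Sum>i<2::nat. \<Sum>k<2::nat. site_kernel s i (j div ?m) k (l div ?m)) = (if s then 2 else 1)"
    using lt[of j] lt[of l] Cons.prems by (auto simp: less_2_cases' numeral_2_eq_2 site_kernel_def)
  finally show ?case using Cons.IH[of "j mod ?m" "l mod ?m"] by simp
qed

lemma expval_pauli_real:
  assumes "length P = n" "\<rho> \<in> states n"
  shows "mtrace (pauli_mat P * \<rho>) = complex_of_real (expval (pauli_mat P) \<rho>)"
proof -
  have c: "pauli_mat P \<in> carrier_mat (2^n) (2^n)" using pauli_mat_carrier[of P] assms by simp
  have r: "\<rho> \<in> carrier_mat (2^n) (2^n)" "mat_adjoint \<rho> = \<rho>" using assms by (auto simp: states_def hermitian_mat_def)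
  have herm: "cnj (\<rho> $$ (j, i)) = \<rho> $$ (i, j)" if "i < 2^n" "j < 2^n" for i j
    using arg_cong[OF r(2), of "\<lambda>A. A $$ (i, j)"] that r(1) by simp
  have "cnj (mtrace (pauli_mat P * \<rho>)) = (\<Sum>i<2^n. \<Sum>j<2^n. pauli_mat P $$ (j, i) * \<rho> $$ (i, j))"
    unfolding mtrace_mult[OF c r(1)] cnj_sum using assms
    by (intro sum.cong refl) (simp add: pauli_mat_cnj herm)
  also have "\<dots> = mtrace (pauli_mat P * \<rho>)"
    unfolding mtrace_mult[OF c r(1)] by (rule sum.swap)
  finally show ?thesis by (simp add: expval_def complex_eq_iff)
qed

text \<open>In operator terms the left side is \<open>2^m\<close> times the purity of the reduced
  state on the \<open>m\<close> marked qubits. No partial trace is formed: the sum is expanded with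
  \<open>pauli_kernel\<close>, whose rows and columns sum to \<open>2^m\<close>, and products of
  entries are bounded by averages of products of diagonal entries, which sum to one.\<close>

lemma sum_expval_sq_le:
  assumes "\<rho> \<in> states (length S)"
  shows "(\<Sum>P\<in>supported_on S. (expval (pauli_mat P) \<rho>)\<^sup>2) \<le> 2 ^ length (filter id S)"
proof -
  let ?n = "length S" let ?m = "2 ^ length S :: nat"
  have r: "\<rho> \<in> carrier_mat ?m ?m" and tr: "mtrace \<rho> = 1" using assms by (auto simp: states_def)
  define p where "p i = Re (\<rho> $$ (i, i))" for i
  have p0: "0 \<le> p i" if "i < ?m" for i using state_entry_le(2)[OF assms that that] by (simp add: p_def)
  have psum: "(\<Sum>i<?m. p i) = 1"
    using arg_cong[OF tr, of Re] r by (simp add: p_def mtrace_def)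
  \<comment> \<open>The two-by-two minors bound the product by the geometric mean of
    \<open>p i * p k\<close> and \<open>p j * p l\<close>. The arithmetic mean separates row from
    column indices, so that each half meets one of the kernel sums.\<close>
  have ent: "cmod (\<rho> $$ (j, i) * \<rho> $$ (l, k)) \<le> (p i * p k + p j * p l) / 2"
    if "i < ?m" "j < ?m" "k < ?m" "l < ?m" for i j k l
  proof -
    have "(cmod (\<rho> $$ (j, i) * \<rho> $$ (l, k)))\<^sup>2 \<le> (p j * p i) * (p l * p k)"
      unfolding norm_mult power_mult_distrib p_def
      using state_entry_le(2)[OF assms] that by (intro mult_mono state_entry_le(1)[OF assms]) auto
    also have "\<dots> \<le> ((p i * p k + p j * p l) / 2)\<^sup>2"
      using sum_squares_ge_zero[of "p i * p k - p j * p l" 0]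
      by (simp add: power2_eq_square field_simps)
    finally have sq: "(cmod (\<rho> $$ (j, i) * \<rho> $$ (l, k)))\<^sup>2 \<le> ((p i * p k + p j * p l) / 2)\<^sup>2" .
    show ?thesis using p0 that
      by (intro power2_le_imp_le[OF sq] divide_nonneg_nonneg add_nonneg_nonneg mult_nonneg_nonneg) simp_all
  qed
  have "complex_of_real (\<Sum>P\<in>supported_on S. (expval (pauli_mat P) \<rho>)\<^sup>2) =
     (\<Sum>P\<in>supported_on S. mtrace (pauli_mat P * \<rho>) * mtrace (pauli_mat P * \<rho>))"
    using assms by (auto simp: expval_pauli_real[of _ ?n] length_supported_on power2_eq_square intro!: sum.cong)
  also have "\<dots> = (\<Sum>P\<in>supported_on S. (\<Sum>i<?m. \<Sum>j<?m. pauli_mat P $$ (i, j) * \<rho> $$ (j, i)) *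
      (\<Sum>k<?m. \<Sum>l<?m. pauli_mat P $$ (k, l) * \<rho> $$ (l, k)))"
  proof (intro sum.cong refl)
    fix P assume "P \<in> supported_on S"
    then have "pauli_mat P \<in> carrier_mat ?m ?m" using pauli_mat_carrier[of P] length_supported_on by auto
    then show "mtrace (pauli_mat P * \<rho>) * mtrace (pauli_mat P * \<rho>) = (\<Sum>i<?m. \<Sum>j<?m. pauli_mat P $$ (i, j) * \<rho> $$ (j, i)) *
      (\<Sum>k<?m. \<Sum>l<?m. pauli_mat P $$ (k, l) * \<rho> $$ (l, k))" by (simp only: mtrace_mult[OF _ r])
  qed
  also have "\<dots> = (\<Sum>P\<in>supported_on S. \<Sum>i<?m. \<Sum>j<?m. \<Sum>k<?m. \<Sum>l<?m.
      pauli_mat P $$ (i, j) * pauli_mat P $$ (k, l) * (\<rho> $$ (j, i) * \<rho> $$ (l, k)))"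
  proof (intro sum.cong refl)
    fix P
    have "(\<Sum>i\<in>A. \<Sum>j\<in>A. F i j) * (\<Sum>k\<in>A. \<Sum>l\<in>A. F k l) = (\<Sum>i\<in>A. \<Sum>j\<in>A. \<Sum>k\<in>A. \<Sum>l\<in>A. F i j * F k l)"
      for F :: "nat \<Rightarrow> nat \<Rightarrow> complex" and A
      by (subst sum_distrib_right, rule sum.cong[OF refl], subst sum_distrib_right, rule sum.cong[OF refl])
         (simp only: sum_distrib_left)
    from this[of "\<lambda>i j. pauli_mat P $$ (i, j) * \<rho> $$ (j, i)" "{..<?m}"]
    show "(\<Sum>i<?m. \<Sum>j<?m. pauli_mat P $$ (i, j) * \<rho> $$ (j, i)) * (\<Sum>k<?m. \<Sum>l<?m. pauli_mat P $$ (k, l) * \<rho> $$ (l, k)) =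
      (\<Sum>i<?m. \<Sum>j<?m. \<Sum>k<?m. \<Sum>l<?m. pauli_mat P $$ (i, j) * pauli_mat P $$ (k, l) * (\<rho> $$ (j, i) * \<rho> $$ (l, k)))"
      by (simp only: mult.assoc mult.left_commute[of "\<rho> $$ _"])
  qed
  also have "\<dots> = (\<Sum>i<?m. \<Sum>j<?m. \<Sum>k<?m. \<Sum>l<?m. pauli_kernel S i j k l * (\<rho> $$ (j, i) * \<rho> $$ (l, k)))"
  proof -
    have "(\<Sum>P\<in>B. \<Sum>i\<in>A. \<Sum>j\<in>A. \<Sum>k\<in>A. \<Sum>l\<in>A. F P i j k l) = (\<Sum>i\<in>A. \<Sum>j\<in>A. \<Sum>k\<in>A. \<Sum>l\<in>A. \<Sum>P\<in>B. F P i j k l)"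
      for F :: "pauli list \<Rightarrow> nat \<Rightarrow> nat \<Rightarrow> nat \<Rightarrow> nat \<Rightarrow> complex" and A B
    proof -
      have "(\<Sum>P\<in>B. \<Sum>i\<in>A. \<Sum>j\<in>A. \<Sum>k\<in>A. \<Sum>l\<in>A. F P i j k l) = (\<Sum>i\<in>A. \<Sum>P\<in>B. \<Sum>j\<in>A. \<Sum>k\<in>A. \<Sum>l\<in>A. F P i j k l)" by (rule sum.swap)
      also have "\<dots> = (\<Sum>i\<in>A. \<Sum>j\<in>A. \<Sum>P\<in>B. \<Sum>k\<in>A. \<Sum>l\<in>A. F P i j k l)" by (intro sum.cong refl sum.swap)
      also have "\<dots> = (\<Sum>i\<in>A. \<Sum>j\<in>A. \<Sum>k\<in>A. \<Sum>P\<in>B. \<Sum>l\<in>A. F P i j k l)" by (intro sum.cong refl sum.swap)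
      also have "\<dots> = (\<Sum>i\<in>A. \<Sum>j\<in>A. \<Sum>k\<in>A. \<Sum>l\<in>A. \<Sum>P\<in>B. F P i j k l)" by (intro sum.cong refl sum.swap)
      finally show ?thesis .
    qed
    then show ?thesis by (simp only: pauli_kernel_def sum_distrib_right)
  qed
  finally have eq: "complex_of_real (\<Sum>P\<in>supported_on S. (expval (pauli_mat P) \<rho>)\<^sup>2) =
    (\<Sum>i<?m. \<Sum>j<?m. \<Sum>k<?m. \<Sum>l<?m. pauli_kernel S i j k l * (\<rho> $$ (j, i) * \<rho> $$ (l, k)))" .
  have "cmod (complex_of_real (\<Sum>P\<in>supported_on S. (expval (pauli_mat P) \<rho>)\<^sup>2)) \<le> (\<Sum>i<?m. \<Sum>j<?m. \<Sum>k<?m. \<Sum>l<?m. Re (pauli_kernel S i j k l) * ((p i * p k + p j * p l) / 2))"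
    unfolding eq
  proof (intro order_trans[OF norm_sum] sum_mono)
    fix i j k l assume b: "i \<in> {..<?m}" "j \<in> {..<?m}" "k \<in> {..<?m}" "l \<in> {..<?m}"
    then have "pauli_kernel S i j k l = complex_of_real (Re (pauli_kernel S i j k l)) \<and> 0 \<le> Re (pauli_kernel S i j k l)"
      by (intro pauli_kernel_nonneg) simp_all
    then obtain w where w: "pauli_kernel S i j k l = complex_of_real w" "0 \<le> w" by blast
    have "cmod (pauli_kernel S i j k l * (\<rho> $$ (j, i) * \<rho> $$ (l, k))) = w * cmod (\<rho> $$ (j, i) * \<rho> $$ (l, k))"
      unfolding w(1) norm_mult[of "complex_of_real w"] using w(2) by simp
    also have "\<dots> \<le> w * ((p i * p k + p j * p l) / 2)"
      using b by (intro mult_left_mono ent w(2)) simp_all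
    finally show "cmod (pauli_kernel S i j k l * (\<rho> $$ (j, i) * \<rho> $$ (l, k))) \<le> Re (pauli_kernel S i j k l) * ((p i * p k + p j * p l) / 2)"
      unfolding w(1) by simp
  qed
  also have "\<dots> = (\<Sum>i<?m. \<Sum>j<?m. \<Sum>k<?m. \<Sum>l<?m. (p i * p k / 2) * Re (pauli_kernel S i j k l)) +
     (\<Sum>i<?m. \<Sum>j<?m. \<Sum>k<?m. \<Sum>l<?m. (p j * p l / 2) * Re (pauli_kernel S i j k l))"
  proof -
    have "w * ((a + b) / 2) = a / 2 * w + b / 2 * w" for w a b :: real by (simp add: field_simps)
    then show ?thesis by (simp only: sum.distrib)
  qed
  also have "(\<Sum>i<?m. \<Sum>j<?m. \<Sum>k<?m. \<Sum>l<?m. (p i * p k / 2) * Re (pauli_kernel S i j k l)) =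
      (\<Sum>i<?m. \<Sum>k<?m. (p i * p k / 2) * (\<Sum>j<?m. \<Sum>l<?m. Re (pauli_kernel S i j k l)))"
    unfolding sum_distrib_left by (intro sum.cong refl sum.swap)
  also have "\<dots> = (\<Sum>i<?m. \<Sum>k<?m. (p i * p k / 2) * 2 ^ length (filter id S))"
    by (intro sum.cong refl) (simp add: pauli_kernel_sum_jl)
  also have "\<dots> = (\<Sum>i<?m. p i) * (\<Sum>k<?m. p k) * 2 ^ length (filter id S) / 2"
    unfolding sum_product by (simp add: sum_distrib_right sum_distrib_left sum_divide_distrib)
  also have "(\<Sum>i<?m. \<Sum>j<?m. \<Sum>k<?m. \<Sum>l<?m. (p j * p l / 2) * Re (pauli_kernel S i j k l)) =
      (\<Sum>j<?m. \<Sum>l<?m. \<Sum>i<?m. \<Sum>k<?m. (p j * p l / 2) * Re (pauli_kernel S i j k l))"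
  proof -
    have "(\<Sum>i\<in>A. \<Sum>j\<in>A. \<Sum>k\<in>A. \<Sum>l\<in>A. F i j k l) = (\<Sum>j\<in>A. \<Sum>l\<in>A. \<Sum>i\<in>A. \<Sum>k\<in>A. F i j k l)"
      for F :: "nat \<Rightarrow> nat \<Rightarrow> nat \<Rightarrow> nat \<Rightarrow> real" and A
    proof -
      have "(\<Sum>i\<in>A. \<Sum>j\<in>A. \<Sum>k\<in>A. \<Sum>l\<in>A. F i j k l) = (\<Sum>j\<in>A. \<Sum>i\<in>A. \<Sum>k\<in>A. \<Sum>l\<in>A. F i j k l)" by (rule sum.swap)
      also have "\<dots> = (\<Sum>j\<in>A. \<Sum>i\<in>A. \<Sum>l\<in>A. \<Sum>k\<in>A. F i j k l)" by (intro sum.cong refl sum.swap)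
      also have "\<dots> = (\<Sum>j\<in>A. \<Sum>l\<in>A. \<Sum>i\<in>A. \<Sum>k\<in>A. F i j k l)" by (intro sum.cong refl sum.swap)
      finally show ?thesis .
    qed
    then show ?thesis .
  qed
  also have "\<dots> = (\<Sum>j<?m. \<Sum>l<?m. (p j * p l / 2) * (\<Sum>i<?m. \<Sum>k<?m. Re (pauli_kernel S i j k l)))"
    unfolding sum_distrib_left ..
  also have "\<dots> = (\<Sum>j<?m. \<Sum>l<?m. (p j * p l / 2) * 2 ^ length (filter id S))"
    by (intro sum.cong refl) (simp add: pauli_kernel_sum_ik)
  also have "\<dots> = (\<Sum>j<?m. p j) * (\<Sum>l<?m. p l) * 2 ^ length (filter id S) / 2"
    unfolding sum_product by (simp add: sum_distrib_right sum_distrib_left sum_divide_distrib)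
  finally show ?thesis unfolding psum norm_of_real by (simp add: sum_nonneg id_def)
qed

section \<open>Clifford gates acting on one qubit\<close>

lemma on_qubit_list_carrier:
  assumes "U \<in> carrier_mat 2 2"
  shows "set ((replicate n (1\<^sub>m 2))[i := U]) \<subseteq> carrier_mat 2 2"
  using set_update_subset_insert[of "replicate n (1\<^sub>m 2)" i U] assms by auto

lemma on_qubit_carrier:
  assumes "U \<in> carrier_mat 2 2"
  shows "on_qubit n i U \<in> carrier_mat (2 ^ n) (2 ^ n)"
  unfolding on_qubit_def using tensor_prod_carrier[OF on_qubit_list_carrier[OF assms], of n i] by simp

lemma one_adjoint: "mat_adjoint (1\<^sub>m m :: complex mat) = 1\<^sub>m m"
  by (rule eq_matI) auto

lemma on_qubit_adjoint: "mat_adjoint (on_qubit n i U) = on_qubit n i (mat_adjoint U)"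
  by (simp add: on_qubit_def tensor_prod_adjoint map_update one_adjoint)

text \<open>The Heisenberg picture: the gate acts on the observable, and every tensor factor except
  the one at \<open>i\<close> is only multiplied by identities.\<close>

lemma on_qubit_conj:
  assumes U: "U \<in> carrier_mat 2 2" and i: "i < n" and P: "length P = n"
    and eq: "mat_adjoint U * pauli1 (P ! i) * U = c \<cdot>\<^sub>m pauli1 q"
  shows "mat_adjoint (on_qubit n i U) * pauli_mat P * on_qubit n i U = c \<cdot>\<^sub>m pauli_mat (P[i := q])"
proof -
  let ?I = "replicate n (1\<^sub>m 2) :: complex mat list"
  let ?V = "mat_adjoint U"
  have V: "?V \<in> carrier_mat 2 2" using U by simp
  note cU = on_qubit_list_carrier[OF U, of n i] and cV = on_qubit_list_carrier[OF V, of n i]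
  have 1: "tensor_prod (?I[i := ?V]) * pauli_mat P = tensor_prod (map2 (*) (?I[i := ?V]) (map pauli1 P))"
    unfolding pauli_mat_def using P cV by (intro tensor_prod_mult) auto
  have l1: "map2 (*) (?I[i := ?V]) (map pauli1 P) = (map pauli1 P)[i := ?V * pauli1 (P ! i)]"
    using P i by (intro nth_equalityI) (auto simp: nth_list_update)
  have c1: "set ((map pauli1 P)[i := ?V * pauli1 (P ! i)]) \<subseteq> carrier_mat 2 2"
    using set_update_subset_insert[of "map pauli1 P" i "?V * pauli1 (P ! i)"] mult_carrier_mat[OF V pauli1_carrier] by auto
  have l2: "map2 (*) ((map pauli1 P)[i := ?V * pauli1 (P ! i)]) (?I[i := U]) = (map pauli1 (P[i := q]))[i := c \<cdot>\<^sub>m pauli1 q]"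
    using P i eq by (intro nth_equalityI) (auto simp: nth_list_update)
  have "tensor_prod (?I[i := ?V]) * pauli_mat P * tensor_prod (?I[i := U]) = tensor_prod ((map pauli1 (P[i := q]))[i := c \<cdot>\<^sub>m pauli1 q])"
    unfolding 1 l1 using P cU c1 by (subst tensor_prod_mult) (simp_all add: l2)
  also have "\<dots> = c \<cdot>\<^sub>m tensor_prod ((map pauli1 (P[i := q]))[i := pauli1 q])"
    using P i by (intro tensor_prod_smult_update) simp
  also have "(map pauli1 (P[i := q]))[i := pauli1 q] = map pauli1 (P[i := q])"
    by (simp add: map_update)
  finally show ?thesis by (simp add: on_qubit_adjoint) (simp add: on_qubit_def pauli_mat_def)
qed

lemma on_qubit_unitary:
  assumes "U \<in> carrier_mat 2 2" "mat_adjoint U * U = 1\<^sub>m 2"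
  shows "mat_adjoint (on_qubit n i U) * on_qubit n i U = 1\<^sub>m (2 ^ n)"
proof -
  let ?I = "replicate n (1\<^sub>m 2) :: complex mat list"
  have V: "mat_adjoint U \<in> carrier_mat 2 2" using assms by simp
  have "tensor_prod (?I[i := mat_adjoint U]) * tensor_prod (?I[i := U]) =
      tensor_prod (map2 (*) (?I[i := mat_adjoint U]) (?I[i := U]))"
    using on_qubit_list_carrier[OF V, of n i] on_qubit_list_carrier[OF assms(1), of n i]
    by (intro tensor_prod_mult) auto
  also have "map2 (*) (?I[i := mat_adjoint U]) (?I[i := U]) = ?I"
  proof (rule nth_equalityI)
    fix j assume "j < length (map2 (*) (?I[i := mat_adjoint U]) (?I[i := U]))"
    then show "map2 (*) (?I[i := mat_adjoint U]) (?I[i := U]) ! j = ?I ! j"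
      using assms by (cases "j = i") simp_all
  qed simp
  finally show ?thesis by (simp add: on_qubit_adjoint) (simp add: on_qubit_def tensor_prod_one)
qed

lemma pauli_sign_cases: "pauli_sign s p = 1 \<or> pauli_sign s p = -1"
  by (simp add: pauli_sign_def)

lemma clifford1_pauli: "clifford1 (pauli1 s)"
proof -
  have "\<exists>m::nat. \<exists>q. pauli1 s * pauli1 p * mat_adjoint (pauli1 s) = (\<i> ^ m) \<cdot>\<^sub>m pauli1 q" for p
  proof -
    have "pauli_sign s p = \<i> ^ (0::nat) \<or> pauli_sign s p = \<i> ^ (2::nat)"
      using pauli_sign_cases[of s p] by simp
    then show ?thesis by (metis pauli1_adjoint pauli1_conj)
  qed
  then show ?thesis by (simp add: clifford1_def unitary_mat_def pauli1_square)
qed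

text \<open>Two gates suffice to permute the three letters up to sign: the Hadamard gate exchanges
  \<open>PX\<close> with \<open>PZ\<close>, the phase gate exchanges \<open>PX\<close> with
  \<open>PY\<close>.\<close>

definition hadamard :: "complex mat" where
  "hadamard = mat 2 2 (\<lambda>(i, j). complex_of_real (if i = 1 \<and> j = 1 then - sqrt (1/2) else sqrt (1/2)))"

definition phase_gate :: "complex mat" where
  "phase_gate = mat 2 2 (\<lambda>(i, j). if i \<noteq> j then 0 else if i = 0 then 1 else \<i>)"

lemma hadamard_carrier [simp]: "hadamard \<in> carrier_mat 2 2" by (simp add: hadamard_def)
lemma phase_gate_carrier [simp]: "phase_gate \<in> carrier_mat 2 2" by (simp add: phase_gate_def)

lemma mult3_entries:
  assumes "A \<in> carrier_mat 2 2" "B \<in> carrier_mat 2 2" "C \<in> carrier_mat 2 2" "i < 2" "j < 2"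
  shows "(A * B * C) $$ (i, j) = (A $$ (i, 0) * B $$ (0, 0) + A $$ (i, 1) * B $$ (1, 0)) * C $$ (0, j)
     + (A $$ (i, 0) * B $$ (0, 1) + A $$ (i, 1) * B $$ (1, 1)) * C $$ (1, j)"
  using assms mult_carrier_mat[OF assms(1,2)] by (subst index_mult2) (simp_all add: index_mult2 del: index_mult_mat(1))

lemma sqrt_half_mult: "complex_of_real (sqrt (1/2)) * complex_of_real (sqrt (1/2)) = 1/2"
  by (simp flip: of_real_mult)

lemma hadamard_entries [simp]:
  "hadamard $$ (0, 0) = complex_of_real (sqrt (1/2))" "hadamard $$ (0, Suc 0) = complex_of_real (sqrt (1/2))"
  "hadamard $$ (Suc 0, 0) = complex_of_real (sqrt (1/2))" "hadamard $$ (Suc 0, Suc 0) = - complex_of_real (sqrt (1/2))"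
  by (simp_all add: hadamard_def del: of_real_divide)

lemma phase_gate_entries [simp]:
  "phase_gate $$ (0, 0) = 1" "phase_gate $$ (0, Suc 0) = 0"
  "phase_gate $$ (Suc 0, 0) = 0" "phase_gate $$ (Suc 0, Suc 0) = \<i>"
  by (simp_all add: phase_gate_def)

lemma phase_gate_adjoint_entries [simp]:
  "mat_adjoint phase_gate $$ (0, 0) = 1" "mat_adjoint phase_gate $$ (0, Suc 0) = 0"
  "mat_adjoint phase_gate $$ (Suc 0, 0) = 0" "mat_adjoint phase_gate $$ (Suc 0, Suc 0) = - \<i>"
  by (simp_all add: phase_gate_def)

lemma phase_gate_adjoint_carrier [simp]: "mat_adjoint phase_gate \<in> carrier_mat 2 2"
  by simp

lemma hadamard_adjoint [simp]: "mat_adjoint hadamard = hadamard"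
  by (rule mat2_eqI) (simp_all add: hadamard_def)

lemma hadamard_square: "hadamard * hadamard = 1\<^sub>m 2"
proof (rule mat2_eqI)
  show "hadamard * hadamard \<in> carrier_mat 2 2" by (rule mult_carrier_mat[of _ 2 2]) simp_all
qed (simp_all add: index_mult2 sqrt_half_mult del: index_mult_mat(1))

lemma hadamard_conj:
  "hadamard * pauli1 p * hadamard =
     (case p of PI \<Rightarrow> \<i> ^ 0 | PX \<Rightarrow> \<i> ^ 0 | PY \<Rightarrow> \<i> ^ 2 | PZ \<Rightarrow> \<i> ^ 0) \<cdot>\<^sub>m
     pauli1 (case p of PI \<Rightarrow> PI | PX \<Rightarrow> PZ | PY \<Rightarrow> PY | PZ \<Rightarrow> PX)" (is "?L = ?R")
proof -
  let ?s = "complex_of_real (sqrt (1/2))"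
  have s: "?s * (z * ?s) = z / 2" "?s * ?s = 1/2" for z
    using sqrt_half_mult by (simp_all only: mult.left_commute[of _ z]) simp_all
  have L: "?L \<in> carrier_mat 2 2"
    by (intro mult_carrier_mat[of _ 2 2] mult_carrier_mat[of _ 2 2 _ 2]) simp_all
  have R: "?R \<in> carrier_mat 2 2" by simp
  show ?thesis
    by (rule mat2_eqI[OF L R];
        simp only: mult3_entries[OF hadamard_carrier pauli1_carrier hadamard_carrier] zero_less_numeral one_less_numeral_iff semiring_norm;
        cases p; simp add: algebra_simps s del: pauli1.simps)
qed

text \<open>The phase gate is not self-adjoint, so both orders are needed: the first shows that it
  is a Clifford gate, the second is its action on observables.\<close>

lemma phase_gate_conj:
  "phase_gate * pauli1 p * mat_adjoint phase_gate =
     (case p of PI \<Rightarrow> \<i> ^ 0 | PX \<Rightarrow> \<i> ^ 0 | PY \<Rightarrow> \<i> ^ 2 | PZ \<Rightarrow> \<i> ^ 0) \<cdot>\<^sub>m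
     pauli1 (case p of PI \<Rightarrow> PI | PX \<Rightarrow> PY | PY \<Rightarrow> PX | PZ \<Rightarrow> PZ)" (is "?L = ?R")
  and phase_gate_conj':
  "mat_adjoint phase_gate * pauli1 p * phase_gate =
     (case p of PI \<Rightarrow> 1 | PX \<Rightarrow> - 1 | PY \<Rightarrow> 1 | PZ \<Rightarrow> 1) \<cdot>\<^sub>m
     pauli1 (case p of PI \<Rightarrow> PI | PX \<Rightarrow> PY | PY \<Rightarrow> PX | PZ \<Rightarrow> PZ)" (is "?L' = ?R'")
proof -
  have L: "?L \<in> carrier_mat 2 2" and L': "?L' \<in> carrier_mat 2 2"
    by (intro mult_carrier_mat[of _ 2 2] mult_carrier_mat[of _ 2 2 _ 2]; simp)+
  have R: "?R \<in> carrier_mat 2 2" and R': "?R' \<in> carrier_mat 2 2" by simp_all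
  show "?L = ?R"
    by (rule mat2_eqI[OF L R];
        simp only: mult3_entries[OF phase_gate_carrier pauli1_carrier phase_gate_adjoint_carrier] zero_less_numeral one_less_numeral_iff semiring_norm;
        cases p; simp del: pauli1.simps)
  show "?L' = ?R'"
    by (rule mat2_eqI[OF L' R'];
        simp only: mult3_entries[OF phase_gate_adjoint_carrier pauli1_carrier phase_gate_carrier] zero_less_numeral one_less_numeral_iff semiring_norm;
        cases p; simp del: pauli1.simps)
qed

lemma clifford1_hadamard: "clifford1 hadamard"
  unfolding clifford1_def unitary_mat_def hadamard_adjoint hadamard_conj
proof (intro conjI allI)
  fix p
  show "\<exists>m::nat. \<exists>q. (case p of PI \<Rightarrow> \<i> ^ 0 | PX \<Rightarrow> \<i> ^ 0 | PY \<Rightarrow> \<i> ^ 2 | PZ \<Rightarrow> \<i> ^ 0) \<cdot>\<^sub>m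
     pauli1 (case p of PI \<Rightarrow> PI | PX \<Rightarrow> PZ | PY \<Rightarrow> PY | PZ \<Rightarrow> PX) = (\<i> ^ m) \<cdot>\<^sub>m pauli1 q"
    by (cases p; simp only: pauli.case; blast)
qed (simp_all add: hadamard_square carrier_matD[OF hadamard_carrier])

lemma phase_gate_unitary:
  "phase_gate * mat_adjoint phase_gate = 1\<^sub>m 2" "mat_adjoint phase_gate * phase_gate = 1\<^sub>m 2"
proof -
  have L: "phase_gate * mat_adjoint phase_gate \<in> carrier_mat 2 2" "mat_adjoint phase_gate * phase_gate \<in> carrier_mat 2 2"
    by (rule mult_carrier_mat[of _ 2 2]; simp)+
  show "phase_gate * mat_adjoint phase_gate = 1\<^sub>m 2"
    by (rule mat2_eqI[OF L(1)]) (simp_all add: index_mult2 del: index_mult_mat(1))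
  show "mat_adjoint phase_gate * phase_gate = 1\<^sub>m 2"
    by (rule mat2_eqI[OF L(2)]) (simp_all add: index_mult2 del: index_mult_mat(1))
qed

lemma clifford1_phase_gate: "clifford1 phase_gate"
  unfolding clifford1_def unitary_mat_def phase_gate_conj
proof (intro conjI allI)
  fix p
  show "\<exists>m::nat. \<exists>q. (case p of PI \<Rightarrow> \<i> ^ 0 | PX \<Rightarrow> \<i> ^ 0 | PY \<Rightarrow> \<i> ^ 2 | PZ \<Rightarrow> \<i> ^ 0) \<cdot>\<^sub>m
     pauli1 (case p of PI \<Rightarrow> PI | PX \<Rightarrow> PY | PY \<Rightarrow> PX | PZ \<Rightarrow> PZ) = (\<i> ^ m) \<cdot>\<^sub>m pauli1 q"
    by (cases p; simp only: pauli.case; blast)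
qed (simp_all add: phase_gate_unitary carrier_matD[OF phase_gate_carrier])

section \<open>Moments under an invariant distribution\<close>

lemma expval_conj:
  assumes "U \<in> carrier_mat (2^n) (2^n)" "A \<in> carrier_mat (2^n) (2^n)" "\<rho> \<in> carrier_mat (2^n) (2^n)"
  shows "expval A (U * \<rho> * mat_adjoint U) = expval (mat_adjoint U * A * U) \<rho>"
proof -
  let ?m = "2 ^ n :: nat"
  have U': "mat_adjoint U \<in> carrier_mat ?m ?m" using assms by simp
  have c: "U * \<rho> \<in> carrier_mat ?m ?m" "A * (U * \<rho>) \<in> carrier_mat ?m ?m" "mat_adjoint U * A \<in> carrier_mat ?m ?m"
    using assms U' by (auto intro: mult_carrier_mat)
  have "mtrace (A * (U * \<rho> * mat_adjoint U)) = mtrace (A * (U * \<rho>) * mat_adjoint U)"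
    using assms U' c by (simp add: assoc_mult_mat[of _ ?m ?m _ ?m _ ?m])
  also have "\<dots> = mtrace (mat_adjoint U * (A * (U * \<rho>)))"
    by (rule mtrace_mult_commute[OF c(2) U'])
  also have "mat_adjoint U * (A * (U * \<rho>)) = mat_adjoint U * A * U * \<rho>"
    using assms U' c by (simp add: assoc_mult_mat[of _ ?m ?m _ ?m _ ?m])
  finally show ?thesis by (simp add: expval_def)
qed

lemma expval_smult:
  assumes "A \<in> carrier_mat m m" "\<rho> \<in> carrier_mat m m"
  shows "expval (complex_of_real c \<cdot>\<^sub>m A) \<rho> = c * expval A \<rho>"
proof -
  have "mtrace (complex_of_real c \<cdot>\<^sub>m A * \<rho>) = complex_of_real c * mtrace (A * \<rho>)"
    using assms by (simp add: mtrace_mult[of _ m m] sum_distrib_left mult.assoc)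
  then show ?thesis by (simp add: expval_def)
qed

locale invariant_states =
  fixes n :: nat and D :: "complex mat measure"
  assumes distribution: "state_distribution n D"
    and invariant: "clifford1_invariant n D"
begin

sublocale prob_space D
  using distribution by (simp add: state_distribution_def)

lemma sets_D: "sets D = sets (state_space n)"
  using distribution by (simp add: state_distribution_def)

lemma space_D: "space D = states n"
  using sets_eq_imp_space_eq[OF sets_D] by (simp add: state_space_def Let_def)

lemma measurable_entry:
  assumes "i < 2^n" "j < 2^n"
  shows "(\<lambda>\<rho>. \<rho> $$ (i, j)) \<in> borel_measurable D"
proof -
  let ?I = "{..<2 ^ n} \<times> {..<2 ^ n} :: (nat \<times> nat) set"
  have "(\<lambda>\<rho>. \<lambda>ij\<in>?I. \<rho> $$ ij) \<in> states n \<rightarrow> space (\<Pi>\<^sub>M ij\<in>?I. borel :: complex measure)"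
    by (auto simp: space_PiM)
  then have "(\<lambda>\<rho>. \<lambda>ij\<in>?I. \<rho> $$ ij) \<in> measurable (state_space n) (\<Pi>\<^sub>M ij\<in>?I. borel)"
    unfolding state_space_def Let_def by (rule measurable_vimage_algebra1)
  then have "(\<lambda>\<rho>. (\<lambda>ij\<in>?I. \<rho> $$ ij) (i, j)) \<in> borel_measurable (state_space n)"
    by (rule measurable_compose[OF _ measurable_component_singleton]) (use assms in auto)
  then have "(\<lambda>\<rho>. \<rho> $$ (i, j)) \<in> borel_measurable (state_space n)" using assms by simp
  then show ?thesis by (simp add: measurable_cong_sets[OF sets_D refl])
qed

lemma state_carrier: "\<rho> \<in> space D \<Longrightarrow> \<rho> \<in> carrier_mat (2^n) (2^n)"
  by (simp add: space_D states_def)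

lemma measurable_expval:
  assumes "A \<in> carrier_mat (2^n) (2^n)"
  shows "expval A \<in> borel_measurable D"
proof -
  have "(\<lambda>\<rho>. \<Sum>i<2^n. \<Sum>j<2^n. A $$ (i, j) * \<rho> $$ (j, i)) \<in> borel_measurable D"
    using measurable_entry by (intro borel_measurable_sum borel_measurable_times borel_measurable_const) auto
  from measurable_compose[OF this, of Re borel]
  have "(\<lambda>\<rho>. Re (\<Sum>i<2^n. \<Sum>j<2^n. A $$ (i, j) * \<rho> $$ (j, i))) \<in> borel_measurable D" by simp
  then show ?thesis
    using state_carrier assms by (subst measurable_cong) (auto simp: expval_def mtrace_mult[of _ "2^n" "2^n"])
qed

text \<open>Each entry of the image is a linear combination of entries of the state, and these
  entries generate the measurable sets. The change of variables in \<open>integral_clifford\<close>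
  rests on this.\<close>

lemma measurable_conj:
  assumes "U \<in> carrier_mat (2^n) (2^n)" "mat_adjoint U * U = 1\<^sub>m (2^n)"
  shows "(\<lambda>\<rho>. U * \<rho> * mat_adjoint U) \<in> measurable D D"
proof -
  let ?I = "{..<2 ^ n} \<times> {..<2 ^ n} :: (nat \<times> nat) set" and ?m = "2 ^ n :: nat"
  have V: "mat_adjoint U \<in> carrier_mat ?m ?m" using assms by simp
  have "(\<lambda>\<rho>. \<lambda>ij\<in>?I. (U * \<rho> * mat_adjoint U) $$ ij) \<in> measurable D (\<Pi>\<^sub>M ij\<in>?I. borel)"
  proof (rule measurable_restrict)
    fix ij assume "ij \<in> ?I"
    then obtain i j where ij: "ij = (i, j)" "i < ?m" "j < ?m" by auto
    have "(\<lambda>\<rho>. \<Sum>k<?m. (\<Sum>l<?m. U $$ (i, l) * \<rho> $$ (l, k)) * mat_adjoint U $$ (k, j)) \<in> borel_measurable D"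
      using measurable_entry by (intro borel_measurable_sum borel_measurable_times borel_measurable_const) auto
    moreover have "(U * \<rho> * mat_adjoint U) $$ (i, j) = (\<Sum>k<?m. (\<Sum>l<?m. U $$ (i, l) * \<rho> $$ (l, k)) * mat_adjoint U $$ (k, j))"
      if "\<rho> \<in> space D" for \<rho>
    proof -
      have r: "\<rho> \<in> carrier_mat ?m ?m" by (rule state_carrier[OF that])
      have "(U * \<rho> * mat_adjoint U) $$ (i, j) = (\<Sum>k<?m. (U * \<rho>) $$ (i, k) * mat_adjoint U $$ (k, j))"
        using mult_carrier_mat[OF assms(1) r] V ij by (intro index_mult) auto
      also have "\<dots> = (\<Sum>k<?m. (\<Sum>l<?m. U $$ (i, l) * \<rho> $$ (l, k)) * mat_adjoint U $$ (k, j))"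
        using assms(1) r ij by (intro sum.cong refl) (subst index_mult[of _ ?m ?m _ ?m], auto)
      finally show ?thesis .
    qed
    ultimately show "(\<lambda>\<rho>. (U * \<rho> * mat_adjoint U) $$ ij) \<in> borel_measurable D"
      unfolding ij by (subst measurable_cong) auto
  qed
  then have "(\<lambda>\<rho>. U * \<rho> * mat_adjoint U) \<in> measurable D (state_space n)"
    unfolding state_space_def Let_def
    using conj_unitary_states[OF assms] by (intro measurable_vimage_algebra2) (auto simp: space_D)
  then show ?thesis by (simp add: measurable_cong_sets[OF refl sets_D])
qed

lemma integral_clifford:
  assumes U: "clifford1 U" and i: "i < n" and f: "f \<in> borel_measurable D"
  shows "(LINT \<rho>|D. f (on_qubit n i U * \<rho> * mat_adjoint (on_qubit n i U))) = (LINT \<rho>|D. f \<rho> :: real)"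
proof -
  have c: "U \<in> carrier_mat 2 2" "mat_adjoint U * U = 1\<^sub>m 2"
    using U by (auto simp: clifford1_def unitary_mat_def)
  have "(\<lambda>\<rho>. on_qubit n i U * \<rho> * mat_adjoint (on_qubit n i U)) \<in> measurable D D"
    by (intro measurable_conj on_qubit_carrier on_qubit_unitary c)
  from integral_distr[OF this f] show ?thesis
    using invariant U i by (simp add: clifford1_invariant_def)
qed

lemma expval_on_qubit:
  assumes "U \<in> carrier_mat 2 2" "i < n" "length P = n" "\<rho> \<in> space D"
    and "mat_adjoint U * pauli1 (P ! i) * U = complex_of_real c \<cdot>\<^sub>m pauli1 q"
  shows "expval (pauli_mat P) (on_qubit n i U * \<rho> * mat_adjoint (on_qubit n i U)) = c * expval (pauli_mat (P[i := q])) \<rho>"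
proof -
  have "pauli_mat P \<in> carrier_mat (2^n) (2^n)" "pauli_mat (P[i := q]) \<in> carrier_mat (2^n) (2^n)"
    using pauli_mat_carrier[of P] pauli_mat_carrier[of "P[i := q]"] assms(3) by simp_all
  then show ?thesis
    using expval_conj[OF on_qubit_carrier[OF assms(1)]] state_carrier[OF assms(4)]
    by (simp add: on_qubit_conj[OF assms(1,2,3,5)] expval_smult[of _ "2^n"])
qed

section \<open>Second moments of Pauli strings\<close>

lemma measurable_pauli: "length P = n \<Longrightarrow> expval (pauli_mat P) \<in> borel_measurable D"
  using measurable_expval[of "pauli_mat P"] pauli_mat_carrier[of P] by simp

lemma integrable_pauli_mult:
  assumes "length P = n" "length Q = n"
  shows "integrable D (\<lambda>\<rho>. expval (pauli_mat P) \<rho> * expval (pauli_mat Q) \<rho>)"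
proof (rule integrable_const_bound[where B = 1])
  show "AE \<rho> in D. norm (expval (pauli_mat P) \<rho> * expval (pauli_mat Q) \<rho>) \<le> 1"
    using expval_pauli_le[OF assms(1)] expval_pauli_le[OF assms(2)]
    by (intro AE_I2) (auto simp: space_D abs_mult intro!: mult_le_one)
qed (use measurable_pauli assms in auto)

definition moment :: "pauli list \<Rightarrow> real" where
  "moment P = (LINT \<rho>|D. (expval (pauli_mat P) \<rho>)\<^sup>2)"

lemma moment_nonneg: "0 \<le> moment P"
  by (simp add: moment_def)

text \<open>At a qubit where the letters differ, some Pauli gate commutes with one letter and
  anticommutes with the other. Conjugation by it preserves the distribution but reverses the sign of
  the product, so the mean equals its own negative.\<close>

lemma cross_moment_zero:
  assumes P: "length P = n" and Q: "length Q = n" and "P \<noteq> Q"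
  shows "(LINT \<rho>|D. expval (pauli_mat P) \<rho> * expval (pauli_mat Q) \<rho>) = 0"
proof -
  obtain i where i: "i < n" "P ! i \<noteq> Q ! i" using assms nth_equalityI by metis
  have ex: "\<exists>s. pauli_sign s p * pauli_sign s q = -1" if "p \<noteq> q" for p q
  proof -
    have "pauli_sign PX p * pauli_sign PX q = -1 \<or> pauli_sign PY p * pauli_sign PY q = -1 \<or> pauli_sign PZ p * pauli_sign PZ q = -1"
      using that by (cases p; cases q; simp add: pauli_sign_def)
    then show ?thesis by blast
  qed
  obtain s where s: "pauli_sign s (P ! i) * pauli_sign s (Q ! i) = -1" using ex[OF i(2)] by blast
  define a b where "a = Re (pauli_sign s (P ! i))" and "b = Re (pauli_sign s (Q ! i))"
  have a: "pauli_sign s (P ! i) = complex_of_real a" and b: "pauli_sign s (Q ! i) = complex_of_real b"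
    using pauli_sign_cases[of s "P ! i"] pauli_sign_cases[of s "Q ! i"] by (auto simp: a_def b_def)
  have ab: "a * b = -1" using s unfolding a b by (metis of_real_1 of_real_eq_iff of_real_minus of_real_mult)
  have e: "expval (pauli_mat R) (on_qubit n i (pauli1 s) * \<rho> * mat_adjoint (on_qubit n i (pauli1 s))) = c * expval (pauli_mat R) \<rho>"
    if "length R = n" "\<rho> \<in> space D" "pauli_sign s (R ! i) = complex_of_real c" for R \<rho> c
    using expval_on_qubit[OF pauli1_carrier i(1) that(1,2), of s c "R ! i"] that by (simp add: pauli1_conj)
  let ?f = "\<lambda>\<rho>. expval (pauli_mat P) \<rho> * expval (pauli_mat Q) \<rho>"
  have "(LINT \<rho>|D. ?f \<rho>) = (LINT \<rho>|D. ?f (on_qubit n i (pauli1 s) * \<rho> * mat_adjoint (on_qubit n i (pauli1 s))))"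
    using measurable_pauli[OF P] measurable_pauli[OF Q] by (intro integral_clifford[symmetric] clifford1_pauli i) auto
  also have "\<dots> = (LINT \<rho>|D. - ?f \<rho>)"
  proof (rule Bochner_Integration.integral_cong[OF refl])
    fix \<rho> assume r: "\<rho> \<in> space D"
    have "a * x * (b * y) = - (x * y)" for x y
      using ab by (metis mult.assoc mult.left_commute mult_minus1)
    then show "?f (on_qubit n i (pauli1 s) * \<rho> * mat_adjoint (on_qubit n i (pauli1 s))) = - ?f \<rho>"
      by (simp only: e[OF P r a] e[OF Q r b])
  qed
  finally show ?thesis by simp
qed

text \<open>The gate replaces the letter at \<open>i\<close> up to the sign \<open>c\<close>, which
  the square removes.\<close>

lemma moment_clifford:
  assumes U: "clifford1 U" and i: "i < n" and P: "length P = n" and c: "c\<^sup>2 = 1"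
    and eq: "mat_adjoint U * pauli1 (P ! i) * U = complex_of_real c \<cdot>\<^sub>m pauli1 q"
  shows "moment (P[i := q]) = moment P"
proof -
  have U2: "U \<in> carrier_mat 2 2" using U by (simp add: clifford1_def)
  have "moment P = (LINT \<rho>|D. (expval (pauli_mat P) (on_qubit n i U * \<rho> * mat_adjoint (on_qubit n i U)))\<^sup>2)"
    unfolding moment_def using measurable_pauli[OF P] by (intro integral_clifford[symmetric] U i) auto
  also have "\<dots> = (LINT \<rho>|D. (expval (pauli_mat (P[i := q])) \<rho>)\<^sup>2)"
    by (intro Bochner_Integration.integral_cong refl)
       (simp add: expval_on_qubit[OF U2 i P _ eq] power_mult_distrib c)
  finally show ?thesis by (simp add: moment_def)
qed

lemma moment_swap:
  assumes i: "i < n" and P: "length P = n"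
  shows "P ! i = PX \<Longrightarrow> moment (P[i := PZ]) = moment P" "P ! i = PX \<Longrightarrow> moment (P[i := PY]) = moment P"
proof -
  show "moment (P[i := PZ]) = moment P" if "P ! i = PX"
    by (rule moment_clifford[OF clifford1_hadamard i P, of 1]) (simp_all add: hadamard_conj that)
  show "moment (P[i := PY]) = moment P" if "P ! i = PX"
    by (rule moment_clifford[OF clifford1_phase_gate i P, of "-1"]) (simp_all add: phase_gate_conj' that)
qed

text \<open>Both strings are compared with the one that has \<open>PX\<close> at \<open>i\<close>,
  the letter that the two gates connect to the other two.\<close>

lemma moment_update:
  assumes i: "i < n" and P: "length P = n" and "P ! i \<noteq> PI" "q \<noteq> PI"
  shows "moment (P[i := q]) = moment P"
proof -
  have X: "moment (P[i := q]) = moment (P[i := PX])" if "q \<noteq> PI" for q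
    using that moment_swap[of i "P[i := PX]"] i P by (cases q) simp_all
  have "moment P = moment (P[i := P ! i])" by simp
  then show ?thesis using X[OF assms(3)] X[OF assms(4)] by simp
qed

definition same_support :: "pauli list \<Rightarrow> pauli list set" where
  "same_support P = {Q. list_all2 (\<lambda>p q. p = PI \<longleftrightarrow> q = PI) P Q}"

text \<open>The letters are replaced one by one from the left, through the hybrids
  \<open>take j Q @ drop j P\<close>.\<close>

lemma moment_same_support:
  assumes P: "length P = n" and Q: "Q \<in> same_support P"
  shows "moment Q = moment P"
proof -
  have l: "length Q = n" and PI: "\<And>j. j < n \<Longrightarrow> P ! j = PI \<longleftrightarrow> Q ! j = PI"
    using Q P by (auto simp: same_support_def list_all2_conv_all_nth)
  have "moment (take j Q @ drop j P) = moment P" if "j \<le> n" for j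
    using that
  proof (induction j)
    case (Suc j)
    let ?R = "take j Q @ drop j P"
    have j: "j < n" using Suc by simp
    have R: "length ?R = n" "?R ! j = P ! j" using l P j by (auto simp: nth_append)
    have e: "take (Suc j) Q @ drop (Suc j) P = ?R[j := Q ! j]"
      using l P j by (simp add: list_update_append take_Suc_conv_app_nth Cons_nth_drop_Suc[symmetric])
    show ?case
    proof (cases "P ! j = PI")
      case True
      then have "?R[j := Q ! j] = ?R" using PI[OF j] R(2) by (metis list_update_id)
      then show ?thesis using Suc e by simp
    next
      case False
      then have "moment (?R[j := Q ! j]) = moment ?R" using PI[OF j] R j by (intro moment_update) auto
      then show ?thesis using Suc e by simp
    qed
  qed simp
  from this[of n] show ?thesis using l P by simp
qed

lemma same_support_Cons: "same_support (p # P) = (\<lambda>(q, Q). q # Q) ` ((if p = PI then {PI} else {PX, PY, PZ}) \<times> same_support P)"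
proof -
  have "q \<noteq> PI \<longleftrightarrow> q \<in> {PX, PY, PZ}" for q by (cases q) auto
  then show ?thesis by (auto simp: same_support_def list_all2_Cons1 image_iff)
qed

lemma card_same_support: "finite (same_support P) \<and> card (same_support P) = 3 ^ pauli_weight P"
proof (induction P)
  case Nil
  then show ?case by (simp add: same_support_def pauli_weight_def)
next
  case (Cons p P)
  have "inj_on (\<lambda>(q, Q). q # Q) A" for A :: "(pauli \<times> pauli list) set" by (auto simp: inj_on_def)
  then show ?case using Cons unfolding same_support_Cons
    by (auto simp: card_image card_cartesian_product pauli_weight_def)
qed

text \<open>The \<open>3^m\<close> strings with the support of \<open>P\<close> have the same
  moment, and pointwise their squares sum to at most \<open>2^m\<close>, because all of them live on
  the same \<open>m\<close> qubits.\<close>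

lemma moment_le:
  assumes P: "length P = n"
  shows "moment P \<le> (2 / 3) ^ pauli_weight P"
proof -
  let ?S = "map (\<lambda>p. p \<noteq> PI) P"
  have S: "length ?S = n" using P by simp
  have f: "length (filter id ?S) = pauli_weight P"
    by (induction P) (auto simp: pauli_weight_def)
  have sub: "same_support P \<subseteq> supported_on ?S"
    by (auto simp: same_support_def supported_on_def list_all2_conv_all_nth)
  have len: "length Q = n" if "Q \<in> same_support P" for Q
    using that P by (auto simp: same_support_def dest: list_all2_lengthD)
  have "3 ^ pauli_weight P * moment P = (\<Sum>Q\<in>same_support P. moment P)"
    using card_same_support[of P] by simp
  also have "\<dots> = (\<Sum>Q\<in>same_support P. moment Q)"
    by (intro sum.cong refl moment_same_support[OF P, symmetric])
  also have "\<dots> = (LINT \<rho>|D. (\<Sum>Q\<in>same_support P. (expval (pauli_mat Q) \<rho>)\<^sup>2))"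
    unfolding moment_def using integrable_pauli_mult[OF len len]
    by (intro Bochner_Integration.integral_sum[symmetric]) (simp add: power2_eq_square)
  also have "\<dots> \<le> (LINT \<rho>|D. 2 ^ pauli_weight P)"
  proof (rule integral_mono)
    show "integrable D (\<lambda>\<rho>. \<Sum>Q\<in>same_support P. (expval (pauli_mat Q) \<rho>)\<^sup>2)"
      using integrable_pauli_mult[OF len len] by (intro Bochner_Integration.integrable_sum) (simp add: power2_eq_square)
    fix \<rho> assume "\<rho> \<in> space D"
    then have r: "\<rho> \<in> states (length ?S)" using S by (simp add: space_D)
    have "(\<Sum>Q\<in>same_support P. (expval (pauli_mat Q) \<rho>)\<^sup>2) \<le> (\<Sum>Q\<in>supported_on ?S. (expval (pauli_mat Q) \<rho>)\<^sup>2)"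
      by (intro sum_mono2 sub) auto
    also have "\<dots> \<le> 2 ^ pauli_weight P" using sum_expval_sq_le[OF r] f by simp
    finally show "(\<Sum>Q\<in>same_support P. (expval (pauli_mat Q) \<rho>)\<^sup>2) \<le> 2 ^ pauli_weight P" .
  qed simp
  finally have "3 ^ pauli_weight P * moment P \<le> 2 ^ pauli_weight P" by (simp add: prob_space)
  then show ?thesis by (simp add: power_divide field_simps)
qed

lemma second_moment_combination:
  assumes S: "S \<subseteq> pauli_strings n"
  shows "integrable D (\<lambda>\<rho>. (\<Sum>P\<in>S. b P * expval (pauli_mat P) \<rho>)\<^sup>2)" (is ?I)
    and "(LINT \<rho>|D. (\<Sum>P\<in>S. b P * expval (pauli_mat P) \<rho>)\<^sup>2) = (\<Sum>P\<in>S. (b P)\<^sup>2 * moment P)" (is ?E)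
proof -
  have fin: "finite S" by (rule finite_subset[OF S finite_pauli_strings])
  have len: "length P = n" if "P \<in> S" for P using that S by (auto simp: pauli_strings_def)
  have e: "(\<Sum>P\<in>S. b P * expval (pauli_mat P) \<rho>)\<^sup>2 =
    (\<Sum>P\<in>S. \<Sum>Q\<in>S. b P * b Q * (expval (pauli_mat P) \<rho> * expval (pauli_mat Q) \<rho>))" for \<rho>
    unfolding power2_eq_square sum_product by (intro sum.cong refl) (simp add: mult_ac)
  have i: "integrable D (\<lambda>\<rho>. b P * b Q * (expval (pauli_mat P) \<rho> * expval (pauli_mat Q) \<rho>))"
    if "P \<in> S" "Q \<in> S" for P Q
    using integrable_pauli_mult[OF len len] that by (intro integrable_mult_right) auto
  show ?I unfolding e using i by (intro Bochner_Integration.integrable_sum) auto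
  have "(LINT \<rho>|D. (\<Sum>P\<in>S. b P * expval (pauli_mat P) \<rho>)\<^sup>2) =
     (\<Sum>P\<in>S. \<Sum>Q\<in>S. (LINT \<rho>|D. b P * b Q * (expval (pauli_mat P) \<rho> * expval (pauli_mat Q) \<rho>)))"
    unfolding e using i by (subst Bochner_Integration.integral_sum, intro Bochner_Integration.integrable_sum, simp)
      (intro sum.cong refl Bochner_Integration.integral_sum, simp)
  also have "\<dots> = (\<Sum>P\<in>S. \<Sum>Q\<in>S. if P = Q then (b P)\<^sup>2 * moment P else 0)"
  proof (rule sum.cong[OF refl], rule sum.cong[OF refl])
    fix P Q assume PQ: "P \<in> S" "Q \<in> S"
    have "(LINT \<rho>|D. b P * b Q * (expval (pauli_mat P) \<rho> * expval (pauli_mat Q) \<rho>)) =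
      b P * b Q * (LINT \<rho>|D. expval (pauli_mat P) \<rho> * expval (pauli_mat Q) \<rho>)" by simp
    then show "(LINT \<rho>|D. b P * b Q * (expval (pauli_mat P) \<rho> * expval (pauli_mat Q) \<rho>)) = (if P = Q then (b P)\<^sup>2 * moment P else 0)"
      using cross_moment_zero[OF len[OF PQ(1)] len[OF PQ(2)]] by (auto simp: moment_def power2_eq_square)
  qed
  also have "\<dots> = (\<Sum>P\<in>S. (b P)\<^sup>2 * moment P)" using fin by simp
  finally show ?E .
qed

end

section \<open>Functions of low degree on the cube\<close>

text \<open>Extensional functions keep the cube finite and let it be split along one
  coordinate.\<close>

definition cube :: "'v set \<Rightarrow> ('v \<Rightarrow> real) set" where
  "cube V = Pi\<^sub>E V (\<lambda>_. {-1, 1})"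

definition cube_mean :: "'v set \<Rightarrow> (('v \<Rightarrow> real) \<Rightarrow> real) \<Rightarrow> real" where
  "cube_mean V g = (\<Sum>s\<in>cube V. g s) / 2 ^ card V"

text \<open>A Walsh-Fourier expansion; \<open>s\<close> is not restricted to the cube, since later
  it is also a point of the solid cube.\<close>

definition multilinear :: "'v set \<Rightarrow> ('v set \<Rightarrow> real) \<Rightarrow> ('v \<Rightarrow> real) \<Rightarrow> real" where
  "multilinear V a s = (\<Sum>S\<in>Pow V. a S * (\<Prod>v\<in>S. s v))"

lemma cube_mean_insert:
  assumes "finite V" "v \<notin> V"
  shows "cube_mean (insert v V) g = cube_mean V (\<lambda>s. (g (s(v := 1)) + g (s(v := -1))) / 2)"
proof -
  have "cube (insert v V) = (\<lambda>(y, s). s(v := y)) ` ({-1, 1} \<times> cube V)"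
    by (simp add: cube_def PiE_insert_eq)
  moreover have "inj_on (\<lambda>(y, s). s(v := y)) ({-1, 1} \<times> cube V)"
    unfolding cube_def using assms(2) by (rule inj_combinator)
  ultimately have "(\<Sum>s\<in>cube (insert v V). g s) = (\<Sum>(y, s)\<in>{-1, 1} \<times> cube V. g (s(v := y)))"
    by (simp add: sum.reindex case_prod_unfold)
  also have "\<dots> = (\<Sum>s\<in>cube V. g (s(v := 1)) + g (s(v := -1)))"
    by (simp add: sum.cartesian_product[symmetric] sum.distrib)
  finally show ?thesis using assms
    by (simp add: cube_mean_def sum_divide_distrib[symmetric] field_simps)
qed

lemma cube_mean_empty: "cube_mean {} g = g (\<lambda>_. undefined)"
  by (simp add: cube_mean_def cube_def)

lemma cube_mean_add: "cube_mean V (\<lambda>s. f s + g s) = cube_mean V f + cube_mean V g"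
  by (simp add: cube_mean_def sum.distrib add_divide_distrib)

lemma cube_mean_diff: "cube_mean V (\<lambda>s. f s - g s) = cube_mean V f - cube_mean V g"
  by (simp add: cube_mean_def sum_subtractf diff_divide_distrib)

lemma cube_mean_cmult: "cube_mean V (\<lambda>s. c * f s) = c * cube_mean V f"
  by (simp add: cube_mean_def sum_distrib_left)

lemma cube_mean_sum: "cube_mean V (\<lambda>s. \<Sum>i\<in>I. f i s) = (\<Sum>i\<in>I. cube_mean V (f i))"
  by (simp add: cube_mean_def sum_divide_distrib[symmetric]) (simp add: sum.swap[of _ I])

lemma cube_mean_mono: "(\<And>s. s \<in> cube V \<Longrightarrow> f s \<le> g s) \<Longrightarrow> cube_mean V f \<le> cube_mean V g"
  unfolding cube_mean_def by (intro divide_right_mono sum_mono) auto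

lemma cube_mean_nonneg: "(\<And>s. s \<in> cube V \<Longrightarrow> 0 \<le> f s) \<Longrightarrow> 0 \<le> cube_mean V f"
  unfolding cube_mean_def by (intro divide_nonneg_nonneg sum_nonneg) auto

lemma card_cube: "finite V \<Longrightarrow> card (cube V) = 2 ^ card V"
  by (simp add: cube_def card_PiE) (simp add: numeral_2_eq_2)

lemma cube_mean_const: "finite V \<Longrightarrow> cube_mean V (\<lambda>_. c) = c"
  by (simp add: cube_mean_def card_cube)

lemma cube_mean_Cauchy_Schwarz:
  "(cube_mean V (\<lambda>s. f s * g s))\<^sup>2 \<le> cube_mean V (\<lambda>s. (f s)\<^sup>2) * cube_mean V (\<lambda>s. (g s)\<^sup>2)"
  unfolding cube_mean_def
  using Cauchy_Schwarz_ineq_sum[of f g "cube V"] by (simp add: power_divide power2_eq_square divide_right_mono)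

lemma multilinear_upd:
  assumes "v \<notin> V"
  shows "multilinear V a (s(v := y)) = multilinear V a s"
  unfolding multilinear_def
proof (intro sum.cong refl arg_cong2[where f="(*)"] prod.cong)
  fix S w assume "S \<in> Pow V" "w \<in> S"
  then show "(s(v := y)) w = s w" using assms by auto
qed

lemma multilinear_insert:
  assumes "finite V" "v \<notin> V"
  shows "multilinear (insert v V) a (s(v := y)) = multilinear V a s + y * multilinear V (\<lambda>S. a (insert v S)) s"
proof -
  have "multilinear (insert v V) a (s(v := y)) = multilinear V a (s(v := y)) +
      (\<Sum>S\<in>Pow V. a (insert v S) * (\<Prod>w\<in>insert v S. (s(v := y)) w))"
  proof -
    have "inj_on (insert v) (Pow V)" using assms(2) by (auto simp: inj_on_def)
    moreover have "Pow V \<inter> insert v ` Pow V = {}" using assms(2) by auto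
    ultimately show ?thesis using assms(1)
      by (simp add: multilinear_def Pow_insert sum.union_disjoint sum.reindex)
  qed
  also have "(\<Sum>S\<in>Pow V. a (insert v S) * (\<Prod>w\<in>insert v S. (s(v := y)) w)) =
      (\<Sum>S\<in>Pow V. y * (a (insert v S) * (\<Prod>w\<in>S. (s(v := y)) w)))"
  proof (intro sum.cong refl)
    fix S assume "S \<in> Pow V"
    then have "finite S" "v \<notin> S" using assms finite_subset by auto
    then show "a (insert v S) * (\<Prod>w\<in>insert v S. (s(v := y)) w) = y * (a (insert v S) * (\<Prod>w\<in>S. (s(v := y)) w))"
      by simp
  qed
  also have "\<dots> = y * multilinear V (\<lambda>S. a (insert v S)) (s(v := y))"
    by (simp add: multilinear_def sum_distrib_left)
  finally show ?thesis unfolding multilinear_upd[OF assms(2)] .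
qed

text \<open>Splitting off a coordinate gives \<open>u + y * h\<close>; averaging over
  \<open>y = 1\<close> and \<open>y = -1\<close> removes the mixed term of the square.\<close>

lemma parseval:
  assumes "finite V"
  shows "cube_mean V (\<lambda>s. (multilinear V a s)\<^sup>2) = (\<Sum>S\<in>Pow V. (a S)\<^sup>2)"
  using assms
proof (induction V arbitrary: a rule: finite_induct)
  case empty
  then show ?case by (simp add: cube_mean_empty multilinear_def)
next
  case (insert v V)
  let ?u = "multilinear V a" and ?h = "multilinear V (\<lambda>S. a (insert v S))"
  have "cube_mean (insert v V) (\<lambda>s. (multilinear (insert v V) a s)\<^sup>2) = cube_mean V (\<lambda>s. (?u s)\<^sup>2 + (?h s)\<^sup>2)"
    unfolding cube_mean_insert[OF insert.hyps] multilinear_insert[OF insert.hyps]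
    by (intro arg_cong[where f="cube_mean V"] ext) (simp add: power2_eq_square field_simps)
  also have "\<dots> = (\<Sum>S\<in>Pow V. (a S)\<^sup>2) + (\<Sum>S\<in>Pow V. (a (insert v S))\<^sup>2)"
    by (simp add: cube_mean_add insert.IH)
  also have "\<dots> = (\<Sum>S\<in>Pow (insert v V). (a S)\<^sup>2)"
  proof -
    have "inj_on (insert v) (Pow V)" using insert.hyps by (auto simp: inj_on_def)
    moreover have "Pow V \<inter> insert v ` Pow V = {}" using insert.hyps by auto
    ultimately show ?thesis using insert.hyps
      by (simp add: Pow_insert sum.union_disjoint sum.reindex)
  qed
  finally show ?case .
qed

text \<open>Bonami's lemma. With one coordinate split off as \<open>u + y * h\<close>, the odd
  powers of \<open>y\<close> average out. The mixed term is estimated by Cauchy-Schwarz; since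
  \<open>h\<close> has degree one less, its constant gains a factor \<open>1/9\<close>, whose square
  root turns the coefficient \<open>6\<close> into the \<open>2\<close> of a binomial
  square.\<close>

lemma bonami_fourth_moment_le:
  assumes "finite V" "\<And>S. S \<subseteq> V \<Longrightarrow> a S \<noteq> 0 \<Longrightarrow> card S \<le> d"
  shows "cube_mean V (\<lambda>s. (multilinear V a s) ^ 4) \<le> 9 ^ d * (cube_mean V (\<lambda>s. (multilinear V a s)\<^sup>2))\<^sup>2"
  using assms
proof (induction V arbitrary: a d rule: finite_induct)
  case empty
  have "(a {}) ^ 4 \<le> 9 ^ d * (a {}) ^ 4" by (intro mult_le_cancel_right1[THEN iffD2]) simp
  then show ?case by (simp add: cube_mean_empty multilinear_def flip: power_mult)
next
  case (insert v V)
  let ?u = "multilinear V a" and ?h = "multilinear V (\<lambda>S. a (insert v S))"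
  define A B where "A = cube_mean V (\<lambda>s. (?u s)\<^sup>2)" and "B = cube_mean V (\<lambda>s. (?h s)\<^sup>2)"
  have A0: "0 \<le> A" and B0: "0 \<le> B" by (auto simp: A_def B_def intro!: cube_mean_nonneg)
  have u4: "cube_mean V (\<lambda>s. ?u s ^ 4) \<le> 9 ^ d * A\<^sup>2"
    unfolding A_def using insert.prems by (intro insert.IH) auto
  have h4: "cube_mean V (\<lambda>s. ?h s ^ 4) \<le> 9 ^ d / 9 * B\<^sup>2"
  proof (cases d)
    \<comment> \<open>In degree zero no coefficient contains \<open>v\<close>, so \<open>h\<close>
      vanishes and the bound with \<open>9 ^ d / 9\<close> still holds.\<close>
    case 0
    have "a (insert v S) = 0" if "S \<subseteq> V" for S
    proof (rule ccontr)
      assume "a (insert v S) \<noteq> 0"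
      then have "card (insert v S) \<le> 0" using insert.prems[of "insert v S"] that 0 by auto
      moreover have "finite (insert v S)" using that insert.hyps finite_subset by auto
      ultimately show False by simp
    qed
    then have "?h s = 0" for s by (simp add: multilinear_def)
    then show ?thesis by (simp add: cube_mean_const insert.hyps)
  next
    case (Suc d')
    have "cube_mean V (\<lambda>s. ?h s ^ 4) \<le> 9 ^ d' * B\<^sup>2"
      unfolding B_def
    proof (rule insert.IH)
      fix S assume S: "S \<subseteq> V" "a (insert v S) \<noteq> 0"
      then have "card (insert v S) \<le> d" by (intro insert.prems) auto
      moreover have "card (insert v S) = Suc (card S)"
        using S insert.hyps finite_subset by (intro card_insert_disjoint) auto
      ultimately show "card S \<le> d'" using Suc by simp
    qed
    then show ?thesis using Suc by simp
  qed
  define M where "M = cube_mean V (\<lambda>s. (?u s)\<^sup>2 * (?h s)\<^sup>2)"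
  have "M\<^sup>2 \<le> cube_mean V (\<lambda>s. ?u s ^ 4) * cube_mean V (\<lambda>s. ?h s ^ 4)"
    unfolding M_def using cube_mean_Cauchy_Schwarz[of V "\<lambda>s. (?u s)\<^sup>2" "\<lambda>s. (?h s)\<^sup>2"]
    by (simp flip: power_mult)
  also have "\<dots> \<le> (9 ^ d * A\<^sup>2) * (9 ^ d / 9 * B\<^sup>2)"
    by (intro mult_mono u4 h4 cube_mean_nonneg) auto
  also have "\<dots> = (9 ^ d / 3 * (A * B))\<^sup>2" by (simp add: power2_eq_square)
  finally have M: "M \<le> 9 ^ d / 3 * (A * B)"
    using A0 B0 by (elim power2_le_imp_le) simp
  have "cube_mean (insert v V) (\<lambda>s. (multilinear (insert v V) a s) ^ 4) =
      cube_mean V (\<lambda>s. ?u s ^ 4 + 6 * ((?u s)\<^sup>2 * (?h s)\<^sup>2) + ?h s ^ 4)"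
    unfolding cube_mean_insert[OF insert.hyps] multilinear_insert[OF insert.hyps]
    by (intro arg_cong[where f="cube_mean V"] ext) (simp add: power4_eq_xxxx power2_eq_square algebra_simps)
  also have "\<dots> = cube_mean V (\<lambda>s. ?u s ^ 4) + 6 * M + cube_mean V (\<lambda>s. ?h s ^ 4)"
    by (simp only: cube_mean_add cube_mean_cmult M_def)
  also have "\<dots> \<le> 9 ^ d * A\<^sup>2 + 6 * (9 ^ d / 3 * (A * B)) + 9 ^ d / 9 * B\<^sup>2"
    by (intro add_mono mult_left_mono u4 h4 M) simp
  also have "\<dots> \<le> 9 ^ d * A\<^sup>2 + 6 * (9 ^ d / 3 * (A * B)) + 9 ^ d * B\<^sup>2"
    by (intro add_left_mono mult_right_mono) auto
  also have "\<dots> = 9 ^ d * (A + B)\<^sup>2" by (simp add: power2_eq_square algebra_simps)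
  also have "A + B = cube_mean (insert v V) (\<lambda>s. (multilinear (insert v V) a s)\<^sup>2)"
    unfolding A_def B_def cube_mean_insert[OF insert.hyps] multilinear_insert[OF insert.hyps] cube_mean_add[symmetric]
    by (intro arg_cong[where f="cube_mean V"] ext) (simp add: power2_eq_square field_simps)
  finally show ?case .
qed

text \<open>
  The pointwise bound is \<open>1 - 3 z / 2 + z\<^sup>3 / 2 = (z - 1)\<^sup>2 (z + 2) / 2 \<ge> 0\<close>, so that the first
  absolute moment is bounded below by the second and the fourth one.
\<close>

lemma norm2_le_norm1:
  assumes "finite V" "\<And>S. S \<subseteq> V \<Longrightarrow> a S \<noteq> 0 \<Longrightarrow> card S \<le> d"
  shows "sqrt (cube_mean V (\<lambda>s. (multilinear V a s)\<^sup>2)) \<le> 3 ^ d * cube_mean V (\<lambda>s. \<bar>multilinear V a s\<bar>)"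
proof -
  let ?g = "multilinear V a"
  define \<sigma> where "\<sigma> = sqrt (cube_mean V (\<lambda>s. (?g s)\<^sup>2))"
  have s2: "\<sigma>\<^sup>2 = cube_mean V (\<lambda>s. (?g s)\<^sup>2)"
    unfolding \<sigma>_def by (intro real_sqrt_pow2 cube_mean_nonneg) simp
  have "0 \<le> \<sigma>" by (auto simp: \<sigma>_def intro!: cube_mean_nonneg)
  show ?thesis
  proof (cases "\<sigma> = 0")
    case True
    then show ?thesis by (simp add: \<sigma>_def cube_mean_nonneg)
  next
    case False
    then have pos: "0 < \<sigma>" using \<open>0 \<le> \<sigma>\<close> by simp
    \<comment> \<open>The scale makes the second-moment term \<open>3/2\<close> times and the
      fourth-moment term at most \<open>1/2\<close> times \<open>\<sigma> / 3 ^ d\<close>.\<close>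
    define c where "c = 1 / (3 ^ d * \<sigma>)"
    have c: "0 < c" using pos by (simp add: c_def)
    have "(3/2) * c * (?g s)\<^sup>2 - (1/2) * c ^ 3 * (?g s) ^ 4 \<le> \<bar>?g s\<bar>" for s
    proof -
      define z where "z = c * \<bar>?g s\<bar>"
      have "0 \<le> z" using c by (simp add: z_def)
      have "0 \<le> (z - 1)\<^sup>2 * (z + 2) / 2" using \<open>0 \<le> z\<close> by simp
      also have "\<dots> = 1 - (3/2) * z + (1/2) * z ^ 3" by (simp add: power2_eq_square power3_eq_cube field_simps)
      finally have "0 \<le> \<bar>?g s\<bar> * (1 - (3/2) * z + (1/2) * z ^ 3)" by simp
      also have "\<dots> = \<bar>?g s\<bar> - ((3/2) * c * \<bar>?g s\<bar>\<^sup>2 - (1/2) * c ^ 3 * \<bar>?g s\<bar> ^ 4)"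
        by (simp add: z_def power2_eq_square power3_eq_cube power4_eq_xxxx algebra_simps)
      finally show ?thesis by simp
    qed
    then have "cube_mean V (\<lambda>s. (3/2) * c * (?g s)\<^sup>2 - (1/2) * c ^ 3 * (?g s) ^ 4) \<le> cube_mean V (\<lambda>s. \<bar>?g s\<bar>)"
      by (intro cube_mean_mono)
    then have "(3/2) * c * \<sigma>\<^sup>2 - (1/2) * c ^ 3 * cube_mean V (\<lambda>s. ?g s ^ 4) \<le> cube_mean V (\<lambda>s. \<bar>?g s\<bar>)"
      by (simp only: cube_mean_diff cube_mean_cmult s2)
    moreover have "(1/2) * c ^ 3 * cube_mean V (\<lambda>s. ?g s ^ 4) \<le> (1/2) * c ^ 3 * (9 ^ d * (\<sigma>\<^sup>2)\<^sup>2)"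
      unfolding s2 using c bonami_fourth_moment_le[OF assms] by (intro mult_left_mono) auto
    moreover have "(3/2) * c * \<sigma>\<^sup>2 = (3/2) * (\<sigma> / 3 ^ d)"
      using pos by (simp add: c_def power2_eq_square)
    moreover have "(1/2) * c ^ 3 * (9 ^ d * (\<sigma>\<^sup>2)\<^sup>2) = (1/2) * (\<sigma> / 3 ^ d)"
    proof -
      have "(9::real) ^ d = 3 ^ d * 3 ^ d" by (simp flip: power_mult_distrib)
      then show ?thesis using pos by (simp add: c_def power2_eq_square power3_eq_cube field_simps)
    qed
    ultimately have "\<sigma> / 3 ^ d \<le> cube_mean V (\<lambda>s. \<bar>?g s\<bar>)" by simp
    then show ?thesis by (simp add: \<sigma>_def[symmetric] field_simps)
  qed
qed

text \<open>The function is affine in each coordinate, so its value is a convex combination of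
  values with that coordinate moved to \<open>1\<close> or \<open>-1\<close>. The induction runs
  over the set \<open>U\<close> of coordinates that may still lie strictly inside.\<close>

lemma multilinear_solid_cube:
  assumes "finite V" and bound: "\<And>s. (\<And>v. v \<in> V \<Longrightarrow> s v \<in> {-1, 1}) \<Longrightarrow> \<bar>multilinear V a s\<bar> \<le> A"
    and w: "\<And>v. v \<in> V \<Longrightarrow> \<bar>w v\<bar> \<le> 1"
  shows "\<bar>multilinear V a w\<bar> \<le> A"
proof -
  have "\<bar>multilinear V a w\<bar> \<le> A" if "finite U" "U \<subseteq> V" "\<And>v. v \<in> U \<Longrightarrow> \<bar>w v\<bar> \<le> 1" "\<And>v. v \<in> V - U \<Longrightarrow> w v \<in> {-1, 1}" for U w
    using that
  proof (induction U arbitrary: w rule: finite_induct)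
    case empty
    then show ?case by (intro bound) auto
  next
    case (insert v U)
    define c where "c = w v"
    have c: "\<bar>c\<bar> \<le> 1" using insert.prems by (simp add: c_def)
    have prod_eq: "(\<Prod>x\<in>S. w x) = (1 + c) / 2 * (\<Prod>x\<in>S. (w(v := 1)) x) + (1 - c) / 2 * (\<Prod>x\<in>S. (w(v := -1)) x)"
      if "S \<in> Pow V" for S
    proof (cases "v \<in> S")
      case True
      have f: "finite S" using that assms(1) finite_subset by auto
      have r: "(\<Prod>x\<in>S. (w(v := y)) x) = y * (\<Prod>x\<in>S - {v}. w x)" for y
      proof -
        have "(\<Prod>x\<in>S - {v}. (w(v := y)) x) = (\<Prod>x\<in>S - {v}. w x)" by (intro prod.cong) auto
        then show ?thesis using prod.remove[OF f True, of "w(v := y)"] by simp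
      qed
      have "(\<Prod>x\<in>S. w x) = c * (\<Prod>x\<in>S - {v}. w x)" using prod.remove[OF f True, of w] by (simp add: c_def)
      then show ?thesis by (simp only: r) (simp add: field_simps)
    next
      case False
      then have "(\<Prod>x\<in>S. (w(v := y)) x) = (\<Prod>x\<in>S. w x)" for y by (intro prod.cong) auto
      then show ?thesis by (simp add: field_simps)
    qed
    have "multilinear V a w = (1 + c) / 2 * multilinear V a (w(v := 1)) + (1 - c) / 2 * multilinear V a (w(v := -1))"
      unfolding multilinear_def sum_distrib_left sum.distrib[symmetric]
      by (intro sum.cong refl, subst prod_eq, assumption) (simp only: distrib_left mult_ac)
    also have "\<bar>\<dots>\<bar> \<le> (1 + c) / 2 * A + (1 - c) / 2 * A"
    proof -
      have IH: "\<bar>multilinear V a (w(v := y))\<bar> \<le> A" if "y \<in> {-1, 1}" for y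
        using insert.prems that insert.hyps by (intro insert.IH) auto
      have "\<bar>(1 + c) / 2 * multilinear V a (w(v := 1))\<bar> \<le> (1 + c) / 2 * A"
        using c IH[of 1] by (simp add: abs_mult mult_left_mono)
      moreover have "\<bar>(1 - c) / 2 * multilinear V a (w(v := -1))\<bar> \<le> (1 - c) / 2 * A"
        using c IH[of "-1"] by (simp add: abs_mult mult_left_mono)
      ultimately show ?thesis by (intro order_trans[OF abs_triangle_ineq] add_mono)
    qed
    also have "\<dots> = A" by (simp add: field_simps)
    finally show ?case .
  qed
  from this[of V w] show ?thesis using assms by auto
qed

text \<open>
  A substitute for Markov's inequality: \<open>(2 p(u/2) - 2\<^sup>-\<^sup>m p(u)) / (1 - 2\<^sup>-\<^sup>m)\<close> has the same linear
  coefficient as \<open>p\<close> but no term of degree \<open>m + 1\<close>.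
\<close>

lemma linear_coeff_bound_aux:
  fixes p :: "real poly"
  assumes "coeff p 0 = 0" "degree p \<le> Suc m" "\<And>u. 0 \<le> u \<Longrightarrow> u \<le> 1 \<Longrightarrow> \<bar>poly p u\<bar> \<le> A"
  shows "\<bar>coeff p 1\<bar> \<le> 5 ^ m * A"
  using assms
proof (induction m arbitrary: p A)
  case 0
  have "poly p 1 = coeff p 1"
    using 0 by (simp add: poly_altdef numeral_2_eq_2 le_Suc_eq) (auto simp: coeff_eq_0)
  then show ?case using 0(3)[of 1] by simp
next
  case (Suc m)
  define t :: real where "t = (1/2) ^ Suc m"
  have t: "0 < t" "t \<le> 1/2" by (auto simp: t_def power_le_one)
  define q where "q = Polynomial.smult (1 / (1 - t)) (Polynomial.smult 2 (pcompose p [:0, 1/2:]) - Polynomial.smult t p)"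
  have cq: "coeff q i = (2 * (1/2) ^ i - t) / (1 - t) * coeff p i" for i
    by (simp add: q_def coeff_pcompose_linear left_diff_distrib diff_divide_distrib)
  have "coeff q 0 = 0" using Suc.prems(1) by (simp add: cq)
  moreover have "degree q \<le> Suc m"
  proof (rule degree_le, intro allI impI)
    fix i assume "Suc m < i"
    then have "i = Suc (Suc m) \<or> degree p < i" using Suc.prems(2) by linarith
    then show "coeff q i = 0" by (auto simp: cq t_def coeff_eq_0)
  qed
  moreover have "\<bar>poly q u\<bar> \<le> 5 * A" if u: "0 \<le> u" "u \<le> 1" for u
  proof -
    have A: "0 \<le> A" using Suc.prems(3)[of 0] by simp
    have "poly q u = (2 * poly p (u / 2) - t * poly p u) / (1 - t)"
      by (simp add: q_def poly_pcompose)
    moreover have "\<bar>2 * poly p (u / 2) - t * poly p u\<bar> \<le> 2 * A + t * A"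
    proof -
      have "\<bar>t * poly p u\<bar> \<le> t * A" using t Suc.prems(3)[OF u] by (simp add: abs_mult)
      moreover have "\<bar>2 * poly p (u / 2)\<bar> \<le> 2 * A" using Suc.prems(3)[of "u / 2"] u by simp
      ultimately show ?thesis by linarith
    qed
    \<comment> \<open>The ratio \<open>(2 + t) / (1 - t)\<close> increases with \<open>t\<close> and
      equals \<open>5\<close> at \<open>t = 1/2\<close>.\<close>
    moreover have "(2 * A + t * A) / (1 - t) \<le> 5 * A"
    proof -
      have "t * A \<le> 1/2 * A" by (intro mult_right_mono t A)
      then show ?thesis using t by (simp add: field_simps)
    qed
    moreover have "\<bar>(2 * poly p (u / 2) - t * poly p u) / (1 - t)\<bar> \<le> (2 * A + t * A) / (1 - t)"
      using t calculation(2) by (simp add: abs_divide divide_right_mono)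
    ultimately show ?thesis by linarith
  qed
  ultimately have "\<bar>coeff q 1\<bar> \<le> 5 ^ m * (5 * A)" by (rule Suc.IH)
  moreover have "coeff q 1 = coeff p 1" using t by (simp add: cq)
  ultimately show ?case by (simp add: mult_ac)
qed

text \<open>Subtracting the constant coefficient, itself a value of \<open>p\<close>, at most
  doubles the bound.\<close>

lemma linear_coeff_bound:
  fixes p :: "real poly"
  assumes "degree p \<le> k" "\<And>u. 0 \<le> u \<Longrightarrow> u \<le> 1 \<Longrightarrow> \<bar>poly p u\<bar> \<le> A"
  shows "\<bar>coeff p 1\<bar> \<le> 2 * 5 ^ k * A"
proof -
  have A: "0 \<le> A" using assms(2)[of 0] by simp
  define q where "q = p - [:coeff p 0:]"
  have "\<bar>coeff q 1\<bar> \<le> 5 ^ k * (2 * A)"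
  proof (rule linear_coeff_bound_aux)
    show "degree q \<le> Suc k" unfolding q_def using assms(1) by (intro degree_diff_le) auto
    fix u :: real assume u: "0 \<le> u" "u \<le> 1"
    have "\<bar>coeff p 0\<bar> \<le> A" using assms(2)[of 0] by (simp add: poly_0_coeff_0)
    then show "\<bar>poly q u\<bar> \<le> 2 * A" using assms(2)[OF u] by (simp add: q_def)
  qed (simp add: q_def)
  then show ?thesis by (simp add: q_def mult_ac)
qed

lemma coeff_1_linear_power: "coeff ([:1, -2:] ^ m :: real poly) 1 = - 2 * real m"
proof (induction m)
  case (Suc m)
  have "coeff ([:1, -2:] ^ m :: real poly) 0 = 1" by (simp add: coeff_0_power)
  then show ?case using Suc by simp
qed simp

text \<open>Along the segment that moves the coordinates in \<open>T\<close> from \<open>s v\<close>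
  to \<open>- s v\<close>, the function is a polynomial of degree at most \<open>k\<close> in the
  parameter \<open>u\<close>, and it stays bounded because the segment lies in the solid cube. Its
  linear coefficient is \<open>-2\<close> times the sum in question, which cancels the
  \<open>2\<close> of \<open>linear_coeff_bound\<close>.\<close>

lemma restricted_derivative_bound:
  assumes fin: "finite V" and deg: "\<And>S. S \<subseteq> V \<Longrightarrow> a S \<noteq> 0 \<Longrightarrow> card S \<le> k"
    and bound: "\<And>s. (\<And>v. v \<in> V \<Longrightarrow> s v \<in> {-1, 1}) \<Longrightarrow> \<bar>multilinear V a s\<bar> \<le> A"
    and s: "\<And>v. v \<in> V \<Longrightarrow> s v \<in> {-1, 1}"
  shows "\<bar>\<Sum>S\<in>Pow V. a S * (\<Prod>v\<in>S. s v) * real (card (S \<inter> T))\<bar> \<le> 5 ^ k * A"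
proof -
  define p :: "real poly" where "p = (\<Sum>S\<in>Pow V. Polynomial.smult (a S * (\<Prod>v\<in>S. s v)) ([:1, -2:] ^ card (S \<inter> T)))"
  have "degree p \<le> k"
    unfolding p_def
  proof (rule degree_sum_le)
    fix S assume S: "S \<in> Pow V"
    show "degree (Polynomial.smult (a S * (\<Prod>v\<in>S. s v)) ([:1, -2:] ^ card (S \<inter> T))) \<le> k"
    proof (cases "a S = 0")
      case False
      have "degree ([:1, -2:] ^ card (S \<inter> T) :: real poly) \<le> degree [:1, -2 :: real:] * card (S \<inter> T)"
        by (rule degree_power_le)
      also have "\<dots> \<le> card S" using S fin by (simp add: card_mono finite_subset)
      also have "\<dots> \<le> k" using S False by (intro deg) auto
      finally show ?thesis by (rule order_trans[OF degree_smult_le])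
    qed simp
  qed (use fin in simp)
  moreover have "\<bar>poly p u\<bar> \<le> A" if u: "0 \<le> u" "u \<le> 1" for u
  proof -
    define w where "w v = (if v \<in> T then (1 - 2 * u) * s v else s v)" for v
    have "(\<Prod>v\<in>S. w v) = (\<Prod>v\<in>S. s v) * (1 - 2 * u) ^ card (S \<inter> T)" if "S \<in> Pow V" for S
    proof -
      have f: "finite S" using that fin finite_subset by auto
      have "(\<Prod>v\<in>S. w v) = (\<Prod>v\<in>S. s v * (if v \<in> T then 1 - 2 * u else 1))"
        by (intro prod.cong) (auto simp: w_def)
      also have "\<dots> = (\<Prod>v\<in>S. s v) * (1 - 2 * u) ^ card (S \<inter> T)"
        using f by (simp add: prod.distrib prod.If_cases)
      finally show ?thesis .
    qed
    then have "poly p u = multilinear V a w"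
      by (auto simp: p_def multilinear_def poly_sum mult.commute[of u 2] intro!: sum.cong)
    also have "\<bar>\<dots>\<bar> \<le> A"
    proof (rule multilinear_solid_cube[OF fin bound])
      fix v assume "v \<in> V"
      then have "\<bar>s v\<bar> = 1" using s by force
      then show "\<bar>w v\<bar> \<le> 1" using u by (auto simp: w_def abs_mult)
    qed auto
    finally show ?thesis .
  qed
  ultimately have "\<bar>coeff p 1\<bar> \<le> 2 * 5 ^ k * A" by (rule linear_coeff_bound)
  moreover have "coeff p 1 = - 2 * (\<Sum>S\<in>Pow V. a S * (\<Prod>v\<in>S. s v) * real (card (S \<inter> T)))"
    by (simp only: p_def coeff_sum coeff_smult coeff_1_linear_power sum_distrib_left) (simp add: mult_ac)
  ultimately show ?thesis by simp
qed

text \<open>\<open>multilinear V (b v)\<close> is \<open>s v\<close> times the partial derivative at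
  \<open>v\<close>, and its mean square is the influence of \<open>v\<close>. The sum of absolute
  values is a difference of two sums over sets of coordinates, one for each sign, hence at most
  twice \<open>5 ^ k * A\<close>; passing from mean squares to mean absolute values costs
  \<open>3 ^ k\<close>.\<close>

theorem influence_sum_bound:
  assumes fin: "finite V" and deg: "\<And>S. S \<subseteq> V \<Longrightarrow> a S \<noteq> 0 \<Longrightarrow> card S \<le> k"
    and bound: "\<And>s. (\<And>v. v \<in> V \<Longrightarrow> s v \<in> {-1, 1}) \<Longrightarrow> \<bar>multilinear V a s\<bar> \<le> A"
  shows "(\<Sum>v\<in>V. sqrt (\<Sum>S\<in>{S \<in> Pow V. v \<in> S}. (a S)\<^sup>2)) \<le> 2 * 15 ^ k * A"
proof -
  define b where "b v S = (if v \<in> S then a S else 0)" for v S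
  have pointwise: "(\<Sum>v\<in>V. \<bar>multilinear V (b v) s\<bar>) \<le> 2 * 5 ^ k * A" if s: "s \<in> cube V" for s
  proof -
    have s': "s v \<in> {-1, 1}" if "v \<in> V" for v using s that by (auto simp: cube_def PiE_def Pi_def)
    have T: "(\<Sum>v\<in>T. multilinear V (b v) s) = (\<Sum>S\<in>Pow V. a S * (\<Prod>v\<in>S. s v) * real (card (S \<inter> T)))"
      if "finite T" for T
    proof -
      have "(\<Sum>v\<in>T. multilinear V (b v) s) = (\<Sum>S\<in>Pow V. \<Sum>v\<in>T. if v \<in> S then a S * (\<Prod>v\<in>S. s v) else 0)"
        unfolding multilinear_def by (subst sum.swap) (auto simp: b_def intro!: sum.cong)
      also have "\<dots> = (\<Sum>S\<in>Pow V. a S * (\<Prod>v\<in>S. s v) * real (card (S \<inter> T)))"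
        using that by (intro sum.cong refl) (simp add: sum.If_cases Int_commute)
      finally show ?thesis .
    qed
    define P where "P = {v \<in> V. 0 \<le> multilinear V (b v) s}"
    have finP: "finite P" "finite (V - P)" using fin by (auto simp: P_def)
    have "(\<Sum>v\<in>V. \<bar>multilinear V (b v) s\<bar>) = (\<Sum>v\<in>P. \<bar>multilinear V (b v) s\<bar>) + (\<Sum>v\<in>V - P. \<bar>multilinear V (b v) s\<bar>)"
      using fin by (simp add: P_def sum.subset_diff[of "{v \<in> V. 0 \<le> multilinear V (b v) s}" V] add.commute)
    also have "\<dots> = (\<Sum>v\<in>P. multilinear V (b v) s) - (\<Sum>v\<in>V - P. multilinear V (b v) s)"
      unfolding diff_conv_add_uminus sum_negf[symmetric]
      by (intro arg_cong2[where f="(+)"] sum.cong) (auto simp: P_def)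
    also have "\<dots> \<le> 5 ^ k * A + 5 ^ k * A"
    proof -
      have "\<bar>\<Sum>S\<in>Pow V. a S * (\<Prod>v\<in>S. s v) * real (card (S \<inter> T))\<bar> \<le> 5 ^ k * A" for T
        by (rule restricted_derivative_bound[OF fin]) (fact deg bound s')+
      from this[of P] this[of "V - P"] show ?thesis
        unfolding T[OF finP(1)] T[OF finP(2)] by linarith
    qed
    finally show ?thesis by (simp add: mult_ac)
  qed
  have "sqrt (\<Sum>S\<in>{S \<in> Pow V. v \<in> S}. (a S)\<^sup>2) \<le> 3 ^ k * cube_mean V (\<lambda>s. \<bar>multilinear V (b v) s\<bar>)" for v
  proof -
    have "(\<Sum>S\<in>{S \<in> Pow V. v \<in> S}. (a S)\<^sup>2) = (\<Sum>S\<in>Pow V. (b v S)\<^sup>2)"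
      using fin by (intro sum.mono_neutral_cong_left) (auto simp: b_def)
    also have "\<dots> = cube_mean V (\<lambda>s. (multilinear V (b v) s)\<^sup>2)" using parseval[OF fin] by simp
    finally show ?thesis
      using norm2_le_norm1[OF fin, of "b v" k] deg by (auto simp: b_def split: if_splits)
  qed
  then have "(\<Sum>v\<in>V. sqrt (\<Sum>S\<in>{S \<in> Pow V. v \<in> S}. (a S)\<^sup>2)) \<le> (\<Sum>v\<in>V. 3 ^ k * cube_mean V (\<lambda>s. \<bar>multilinear V (b v) s\<bar>))"
    by (intro sum_mono)
  also have "\<dots> = 3 ^ k * cube_mean V (\<lambda>s. \<Sum>v\<in>V. \<bar>multilinear V (b v) s\<bar>)"
    by (simp add: cube_mean_sum sum_distrib_left)
  also have "\<dots> \<le> 3 ^ k * cube_mean V (\<lambda>s. 2 * 5 ^ k * A)"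
    by (intro mult_left_mono cube_mean_mono pointwise) auto
  also have "\<dots> = 2 * 15 ^ k * A"
    using power_mult_distrib[of 3 "5::real" k] by (simp add: cube_mean_const fin)
  finally show ?thesis .
qed

section \<open>Small Pauli coefficients of a local observable\<close>

text \<open>Turns a string into a set of variables, one for each pair of a qubit and a nonidentity
  letter, so that Pauli expansions become multilinear functions on a cube of dimension
  \<open>3 * n\<close>.\<close>

definition letters :: "pauli list \<Rightarrow> (nat \<times> pauli) set" where
  "letters P = (\<lambda>i. (i, P ! i)) ` {i. i < length P \<and> P ! i \<noteq> PI}"

definition low_weight :: "nat \<Rightarrow> nat \<Rightarrow> pauli list set" where
  "low_weight n k = {P \<in> pauli_strings n. pauli_weight P \<le> k}"

lemma low_weight_subset: "low_weight n k \<subseteq> pauli_strings n"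
  by (auto simp: low_weight_def)

lemma finite_low_weight [simp]: "finite (low_weight n k)"
  by (rule finite_subset[OF low_weight_subset finite_pauli_strings])

lemma length_low_weight: "P \<in> low_weight n k \<Longrightarrow> length P = n"
  by (simp add: low_weight_def pauli_strings_def)

lemma card_letters: "card (letters P) = pauli_weight P"
proof -
  have "card (letters P) = card {i. i < length P \<and> P ! i \<noteq> PI}"
    unfolding letters_def by (intro card_image inj_onI) auto
  then show ?thesis by (simp add: pauli_weight_def length_filter_conv_card)
qed

lemma mem_letters: "(i, p) \<in> letters P \<longleftrightarrow> i < length P \<and> P ! i = p \<and> p \<noteq> PI"
  by (auto simp: letters_def)

lemma letters_inj:
  assumes "length P = length Q" "letters P = letters Q"
  shows "P = Q"
proof (rule nth_equalityI[OF assms(1)])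
  fix i assume "i < length P"
  then show "P ! i = Q ! i" using mem_letters[of i _ P] mem_letters[of i _ Q] assms by metis
qed

lemma letters_subset: "length P = n \<Longrightarrow> letters P \<subseteq> {..<n} \<times> {PX, PY, PZ}"
  using UNIV_pauli by (auto simp: letters_def)

section \<open>Product states on which Pauli strings become monomials\<close>

definition bloch :: "real \<Rightarrow> real \<Rightarrow> real \<Rightarrow> complex mat" where
  "bloch x y z = mat 2 2 (\<lambda>(i, j).
     if i = 0 then (if j = 0 then Complex ((1 + z) / 2) 0 else Complex (x / 2) (- y / 2))
     else (if j = 0 then Complex (x / 2) (y / 2) else Complex ((1 - z) / 2) 0))"

lemma bloch_carrier [simp]: "bloch x y z \<in> carrier_mat 2 2" by (simp add: bloch_def)

lemma bloch_entries [simp]: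
  "bloch x y z $$ (0, 0) = Complex ((1 + z) / 2) 0"
  "bloch x y z $$ (0, Suc 0) = Complex (x / 2) (- y / 2)"
  "bloch x y z $$ (Suc 0, 0) = Complex (x / 2) (y / 2)"
  "bloch x y z $$ (Suc 0, Suc 0) = Complex ((1 - z) / 2) 0"
  by (simp_all add: bloch_def)

lemma bloch_adjoint: "mat_adjoint (bloch x y z) = bloch x y z"
  by (rule mat2_eqI) (simp_all add: carrier_matD[OF bloch_carrier] complex_eq_iff)

lemma mtrace_bloch: "mtrace (bloch x y z) = 1"
  by (simp add: mtrace2 complex_eq_iff field_simps)

text \<open>A unit Bloch vector belongs to a pure state, whose matrix is a projection.\<close>

lemma bloch_square:
  assumes "x * x + y * y + z * z = 1"
  shows "bloch x y z * bloch x y z = bloch x y z"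
proof -
  have c: "bloch x y z * bloch x y z \<in> carrier_mat 2 2" by (rule mult_carrier_mat[OF bloch_carrier bloch_carrier])
  show ?thesis
    by (rule mat2_eqI[OF c bloch_carrier];
        simp only: index_mult2[OF bloch_carrier bloch_carrier] zero_less_numeral one_less_numeral_iff semiring_norm One_nat_def bloch_entries;
        rule complex_eqI; simp; (use assms in \<open>simp add: field_simps\<close>)?)
qed

lemma mtrace_pauli_bloch:
  "mtrace (pauli1 p * bloch x y z) =
     complex_of_real (case p of PI \<Rightarrow> 1 | PX \<Rightarrow> x | PY \<Rightarrow> y | PZ \<Rightarrow> z)"
proof -
  have "pauli1 p * bloch x y z \<in> carrier_mat 2 2" by (rule mult_carrier_mat[OF pauli1_carrier bloch_carrier])
  then have "mtrace (pauli1 p * bloch x y z) =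
    (pauli1 p $$ (0, 0) * bloch x y z $$ (0, 0) + pauli1 p $$ (0, 1) * bloch x y z $$ (1, 0)) +
    (pauli1 p $$ (1, 0) * bloch x y z $$ (0, 1) + pauli1 p $$ (1, 1) * bloch x y z $$ (1, 1))"
    by (simp only: mtrace2 index_mult2[OF pauli1_carrier bloch_carrier] zero_less_numeral one_less_numeral_iff semiring_norm)
  then show ?thesis by (cases p) (simp_all add: complex_eq_iff field_simps del: pauli1.simps)
qed

definition bloch_product :: "nat \<Rightarrow> (nat \<times> pauli \<Rightarrow> real) \<Rightarrow> complex mat" where
  "bloch_product n s = tensor_prod (map (\<lambda>i. bloch (s (i, PX) / sqrt 3) (s (i, PY) / sqrt 3) (s (i, PZ) / sqrt 3)) [0..<n])"

text \<open>With three entries of modulus \<open>1 / sqrt 3\<close> each Bloch vector is a unit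
  vector for every choice of signs. The product \<open>R\<close> is then a projection, and its form
  at \<open>v\<close> is the squared norm of \<open>R v\<close>.\<close>

lemma bloch_product_states:
  assumes "\<And>v. v \<in> {..<n} \<times> {PX, PY, PZ} \<Longrightarrow> s v \<in> {-1, 1}"
  shows "bloch_product n s \<in> states n"
proof -
  let ?L = "map (\<lambda>i. bloch (s (i, PX) / sqrt 3) (s (i, PY) / sqrt 3) (s (i, PZ) / sqrt 3)) [0..<n]"
  let ?R = "bloch_product n s" and ?m = "2 ^ n :: nat"
  have L: "set ?L \<subseteq> carrier_mat 2 2" by auto
  have c: "?R \<in> carrier_mat ?m ?m" unfolding bloch_product_def using tensor_prod_carrier[OF L] by simp
  have adj: "mat_adjoint ?R = ?R"
    by (simp add: bloch_product_def tensor_prod_adjoint comp_def bloch_adjoint)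
  have sq: "s (i, p) / sqrt 3 * (s (i, p) / sqrt 3) = 1 / 3" if "i < n" "p \<in> {PX, PY, PZ}" for i p
    using assms[of "(i, p)"] that by auto
  have "?R * ?R = tensor_prod (map2 (*) ?L ?L)"
    unfolding bloch_product_def using L by (intro tensor_prod_mult) auto
  also have "map2 (*) ?L ?L = ?L"
    by (rule nth_equalityI) (simp_all add: bloch_square sq del: times_divide_eq_left times_divide_eq_right times_divide_times_eq)
  finally have idem: "?R * ?R = ?R" by (simp add: bloch_product_def)
  have tr: "mtrace ?R = 1"
    unfolding bloch_product_def mtrace_tensor_prod[OF L] by (simp add: comp_def mtrace_bloch map_replicate_const)
  have "0 \<le> Re ((?R *\<^sub>v v) \<bullet>c v)" if v: "v \<in> carrier_vec ?m" for v
  proof -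
    have Rv: "?R *\<^sub>v v \<in> carrier_vec ?m" using c v by (rule mult_mat_vec_carrier)
    have "(?R *\<^sub>v v) \<bullet>c v = (?R *\<^sub>v (?R *\<^sub>v v)) \<bullet>c v"
      using assoc_mult_mat_vec[OF c c v] idem by simp
    also have "\<dots> = (?R *\<^sub>v v) \<bullet>c (?R *\<^sub>v v)"
      using inner_adjoint[OF c Rv v] adj by simp
    finally show ?thesis by (simp add: cscalar_prod_self sum_nonneg)
  qed
  then show ?thesis using c adj tr by (simp add: states_def hermitian_mat_def)
qed

text \<open>The trace factorises over the qubits; identities contribute \<open>1\<close> and every
  other letter its Bloch entry.\<close>

lemma expval_bloch_product:
  assumes P: "length P = n"
  shows "expval (pauli_mat P) (bloch_product n s) = (\<Prod>v\<in>letters P. s v) / sqrt 3 ^ pauli_weight P"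
proof -
  let ?L = "map (\<lambda>i. bloch (s (i, PX) / sqrt 3) (s (i, PY) / sqrt 3) (s (i, PZ) / sqrt 3)) [0..<n]"
  let ?f = "\<lambda>i. if P ! i = PI then 1 else s (i, P ! i) / sqrt 3"
  have "pauli_mat P * bloch_product n s = tensor_prod (map2 (*) (map pauli1 P) ?L)"
    unfolding pauli_mat_def bloch_product_def using P by (intro tensor_prod_mult) auto
  moreover have "map2 (*) (map pauli1 P) ?L = map (\<lambda>i. pauli1 (P ! i) * bloch (s (i, PX) / sqrt 3) (s (i, PY) / sqrt 3) (s (i, PZ) / sqrt 3)) [0..<n]"
    using P by (intro nth_equalityI) simp_all
  moreover have "set (map (\<lambda>i. pauli1 (P ! i) * bloch (s (i, PX) / sqrt 3) (s (i, PY) / sqrt 3) (s (i, PZ) / sqrt 3)) [0..<n]) \<subseteq> carrier_mat 2 2"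
    using mult_carrier_mat[OF pauli1_carrier bloch_carrier] by auto
  ultimately have "mtrace (pauli_mat P * bloch_product n s) =
      prod_list (map (\<lambda>i. mtrace (pauli1 (P ! i) * bloch (s (i, PX) / sqrt 3) (s (i, PY) / sqrt 3) (s (i, PZ) / sqrt 3))) [0..<n])"
    by (simp only: mtrace_tensor_prod map_map comp_def)
  also have "(\<lambda>i. mtrace (pauli1 (P ! i) * bloch (s (i, PX) / sqrt 3) (s (i, PY) / sqrt 3) (s (i, PZ) / sqrt 3))) = (\<lambda>i. complex_of_real (?f i))"
    by (rule ext) (auto simp: mtrace_pauli_bloch split: pauli.split)
  also have "prod_list (map (\<lambda>i. complex_of_real (?f i)) [0..<n]) = complex_of_real (\<Prod>i<n. ?f i)"
    by (simp add: prod.distinct_set_conv_list[symmetric] atLeast0LessThan del: of_real_divide)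
  also have "(\<Prod>i<n. ?f i) = (\<Prod>i\<in>{i. i < length P \<and> P ! i \<noteq> PI}. s (i, P ! i) / sqrt 3)"
    using P by (intro prod.mono_neutral_cong_right) auto
  also have "\<dots> = (\<Prod>v\<in>letters P. s v / sqrt 3)"
    unfolding letters_def by (subst prod.reindex) (auto simp: inj_on_def)
  also have "\<dots> = (\<Prod>v\<in>letters P. s v) / sqrt 3 ^ pauli_weight P"
    by (simp add: prod_dividef card_letters)
  finally show ?thesis by (simp only: expval_def Re_complex_of_real)
qed

definition influence :: "nat \<Rightarrow> nat \<Rightarrow> (pauli list \<Rightarrow> real) \<Rightarrow> nat \<times> pauli \<Rightarrow> real" where
  "influence n k \<alpha> v = (\<Sum>P\<in>{P \<in> low_weight n k. v \<in> letters P}. (\<alpha> P)\<^sup>2)"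

text \<open>On the product states the truncation is a multilinear function with coefficients
  \<open>\<alpha> P / sqrt 3 ^ pauli_weight P\<close>, bounded by its norm. Undoing the scaling
  costs at most \<open>sqrt 3 ^ k\<close>, and \<open>15 * sqrt 3\<close> is at most
  \<open>26\<close>.\<close>

lemma pauli_influence_sum:
  "(\<Sum>v\<in>{..<n} \<times> {PX, PY, PZ}. sqrt (influence n k \<alpha> v)) \<le> 2 * 26 ^ k * spectral_norm (truncated_observable n k \<alpha>)"
proof -
  let ?V = "{..<n} \<times> {PX, PY, PZ}" and ?T = "low_weight n k"
  let ?A = "spectral_norm (truncated_observable n k \<alpha>)"
  define c where "c P = \<alpha> P / sqrt 3 ^ pauli_weight P" for P
  \<comment> \<open>The coefficients are transported along the injective map \<open>letters\<close>;
    variable sets with two letters on one qubit belong to no string and get coefficient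
    \<open>0\<close>.\<close>
  define a where "a S = (\<Sum>P\<in>{P \<in> ?T. letters P = S}. c P)" for S
  have len: "length P = n" if "P \<in> ?T" for P using that by (rule length_low_weight)
  have sub: "letters ` ?T \<subseteq> Pow ?V" using letters_subset len by blast
  have fib: "{Q \<in> ?T. letters Q = letters P} = {P}" if "P \<in> ?T" for P
    using that letters_inj len by blast
  have aP: "a (letters P) = c P" if "P \<in> ?T" for P using fib[OF that] by (simp add: a_def)
  have a0: "a S = 0" if "S \<notin> letters ` ?T" for S
  proof -
    have "{P \<in> ?T. letters P = S} = {}" using that by auto
    then show ?thesis unfolding a_def by (simp only: sum.empty)
  qed
  have inj: "inj_on letters ?T" using letters_inj len by (auto intro!: inj_onI)
  have deg: "card S \<le> k" if "S \<subseteq> ?V" and S: "a S \<noteq> 0" for S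
  proof -
    obtain P where "P \<in> ?T" "S = letters P" using S a0[of S] by blast
    then show ?thesis by (simp add: card_letters low_weight_def)
  qed
  have bound: "\<bar>multilinear ?V a s\<bar> \<le> ?A" if s: "\<And>v. v \<in> ?V \<Longrightarrow> s v \<in> {-1, 1}" for s
  proof -
    have "multilinear ?V a s = (\<Sum>S\<in>letters ` ?T. a S * (\<Prod>v\<in>S. s v))"
      unfolding multilinear_def using sub a0 by (intro sum.mono_neutral_right) auto
    also have "\<dots> = (\<Sum>P\<in>?T. c P * (\<Prod>v\<in>letters P. s v))"
      by (subst sum.reindex[OF inj]) (auto simp: aP)
    also have "\<dots> = (\<Sum>P\<in>?T. \<alpha> P * expval (pauli_mat P) (bloch_product n s))"
      by (intro sum.cong refl) (simp add: expval_bloch_product len c_def)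
    also have "\<dots> = expval (truncated_observable n k \<alpha>) (bloch_product n s)"
      unfolding truncated_observable_def low_weight_def[symmetric]
      using bloch_product_states[OF s] low_weight_subset
      by (intro expval_pauli_combination[symmetric]) (auto simp: states_def)
    finally show ?thesis
      using expval_le_spectral_norm[OF _ bloch_product_states[OF s], of "truncated_observable n k \<alpha>"]
      by (simp add: truncated_observable_def)
  qed
  have fin: "finite ?V" by simp
  have main: "(\<Sum>v\<in>?V. sqrt (\<Sum>S\<in>{S \<in> Pow ?V. v \<in> S}. (a S)\<^sup>2)) \<le> 2 * 15 ^ k * ?A"
    using influence_sum_bound[OF fin deg bound] .
  have "sqrt (influence n k \<alpha> v) \<le> sqrt 3 ^ k * sqrt (\<Sum>S\<in>{S \<in> Pow ?V. v \<in> S}. (a S)\<^sup>2)" for v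
  proof -
    have "(\<Sum>S\<in>{S \<in> Pow ?V. v \<in> S}. (a S)\<^sup>2) = (\<Sum>S\<in>letters ` {P \<in> ?T. v \<in> letters P}. (a S)\<^sup>2)"
      using sub by (intro sum.mono_neutral_right) (auto intro!: a0)
    also have "\<dots> = (\<Sum>P\<in>{P \<in> ?T. v \<in> letters P}. (c P)\<^sup>2)"
      using inj by (subst sum.reindex) (auto simp: aP inj_on_def)
    finally have e: "(\<Sum>S\<in>{S \<in> Pow ?V. v \<in> S}. (a S)\<^sup>2) = (\<Sum>P\<in>{P \<in> ?T. v \<in> letters P}. (c P)\<^sup>2)" .
    have "influence n k \<alpha> v \<le> 3 ^ k * (\<Sum>P\<in>{P \<in> ?T. v \<in> letters P}. (c P)\<^sup>2)"
      unfolding influence_def sum_distrib_left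
    proof (rule sum_mono)
      fix P assume "P \<in> {P \<in> ?T. v \<in> letters P}"
      then have w: "pauli_weight P \<le> k" by (simp add: low_weight_def)
      have "(sqrt 3 ^ pauli_weight P)\<^sup>2 = 3 ^ pauli_weight P"
        by (simp flip: power_mult power_mult_distrib add: mult.commute[of _ 2]) (simp add: power_mult)
      then have "(c P)\<^sup>2 = (\<alpha> P)\<^sup>2 / 3 ^ pauli_weight P" by (simp add: c_def power_divide)
      moreover have "(3::real) ^ pauli_weight P \<le> 3 ^ k" using w by (intro power_increasing) auto
      ultimately show "(\<alpha> P)\<^sup>2 \<le> 3 ^ k * (c P)\<^sup>2"
        using mult_right_mono[of "3 ^ pauli_weight P" "3 ^ k" "(c P)\<^sup>2"] by (simp add: field_simps)
    qed
    then have "sqrt (influence n k \<alpha> v) \<le> sqrt (3 ^ k * (\<Sum>P\<in>{P \<in> ?T. v \<in> letters P}. (c P)\<^sup>2))" by simp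
    then show ?thesis unfolding e by (simp add: real_sqrt_mult real_sqrt_power)
  qed
  then have "(\<Sum>v\<in>?V. sqrt (influence n k \<alpha> v)) \<le> (\<Sum>v\<in>?V. sqrt 3 ^ k * sqrt (\<Sum>S\<in>{S \<in> Pow ?V. v \<in> S}. (a S)\<^sup>2))"
    by (intro sum_mono)
  also have "\<dots> \<le> sqrt 3 ^ k * (2 * 15 ^ k * ?A)"
    unfolding sum_distrib_left[symmetric] by (intro mult_left_mono main) simp
  also have "\<dots> = 2 * (sqrt 3 * 15) ^ k * ?A" by (simp add: power_mult_distrib)
  also have "\<dots> \<le> 2 * 26 ^ k * ?A"
  proof -
    have "sqrt 3 * 15 \<le> (26::real)"
    proof -
      have "sqrt 3 \<le> 26 / 15" by (rule real_le_lsqrt) (simp_all add: power2_eq_square)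
      then show ?thesis by simp
    qed
    then have "(sqrt 3 * 15) ^ k \<le> 26 ^ k" by (intro power_mono) auto
    moreover have "0 \<le> ?A" by (intro spectral_norm_nonneg) (simp add: truncated_observable_def pauli_combination_def)
    ultimately show ?thesis by (intro mult_right_mono mult_left_mono) auto
  qed
  finally show ?thesis .
qed

lemma sum_UN_le:
  fixes f :: "'b \<Rightarrow> real"
  assumes "finite I" "\<And>i. i \<in> I \<Longrightarrow> finite (A i)" "\<And>x. 0 \<le> f x"
  shows "sum f (\<Union>i\<in>I. A i) \<le> (\<Sum>i\<in>I. sum f (A i))"
  using assms
proof (induction I rule: finite_induct)
  case (insert i I)
  have "sum f (\<Union>j\<in>insert i I. A j) \<le> sum f (A i) + sum f (\<Union>j\<in>I. A j)"
    using insert.prems insert.hyps by (simp add: sum_Un sum_nonneg)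
  also have "\<dots> \<le> sum f (A i) + (\<Sum>j\<in>I. sum f (A j))"
    using insert.IH insert.prems by simp
  finally show ?case using insert.hyps by simp
qed simp

text \<open>A subset of at most \<open>K + 1\<close> elements arises from one of at most
  \<open>K\<close> elements by adding an element of \<open>H\<close> or nothing, the latter encoded
  by \<open>None\<close>.\<close>

lemma card_small_subsets:
  assumes "finite H"
  shows "card {S. S \<subseteq> H \<and> card S \<le> K} \<le> (card H + 1) ^ K"
proof (induction K)
  case 0
  have "{S. S \<subseteq> H \<and> card S \<le> 0} \<subseteq> {{}}" using assms finite_subset by fastforce
  then have "card {S. S \<subseteq> H \<and> card S \<le> 0} \<le> card {{} :: 'a set}" by (intro card_mono) auto
  then show ?case by simp
next
  case (Suc K)
  let ?f = "\<lambda>(S, x). case x of None \<Rightarrow> S | Some v \<Rightarrow> insert v S"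
  let ?B = "{S. S \<subseteq> H \<and> card S \<le> K}" and ?O = "insert None (Some ` H)"
  have fB: "finite ?B" using assms by simp
  have "{S. S \<subseteq> H \<and> card S \<le> Suc K} \<subseteq> ?f ` (?B \<times> ?O)"
  proof
    fix S assume "S \<in> {S. S \<subseteq> H \<and> card S \<le> Suc K}"
    then have S: "S \<subseteq> H" "card S \<le> Suc K" by auto
    show "S \<in> ?f ` (?B \<times> ?O)"
    proof (cases "S = {}")
      case True
      then show ?thesis by (intro image_eqI[of _ _ "(S, None)"]) auto
    next
      case False
      then obtain v where v: "v \<in> S" by blast
      then have "card (S - {v}) \<le> K" using S finite_subset[OF S(1) assms] by simp
      then show ?thesis using S v by (intro image_eqI[of _ _ "(S - {v}, Some v)"]) auto
    qed
  qed
  then have "card {S. S \<subseteq> H \<and> card S \<le> Suc K} \<le> card (?f ` (?B \<times> ?O))"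
    using fB assms by (intro card_mono) auto
  also have "\<dots> \<le> card (?B \<times> ?O)" using fB assms by (intro card_image_le) auto
  also have "\<dots> = card ?B * (card H + 1)"
    using assms by (simp add: card_cartesian_product card_insert_if card_image)
  also have "\<dots> \<le> (card H + 1) ^ K * (card H + 1)" by (intro mult_right_mono Suc) simp
  finally show ?case by (simp add: mult.commute)
qed

text \<open>
  Letters of small influence carry little weight in total; the strings that avoid them are so few
  that their small coefficients cannot add up. This replaces the Bohnenblust-Hille inequality.
\<close>

lemma small_coefficients_bound:
  assumes K: "K \<le> k" and \<tau>: "0 \<le> \<tau>" and \<eta>: "0 < \<eta>"
    and M: "2 * 26 ^ k * spectral_norm (truncated_observable n k \<alpha>) \<le> M"
  shows "(\<Sum>P\<in>{P \<in> low_weight n K. \<bar>\<alpha> P\<bar> \<le> \<tau>}. (\<alpha> P)\<^sup>2) \<le> \<eta> * M + \<tau>\<^sup>2 * (1 + M / \<eta>) ^ K"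
proof -
  let ?V = "{..<n} \<times> {PX, PY, PZ}" and ?J = "influence n k \<alpha>"
  let ?X = "{P \<in> low_weight n K. \<bar>\<alpha> P\<bar> \<le> \<tau>}"
  \<comment> \<open>The influential letters; as the square roots of the influences sum to at most
    \<open>M\<close>, there are at most \<open>M / \<eta>\<close> of them.\<close>
  define H where "H = {v \<in> ?V. \<eta> \<le> sqrt (?J v)}"
  have J0: "0 \<le> ?J v" for v by (simp add: influence_def sum_nonneg)
  have tot: "(\<Sum>v\<in>?V. sqrt (?J v)) \<le> M" using pauli_influence_sum M by (rule order_trans)
  have finH: "finite H" by (simp add: H_def)
  have "\<eta> * real (card H) = (\<Sum>v\<in>H. \<eta>)" by simp
  also have "\<dots> \<le> (\<Sum>v\<in>H. sqrt (?J v))" by (intro sum_mono) (simp add: H_def)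
  also have "\<dots> \<le> (\<Sum>v\<in>?V. sqrt (?J v))" using J0 by (intro sum_mono2) (auto simp: H_def)
  finally have cardH: "real (card H) \<le> M / \<eta>" using tot \<eta> by (simp add: field_simps)
  have fX: "finite ?X" by simp
  have split: "(\<Sum>P\<in>?X. (\<alpha> P)\<^sup>2) = (\<Sum>P\<in>{P \<in> ?X. letters P \<subseteq> H}. (\<alpha> P)\<^sup>2) + (\<Sum>P\<in>{P \<in> ?X. \<not> letters P \<subseteq> H}. (\<alpha> P)\<^sup>2)"
    using sum.Int_Diff[OF fX, of "\<lambda>P. (\<alpha> P)\<^sup>2" "{P. letters P \<subseteq> H}"]
    by (simp add: Int_def set_diff_eq)
  have "(\<Sum>P\<in>{P \<in> ?X. \<not> letters P \<subseteq> H}. (\<alpha> P)\<^sup>2) \<le> (\<Sum>v\<in>?V - H. ?J v)"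
  proof -
    have "{P \<in> ?X. \<not> letters P \<subseteq> H} \<subseteq> (\<Union>v\<in>?V - H. {P \<in> low_weight n k. v \<in> letters P})"
    proof
      fix P assume P: "P \<in> {P \<in> ?X. \<not> letters P \<subseteq> H}"
      then obtain v where v: "v \<in> letters P" "v \<notin> H" by blast
      have "length P = n" using P length_low_weight by auto
      then have "v \<in> ?V" using letters_subset v by blast
      moreover have "P \<in> low_weight n k" using P K by (auto simp: low_weight_def)
      ultimately show "P \<in> (\<Union>v\<in>?V - H. {P \<in> low_weight n k. v \<in> letters P})" using v by blast
    qed
    then have "(\<Sum>P\<in>{P \<in> ?X. \<not> letters P \<subseteq> H}. (\<alpha> P)\<^sup>2) \<le> (\<Sum>P\<in>(\<Union>v\<in>?V - H. {P \<in> low_weight n k. v \<in> letters P}). (\<alpha> P)\<^sup>2)"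
      by (intro sum_mono2) auto
    also have "\<dots> \<le> (\<Sum>v\<in>?V - H. \<Sum>P\<in>{P \<in> low_weight n k. v \<in> letters P}. (\<alpha> P)\<^sup>2)"
      by (rule sum_UN_le) auto
    finally show ?thesis by (simp add: influence_def)
  qed
  \<comment> \<open>Outside \<open>H\<close> one of the two factors \<open>sqrt (?J v)\<close> of
    the influence is at most \<open>\<eta>\<close>.\<close>
  also have "\<dots> \<le> (\<Sum>v\<in>?V - H. \<eta> * sqrt (?J v))"
  proof (rule sum_mono)
    fix v assume "v \<in> ?V - H"
    then have "sqrt (?J v) \<le> \<eta>" by (auto simp: H_def)
    then have "sqrt (?J v) * sqrt (?J v) \<le> \<eta> * sqrt (?J v)" using J0 by (intro mult_right_mono) auto
    then show "?J v \<le> \<eta> * sqrt (?J v)" using J0 by simp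
  qed
  also have "\<dots> \<le> \<eta> * M"
  proof -
    have "(\<Sum>v\<in>?V - H. sqrt (?J v)) \<le> (\<Sum>v\<in>?V. sqrt (?J v))" using J0 by (intro sum_mono2) auto
    then show ?thesis unfolding sum_distrib_left[symmetric] using tot \<eta> by (intro mult_left_mono) auto
  qed
  finally have low: "(\<Sum>P\<in>{P \<in> ?X. \<not> letters P \<subseteq> H}. (\<alpha> P)\<^sup>2) \<le> \<eta> * M" .
  have "(\<Sum>P\<in>{P \<in> ?X. letters P \<subseteq> H}. (\<alpha> P)\<^sup>2) \<le> (\<Sum>P\<in>{P \<in> ?X. letters P \<subseteq> H}. \<tau>\<^sup>2)"
    using \<tau> by (intro sum_mono) (auto simp: abs_le_square_iff[symmetric])
  also have "\<dots> = \<tau>\<^sup>2 * real (card {P \<in> ?X. letters P \<subseteq> H})" by simp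
  also have "\<dots> \<le> \<tau>\<^sup>2 * real ((card H + 1) ^ K)"
  proof (intro mult_left_mono of_nat_mono)
    have "card {P \<in> ?X. letters P \<subseteq> H} = card (letters ` {P \<in> ?X. letters P \<subseteq> H})"
      using letters_inj length_low_weight by (intro card_image[symmetric] inj_onI) (metis (no_types, lifting) mem_Collect_eq)
    also have "\<dots> \<le> card {S. S \<subseteq> H \<and> card S \<le> K}"
      using finH by (intro card_mono) (auto simp: card_letters low_weight_def)
    also have "\<dots> \<le> (card H + 1) ^ K" by (rule card_small_subsets[OF finH])
    finally show "card {P \<in> ?X. letters P \<subseteq> H} \<le> (card H + 1) ^ K" .
  qed simp
  also have "\<dots> \<le> \<tau>\<^sup>2 * (1 + M / \<eta>) ^ K"
    unfolding of_nat_power using cardH by (intro mult_left_mono power_mono) auto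
  finally show ?thesis using split low by linarith
qed

section \<open>Concentration of sample averages\<close>

text \<open>Hoeffding's inequality for the coordinates of a product measure. The deviation is
  measured in units of the bound \<open>b\<close>, so the probability does not depend on
  \<open>b\<close>; this makes the unknown norm of the observable harmless.\<close>

lemma (in prob_space) hoeffding_product:
  fixes f :: "'a \<Rightarrow> real"
  assumes f: "f \<in> borel_measurable M" and bound: "\<And>x. x \<in> space M \<Longrightarrow> \<bar>f x\<bar> \<le> b"
    and b: "0 < b" and N: "0 < N" and \<gamma>: "0 \<le> \<gamma>"
  shows "measure (\<Pi>\<^sub>M l\<in>{..<N}. M) {\<omega> \<in> space (\<Pi>\<^sub>M l\<in>{..<N}. M). real N * (\<gamma> * b) \<le> \<bar>(\<Sum>l<N. f (\<omega> l)) - real N * expectation f\<bar>}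
    \<le> 2 * exp (- real N * \<gamma>\<^sup>2 / 2)"
proof -
  let ?P = "\<Pi>\<^sub>M l\<in>{..<N}. M" and ?X = "\<lambda>l \<omega>. f (\<omega> l)"
  interpret P: prob_space ?P by (rule prob_space_PiM) (rule prob_space_axioms)
  have rv: "?X l \<in> borel_measurable ?P" if "l < N" for l
    using that f by simp
  have distr_comp: "distr ?P M (\<lambda>\<omega>. \<omega> l) = M" if "l < N" for l
    using that by (intro distr_PiM_component prob_space_axioms) auto
  have distr_X: "distr ?P borel (?X l) = distr M borel f" if "l < N" for l
  proof -
    have "distr ?P borel (?X l) = distr (distr ?P M (\<lambda>\<omega>. \<omega> l)) borel f"
      using that f by (subst distr_distr) (auto simp: comp_def)
    then show ?thesis using distr_comp[OF that] by simp
  qed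
  have indep: "P.indep_vars (\<lambda>_. borel) ?X {..<N}"
  proof (subst P.indep_vars_iff_distr_eq_PiM')
    have "distr ?P (\<Pi>\<^sub>M l\<in>{..<N}. borel) (\<lambda>\<omega>. \<lambda>l\<in>{..<N}. f (\<omega> l)) = (\<Pi>\<^sub>M l\<in>{..<N}. distr M borel f)"
    proof -
      let ?Q = "distr M borel f"
      have Q: "distr M ?Q f = ?Q" by (intro distr_cong) auto
      have "distr ?P (\<Pi>\<^sub>M l\<in>{..<N}. borel) (\<lambda>\<omega>. \<lambda>l\<in>{..<N}. f (\<omega> l)) = distr ?P (\<Pi>\<^sub>M l\<in>{..<N}. ?Q) (compose {..<N} f)"
        by (intro distr_cong sets_PiM_cong) (auto simp: compose_def)
      also have "\<dots> = (\<Pi>\<^sub>M l\<in>{..<N}. distr M ?Q f)"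
        using f by (intro distr_PiM_finite_prob_space' prob_space_axioms prob_space_distr) auto
      finally show ?thesis by (simp only: Q)
    qed
    also have "\<dots> = (\<Pi>\<^sub>M l\<in>{..<N}. distr ?P borel (?X l))"
      using distr_X by (intro PiM_cong) auto
    finally show "distr ?P (\<Pi>\<^sub>M l\<in>{..<N}. borel) (\<lambda>\<omega>. \<lambda>l\<in>{..<N}. f (\<omega> l)) = (\<Pi>\<^sub>M l\<in>{..<N}. distr ?P borel (?X l))" .
  qed (use N rv in auto)
  \<comment> \<open>The values lie in an interval of length \<open>2 b\<close>, so the exponent
    \<open>2 (N \<gamma> b)^2 / (N (2 b)^2)\<close> reduces to
    \<open>N \<gamma>^2 / 2\<close>.\<close>
  interpret H: Hoeffding_ineq_iid ?P "{..<N}" ?X "?X 0" "-b" b "P.expectation (?X 0)"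
  proof unfold_locales
    show "distr ?P borel (?X i) = distr ?P borel (?X 0)" if "i \<in> {..<N}" for i
      using that N distr_X by simp
    show "AE x in ?P. f (x 0) \<in> {- b..b}"
      using N bound by (intro AE_I2) (force simp: space_PiM PiE_def Pi_def abs_le_iff)
  qed (use N indep rv in auto)
  have E: "P.expectation (?X 0) = expectation f"
  proof -
    have "P.expectation (?X 0) = integral\<^sup>L (distr ?P M (\<lambda>\<omega>. \<omega> 0)) f"
      using N f by (intro integral_distr[symmetric]) auto
    then show ?thesis using distr_comp[OF N] by simp
  qed
  have "P.prob {\<omega> \<in> space ?P. real N * (\<gamma> * b) \<le> \<bar>(\<Sum>l<N. ?X l \<omega>) - real (card {..<N}) * P.expectation (?X 0)\<bar>}
      \<le> 2 * exp (- 2 * (real N * (\<gamma> * b))\<^sup>2 / (real (card {..<N}) * (b - - b)\<^sup>2))"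
    using \<gamma> b N by (intro H.Hoeffding_ineq_abs_ge) auto
  also have "- 2 * (real N * (\<gamma> * b))\<^sup>2 / (real (card {..<N}) * (b - - b)\<^sup>2) = - real N * \<gamma>\<^sup>2 / 2"
    using b N by (simp add: power2_eq_square field_simps)
  finally show ?thesis by (simp add: E)
qed

section \<open>Keeping the largest scores\<close>

fun argmax :: "(nat \<Rightarrow> real) \<Rightarrow> nat \<Rightarrow> nat" where
  "argmax s 0 = 0"
| "argmax s (Suc i) = (if s (argmax s i) < s i then i else argmax s i)"

lemma argmax_ge: "i < m \<Longrightarrow> s i \<le> s (argmax s m)"
proof (induction m)
  case (Suc m)
  then show ?case by (cases "i = m") (auto simp: less_Suc_eq)
qed simp

lemma argmax_less: "0 < m \<Longrightarrow> argmax s m < m"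
proof (induction m)
  case (Suc m)
  then show ?case by (cases "m = 0") auto
qed simp

text \<open>Overwriting with \<open>-1\<close> is what the program does to a selected score. Once
  only \<open>-1\<close> is left, a round repeats an index or selects a rejected string, whose
  estimate is \<open>0\<close>.\<close>

fun remaining :: "(nat \<Rightarrow> real) \<Rightarrow> nat \<Rightarrow> nat \<Rightarrow> nat \<Rightarrow> real" where
  "remaining s m 0 = s"
| "remaining s m (Suc j) = (remaining s m j)(argmax (remaining s m j) m := -1)"

definition kept :: "(nat \<Rightarrow> real) \<Rightarrow> nat \<Rightarrow> nat \<Rightarrow> nat set" where
  "kept s m j = (\<lambda>i. argmax (remaining s m i) m) ` {..<j}"

lemma kept_0 [simp]: "kept s m 0 = {}" by (simp add: kept_def)

lemma kept_Suc: "kept s m (Suc j) = insert (argmax (remaining s m j) m) (kept s m j)"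
  by (auto simp: kept_def lessThan_Suc)

lemma finite_kept [simp]: "finite (kept s m j)"
  by (simp add: kept_def)

lemma card_kept_le: "card (kept s m j) \<le> j"
  unfolding kept_def using card_image_le[of "{..<j}"] by force

lemma kept_less: "0 < m \<Longrightarrow> i \<in> kept s m j \<Longrightarrow> i < m"
  using argmax_less by (auto simp: kept_def)

lemma remaining_eq: "remaining s m j i = (if i \<in> kept s m j then -1 else s i)"
  by (induction j) (auto simp: kept_Suc)

text \<open>An index with nonnegative score that is never selected loses every round to a score at
  least as large. The winner is therefore not an overwritten \<open>-1\<close>, so every round adds
  a new index.\<close>

lemma kept_dominates:
  assumes "i < m" "i \<notin> kept s m j" "0 \<le> s i"
  shows "card (kept s m j) = j \<and> (\<forall>b\<in>kept s m j. s i \<le> s b)"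
  using assms
proof (induction j)
  case (Suc j)
  let ?b = "argmax (remaining s m j) m"
  have i: "i \<notin> kept s m j" "i \<noteq> ?b" using Suc.prems by (auto simp: kept_Suc)
  have "s i = remaining s m j i" using i by (simp add: remaining_eq)
  also have "\<dots> \<le> remaining s m j ?b" using Suc.prems by (intro argmax_ge)
  finally have "?b \<notin> kept s m j" "s i \<le> s ?b"
    using Suc.prems(3) by (auto simp: remaining_eq split: if_splits)
  then show ?case using Suc i by (simp add: kept_Suc)
qed simp

text \<open>The score at a measurable index is measurable because there are only countably many
  indices.\<close>

lemma measurable_argmax:
  assumes "\<And>i. (\<lambda>x. s x i) \<in> borel_measurable M"
  shows "(\<lambda>x. argmax (s x) m) \<in> measurable M (count_space UNIV)"
proof (induction m)
  case (Suc m)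
  note [measurable] = assms Suc
  have "(\<lambda>x. s x (argmax (s x) m)) \<in> borel_measurable M"
    by (rule measurable_compose_countable[OF assms Suc])
  note [measurable] = this
  show ?case by simp
qed simp

lemma measurable_remaining:
  assumes "\<And>i. (\<lambda>x. s x i) \<in> borel_measurable M"
  shows "(\<lambda>x. remaining (s x) m j i) \<in> borel_measurable M"
proof (induction j arbitrary: i)
  case 0
  then show ?case using assms by simp
next
  case (Suc j)
  note [measurable] = Suc measurable_argmax[of "\<lambda>x. remaining (s x) m j", OF Suc]
  show ?case by (simp add: fun_upd_def)
qed

lemma sets_kept:
  assumes "\<And>i. (\<lambda>x. s x i) \<in> borel_measurable M"
  shows "{x \<in> space M. i \<in> kept (s x) m j} \<in> sets M"
proof (induction j)
  case (Suc j)
  note [measurable] = measurable_argmax[of "\<lambda>x. remaining (s x) m j" M m, OF measurable_remaining[OF assms]]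
  have "{x \<in> space M. i \<in> kept (s x) m (Suc j)} =
    {x \<in> space M. i = argmax (remaining (s x) m j) m} \<union> {x \<in> space M. i \<in> kept (s x) m j}"
    by (auto simp: kept_Suc)
  also have "\<dots> \<in> sets M" by (intro sets.Un Suc) measurable
  finally show ?case .
qed simp

section \<open>The learned model\<close>

definition sample_square :: "nat \<Rightarrow> (nat \<Rightarrow> complex mat) \<Rightarrow> pauli list \<Rightarrow> real" where
  "sample_square N \<omega> P = (\<Sum>l<N. expval (pauli_mat P) (\<omega> l) * expval (pauli_mat P) (\<omega> l))"

definition sample_product :: "complex mat \<Rightarrow> nat \<Rightarrow> (nat \<Rightarrow> complex mat) \<Rightarrow> pauli list \<Rightarrow> real" where
  "sample_product Obs N \<omega> P = (\<Sum>l<N. expval (pauli_mat P) (\<omega> l) * expval Obs (\<omega> l))"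

text \<open>Strings with estimated second moment below \<open>e / 12\<close> are rejected;
  \<open>-1\<close> ranks them behind every genuine score. The same test keeps the divisor in
  \<open>estimate\<close> away from zero.\<close>

definition score :: "complex mat \<Rightarrow> nat \<Rightarrow> real \<Rightarrow> (nat \<Rightarrow> complex mat) \<Rightarrow> pauli list \<Rightarrow> real" where
  "score Obs N e \<omega> P =
     (if sample_square N \<omega> P < e / 12 * real N then -1 else \<bar>sample_product Obs N \<omega> P\<bar>)"

definition estimate :: "complex mat \<Rightarrow> nat \<Rightarrow> real \<Rightarrow> (nat \<Rightarrow> complex mat) \<Rightarrow> pauli list \<Rightarrow> real" where
  "estimate Obs N e \<omega> P =
     (if sample_square N \<omega> P < e / 12 * real N then 0 else sample_product Obs N \<omega> P / sample_square N \<omega> P)"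

definition learned_coefficient ::
  "complex mat \<Rightarrow> nat \<Rightarrow> real \<Rightarrow> pauli list list \<Rightarrow> nat \<Rightarrow> (nat \<Rightarrow> complex mat) \<Rightarrow> nat \<Rightarrow> real" where
  "learned_coefficient Obs N e Ps J \<omega> i =
     (if i \<in> kept (\<lambda>i. score Obs N e \<omega> (Ps ! i)) (length Ps) J then estimate Obs N e \<omega> (Ps ! i) else 0)"

text \<open>A deterministic statement about true moments \<open>x\<close>, estimates
  \<open>xh\<close> and \<open>yh\<close> and a kept set \<open>S\<close>. The set \<open>U\<close>
  splits into strings outside \<open>T\<close>, strings with small estimated moment, kept strings
  and discarded ones. The first three groups cost \<open>2/3\<close>, \<open>1/12 + 1/29\<close> and
  \<open>1/12\<close> times \<open>e * B\<^sup>2\<close>, together less than \<open>7/8\<close>. The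
  discarded strings are left as the sum on the right, which is empty unless
  \<open>J < card T\<close>.\<close>

lemma estimation_error_bound:
  fixes x \<alpha> xh yh c :: "'a \<Rightarrow> real"
  assumes fin: "finite U" and TU: "T \<subseteq> U"
    and x0: "\<And>P. P \<in> U \<Longrightarrow> 0 \<le> x P" and x1: "\<And>P. P \<in> U \<Longrightarrow> x P \<le> 1"
    and xT: "\<And>P. P \<in> U - T \<Longrightarrow> x P \<le> 2 / 3 * e"
    and B: "(\<Sum>P\<in>U. (\<alpha> P)\<^sup>2) \<le> B\<^sup>2" "0 \<le> B"
    and e: "0 < e" "e \<le> 1/4" and J: "0 < J" and \<gamma>: "0 \<le> \<gamma>" "\<gamma>\<^sup>2 = e\<^sup>2 / (864 * real J)"
    and xh: "\<And>P. P \<in> T \<Longrightarrow> \<bar>xh P - x P\<bar> \<le> \<gamma>" and yh: "\<And>P. P \<in> T \<Longrightarrow> \<bar>yh P - \<alpha> P * x P\<bar> \<le> \<gamma> * B"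
    and S: "S \<subseteq> T" "card S \<le> J"
    and c: "\<And>P. P \<in> U \<Longrightarrow> c P = (if P \<in> S \<and> e / 12 \<le> xh P then yh P / xh P else 0)"
    and dom: "\<And>P. P \<in> T - S \<Longrightarrow> e / 12 \<le> xh P \<Longrightarrow> card S = J \<and> (\<forall>Q\<in>S. e / 12 \<le> xh Q \<and> \<bar>yh P\<bar> \<le> \<bar>yh Q\<bar>)"
  shows "(\<Sum>P\<in>U. (c P - \<alpha> P)\<^sup>2 * x P) \<le> 7 / 8 * e * B\<^sup>2 +
     (\<Sum>P\<in>{P \<in> T. card S = J \<and> J < card T \<and> \<bar>\<alpha> P\<bar> \<le> 48 * B / (e * sqrt (real J))}. (\<alpha> P)\<^sup>2)"
proof -
  have finT: "finite T" and finS: "finite S" using fin TU S by (auto intro: finite_subset)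
  \<comment> \<open>The constant \<open>864\<close> is \<open>72 * 12\<close>, as the kept strings
    require below; here only \<open>29\<^sup>2 \<le> 864\<close> matters.\<close>
  have \<gamma>e: "\<gamma> * sqrt (real J) \<le> e / 29"
  proof (rule power2_le_imp_le)
    show "(\<gamma> * sqrt (real J))\<^sup>2 \<le> (e / 29)\<^sup>2"
      using J e by (simp add: power_mult_distrib \<gamma> power_divide field_simps)
  qed (use e in simp)
  have \<gamma>1: "\<gamma> \<le> e / 29"
  proof -
    have "1 \<le> sqrt (real J)" using J by simp
    then have "\<gamma> * 1 \<le> \<gamma> * sqrt (real J)" using \<gamma>(1) by (intro mult_left_mono) auto
    then show ?thesis using \<gamma>e by simp
  qed
  have \<alpha>B: "\<bar>\<alpha> P\<bar> \<le> B" if "P \<in> U" for P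
  proof (rule power2_le_imp_le[OF _ B(2)])
    have "(\<alpha> P)\<^sup>2 \<le> (\<Sum>P\<in>U. (\<alpha> P)\<^sup>2)" using fin that by (intro member_le_sum) auto
    then show "\<bar>\<alpha> P\<bar>\<^sup>2 \<le> B\<^sup>2" using B by simp
  qed
  let ?low = "{P \<in> T. xh P < e / 12}" and ?S = "{P \<in> S. e / 12 \<le> xh P}" and ?D = "{P \<in> T - S. e / 12 \<le> xh P}"
  let ?X = "{P \<in> T. card S = J \<and> J < card T \<and> \<bar>\<alpha> P\<bar> \<le> 48 * B / (e * sqrt (real J))}"
  have part: "sum g U = sum g (U - T) + (sum g ?low + (sum g ?S + sum g ?D))" for g :: "'a \<Rightarrow> real"
  proof -
    have "T = ?low \<union> (?S \<union> ?D)" using S(1) by auto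
    then have "sum g T = sum g (?low \<union> (?S \<union> ?D))" by simp
    also have "\<dots> = sum g ?low + sum g (?S \<union> ?D)" using finT finS by (intro sum.union_disjoint) auto
    also have "sum g (?S \<union> ?D) = sum g ?S + sum g ?D" using finT finS by (intro sum.union_disjoint) auto
    finally show ?thesis using sum.subset_diff[OF TU fin, of g] by simp
  qed
  have 1: "(\<Sum>P\<in>U - T. (c P - \<alpha> P)\<^sup>2 * x P) \<le> 2 / 3 * e * (\<Sum>P\<in>U - T. (\<alpha> P)\<^sup>2)"
    unfolding sum_distrib_left
  proof (rule sum_mono)
    fix P assume P: "P \<in> U - T"
    then have "c P = 0" using c S(1) by auto
    then show "(c P - \<alpha> P)\<^sup>2 * x P \<le> 2 / 3 * e * (\<alpha> P)\<^sup>2"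
      using mult_left_mono[OF xT[OF P], of "(\<alpha> P)\<^sup>2"] by (simp add: mult.commute)
  qed
  have 2: "(\<Sum>P\<in>?low. (c P - \<alpha> P)\<^sup>2 * x P) \<le> (e / 12 + e / 29) * (\<Sum>P\<in>?low. (\<alpha> P)\<^sup>2)"
    unfolding sum_distrib_left
  proof (rule sum_mono)
    fix P assume P: "P \<in> ?low"
    then have "c P = 0" using c TU by auto
    moreover have "x P \<le> e / 12 + e / 29" using P xh[of P] \<gamma>1 by auto
    ultimately show "(c P - \<alpha> P)\<^sup>2 * x P \<le> (e / 12 + e / 29) * (\<alpha> P)\<^sup>2"
      using mult_left_mono[of "x P" "e / 12 + e / 29" "(\<alpha> P)\<^sup>2"] by (simp add: mult.commute)
  qed
  have 3: "(\<Sum>P\<in>?S. (c P - \<alpha> P)\<^sup>2 * x P) \<le> e / 12 * B\<^sup>2"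
  proof -
    \<comment> \<open>The error of the quotient is at most \<open>2 * \<gamma> * B / xh P\<close>,
      and \<open>x P\<close> is at most \<open>3/2 * xh P\<close>, so a single factor
      \<open>1 / xh P \<le> 12 / e\<close> survives. The sum of \<open>J\<close> such terms is
      \<open>e / 12 * B\<^sup>2\<close>.\<close>
    have "(c P - \<alpha> P)\<^sup>2 * x P \<le> 72 * \<gamma>\<^sup>2 * B\<^sup>2 / e" if P: "P \<in> ?S" for P
    proof -
      have PT: "P \<in> T" "P \<in> U" using P S TU by auto
      have h: "0 < xh P" using P e by (auto intro: less_le_trans[of 0 "e / 12"])
      have cP: "c P = yh P / xh P" using c[OF PT(2)] P by simp
      have "\<bar>yh P - \<alpha> P * xh P\<bar> \<le> \<bar>yh P - \<alpha> P * x P\<bar> + \<bar>\<alpha> P\<bar> * \<bar>xh P - x P\<bar>"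
      proof -
        have "yh P - \<alpha> P * xh P = (yh P - \<alpha> P * x P) - \<alpha> P * (xh P - x P)" by (simp add: algebra_simps)
        then show ?thesis by (metis abs_triangle_ineq4 abs_mult)
      qed
      also have "\<dots> \<le> \<gamma> * B + B * \<gamma>"
        by (intro add_mono mult_mono yh xh PT \<alpha>B B) auto
      finally have d: "\<bar>yh P - \<alpha> P * xh P\<bar> \<le> 2 * \<gamma> * B" by (simp add: mult_ac)
      have "(c P - \<alpha> P)\<^sup>2 = \<bar>yh P - \<alpha> P * xh P\<bar>\<^sup>2 / (xh P)\<^sup>2"
        using h by (simp add: cP power2_eq_square field_simps)
      also have "\<dots> \<le> (2 * \<gamma> * B)\<^sup>2 / (xh P)\<^sup>2"
        by (intro divide_right_mono power_mono d) auto
      finally have sq: "(c P - \<alpha> P)\<^sup>2 \<le> (2 * \<gamma> * B)\<^sup>2 / (xh P)\<^sup>2" .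
      have "x P \<le> xh P + e / 29" using xh[OF PT(1)] \<gamma>1 by linarith
      also have "\<dots> \<le> 3 / 2 * xh P" using P e by simp
      finally have xP: "x P \<le> 3 / 2 * xh P" .
      have "(c P - \<alpha> P)\<^sup>2 * x P \<le> (2 * \<gamma> * B)\<^sup>2 / (xh P)\<^sup>2 * (3 / 2 * xh P)"
        using x0[OF PT(2)] by (intro mult_mono sq xP) auto
      also have "\<dots> = 6 * \<gamma>\<^sup>2 * B\<^sup>2 / xh P" using h by (simp add: power2_eq_square field_simps)
      also have "\<dots> \<le> 6 * \<gamma>\<^sup>2 * B\<^sup>2 / (e / 12)"
        using P e h by (intro divide_left_mono) auto
      finally show ?thesis by simp
    qed
    then have "(\<Sum>P\<in>?S. (c P - \<alpha> P)\<^sup>2 * x P) \<le> (\<Sum>P\<in>?S. 72 * \<gamma>\<^sup>2 * B\<^sup>2 / e)" by (rule sum_mono)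
    also have "\<dots> = real (card ?S) * (72 * \<gamma>\<^sup>2 * B\<^sup>2 / e)" by simp
    also have "\<dots> \<le> real J * (72 * \<gamma>\<^sup>2 * B\<^sup>2 / e)"
    proof (intro mult_right_mono of_nat_mono)
      have "card ?S \<le> card S" using finS by (intro card_mono) auto
      then show "card ?S \<le> J" using S(2) by linarith
    qed (use e in simp)
    also have "\<dots> = e / 12 * B\<^sup>2"
      unfolding \<gamma>(2) using e J by (simp add: field_simps power2_eq_square)
    finally show ?thesis .
  qed
  have 4: "(\<Sum>P\<in>?D. (c P - \<alpha> P)\<^sup>2 * x P) \<le> (\<Sum>P\<in>?X. (\<alpha> P)\<^sup>2)"
  proof -
    have "P \<in> ?X \<and> (c P - \<alpha> P)\<^sup>2 * x P \<le> (\<alpha> P)\<^sup>2" if P: "P \<in> ?D" for P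
    proof -
      have PT: "P \<in> T" "P \<in> U" "P \<notin> S" "e / 12 \<le> xh P" using P TU by auto
      have d: "card S = J" "\<And>Q. Q \<in> S \<Longrightarrow> \<bar>yh P\<bar> \<le> \<bar>yh Q\<bar>" using dom[of P] PT by auto
      have "card S < card T" using PT S(1) finT by (intro psubset_card_mono) auto
      \<comment> \<open>Up to estimation errors, each of the \<open>J\<close> kept coefficients is
        at least \<open>\<bar>\<alpha> P\<bar> * x P\<close> in modulus. As their squares sum to at
        most \<open>B\<^sup>2\<close>, the lower bound \<open>z\<close> is at most
        \<open>B / sqrt J\<close>.\<close>
      define z where "z = \<bar>\<alpha> P\<bar> * x P - 2 * \<gamma> * B"
      have z: "z \<le> \<bar>\<alpha> Q\<bar>" if Q: "Q \<in> S" for Q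
      proof -
        have QT: "Q \<in> T" "Q \<in> U" using Q S TU by auto
        have "\<bar>\<alpha> P\<bar> * x P = \<bar>\<alpha> P * x P\<bar>" using x0[OF PT(2)] by (simp add: abs_mult)
        also have "\<dots> \<le> \<bar>yh P\<bar> + \<gamma> * B" using yh[OF PT(1)] by linarith
        also have "\<dots> \<le> \<bar>yh Q\<bar> + \<gamma> * B" using d(2)[OF Q] by simp
        also have "\<dots> \<le> \<bar>\<alpha> Q * x Q\<bar> + 2 * \<gamma> * B" using yh[OF QT(1)] by linarith
        also have "\<bar>\<alpha> Q * x Q\<bar> \<le> \<bar>\<alpha> Q\<bar> * 1"
          using x0[OF QT(2)] x1[OF QT(2)] by (simp add: abs_mult mult_left_le)
        finally show ?thesis by (simp add: z_def)
      qed
      have zJ: "z * sqrt (real J) \<le> B"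
      proof (cases "z \<le> 0")
        case True
        then have "z * sqrt (real J) \<le> 0" by (simp add: mult_nonpos_nonneg)
        then show ?thesis using B by linarith
      next
        case False
        have "(z * sqrt (real J))\<^sup>2 = (\<Sum>Q\<in>S. z\<^sup>2)" using d(1) by (simp add: power_mult_distrib)
        also have "\<dots> \<le> (\<Sum>Q\<in>S. (\<alpha> Q)\<^sup>2)"
        proof (rule sum_mono)
          fix Q assume "Q \<in> S"
          then have "z\<^sup>2 \<le> \<bar>\<alpha> Q\<bar>\<^sup>2" using z False by (intro power_mono) auto
          then show "z\<^sup>2 \<le> (\<alpha> Q)\<^sup>2" by simp
        qed
        also have "\<dots> \<le> (\<Sum>Q\<in>U. (\<alpha> Q)\<^sup>2)" using S TU fin by (intro sum_mono2) auto
        also have "\<dots> \<le> B\<^sup>2" by (rule B(1))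
        finally show ?thesis using B(2) by (rule power2_le_imp_le)
      qed
      have sJ: "0 < sqrt (real J)" using J by simp
      have "\<bar>\<alpha> P\<bar> * x P * sqrt (real J) = z * sqrt (real J) + 2 * B * (\<gamma> * sqrt (real J))"
        by (simp add: z_def algebra_simps)
      also have "\<dots> \<le> B + 2 * B * (e / 29)"
        using zJ \<gamma>e B(2) by (intro add_mono mult_left_mono) auto
      also have "\<dots> = B + 2 / 29 * (e * B)" by simp
      also have "\<dots> \<le> 2 * B" using B(2) mult_right_mono[OF e(2) B(2)] by linarith
      finally have u: "\<bar>\<alpha> P\<bar> * x P * sqrt (real J) \<le> 2 * B" .
      \<comment> \<open>\<open>1/12 - 1/29\<close> exceeds \<open>1/24\<close>; dividing by
        \<open>x P\<close> turns the \<open>2\<close> into the \<open>48\<close> of the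
        statement.\<close>
      have "e / 24 \<le> x P" using PT(4) xh[OF PT(1)] \<gamma>1 e by linarith
      then have "\<bar>\<alpha> P\<bar> * (e / 24) * sqrt (real J) \<le> \<bar>\<alpha> P\<bar> * x P * sqrt (real J)"
        by (intro mult_right_mono mult_left_mono) auto
      then have "\<bar>\<alpha> P\<bar> * (e * sqrt (real J)) \<le> 48 * B" using u by simp
      then have "\<bar>\<alpha> P\<bar> \<le> 48 * B / (e * sqrt (real J))" using e sJ by (simp add: pos_le_divide_eq)
      moreover have "(c P - \<alpha> P)\<^sup>2 * x P \<le> (\<alpha> P)\<^sup>2"
        using c[OF PT(2)] PT x0[OF PT(2)] x1[OF PT(2)] by (simp add: mult_left_le)
      ultimately show ?thesis using PT d(1) \<open>card S < card T\<close> by simp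
    qed
    then have "(\<Sum>P\<in>?D. (c P - \<alpha> P)\<^sup>2 * x P) \<le> (\<Sum>P\<in>?D. (\<alpha> P)\<^sup>2)" "?D \<subseteq> ?X"
      by (auto intro!: sum_mono)
    moreover have "(\<Sum>P\<in>?D. (\<alpha> P)\<^sup>2) \<le> (\<Sum>P\<in>?X. (\<alpha> P)\<^sup>2)"
      using \<open>?D \<subseteq> ?X\<close> finT by (intro sum_mono2) auto
    ultimately show ?thesis by linarith
  qed
  have 5: "2 / 3 * e * (\<Sum>P\<in>U - T. (\<alpha> P)\<^sup>2) + (e / 12 + e / 29) * (\<Sum>P\<in>?low. (\<alpha> P)\<^sup>2) \<le> (2 / 3 * e + (e / 12 + e / 29)) * B\<^sup>2"
  proof -
    have "(\<Sum>P\<in>U - T. (\<alpha> P)\<^sup>2) \<le> (\<Sum>P\<in>U. (\<alpha> P)\<^sup>2)" "(\<Sum>P\<in>?low. (\<alpha> P)\<^sup>2) \<le> (\<Sum>P\<in>U. (\<alpha> P)\<^sup>2)"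
      using fin TU by (auto intro!: sum_mono2)
    then have "(\<Sum>P\<in>U - T. (\<alpha> P)\<^sup>2) \<le> B\<^sup>2" "(\<Sum>P\<in>?low. (\<alpha> P)\<^sup>2) \<le> B\<^sup>2" using B(1) by linarith+
    then show ?thesis unfolding distrib_right using e by (intro add_mono mult_left_mono) auto
  qed
  have "(2 / 3 * e + (e / 12 + e / 29)) * B\<^sup>2 + e / 12 * B\<^sup>2 \<le> 7 / 8 * e * B\<^sup>2"
    unfolding distrib_right[symmetric] using e by (intro mult_right_mono) auto
  then show ?thesis unfolding part[of "\<lambda>P. (c P - \<alpha> P)\<^sup>2 * x P"] using 1 2 3 4 5 by linarith
qed

section \<open>Total correctness with running time\<close>

text \<open>A total-correctness triple. An upper bound \<open>T\<close> instead of the exact time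
  lets the two branches of a conditional and the iterations of a loop share one figure.\<close>

definition run :: "environment \<Rightarrow> com \<Rightarrow> memory \<Rightarrow> nat \<Rightarrow> (memory \<Rightarrow> bool) \<Rightarrow> bool" where
  "run E c s T Q \<longleftrightarrow> (\<exists>t s'. exec E c s t s' \<and> t \<le> T \<and> Q s')"

lemma run_weaken: "run E c s T Q \<Longrightarrow> T \<le> T' \<Longrightarrow> (\<And>s'. Q s' \<Longrightarrow> Q' s') \<Longrightarrow> run E c s T' Q'"
  unfolding run_def by (meson order_trans)

lemma run_le: "run E c s T Q \<Longrightarrow> T \<le> T' \<Longrightarrow> run E c s T' Q"
  by (rule run_weaken)

lemma run_Skip: "Q s \<Longrightarrow> run E Skip s 0 Q"
  unfolding run_def using exec.Skip by blast

lemma run_NSet: "Q (s\<lparr>narr := (narr s)(a := (narr s a)(nval s i := nval s e))\<rparr>) \<Longrightarrow> run E (NSet a i e) s (Suc 0) Q"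
  unfolding run_def using exec.NSet by (metis One_nat_def order_refl)

lemma run_RSet: "Q (s\<lparr>rarr := (rarr s)(a := (rarr s a)(nval s i := rval E s e))\<rparr>) \<Longrightarrow> run E (RSet a i e) s (Suc 0) Q"
  unfolding run_def using exec.RSet by (metis One_nat_def order_refl)

lemma run_Seq:
  assumes "run E c s T R" "\<And>s'. R s' \<Longrightarrow> run E d s' U Q"
  shows "run E (Seq c d) s (T + U) Q"
proof -
  obtain t s' where 1: "exec E c s t s'" "t \<le> T" "R s'" using assms(1) by (auto simp: run_def)
  obtain u s'' where 2: "exec E d s' u s''" "u \<le> U" "Q s''" using assms(2)[OF 1(3)] by (auto simp: run_def)
  have "exec E (Seq c d) s (t + u) s''" using 1(1) 2(1) by (rule exec.Seq)
  then show ?thesis using 1(2) 2(2,3) add_mono unfolding run_def by blast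
qed

lemma run_Seq_NSet:
  "run E d (s\<lparr>narr := (narr s)(a := (narr s a)(nval s i := nval s e))\<rparr>) U Q \<Longrightarrow> run E (Seq (NSet a i e) d) s (Suc U) Q"
  using run_Seq[OF run_NSet[of "\<lambda>s'. s' = s\<lparr>narr := (narr s)(a := (narr s a)(nval s i := nval s e))\<rparr>"], of s a i e E d U Q]
  by simp

lemma run_Seq_RSet:
  "run E d (s\<lparr>rarr := (rarr s)(a := (rarr s a)(nval s i := rval E s e))\<rparr>) U Q \<Longrightarrow> run E (Seq (RSet a i e) d) s (Suc U) Q"
  using run_Seq[OF run_RSet[of "\<lambda>s'. s' = s\<lparr>rarr := (rarr s)(a := (rarr s a)(nval s i := rval E s e))\<rparr>"], of s a i E e d U Q]
  by simp

lemma run_Cond: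
  assumes "bval E s b \<Longrightarrow> run E c s T Q" "\<not> bval E s b \<Longrightarrow> run E d s T Q"
  shows "run E (Cond b c d) s (Suc T) Q"
proof (cases "bval E s b")
  case True
  then obtain t s' where "exec E c s t s'" "t \<le> T" "Q s'" using assms(1) by (auto simp: run_def)
  then show ?thesis unfolding run_def using exec.CondTrue[OF True] by (metis Suc_eq_plus1_left Suc_le_mono)
next
  case False
  then obtain t s' where "exec E d s t s'" "t \<le> T" "Q s'" using assms(2) by (auto simp: run_def)
  then show ?thesis unfolding run_def using exec.CondFalse[OF False] by (metis Suc_eq_plus1_left Suc_le_mono)
qed

lemma run_While_False: "\<not> bval E s b \<Longrightarrow> Q s \<Longrightarrow> run E (While b c) s (Suc 0) Q"
  unfolding run_def using exec.WhileFalse by (metis One_nat_def order_refl)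

lemma run_While_True:
  assumes "bval E s b" "run E c s T R" "\<And>s'. R s' \<Longrightarrow> run E (While b c) s' U Q"
  shows "run E (While b c) s (Suc (T + U)) Q"
proof -
  obtain t s' where 1: "exec E c s t s'" "t \<le> T" "R s'" using assms(2) by (auto simp: run_def)
  obtain u s'' where 2: "exec E (While b c) s' u s''" "u \<le> U" "Q s''" using assms(3)[OF 1(3)] by (auto simp: run_def)
  have "exec E (While b c) s (1 + t + u) s''" using assms(1) 1(1) 2(1) by (rule exec.WhileTrue)
  moreover have "1 + t + u \<le> Suc (T + U)" using 1(2) 2(2) by simp
  ultimately show ?thesis using 2(3) unfolding run_def by blast
qed

text \<open>The invariant is indexed by the number of finished iterations; every iteration pays one
  test, and the final failing test is the \<open>+ 1\<close>.\<close>

lemma run_For: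
  assumes "I 0 s" and step: "\<And>i s. i < m \<Longrightarrow> I i s \<Longrightarrow> bval E s b \<and> run E c s T (I (Suc i))"
    and stop: "\<And>s. I m s \<Longrightarrow> \<not> bval E s b"
  shows "run E (While b c) s (m * Suc T + 1) (I m)"
proof -
  have "run E (While b c) s (d * Suc T + 1) (I m)" if "I i s" "i + d = m" for i d s
    using that
  proof (induction d arbitrary: i s)
    case 0
    then have "run E (While b c) s (Suc 0) (I m)" using stop by (intro run_While_False) auto
    then show ?case by simp
  next
    case (Suc d)
    then have "bval E s b" "run E c s T (I (Suc i))" using step[of i s] by auto
    then have "run E (While b c) s (Suc (T + (d * Suc T + 1))) (I m)"
    proof (rule run_While_True)
      fix s' assume "I (Suc i) s'"
      then show "run E (While b c) s' (d * Suc T + 1) (I m)" using Suc by simp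
    qed
    then show ?case by (rule run_le) simp
  qed
  from this[of 0 s m] show ?thesis using assms(1) by simp
qed

text \<open>
  Amortised analysis: the potential \<open>\<Psi>\<close> of the current memory pays for all iterations so far.
\<close>

lemma run_While_potential:
  fixes V \<Psi> :: "memory \<Rightarrow> nat"
  assumes "I s" and step: "\<And>s. I s \<Longrightarrow> bval E s b \<Longrightarrow> \<exists>T. run E c s T (\<lambda>s'. I s' \<and> V s' < V s \<and> Suc T + \<Psi> s \<le> \<Psi> s')"
    and bound: "\<And>s. I s \<Longrightarrow> \<Psi> s \<le> B"
  shows "run E (While b c) s (Suc B) (\<lambda>s'. I s' \<and> \<not> bval E s' b)"
proof -
  have "run E (While b c) s (Suc (B - \<Psi> s)) (\<lambda>s'. I s' \<and> \<not> bval E s' b)"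
    using assms(1)
  proof (induction "V s" arbitrary: s rule: less_induct)
    case less
    show ?case
    proof (cases "bval E s b")
      case True
      from step[OF less.prems True] obtain T where
        T: "run E c s T (\<lambda>s'. I s' \<and> V s' < V s \<and> Suc T + \<Psi> s \<le> \<Psi> s')" by blast
      obtain t s' where 1: "exec E c s t s'" "t \<le> T" and s': "I s'" "V s' < V s" "Suc T + \<Psi> s \<le> \<Psi> s'"
        using T by (auto simp: run_def)
      have r: "run E c s T (\<lambda>x. x = s')" using 1 by (auto simp: run_def)
      have "run E (While b c) s (Suc (T + Suc (B - \<Psi> s'))) (\<lambda>s'. I s' \<and> \<not> bval E s' b)"
        using less.hyps[OF s'(2,1)] by (intro run_While_True[OF True r]) auto
      moreover have "Suc (T + Suc (B - \<Psi> s')) \<le> Suc (B - \<Psi> s)"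
        using s'(3) bound[OF s'(1)] by linarith
      ultimately show ?thesis by (rule run_weaken)
    next
      case False
      then show ?thesis using run_weaken[OF run_While_False[OF False, of "\<lambda>s'. I s' \<and> \<not> bval E s' b"]] less.prems by auto
    qed
  qed
  then show ?thesis by (rule run_weaken) auto
qed

section \<open>A table of Pauli strings\<close>

abbreviation var :: "nat \<Rightarrow> nexp" where "var j \<equiv> NGet 0 (NConst j)"
abbreviation rvar :: "nat \<Rightarrow> rexp" where "rvar j \<equiv> RGet 0 (NConst j)"
abbreviation set_var :: "nat \<Rightarrow> nexp \<Rightarrow> com" where "set_var j e \<equiv> NSet 0 (NConst j) e"
abbreviation set_rvar :: "nat \<Rightarrow> rexp \<Rightarrow> com" where "set_rvar j e \<equiv> RSet 0 (NConst j) e"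
abbreviation seq_abbrev :: "com \<Rightarrow> com \<Rightarrow> com" (infixr \<open>;;\<close> 60) where "c ;; d \<equiv> Seq c d"

fun encode_pauli :: "pauli \<Rightarrow> nat" where
  "encode_pauli PI = 0" | "encode_pauli PX = 1" | "encode_pauli PY = 2" | "encode_pauli PZ = 3"

lemma decode_encode [simp]: "decode_pauli (encode_pauli p) = p"
  by (cases p) (simp_all add: decode_pauli_def)

lemma encode_decode: "c \<in> {1, 2, 3} \<Longrightarrow> encode_pauli (decode_pauli c) = c"
  by (auto simp: decode_pauli_def)

lemma decode_neq_PI: "c \<in> {1, 2, 3} \<Longrightarrow> decode_pauli c \<noteq> PI"
  by (auto simp: decode_pauli_def)

lemma encode_cases: "p \<noteq> PI \<Longrightarrow> encode_pauli p \<in> {1, 2, 3}"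
  by (cases p) auto

text \<open>
  String \<open>i > 0\<close> arises from string \<open>A 2 i\<close> by placing the letter with code \<open>A 4 i\<close> at qubit \<open>A 3 i\<close>,
  which lies behind all letters of that string; \<open>A 5 i\<close> is the first qubit behind its own letters and
  \<open>A 6 i\<close> its weight.
\<close>

definition table_entry :: "nat \<Rightarrow> pauli list list \<Rightarrow> (nat \<Rightarrow> nat \<Rightarrow> nat) \<Rightarrow> nat \<Rightarrow> bool" where
  "table_entry n Ps A i \<longleftrightarrow> A 2 i < i \<and> A 3 i < n \<and> A 4 i \<in> {1, 2, 3} \<and> A 5 (A 2 i) \<le> A 3 i \<and>
     A 5 i = Suc (A 3 i) \<and> Ps ! i = (Ps ! A 2 i)[A 3 i := decode_pauli (A 4 i)]"

definition table :: "nat \<Rightarrow> pauli list list \<Rightarrow> (nat \<Rightarrow> nat \<Rightarrow> nat) \<Rightarrow> bool" where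
  "table n Ps A \<longleftrightarrow> Ps \<noteq> [] \<and> Ps ! 0 = replicate n PI \<and> A 5 0 = 0 \<and>
     (\<forall>i<length Ps. length (Ps ! i) = n \<and> A 6 i = pauli_weight (Ps ! i) \<and>
        (\<forall>j<n. A 5 i \<le> j \<longrightarrow> Ps ! i ! j = PI) \<and> (0 < i \<longrightarrow> table_entry n Ps A i))"

text \<open>The variables in array \<open>0\<close> and the query tape in array \<open>1\<close> can
  change without affecting the table.\<close>

lemma table_cong:
  assumes "\<And>a. a \<in> {2, 3, 4, 5, 6} \<Longrightarrow> A a = B a"
  shows "table n Ps A \<longleftrightarrow> table n Ps B"
  using assms[of 2] assms[of 3] assms[of 4] assms[of 5] assms[of 6] by (simp add: table_def table_entry_def)

lemma weight_update:
  assumes "p < length P" "P ! p = PI" "q \<noteq> PI"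
  shows "pauli_weight (P[p := q]) = Suc (pauli_weight P)"
  using assms
proof (induction P arbitrary: p)
  case (Cons x P)
  then show ?case by (cases p) (auto simp: pauli_weight_def)
qed simp

lemma table_weight:
  assumes "table n Ps A" "i < length Ps" "0 < i"
  shows "pauli_weight (Ps ! i) = Suc (pauli_weight (Ps ! A 2 i))" "Ps ! A 2 i ! A 3 i = PI"
    "\<And>j. j < n \<Longrightarrow> Ps ! i ! j = (if j = A 3 i then decode_pauli (A 4 i) else Ps ! A 2 i ! j)"
proof -
  have e: "table_entry n Ps A i" using assms by (simp add: table_def)
  have q: "A 2 i < length Ps" using e assms by (simp add: table_entry_def)
  have l: "length (Ps ! A 2 i) = n" using assms(1) q by (simp add: table_def)
  show PI: "Ps ! A 2 i ! A 3 i = PI" using assms(1) q e by (simp add: table_def table_entry_def)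
  show "pauli_weight (Ps ! i) = Suc (pauli_weight (Ps ! A 2 i))"
    using e l PI decode_neq_PI by (simp add: table_entry_def weight_update)
  show "Ps ! i ! j = (if j = A 3 i then decode_pauli (A 4 i) else Ps ! A 2 i ! j)" if "j < n" for j
    using e l that by (auto simp: table_entry_def nth_list_update)
qed

text \<open>Follows the parent pointers from the string in \<open>var 6\<close> to the all-identity
  string and writes \<open>v\<close> at each letter. With the letter codes it loads the tape; with
  \<open>0\<close> it clears exactly the cells that were loaded, whereas resetting the whole tape
  would cost \<open>n\<close> steps for each string.\<close>

definition walk :: "nexp \<Rightarrow> com" where
  "walk v = While (NLess (NConst 0) (var 6)) (NSet 1 (NGet 3 (var 6)) v ;; set_var 6 (NGet 2 (var 6)))"

text \<open>Induction along the parent pointers, which decrease the index. Each letter costs a test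
  and two assignments, and the last test one more step.\<close>

lemma run_walk:
  assumes "table n Ps (narr s)" "narr s 0 6 = i" "i < length Ps"
    and v: "\<And>s. table n Ps (narr s) \<Longrightarrow> 0 < narr s 0 6 \<Longrightarrow> narr s 0 6 < length Ps \<Longrightarrow>
      nval s v = g (decode_pauli (narr s 4 (narr s 0 6)))"
  shows "run E (walk v) s (3 * pauli_weight (Ps ! i) + 1)
    (\<lambda>s'. rarr s' = rarr s \<and> narr s' = (narr s)(0 := (narr s 0)(6 := 0),
       1 := (\<lambda>j. if j < n \<and> Ps ! i ! j \<noteq> PI then g (Ps ! i ! j) else narr s 1 j)))"
  using assms(1-3)
proof (induction i arbitrary: s rule: less_induct)
  case (less i)
  show ?case
  proof (cases "i = 0")
    case True
    have "\<And>j. j < n \<Longrightarrow> Ps ! 0 ! j = PI" using less.prems(1) by (simp add: table_def)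
    then have "narr s = (narr s)(0 := (narr s 0)(6 := 0),
       1 := (\<lambda>j. if j < n \<and> Ps ! i ! j \<noteq> PI then g (Ps ! i ! j) else narr s 1 j))"
      using True less.prems(2) by (auto simp: fun_eq_iff)
    then have "run E (walk v) s (Suc 0)
      (\<lambda>s'. rarr s' = rarr s \<and> narr s' = (narr s)(0 := (narr s 0)(6 := 0),
       1 := (\<lambda>j. if j < n \<and> Ps ! i ! j \<noteq> PI then g (Ps ! i ! j) else narr s 1 j)))"
      unfolding walk_def using True less.prems(2) by (intro run_While_False) simp_all
    then show ?thesis by (rule run_le) simp
  next
    case False
    let ?q = "narr s 2 i" and ?p = "narr s 3 i"
    have e: "table_entry n Ps (narr s) i" using less.prems False by (simp add: table_def)
    have q: "?q < i" "?q < length Ps" "?p < n" using e less.prems(3) by (simp_all add: table_entry_def)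
    note w = table_weight[OF less.prems(1,3)] False
    define s1 where "s1 = s\<lparr>narr := (narr s)(0 := (narr s 0)(6 := ?q), 1 := (narr s 1)(?p := g (Ps ! i ! ?p)))\<rparr>"
    have t1: "table n Ps (narr s1)"
      using less.prems(1) by (subst table_cong[of _ "narr s"]) (auto simp: s1_def)
    have v1: "nval s v = g (Ps ! i ! ?p)"
      using v[OF less.prems(1)] less.prems False w(3)[of ?p] q by simp
    have step: "run E (NSet 1 (NGet 3 (var 6)) v ;; set_var 6 (NGet 2 (var 6))) s (Suc (Suc 0)) (\<lambda>s'. s' = s1)"
      using less.prems(2) v1 by (intro run_Seq_NSet run_NSet) (simp add: s1_def fun_upd_twist)
    have IH: "run E (walk v) s1 (3 * pauli_weight (Ps ! ?q) + 1)
      (\<lambda>s'. rarr s' = rarr s1 \<and> narr s' = (narr s1)(0 := (narr s1 0)(6 := 0),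
         1 := (\<lambda>j. if j < n \<and> Ps ! ?q ! j \<noteq> PI then g (Ps ! ?q ! j) else narr s1 1 j)))"
    proof (rule less.IH[OF q(1) t1 _ q(2)])
      show "narr s1 0 6 = ?q" by (simp add: s1_def)
    qed
    have eq: "(narr s1)(0 := (narr s1 0)(6 := 0), 1 := (\<lambda>j. if j < n \<and> Ps ! ?q ! j \<noteq> PI then g (Ps ! ?q ! j) else narr s1 1 j))
      = (narr s)(0 := (narr s 0)(6 := 0), 1 := (\<lambda>j. if j < n \<and> Ps ! i ! j \<noteq> PI then g (Ps ! i ! j) else narr s 1 j))"
      using w q(3) decode_neq_PI e by (auto simp: fun_eq_iff s1_def table_entry_def)
    have "run E (walk v) s (Suc (Suc (Suc 0) + (3 * pauli_weight (Ps ! ?q) + 1)))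
      (\<lambda>s'. rarr s' = rarr s \<and> narr s' = (narr s)(0 := (narr s 0)(6 := 0),
         1 := (\<lambda>j. if j < n \<and> Ps ! i ! j \<noteq> PI then g (Ps ! i ! j) else narr s 1 j)))"
      unfolding walk_def
    proof (rule run_While_True[OF _ step])
      show "bval E s (NLess (NConst 0) (var 6))" using False less.prems(2) by simp
      fix s' assume "s' = s1"
      moreover have "rarr s1 = rarr s" by (simp add: s1_def)
      ultimately show "run E (While (NLess (NConst 0) (var 6)) (NSet 1 (NGet 3 (var 6)) v ;; set_var 6 (NGet 2 (var 6)))) s'
        (3 * pauli_weight (Ps ! ?q) + 1)
        (\<lambda>s'. rarr s' = rarr s \<and> narr s' = (narr s)(0 := (narr s 0)(6 := 0),
         1 := (\<lambda>j. if j < n \<and> Ps ! i ! j \<noteq> PI then g (Ps ! i ! j) else narr s 1 j)))"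
        using IH unfolding eq walk_def by simp
    qed
    then show ?thesis by (rule run_le) (use w(1) False in simp)
  qed
qed

section \<open>Enumerating the Pauli strings of low weight\<close>

definition triples :: "(nat \<Rightarrow> nat \<Rightarrow> nat) \<Rightarrow> nat \<Rightarrow> (nat \<times> nat \<times> nat) set" where
  "triples A m = (\<lambda>j. (A 2 j, A 3 j, A 4 j)) ` {0<..<m}"

text \<open>The entries that the search has to produce from the first \<open>m\<close> strings. A
  letter is placed only behind the existing ones, so every string has a single parent. The table is
  complete when its \<open>triples\<close> are the children of all its strings.\<close>

definition children :: "nat \<Rightarrow> nat \<Rightarrow> (nat \<Rightarrow> nat \<Rightarrow> nat) \<Rightarrow> nat \<Rightarrow> (nat \<times> nat \<times> nat) set" where
  "children n K A m = {(h, p, c). h < m \<and> A 6 h < K \<and> A 5 h \<le> p \<and> p < n \<and> c \<in> {1, 2, 3}}"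

lemma decode_inj: "c \<in> {1, 2, 3} \<Longrightarrow> d \<in> {1, 2, 3} \<Longrightarrow> decode_pauli c = decode_pauli d \<Longrightarrow> c = d"
  by (metis encode_decode)

text \<open>The point is distinctness: a string determines its last letter, and deleting that letter
  determines its parent, so an equal older entry would have the same triple.\<close>

lemma append_table:
  assumes t: "table n Ps A" and dist: "distinct Ps" and low: "set Ps \<subseteq> low_weight n K"
    and h: "h < length Ps" "A 6 h < K" and p: "A 5 h \<le> p" "p < n" and c: "c \<in> {1, 2, 3}"
    and new: "(h, p, c) \<notin> triples A (length Ps)"
    and A': "A' 2 = (A 2)(length Ps := h)" "A' 3 = (A 3)(length Ps := p)" "A' 4 = (A 4)(length Ps := c)"
      "A' 5 = (A 5)(length Ps := Suc p)" "A' 6 = (A 6)(length Ps := Suc (A 6 h))"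
  defines "R \<equiv> (Ps ! h)[p := decode_pauli c]"
  shows "table n (Ps @ [R]) A'" "distinct (Ps @ [R])" "R \<in> low_weight n K"
    "triples A' (Suc (length Ps)) = insert (h, p, c) (triples A (length Ps))"
proof -
  let ?m = "length Ps"
  have l: "length (Ps ! h) = n" and w: "A 6 h = pauli_weight (Ps ! h)" and z: "\<And>j. j < n \<Longrightarrow> A 5 h \<le> j \<Longrightarrow> Ps ! h ! j = PI"
    using t h(1) by (auto simp: table_def)
  have dc: "decode_pauli c \<noteq> PI" using c by (rule decode_neq_PI)
  have wR: "pauli_weight R = Suc (pauli_weight (Ps ! h))"
    unfolding R_def using p l z dc by (intro weight_update) auto
  have lR: "length R = n" using l by (simp add: R_def)
  have Rj: "R ! j = (if j = p then decode_pauli c else Ps ! h ! j)" if "j < n" for j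
    using that l by (simp add: R_def nth_list_update)
  show R: "R \<in> low_weight n K" using lR wR w h(2) by (simp add: low_weight_def pauli_strings_def)
  show "table n (Ps @ [R]) A'"
  proof -
    have "Ps \<noteq> []" "Ps ! 0 = replicate n PI" "A 5 0 = 0" using t by (auto simp: table_def)
    have old: "length (Ps ! i) = n \<and> A' 6 i = pauli_weight (Ps ! i) \<and> (\<forall>j<n. A' 5 i \<le> j \<longrightarrow> Ps ! i ! j = PI) \<and>
      (0 < i \<longrightarrow> table_entry n (Ps @ [R]) A' i)" if "i < ?m" for i
    proof -
      have "0 < i \<longrightarrow> table_entry n Ps A i" using t that by (simp add: table_def)
      then have "0 < i \<longrightarrow> table_entry n (Ps @ [R]) A' i"
        using that by (auto simp: table_entry_def A' nth_append)
      then show ?thesis using t that by (simp add: table_def A')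
    qed
    have new: "length R = n \<and> A' 6 ?m = pauli_weight R \<and> (\<forall>j<n. A' 5 ?m \<le> j \<longrightarrow> R ! j = PI) \<and>
      (0 < ?m \<longrightarrow> table_entry n (Ps @ [R]) A' ?m)"
    proof (intro conjI allI impI)
      fix j assume "j < n" "A' 5 ?m \<le> j"
      then show "R ! j = PI" using Rj[of j] z[of j] p by (simp add: A')
    next
      show "table_entry n (Ps @ [R]) A' ?m"
        using h p c by (simp add: table_entry_def A' R_def nth_append)
    qed (use lR wR w in \<open>simp_all add: A'\<close>)
    show ?thesis unfolding table_def
    proof (intro conjI allI impI)
      fix i assume i: "i < length (Ps @ [R])"
      show "length ((Ps @ [R]) ! i) = n"
        using old[of i] new i by (cases "i < ?m") (auto simp: nth_append less_Suc_eq)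
      show "A' 6 i = pauli_weight ((Ps @ [R]) ! i)"
        using old[of i] new i by (cases "i < ?m") (auto simp: nth_append less_Suc_eq)
    next
      fix i j assume "i < length (Ps @ [R])" "j < n" "A' 5 i \<le> j"
      then show "(Ps @ [R]) ! i ! j = PI" using old[of i] new by (cases "i < ?m") (auto simp: nth_append less_Suc_eq)
    next
      fix i assume "i < length (Ps @ [R])" "0 < i"
      then show "table_entry n (Ps @ [R]) A' i" using old[of i] new by (cases "i < ?m") (auto simp: less_Suc_eq)
    qed (use \<open>Ps \<noteq> []\<close> \<open>Ps ! 0 = replicate n PI\<close> \<open>A 5 0 = 0\<close> in \<open>simp_all add: A' nth_append\<close>)
  qed
  have "R \<notin> set Ps"
  proof
    assume "R \<in> set Ps"
    then obtain j where j: "j < ?m" "Ps ! j = R" by (metis in_set_conv_nth)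
    have "j \<noteq> 0"
    proof
      assume "j = 0"
      then have "R = replicate n PI" using t j by (simp add: table_def)
      then have "R ! p = PI" using p(2) by simp
      then show False using Rj[OF p(2)] dc by simp
    qed
    then have e: "table_entry n Ps A j" and zj: "\<And>i. i < n \<Longrightarrow> A 5 j \<le> i \<Longrightarrow> R ! i = PI"
      using t j by (auto simp: table_def)
    note wt = table_weight[OF t j(1), unfolded j(2)]
    have q: "A 2 j < ?m" "A 3 j < n" "A 4 j \<in> {1, 2, 3}" "A 5 j = Suc (A 3 j)"
      using e j(1) by (auto simp: table_entry_def)
    \<comment> \<open>Both \<open>p\<close> and \<open>A 3 j\<close> are the position of the last
      letter of \<open>R\<close>, hence equal.\<close>
    have "p \<le> A 3 j" using zj[OF p(2)] Rj[OF p(2)] dc q(4) by (metis not_less_eq_eq)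
    moreover have "A 3 j \<le> p"
    proof (rule ccontr)
      assume "\<not> A 3 j \<le> p"
      then have "R ! A 3 j = PI" using Rj[OF q(2)] z[OF q(2)] p(1) by simp
      then show False using wt(3)[of "A 3 j"] \<open>j \<noteq> 0\<close> q(2,3) decode_neq_PI by simp
    qed
    ultimately have pj: "A 3 j = p" by simp
    have "decode_pauli (A 4 j) = decode_pauli c" using wt(3)[of p] Rj[OF p(2)] p(2) pj \<open>j \<noteq> 0\<close> by simp
    then have cj: "A 4 j = c" using decode_inj q(3) c by blast
    have "Ps ! A 2 j = Ps ! h"
    proof (rule nth_equalityI)
      show "length (Ps ! A 2 j) = length (Ps ! h)" using t q(1) l by (simp add: table_def)
      fix i assume "i < length (Ps ! A 2 j)"
      then have i: "i < n" using t q(1) by (simp add: table_def)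
      show "Ps ! A 2 j ! i = Ps ! h ! i"
        using wt(2) wt(3)[of i] \<open>j \<noteq> 0\<close> Rj[OF i] i pj z[OF p(2,1)] by (cases "i = p") auto
    qed
    then have "A 2 j = h" using dist q(1) h(1) by (simp add: nth_eq_iff_index_eq)
    then have "(h, p, c) \<in> triples A ?m"
      using j(1) \<open>j \<noteq> 0\<close> pj cj unfolding triples_def by (intro image_eqI[of _ _ j]) auto
    then show False using new by simp
  qed
  then show "distinct (Ps @ [R])" using dist by simp
  have "{0<..<Suc ?m} = insert ?m {0<..<?m}" using h(1) by auto
  moreover have "(\<lambda>j. (A' 2 j, A' 3 j, A' 4 j)) ` {0<..<?m} = (\<lambda>j. (A 2 j, A 3 j, A 4 j)) ` {0<..<?m}"
    by (intro image_cong refl) (auto simp: A')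
  ultimately show "triples A' (Suc ?m) = insert (h, p, c) (triples A ?m)"
    by (simp add: triples_def A')
qed

text \<open>Induction on the weight: deleting the last letter of \<open>P\<close> leaves a string of
  the table, and restoring it gives a child because that string has no letter behind this
  position.\<close>

lemma children_complete:
  assumes t: "table n Ps A" and tr: "triples A (length Ps) = children n K A (length Ps)"
  shows "low_weight n K \<subseteq> set Ps"
proof
  fix P assume "P \<in> low_weight n K"
  then have "length P = n" "pauli_weight P \<le> K" by (auto simp: low_weight_def pauli_strings_def)
  then show "P \<in> set Ps"
  proof (induction "pauli_weight P" arbitrary: P)
    case 0
    then have "P = replicate n PI"
      by (metis (mono_tags, lifting) filter_empty_conv length_0_conv pauli_weight_def replicate_eqI)
    then show ?case using t by (metis length_greater_0_conv nth_mem table_def)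
  next
    case (Suc w)
    let ?I = "{i. i < n \<and> P ! i \<noteq> PI}"
    have "card ?I = Suc w" using Suc by (simp add: pauli_weight_def length_filter_conv_card)
    then have ne: "?I \<noteq> {}" by (metis card.empty nat.distinct(1))
    define p where "p = Max ?I"
    have p: "p < n" "P ! p \<noteq> PI" using Max_in[OF _ ne] by (auto simp: p_def)
    have pmax: "i \<le> p" if "i < n" "P ! i \<noteq> PI" for i using that by (auto simp: p_def intro: Max_ge)
    let ?Q = "P[p := PI]"
    have PQ: "P = ?Q[p := P ! p]" by simp
    have wQ: "pauli_weight P = Suc (pauli_weight ?Q)"
      by (subst PQ, rule weight_update) (use p Suc.prems in auto)
    then have "?Q \<in> set Ps" using Suc by (intro Suc.hyps) auto
    then obtain h where h: "h < length Ps" "Ps ! h = ?Q" by (metis in_set_conv_nth)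
    have start: "A 5 h \<le> p"
    proof (cases "h = 0")
      case True
      then show ?thesis using t by (simp add: table_def)
    next
      case False
      then have e: "table_entry n Ps A h" using t h by (simp add: table_def)
      then have q: "A 3 h < n" "A 4 h \<in> {1, 2, 3}" "A 5 h = Suc (A 3 h)" by (auto simp: table_entry_def)
      have "?Q ! A 3 h \<noteq> PI"
        using table_weight(3)[OF t h(1) _ q(1)] False h(2) decode_neq_PI[OF q(2)] by simp
      then have "A 3 h \<noteq> p" "P ! A 3 h \<noteq> PI" using p Suc.prems q(1) by (auto simp: nth_list_update split: if_splits)
      then show ?thesis using pmax[OF q(1)] q(3) by simp
    qed
    have "A 6 h < K" using t h wQ Suc by (simp add: table_def)
    then have "(h, p, encode_pauli (P ! p)) \<in> children n K A (length Ps)"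
      using h p start encode_cases[OF p(2)] by (simp add: children_def)
    then obtain j where j: "0 < j" "j < length Ps" "A 2 j = h" "A 3 j = p" "A 4 j = encode_pauli (P ! p)"
      unfolding tr[symmetric] triples_def by auto
    then have "Ps ! j = ?Q[p := P ! p]"
      using t h by (auto simp: table_def table_entry_def)
    then show ?case using j PQ by (metis nth_mem)
  qed
qed

section \<open>The breadth-first search and its running time\<close>

definition append_child :: "nat \<Rightarrow> com" where
  "append_child c =
     NSet 2 (var 3) (var 4) ;; NSet 3 (var 3) (var 5) ;; NSet 4 (var 3) (NConst c) ;;
     NSet 5 (var 3) (NAdd (var 5) (NConst 1)) ;;
     NSet 6 (var 3) (NAdd (NGet 6 (var 4)) (NConst 1)) ;;
     set_var 3 (NAdd (var 3) (NConst 1))"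

text \<open>The table is its own queue: \<open>var 4\<close> is the head, \<open>var 3\<close> the
  tail, \<open>var 5\<close> the qubit of the new letter, and \<open>var 0\<close> and
  \<open>var 2\<close> hold \<open>n\<close> and \<open>K\<close>.\<close>

definition enumerate_strings :: com where
  "enumerate_strings =
     set_var 3 (NConst 1) ;;
     While (NLess (var 4) (var 3))
       (Cond (NLess (NGet 6 (var 4)) (var 2))
          (set_var 5 (NGet 5 (var 4)) ;;
           While (NLess (var 5) (var 0))
             (append_child 1 ;; append_child 2 ;; append_child 3 ;; set_var 5 (NAdd (var 5) (NConst 1))))
          Skip ;;
        set_var 4 (NAdd (var 4) (NConst 1)))"

text \<open>\<open>s0\<close> is the memory at the start. The last conjuncts are the frame
  condition; \<open>3\<close>, \<open>4\<close> and \<open>5\<close> are the variables that the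
  search changes.\<close>

definition enum_inv :: "nat \<Rightarrow> nat \<Rightarrow> memory \<Rightarrow> pauli list list \<Rightarrow> memory \<Rightarrow> bool" where
  "enum_inv n K s0 Ps s \<longleftrightarrow> table n Ps (narr s) \<and> narr s 0 3 = length Ps \<and> distinct Ps \<and>
     set Ps \<subseteq> low_weight n K \<and> rarr s = rarr s0 \<and> narr s 1 = narr s0 1 \<and>
     (\<forall>j. j \<notin> {3, 4, 5} \<longrightarrow> narr s 0 j = narr s0 0 j)"

lemma run_append_child:
  assumes inv: "enum_inv n K s0 Ps s" and s0: "narr s0 0 0 = n" "narr s0 0 2 = K"
    and h: "narr s 0 4 = h" "h < length Ps" "narr s 6 h < K" and p: "narr s 0 5 = p" "narr s 5 h \<le> p" "p < n"
    and c: "c \<in> {1, 2, 3}" and new: "(h, p, c) \<notin> triples (narr s) (length Ps)"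
  shows "run E (append_child c) s 6 (\<lambda>s'. \<exists>Ps'. length Ps' = Suc (length Ps) \<and> enum_inv n K s0 Ps' s' \<and>
    narr s' 0 4 = h \<and> narr s' 0 5 = p \<and>
    triples (narr s') (length Ps') = insert (h, p, c) (triples (narr s) (length Ps)) \<and>
    (\<forall>i<length Ps. narr s' 5 i = narr s 5 i \<and> narr s' 6 i = narr s 6 i))"
proof -
  let ?m = "length Ps"
  let ?A = "(narr s)(2 := (narr s 2)(?m := h), 3 := (narr s 3)(?m := p), 4 := (narr s 4)(?m := c),
    5 := (narr s 5)(?m := Suc p), 6 := (narr s 6)(?m := Suc (narr s 6 h)), 0 := (narr s 0)(3 := Suc ?m))"
  let ?R = "(Ps ! h)[p := decode_pauli c]"
  have m: "narr s 0 3 = ?m" using inv by (simp add: enum_inv_def)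
  have "run E (append_child c) s (Suc (Suc (Suc (Suc (Suc (Suc 0)))))) (\<lambda>s'. s' = s\<lparr>narr := ?A\<rparr>)"
    unfolding append_child_def
    by ((rule run_Seq_NSet, simp add: m h p)+, rule run_NSet, simp add: m h p)
  then show ?thesis
  proof (rule run_weaken)
    fix s' assume s': "s' = s\<lparr>narr := ?A\<rparr>"
    have t: "table n Ps (narr s)" "distinct Ps" "set Ps \<subseteq> low_weight n K" using inv by (simp_all add: enum_inv_def)
    note app = append_table[OF t h(2,3) p(2,3) c new, of "narr s'"]
    have A: "narr s' 2 = (narr s 2)(?m := h)" "narr s' 3 = (narr s 3)(?m := p)" "narr s' 4 = (narr s 4)(?m := c)"
      "narr s' 5 = (narr s 5)(?m := Suc p)" "narr s' 6 = (narr s 6)(?m := Suc (narr s 6 h))"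
      by (simp_all add: s')
    have "enum_inv n K s0 (Ps @ [?R]) s'"
      unfolding enum_inv_def
    proof (intro conjI allI impI)
      fix j :: nat assume "j \<notin> {3, 4, 5}"
      then show "narr s' 0 j = narr s0 0 j" using inv by (simp add: enum_inv_def s')
    next
      show "table n (Ps @ [?R]) (narr s')" by (rule app(1)[OF A])
      show "distinct (Ps @ [?R])" by (rule app(2)[OF A])
      show "set (Ps @ [?R]) \<subseteq> low_weight n K" using app(3)[OF A] t(3) by simp
      show "narr s' 0 3 = length (Ps @ [?R])" by (simp add: s')
      show "rarr s' = rarr s0" "narr s' 1 = narr s0 1" using inv by (simp_all add: s' enum_inv_def)
    qed
    moreover have "triples (narr s') (length (Ps @ [?R])) = insert (h, p, c) (triples (narr s) ?m)"
      using app(4)[OF A] by simp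
    ultimately show "\<exists>Ps'. length Ps' = Suc (length Ps) \<and> enum_inv n K s0 Ps' s' \<and>
      narr s' 0 4 = h \<and> narr s' 0 5 = p \<and>
      triples (narr s') (length Ps') = insert (h, p, c) (triples (narr s) (length Ps)) \<and>
      (\<forall>i<length Ps. narr s' 5 i = narr s 5 i \<and> narr s' 6 i = narr s 6 i)"
    proof (intro exI[of _ "Ps @ [?R]"] conjI)
      show "narr s' 0 4 = h" "narr s' 0 5 = p" using h(1) p(1) by (simp_all add: s')
      show "\<forall>i<?m. narr s' 5 i = narr s 5 i \<and> narr s' 6 i = narr s 6 i" by (simp add: s')
    qed simp_all
  qed simp
qed

lemma run_append_children:
  assumes inv: "enum_inv n K s0 Ps s" and s0: "narr s0 0 0 = n" "narr s0 0 2 = K"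
    and h: "narr s 0 4 = h" "h < length Ps" "narr s 6 h < K"
    and p: "narr s 5 h \<le> narr s 0 5" "narr s 0 5 = p" "p < n"
    and tr: "triples (narr s) (length Ps) = children n K (narr s) h \<union> {h} \<times> {narr s 5 h..<p} \<times> {1, 2, 3}"
  shows "run E (append_child 1 ;; append_child 2 ;; append_child 3 ;; set_var 5 (NAdd (var 5) (NConst 1))) s 19
    (\<lambda>s'. \<exists>Ps'. length Ps' = length Ps + 3 \<and> enum_inv n K s0 Ps' s' \<and>
      narr s' 0 4 = h \<and> narr s' 0 5 = Suc p \<and>
      triples (narr s') (length Ps') = children n K (narr s) h \<union> {h} \<times> {narr s 5 h..<Suc p} \<times> {1, 2, 3} \<and>
      (\<forall>i<length Ps. narr s' 5 i = narr s 5 i \<and> narr s' 6 i = narr s 6 i))" (is "run E _ s 19 ?Q")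
proof -
  let ?T = "triples (narr s) (length Ps)"
  \<comment> \<open>The three appends are handled uniformly, with \<open>C\<close> the set of codes
    already appended at qubit \<open>p\<close>.\<close>
  define Q where "Q C s' \<longleftrightarrow> (\<exists>Ps'. length Ps' = length Ps + card C \<and> enum_inv n K s0 Ps' s' \<and>
      narr s' 0 4 = h \<and> narr s' 0 5 = p \<and> triples (narr s') (length Ps') = ?T \<union> {h} \<times> {p} \<times> C \<and>
      (\<forall>i<length Ps. narr s' 5 i = narr s 5 i \<and> narr s' 6 i = narr s 6 i))" for C s'
  have T: "(h, p, c) \<notin> ?T" for c unfolding tr by (auto simp: children_def)
  have step: "run E (append_child c) s' 6 (Q (insert c C))"
    if QC: "Q C s'" and c: "c \<in> {1, 2, 3}" "c \<notin> C" "finite C" for C c s'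
  proof -
    obtain Ps' where 1: "length Ps' = length Ps + card C" "enum_inv n K s0 Ps' s'" "narr s' 0 4 = h" "narr s' 0 5 = p"
      "triples (narr s') (length Ps') = ?T \<union> {h} \<times> {p} \<times> C"
      "\<And>i. i < length Ps \<Longrightarrow> narr s' 5 i = narr s 5 i \<and> narr s' 6 i = narr s 6 i"
      using QC unfolding Q_def by blast
    have "run E (append_child c) s' 6 (\<lambda>s''. \<exists>Ps''. length Ps'' = Suc (length Ps') \<and> enum_inv n K s0 Ps'' s'' \<and>
      narr s'' 0 4 = h \<and> narr s'' 0 5 = p \<and>
      triples (narr s'') (length Ps'') = insert (h, p, c) (triples (narr s') (length Ps')) \<and>
      (\<forall>i<length Ps'. narr s'' 5 i = narr s' 5 i \<and> narr s'' 6 i = narr s' 6 i))"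
    proof (rule run_append_child[OF 1(2) s0 1(3) _ _ 1(4) _ p(3) c(1)])
      show "h < length Ps'" using h 1(1) by simp
      show "narr s' 6 h < K" "narr s' 5 h \<le> p" using 1(6)[OF h(2)] h p by simp_all
      show "(h, p, c) \<notin> triples (narr s') (length Ps')" unfolding 1(5) using T c(2) by auto
    qed
    then show ?thesis
    proof (rule run_weaken)
      fix s''
      assume "\<exists>Ps''. length Ps'' = Suc (length Ps') \<and> enum_inv n K s0 Ps'' s'' \<and>
        narr s'' 0 4 = h \<and> narr s'' 0 5 = p \<and>
        triples (narr s'') (length Ps'') = insert (h, p, c) (triples (narr s') (length Ps')) \<and>
        (\<forall>i<length Ps'. narr s'' 5 i = narr s' 5 i \<and> narr s'' 6 i = narr s' 6 i)"
      then obtain Ps'' where 2: "length Ps'' = Suc (length Ps')" "enum_inv n K s0 Ps'' s''"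
        "narr s'' 0 4 = h" "narr s'' 0 5 = p"
        "triples (narr s'') (length Ps'') = insert (h, p, c) (triples (narr s') (length Ps'))"
        "\<And>i. i < length Ps' \<Longrightarrow> narr s'' 5 i = narr s' 5 i \<and> narr s'' 6 i = narr s' 6 i" by blast
      have "length Ps'' = length Ps + card (insert c C)" using 1(1) 2(1) c by simp
      moreover have "triples (narr s'') (length Ps'') = ?T \<union> {h} \<times> {p} \<times> insert c C"
        unfolding 2(5) 1(5) by auto
      ultimately show "Q (insert c C) s''"
        unfolding Q_def using 2(2,3,4,6) 1(1,6) by (intro exI[of _ Ps'']) simp
    qed simp
  qed
  have Q0: "Q {} s" unfolding Q_def using inv h p by (intro exI[of _ Ps]) simp
  have "run E (append_child 1 ;; append_child 2 ;; append_child 3 ;; set_var 5 (NAdd (var 5) (NConst 1))) s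
    (6 + (6 + (6 + Suc 0))) ?Q"
  proof (rule run_Seq[OF step[OF Q0, of 1]], simp, simp, simp)
    fix s1 assume s1: "Q {1} s1"
    show "run E (append_child 2 ;; append_child 3 ;; set_var 5 (NAdd (var 5) (NConst 1))) s1 (6 + (6 + Suc 0)) ?Q"
    proof (rule run_Seq[OF step[OF s1, of 2]], simp, simp, simp)
      fix s2 assume s2: "Q {2, 1} s2"
      show "run E (append_child 3 ;; set_var 5 (NAdd (var 5) (NConst 1))) s2 (6 + Suc 0) ?Q"
      proof (rule run_Seq[OF step[OF s2, of 3]], simp, simp, simp)
        fix s3 assume Q3: "Q {3, 2, 1} s3"
        have c3: "card {3, 2, 1 :: nat} = 3" by simp
        obtain Ps' where 3: "length Ps' = length Ps + 3" "enum_inv n K s0 Ps' s3"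
          "narr s3 0 4 = h" "narr s3 0 5 = p" "triples (narr s3) (length Ps') = ?T \<union> {h} \<times> {p} \<times> {3, 2, 1}"
          "\<And>i. i < length Ps \<Longrightarrow> narr s3 5 i = narr s 5 i \<and> narr s3 6 i = narr s 6 i"
          using Q3 unfolding Q_def c3 by blast
        let ?s = "s3\<lparr>narr := (narr s3)(0 := (narr s3 0)(5 := Suc p))\<rparr>"
        have "enum_inv n K s0 Ps' ?s"
          unfolding enum_inv_def
        proof (intro conjI allI impI)
          show "table n Ps' (narr ?s)" using 3(2) by (subst table_cong[of _ "narr s3"]) (auto simp: enum_inv_def)
        qed (use 3(2) in \<open>simp_all add: enum_inv_def\<close>)
        moreover have "triples (narr ?s) (length Ps') = triples (narr s3) (length Ps')"
          by (simp add: triples_def)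
        moreover have "?T \<union> {h} \<times> {p} \<times> {3, 2, 1} = children n K (narr s) h \<union> {h} \<times> {narr s 5 h..<Suc p} \<times> {1, 2, 3}"
          unfolding tr using p by (auto simp: less_Suc_eq)
        ultimately have "?Q ?s" using 3 by (intro exI[of _ Ps']) simp
        then show "run E (set_var 5 (NAdd (var 5) (NConst 1))) s3 (Suc 0) ?Q"
          using 3(4) by (intro run_NSet) simp
      qed
    qed
  qed
  then show ?thesis by (rule run_le) simp
qed

lemma children_Suc:
  assumes "A 6 h < K"
  shows "children n K A h \<union> {h} \<times> {A 5 h..<n} \<times> {1, 2, 3} = children n K A (Suc h)"
  using assms by (auto simp: children_def less_Suc_eq)

lemma children_Suc_leaf: "\<not> A 6 h < K \<Longrightarrow> children n K A (Suc h) = children n K A h"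
  by (auto simp: children_def less_Suc_eq)

lemma children_cong:
  "(\<And>i. i < m \<Longrightarrow> A 5 i = B 5 i \<and> A 6 i = B 6 i) \<Longrightarrow> children n K A m = children n K B m"
  by (auto simp: children_def)

text \<open>The time is tied to the number of appended strings: a round of the inner loop takes
  \<open>20\<close> steps and appends \<open>3\<close> strings, which \<open>7\<close> units per
  string cover; \<open>4\<close> units cover the rest.\<close>

lemma run_expand:
  assumes inv: "enum_inv n K s0 Ps s" and s0: "narr s0 0 0 = n" "narr s0 0 2 = K"
    and h: "narr s 0 4 = h" "h < length Ps"
    and tr: "triples (narr s) (length Ps) = children n K (narr s) h"
  shows "\<exists>T. run E (Cond (NLess (NGet 6 (var 4)) (var 2))
          (set_var 5 (NGet 5 (var 4)) ;;
           While (NLess (var 5) (var 0))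
             (append_child 1 ;; append_child 2 ;; append_child 3 ;; set_var 5 (NAdd (var 5) (NConst 1))))
          Skip ;;
        set_var 4 (NAdd (var 4) (NConst 1))) s T
    (\<lambda>s'. \<exists>Ps'. enum_inv n K s0 Ps' s' \<and> narr s' 0 4 = Suc h \<and> length Ps \<le> length Ps' \<and>
      triples (narr s') (length Ps') = children n K (narr s') (Suc h) \<and> T + 7 * length Ps \<le> 7 * length Ps' + 4)"
proof -
  have n: "narr s 0 0 = n" "narr s 0 2 = K" using inv s0 by (simp_all add: enum_inv_def)
  let ?R = "\<lambda>d s'. \<exists>Ps'. enum_inv n K s0 Ps' s' \<and> narr s' 0 4 = h \<and> length Ps' = length Ps + 3 * d \<and>
      triples (narr s') (length Ps') = children n K (narr s) (Suc h) \<and>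
      (\<forall>i<length Ps. narr s' 5 i = narr s 5 i \<and> narr s' 6 i = narr s 6 i)"
  have "\<exists>d. run E (Cond (NLess (NGet 6 (var 4)) (var 2))
          (set_var 5 (NGet 5 (var 4)) ;;
           While (NLess (var 5) (var 0))
             (append_child 1 ;; append_child 2 ;; append_child 3 ;; set_var 5 (NAdd (var 5) (NConst 1))))
          Skip) s (20 * d + 3) (?R d)"
  proof (cases "narr s 6 h < K")
    case False
    have "run E (Cond (NLess (NGet 6 (var 4)) (var 2))
          (set_var 5 (NGet 5 (var 4)) ;;
           While (NLess (var 5) (var 0))
             (append_child 1 ;; append_child 2 ;; append_child 3 ;; set_var 5 (NAdd (var 5) (NConst 1))))
          Skip) s (Suc 0) (?R 0)"
    proof (rule run_Cond)
      have "?R 0 s" using inv h tr children_Suc_leaf[of "narr s" h K n] False by (intro exI[of _ Ps]) simp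
      then show "run E Skip s 0 (?R 0)" by (rule run_Skip)
    qed (use False h n in simp)
    then have "run E (Cond (NLess (NGet 6 (var 4)) (var 2))
          (set_var 5 (NGet 5 (var 4)) ;;
           While (NLess (var 5) (var 0))
             (append_child 1 ;; append_child 2 ;; append_child 3 ;; set_var 5 (NAdd (var 5) (NConst 1))))
          Skip) s (20 * 0 + 3) (?R 0)" by (rule run_le) simp
    then show ?thesis by blast
  next
    case True
    let ?b = "narr s 5 h" and ?d = "n - narr s 5 h"
    have bn: "?b \<le> n"
    proof (cases "h = 0")
      case True
      then show ?thesis using inv by (simp add: enum_inv_def table_def)
    next
      case False
      then have "table_entry n Ps (narr s) h" using inv h by (simp add: enum_inv_def table_def)
      then show ?thesis by (simp add: table_entry_def)
    qed
    define I where "I q s' \<longleftrightarrow> (\<exists>Ps'. enum_inv n K s0 Ps' s' \<and> narr s' 0 4 = h \<and> narr s' 0 5 = ?b + q \<and>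
      length Ps' = length Ps + 3 * q \<and>
      triples (narr s') (length Ps') = children n K (narr s) h \<union> {h} \<times> {?b..<?b + q} \<times> {1, 2, 3} \<and>
      (\<forall>i<length Ps. narr s' 5 i = narr s 5 i \<and> narr s' 6 i = narr s 6 i))" for q s'
    let ?body = "append_child 1 ;; append_child 2 ;; append_child 3 ;; set_var 5 (NAdd (var 5) (NConst 1))"
    let ?s = "s\<lparr>narr := (narr s)(0 := (narr s 0)(5 := ?b))\<rparr>"
    have "I 0 ?s"
    proof -
      have "enum_inv n K s0 Ps ?s"
        unfolding enum_inv_def
      proof (intro conjI allI impI)
        show "table n Ps (narr ?s)" using inv by (subst table_cong[of _ "narr s"]) (auto simp: enum_inv_def)
      qed (use inv in \<open>simp_all add: enum_inv_def\<close>)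
      then show ?thesis unfolding I_def using h tr by (intro exI[of _ Ps]) (simp add: triples_def)
    qed
    then have loop: "run E (While (NLess (var 5) (var 0)) ?body) ?s (?d * Suc 19 + 1) (I ?d)"
    proof (rule run_For)
      fix q s' assume q: "q < ?d" and "I q s'"
      then obtain Ps' where 1: "enum_inv n K s0 Ps' s'" "narr s' 0 4 = h" "narr s' 0 5 = ?b + q"
        "length Ps' = length Ps + 3 * q"
        "triples (narr s') (length Ps') = children n K (narr s) h \<union> {h} \<times> {?b..<?b + q} \<times> {1, 2, 3}"
        and fr: "\<And>i. i < length Ps \<Longrightarrow> narr s' 5 i = narr s 5 i \<and> narr s' 6 i = narr s 6 i"
        unfolding I_def by blast
      have n': "narr s' 0 0 = n" using 1(1) s0 by (simp add: enum_inv_def)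
      have ch: "children n K (narr s') h = children n K (narr s) h" using fr h by (intro children_cong) auto
      have b': "narr s' 5 h = ?b" "narr s' 6 h < K" using fr[OF h(2)] True by simp_all
      have "run E ?body s' 19 (\<lambda>s''. \<exists>Ps''. length Ps'' = length Ps' + 3 \<and> enum_inv n K s0 Ps'' s'' \<and>
        narr s'' 0 4 = h \<and> narr s'' 0 5 = Suc (?b + q) \<and>
        triples (narr s'') (length Ps'') = children n K (narr s') h \<union> {h} \<times> {narr s' 5 h..<Suc (?b + q)} \<times> {1, 2, 3} \<and>
        (\<forall>i<length Ps'. narr s'' 5 i = narr s' 5 i \<and> narr s'' 6 i = narr s' 6 i))"
        using 1 h b' ch q by (intro run_append_children s0) auto
      then have "run E ?body s' 19 (I (Suc q))"
      proof (rule run_weaken)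
        fix s'' assume "\<exists>Ps''. length Ps'' = length Ps' + 3 \<and> enum_inv n K s0 Ps'' s'' \<and>
          narr s'' 0 4 = h \<and> narr s'' 0 5 = Suc (?b + q) \<and>
          triples (narr s'') (length Ps'') = children n K (narr s') h \<union> {h} \<times> {narr s' 5 h..<Suc (?b + q)} \<times> {1, 2, 3} \<and>
          (\<forall>i<length Ps'. narr s'' 5 i = narr s' 5 i \<and> narr s'' 6 i = narr s' 6 i)"
        then obtain Ps'' where "length Ps'' = length Ps' + 3" "enum_inv n K s0 Ps'' s''"
          "narr s'' 0 4 = h" "narr s'' 0 5 = Suc (?b + q)"
          "triples (narr s'') (length Ps'') = children n K (narr s') h \<union> {h} \<times> {narr s' 5 h..<Suc (?b + q)} \<times> {1, 2, 3}"
          "\<And>i. i < length Ps' \<Longrightarrow> narr s'' 5 i = narr s' 5 i \<and> narr s'' 6 i = narr s' 6 i" by blast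
        then show "I (Suc q) s''" unfolding I_def using 1(4) fr ch b' by (intro exI[of _ Ps'']) simp
      qed simp
      then show "bval E s' (NLess (var 5) (var 0)) \<and> run E ?body s' 19 (I (Suc q))"
        using 1(3) n' q by simp
    next
      fix s' assume "I ?d s'"
      then obtain Ps' where "enum_inv n K s0 Ps' s'" "narr s' 0 5 = ?b + ?d" unfolding I_def by blast
      then show "\<not> bval E s' (NLess (var 5) (var 0))" using bn s0 by (simp add: enum_inv_def)
    qed
    have R: "?R ?d s'" if "I ?d s'" for s'
    proof -
      have "{?b..<?b + ?d} = {?b..<n}" using bn by simp
      then show ?thesis using that children_Suc[of "narr s" h K n, OF True] unfolding I_def by auto
    qed
    have "run E (Cond (NLess (NGet 6 (var 4)) (var 2)) (set_var 5 (NGet 5 (var 4)) ;; While (NLess (var 5) (var 0)) ?body) Skip)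
       s (Suc (Suc (?d * Suc 19 + 1))) (?R ?d)"
    proof (rule run_Cond)
      show "run E (set_var 5 (NGet 5 (var 4)) ;; While (NLess (var 5) (var 0)) ?body) s (Suc (?d * Suc 19 + 1)) (?R ?d)"
        using run_weaken[OF loop order_refl R] h by (intro run_Seq_NSet) simp
    qed (use True h n in simp)
    then have "run E (Cond (NLess (NGet 6 (var 4)) (var 2)) (set_var 5 (NGet 5 (var 4)) ;; While (NLess (var 5) (var 0)) ?body) Skip)
       s (20 * ?d + 3) (?R ?d)" by (rule run_le) simp
    then show ?thesis by blast
  qed
  then obtain d where d: "run E (Cond (NLess (NGet 6 (var 4)) (var 2))
          (set_var 5 (NGet 5 (var 4)) ;;
           While (NLess (var 5) (var 0))
             (append_child 1 ;; append_child 2 ;; append_child 3 ;; set_var 5 (NAdd (var 5) (NConst 1))))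
          Skip) s (20 * d + 3) (?R d)" by blast
  show ?thesis
  proof (rule exI[of _ "20 * d + 3 + Suc 0"], rule run_Seq[OF d])
    fix s1 assume "?R d s1"
    then obtain Ps' where 1: "enum_inv n K s0 Ps' s1" "narr s1 0 4 = h" "length Ps' = length Ps + 3 * d"
      "triples (narr s1) (length Ps') = children n K (narr s) (Suc h)"
      "\<And>i. i < length Ps \<Longrightarrow> narr s1 5 i = narr s 5 i \<and> narr s1 6 i = narr s 6 i" by blast
    let ?s = "s1\<lparr>narr := (narr s1)(0 := (narr s1 0)(4 := Suc h))\<rparr>"
    have "enum_inv n K s0 Ps' ?s"
      unfolding enum_inv_def
    proof (intro conjI allI impI)
      show "table n Ps' (narr ?s)" using 1(1) by (subst table_cong[of _ "narr s1"]) (auto simp: enum_inv_def)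
    qed (use 1(1) in \<open>simp_all add: enum_inv_def\<close>)
    moreover have "children n K (narr ?s) (Suc h) = children n K (narr s) (Suc h)"
      using 1(5) h by (intro children_cong) auto
    moreover have "triples (narr ?s) (length Ps') = triples (narr s1) (length Ps')" by (simp add: triples_def)
    ultimately have "\<exists>Ps'. enum_inv n K s0 Ps' ?s \<and> narr ?s 0 4 = Suc h \<and> length Ps \<le> length Ps' \<and>
      triples (narr ?s) (length Ps') = children n K (narr ?s) (Suc h) \<and> 20 * d + 3 + Suc 0 + 7 * length Ps \<le> 7 * length Ps' + 4"
      using 1(3,4) by (intro exI[of _ Ps']) simp
    then show "run E (set_var 4 (NAdd (var 4) (NConst 1))) s1 (Suc 0)
      (\<lambda>s'. \<exists>Ps'. enum_inv n K s0 Ps' s' \<and> narr s' 0 4 = Suc h \<and> length Ps \<le> length Ps' \<and>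
      triples (narr s') (length Ps') = children n K (narr s') (Suc h) \<and> 20 * d + 3 + Suc 0 + 7 * length Ps \<le> 7 * length Ps' + 4)"
      using 1(2) by (intro run_NSet) simp
  qed
qed

text \<open>The potential charges \<open>5\<close> for each string passed by the head and
  \<open>7\<close> for each string appended. As the strings are distinct and of low weight, both
  counts are at most \<open>card (low_weight n K)\<close>, hence the \<open>12\<close>.\<close>

lemma run_enumerate_strings:
  assumes s: "narr s 0 0 = n" "narr s 0 2 = K" "narr s 0 4 = 0" "narr s 5 0 = 0" "narr s 6 0 = 0"
  shows "run E enumerate_strings s (12 * card (low_weight n K) + 2)
    (\<lambda>s'. \<exists>Ps. enum_inv n K s Ps s' \<and> set Ps = low_weight n K)"
proof -
  let ?c = "card (low_weight n K)"
  define I where "I s' \<longleftrightarrow> (\<exists>Ps. enum_inv n K s Ps s' \<and> narr s' 0 4 \<le> length Ps \<and>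
    triples (narr s') (length Ps) = children n K (narr s') (narr s' 0 4))" for s'
  let ?s = "s\<lparr>narr := (narr s)(0 := (narr s 0)(3 := 1))\<rparr>"
  have "I ?s"
  proof -
    have w: "pauli_weight (replicate n PI) = 0" by (simp add: pauli_weight_def)
    then have "enum_inv n K s [replicate n PI] ?s"
      using s by (auto simp: enum_inv_def table_def low_weight_def pauli_strings_def)
    then show ?thesis unfolding I_def using s
      by (intro exI[of _ "[replicate n PI]"]) (auto simp: triples_def children_def)
  qed
  have len: "length Ps \<le> ?c" if "enum_inv n K s Ps s'" for Ps s'
    using that card_mono[of "low_weight n K" "set Ps"] by (simp add: enum_inv_def distinct_card)
  let ?body = "Cond (NLess (NGet 6 (var 4)) (var 2))
          (set_var 5 (NGet 5 (var 4)) ;;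
           While (NLess (var 5) (var 0))
             (append_child 1 ;; append_child 2 ;; append_child 3 ;; set_var 5 (NAdd (var 5) (NConst 1))))
          Skip ;;
        set_var 4 (NAdd (var 4) (NConst 1))"
  have "run E (While (NLess (var 4) (var 3)) ?body) ?s (Suc (12 * ?c)) (\<lambda>s'. I s' \<and> \<not> bval E s' (NLess (var 4) (var 3)))"
  proof (rule run_While_potential[where I = I and V = "\<lambda>s'. ?c - narr s' 0 4" and \<Psi> = "\<lambda>s'. 5 * narr s' 0 4 + 7 * narr s' 0 3"])
    show "I ?s" by fact
  next
    fix s1 assume "I s1" and b: "bval E s1 (NLess (var 4) (var 3))"
    then obtain Ps where 1: "enum_inv n K s Ps s1" "triples (narr s1) (length Ps) = children n K (narr s1) (narr s1 0 4)"
      unfolding I_def by blast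
    have h: "narr s1 0 4 < length Ps" using b 1(1) by (simp add: enum_inv_def)
    from run_expand[OF 1(1) s(1,2) refl h 1(2)] obtain T where
      T: "run E ?body s1 T (\<lambda>s'. \<exists>Ps'. enum_inv n K s Ps' s' \<and> narr s' 0 4 = Suc (narr s1 0 4) \<and> length Ps \<le> length Ps' \<and>
      triples (narr s') (length Ps') = children n K (narr s') (Suc (narr s1 0 4)) \<and> T + 7 * length Ps \<le> 7 * length Ps' + 4)" by blast
    have "run E ?body s1 T (\<lambda>s'. I s' \<and> ?c - narr s' 0 4 < ?c - narr s1 0 4 \<and>
        Suc T + (5 * narr s1 0 4 + 7 * narr s1 0 3) \<le> 5 * narr s' 0 4 + 7 * narr s' 0 3)"
      using T
    proof (rule run_weaken)
      fix s' assume "\<exists>Ps'. enum_inv n K s Ps' s' \<and> narr s' 0 4 = Suc (narr s1 0 4) \<and> length Ps \<le> length Ps' \<and>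
      triples (narr s') (length Ps') = children n K (narr s') (Suc (narr s1 0 4)) \<and> T + 7 * length Ps \<le> 7 * length Ps' + 4"
      then obtain Ps' where 2: "enum_inv n K s Ps' s'" "narr s' 0 4 = Suc (narr s1 0 4)" "length Ps \<le> length Ps'"
        "triples (narr s') (length Ps') = children n K (narr s') (Suc (narr s1 0 4))" "T + 7 * length Ps \<le> 7 * length Ps' + 4" by blast
      have "I s'" unfolding I_def using 2 h by (intro exI[of _ Ps']) simp
      moreover have "?c - narr s' 0 4 < ?c - narr s1 0 4" using 2(2) h len[OF 1(1)] by simp
      moreover have "Suc T + (5 * narr s1 0 4 + 7 * narr s1 0 3) \<le> 5 * narr s' 0 4 + 7 * narr s' 0 3"
        using 2(1,2,5) 1(1) by (simp add: enum_inv_def)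
      ultimately show "I s' \<and> ?c - narr s' 0 4 < ?c - narr s1 0 4 \<and>
        Suc T + (5 * narr s1 0 4 + 7 * narr s1 0 3) \<le> 5 * narr s' 0 4 + 7 * narr s' 0 3" by blast
    qed simp
    then show "\<exists>T. run E ?body s1 T (\<lambda>s'. I s' \<and> ?c - narr s' 0 4 < ?c - narr s1 0 4 \<and>
        Suc T + (5 * narr s1 0 4 + 7 * narr s1 0 3) \<le> 5 * narr s' 0 4 + 7 * narr s' 0 3)" by blast
  next
    fix s1 assume "I s1"
    then obtain Ps where 1: "enum_inv n K s Ps s1" "narr s1 0 4 \<le> length Ps" unfolding I_def by blast
    then show "5 * narr s1 0 4 + 7 * narr s1 0 3 \<le> 12 * ?c" using len[OF 1(1)] by (simp add: enum_inv_def)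
  qed
  then have "run E enumerate_strings s (Suc (Suc (12 * ?c))) (\<lambda>s'. I s' \<and> \<not> bval E s' (NLess (var 4) (var 3)))"
    unfolding enumerate_strings_def by (intro run_Seq_NSet) simp
  then show ?thesis
  proof (rule run_weaken)
    fix s' assume a: "I s' \<and> \<not> bval E s' (NLess (var 4) (var 3))"
    then obtain Ps where 1: "enum_inv n K s Ps s'" "narr s' 0 4 \<le> length Ps"
      "triples (narr s') (length Ps) = children n K (narr s') (narr s' 0 4)" unfolding I_def by blast
    have "narr s' 0 4 = length Ps" using a 1 by (simp add: enum_inv_def)
    then have "low_weight n K \<subseteq> set Ps" using 1 by (intro children_complete) (auto simp: enum_inv_def)
    then show "\<exists>Ps. enum_inv n K s Ps s' \<and> set Ps = low_weight n K" using 1(1) by (intro exI[of _ Ps]) (auto simp: enum_inv_def)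
  qed simp
qed

section \<open>Training and prediction\<close>

abbreviation rnat :: "nat \<Rightarrow> rexp" where "rnat c \<equiv> ROfNat (NConst c)"

fun rpower :: "rexp \<Rightarrow> nat \<Rightarrow> rexp" where
  "rpower x 0 = rnat 1"
| "rpower x (Suc m) = RMul x (rpower x m)"

lemma rval_rpower: "rval E s (rpower x m) = rval E s x ^ m"
  by (induction m) simp_all

text \<open>The exponent \<open>25\<close> is dictated by \<open>kept_count_bound\<close>.\<close>

definition growth :: rexp where
  "growth = rpower (RDiv (rnat 1) (RMul (rvar 0) (rvar 1))) 25"

text \<open>The machine cannot round, so the cutoff weight is found by multiplying by
  \<open>3/2\<close> until \<open>1 / max \<epsilon> \<epsilon>'\<close> is reached. The same loop
  accumulates \<open>growth ^ (K + 1)\<close>, the limit on the number of kept strings.\<close>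

definition setup_params :: com where
  "setup_params =
     Cond (RLess (rvar 0) (rvar 1)) (set_rvar 3 (rvar 1)) (set_rvar 3 (rvar 0)) ;;
     set_rvar 4 (rnat 1) ;; set_rvar 5 growth ;;
     While (RLess (RMul (rvar 4) (rvar 3)) (rnat 1))
       (set_rvar 4 (RMul (rvar 4) (RDiv (rnat 3) (rnat 2))) ;; set_rvar 5 (RMul (rvar 5) growth) ;;
        set_var 2 (NAdd (var 2) (NConst 1)))"

definition sample_sums :: com where
  "sample_sums =
     set_rvar 6 (rnat 0) ;; set_rvar 7 (rnat 0) ;; set_var 7 (NConst 0) ;;
     While (NLess (var 7) (var 1))
       (set_rvar 6 (RAdd (rvar 6) (RMul (RPauli 1 (var 7)) (RPauli 1 (var 7)))) ;;
        set_rvar 7 (RAdd (rvar 7) (RMul (RPauli 1 (var 7)) (RLabel (var 7)))) ;;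
        set_var 7 (NAdd (var 7) (NConst 1)))"

definition record_score :: com where
  "record_score =
     Cond (RLess (rvar 6) (RMul (RDiv (rvar 3) (rnat 12)) (ROfNat (var 1))))
       (RSet 2 (var 4) (RSub (rnat 0) (rnat 1)) ;; RSet 4 (var 4) (rnat 0))
       (Cond (RLess (rvar 7) (rnat 0)) (RSet 2 (var 4) (RSub (rnat 0) (rvar 7))) (RSet 2 (var 4) (rvar 7)) ;;
        RSet 4 (var 4) (RDiv (rvar 7) (rvar 6)))"

definition process_string :: com where
  "process_string =
     set_var 6 (var 4) ;; walk (NGet 4 (var 6)) ;; sample_sums ;;
     set_var 6 (var 4) ;; walk (NConst 0) ;; record_score ;; set_var 4 (NAdd (var 4) (NConst 1))"

definition compute_scores :: com where
  "compute_scores = set_var 4 (NConst 0) ;; While (NLess (var 4) (var 3)) process_string"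

definition find_best :: com where
  "find_best =
     set_var 9 (NConst 0) ;; set_var 4 (NConst 0) ;;
     While (NLess (var 4) (var 3))
       (Cond (RLess (RGet 2 (var 9)) (RGet 2 (var 4))) (set_var 9 (var 4)) Skip ;;
        set_var 4 (NAdd (var 4) (NConst 1)))"

text \<open>Comparing the round number with the real limit in \<open>rvar 5\<close> counts up to its
  ceiling without computing it.\<close>

definition select_largest :: com where
  "select_largest =
     While (BAnd (NLess (var 8) (var 3)) (RLess (ROfNat (var 8)) (rvar 5)))
       (find_best ;; RSet 3 (var 9) (RGet 4 (var 9)) ;; RSet 2 (var 9) (RSub (rnat 0) (rnat 1)) ;;
        set_var 8 (NAdd (var 8) (NConst 1)))"

text \<open>For \<delta> at least \<open>1\<close> the probability bound is vacuous, but the sample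
  may be too small to pay for the training; the program then stops at once.\<close>

definition training_program :: com where
  "training_program =
     Cond (RLess (rvar 2) (rnat 1))
       ((setup_params ;; enumerate_strings) ;; compute_scores ;; select_largest) Skip"

definition add_term :: com where
  "add_term =
     set_var 6 (var 4) ;; walk (NGet 4 (var 6)) ;;
     set_rvar 6 (RAdd (rvar 6) (RMul (RGet 3 (var 4)) (RPauli 1 (NConst 0)))) ;;
     set_var 6 (var 4) ;; walk (NConst 0) ;; set_var 4 (NAdd (var 4) (NConst 1))"

definition prediction_program :: com where
  "prediction_program =
     set_rvar 6 (rnat 0) ;; set_var 4 (NConst 0) ;;
     While (NLess (var 4) (var 3)) add_term ;; set_rvar 0 (rvar 6)"

section \<open>Correctness and running time\<close>

definition tape_of :: "nat \<Rightarrow> pauli list \<Rightarrow> nat \<Rightarrow> nat" where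
  "tape_of n P = (\<lambda>j. if j < n \<and> P ! j \<noteq> PI then encode_pauli (P ! j) else 0)"

lemma decode_tape: "length P = n \<Longrightarrow> map (\<lambda>i. decode_pauli (tape_of n P i)) [0..<n] = P"
  by (rule nth_equalityI) (auto simp: tape_of_def decode_pauli_def[of 0])

text \<open>The walk overwrites only the cells of letters, so the tape has to be zero before;
  \<open>run_unload\<close> restores this.\<close>

lemma run_load:
  assumes t: "table n Ps (narr s)" and i: "narr s 0 6 = i" "i < length Ps" and z: "narr s 1 = (\<lambda>_. 0)"
  shows "run E (walk (NGet 4 (var 6))) s (3 * pauli_weight (Ps ! i) + 1)
    (\<lambda>s'. rarr s' = rarr s \<and> narr s' = (narr s)(0 := (narr s 0)(6 := 0), 1 := tape_of n (Ps ! i)))"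
proof (rule run_weaken[OF run_walk[OF t i, where g = encode_pauli] order_refl])
  fix s :: memory assume "table n Ps (narr s)" "0 < narr s 0 6" "narr s 0 6 < length Ps"
  then have "narr s 4 (narr s 0 6) \<in> {1, 2, 3}" by (simp add: table_def table_entry_def)
  then show "nval s (NGet 4 (var 6)) = encode_pauli (decode_pauli (narr s 4 (narr s 0 6)))"
    by (simp only: encode_decode nval.simps)
next
  have "(\<lambda>j. if j < n \<and> Ps ! i ! j \<noteq> PI then encode_pauli (Ps ! i ! j) else narr s 1 j) = tape_of n (Ps ! i)"
    unfolding z tape_of_def ..
  then show "rarr s' = rarr s \<and> narr s' = (narr s)(0 := (narr s 0)(6 := 0), 1 := tape_of n (Ps ! i))"
    if "rarr s' = rarr s \<and> narr s' = (narr s)(0 := (narr s 0)(6 := 0),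
      1 := (\<lambda>j. if j < n \<and> Ps ! i ! j \<noteq> PI then encode_pauli (Ps ! i ! j) else narr s 1 j))" for s' :: memory
    using that by simp
qed

lemma run_unload:
  assumes t: "table n Ps (narr s)" and i: "narr s 0 6 = i" "i < length Ps" and z: "narr s 1 = tape_of n (Ps ! i)"
  shows "run E (walk (NConst 0)) s (3 * pauli_weight (Ps ! i) + 1)
    (\<lambda>s'. rarr s' = rarr s \<and> narr s' = (narr s)(0 := (narr s 0)(6 := 0), 1 := (\<lambda>_. 0)))"
proof (rule run_weaken[OF run_walk[OF t i, where g = "\<lambda>_. 0"] order_refl])
  have "(\<lambda>j. if j < n \<and> Ps ! i ! j \<noteq> PI then 0 else narr s 1 j) = (\<lambda>_. 0)"
    unfolding z tape_of_def by auto
  then show "rarr s' = rarr s \<and> narr s' = (narr s)(0 := (narr s 0)(6 := 0), 1 := (\<lambda>_. 0))"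
    if "rarr s' = rarr s \<and> narr s' = (narr s)(0 := (narr s 0)(6 := 0), 1 := (\<lambda>j. if j < n \<and> Ps ! i ! j \<noteq> PI then 0 else narr s 1 j))" for s' :: memory
    using that by simp
qed simp

lemma run_sample_sums:
  fixes E s
  defines "q \<equiv> \<lambda>l. pauli_of E l (map (\<lambda>i. decode_pauli (narr s 1 i)) [0..<num_qubits E])"
  assumes N: "narr s 0 1 = N"
  shows "run E sample_sums s (4 * N + 4) (\<lambda>s'. narr s' = (narr s)(0 := (narr s 0)(7 := N)) \<and>
    rarr s' = (rarr s)(0 := (rarr s 0)(6 := \<Sum>l<N. q l * q l, 7 := \<Sum>l<N. q l * label_of E l)))"
proof -
  define I where "I i s' \<longleftrightarrow> narr s' = (narr s)(0 := (narr s 0)(7 := i)) \<and>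
    rarr s' = (rarr s)(0 := (rarr s 0)(6 := \<Sum>l<i. q l * q l, 7 := \<Sum>l<i. q l * label_of E l))" for i and s' :: memory
  let ?b = "set_rvar 6 (RAdd (rvar 6) (RMul (RPauli 1 (var 7)) (RPauli 1 (var 7)))) ;;
        set_rvar 7 (RAdd (rvar 7) (RMul (RPauli 1 (var 7)) (RLabel (var 7)))) ;;
        set_var 7 (NAdd (var 7) (NConst 1))"
  let ?s = "s\<lparr>rarr := (rarr s)(0 := (rarr s 0)(6 := 0, 7 := 0)), narr := (narr s)(0 := (narr s 0)(7 := 0))\<rparr>"
  have loop: "run E (While (NLess (var 7) (var 1)) ?b) ?s (N * Suc 3 + 1) (I N)"
  proof (rule run_For)
    show "I 0 ?s" by (simp add: I_def)
    fix i and s' :: memory assume i: "i < N" and inv: "I i s'"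
    have n: "narr s' = (narr s)(0 := (narr s 0)(7 := i))"
      and r: "rarr s' = (rarr s)(0 := (rarr s 0)(6 := \<Sum>l<i. q l * q l, 7 := \<Sum>l<i. q l * label_of E l))"
      using inv by (simp_all add: I_def)
    have "run E ?b s' (Suc (Suc (Suc 0))) (I (Suc i))"
      by ((rule run_Seq_RSet, simp add: n r)+, rule run_NSet) (simp add: I_def n r q_def)
    moreover have "Suc (Suc (Suc 0)) = 3" by simp
    ultimately show "bval E s' (NLess (var 7) (var 1)) \<and> run E ?b s' 3 (I (Suc i))"
      using i n N by simp
  qed (use N in \<open>simp add: I_def\<close>)
  have "run E sample_sums s (Suc (Suc (Suc (N * Suc 3 + 1)))) (I N)"
    unfolding sample_sums_def
    by ((rule run_Seq_RSet, simp)+, rule run_Seq_NSet) (use loop in simp)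
  then show ?thesis by (rule run_weaken) (simp_all add: I_def)
qed

lemma run_record_score:
  assumes i: "narr s 0 4 = i" and N: "narr s 0 1 = N" and e: "rarr s 0 3 = e"
    and x: "rarr s 0 6 = x" and y: "rarr s 0 7 = y"
  shows "run E record_score s 4 (\<lambda>s'. narr s' = narr s \<and>
    rarr s' = (rarr s)(2 := (rarr s 2)(i := if x < e / 12 * real N then -1 else \<bar>y\<bar>),
      4 := (rarr s 4)(i := if x < e / 12 * real N then 0 else y / x)))" (is "run E _ s 4 ?Q")
proof -
  have "run E record_score s (Suc 3) ?Q"
    unfolding record_score_def
  proof (rule run_Cond)
    assume "bval E s (RLess (rvar 6) (RMul (RDiv (rvar 3) (rnat 12)) (ROfNat (var 1))))"
    then have lt: "x < e / 12 * real N" using assms by simp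
    have "run E (RSet 2 (var 4) (RSub (rnat 0) (rnat 1)) ;; RSet 4 (var 4) (rnat 0)) s (Suc (Suc 0)) ?Q"
      by (intro run_Seq_RSet run_RSet) (use lt i in simp)
    then show "run E (RSet 2 (var 4) (RSub (rnat 0) (rnat 1)) ;; RSet 4 (var 4) (rnat 0)) s 3 ?Q"
      by (rule run_le) simp
  next
    assume "\<not> bval E s (RLess (rvar 6) (RMul (RDiv (rvar 3) (rnat 12)) (ROfNat (var 1))))"
    then have ge: "\<not> x < e / 12 * real N" using assms by simp
    have "run E (Cond (RLess (rvar 7) (rnat 0)) (RSet 2 (var 4) (RSub (rnat 0) (rvar 7))) (RSet 2 (var 4) (rvar 7))) s
       (Suc (Suc 0)) (\<lambda>s'. s' = s\<lparr>rarr := (rarr s)(2 := (rarr s 2)(i := \<bar>y\<bar>))\<rparr>)"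
      by (rule run_Cond; rule run_RSet) (use i y in \<open>simp_all add: abs_if\<close>)
    then have "run E (Cond (RLess (rvar 7) (rnat 0)) (RSet 2 (var 4) (RSub (rnat 0) (rvar 7))) (RSet 2 (var 4) (rvar 7)) ;;
        RSet 4 (var 4) (RDiv (rvar 7) (rvar 6))) s (Suc (Suc 0) + Suc 0) ?Q"
      by (rule run_Seq, intro run_RSet) (use ge i x y in simp)
    then show "run E (Cond (RLess (rvar 7) (rnat 0)) (RSet 2 (var 4) (RSub (rnat 0) (rvar 7))) (RSet 2 (var 4) (rvar 7)) ;;
        RSet 4 (var 4) (RDiv (rvar 7) (rvar 6))) s 3 ?Q" by (rule run_le) simp
  qed
  then show ?thesis by (rule run_le) simp
qed

section \<open>Verification of the training program\<close>

locale training =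
  fixes n k N :: nat and Obs :: "complex mat" and \<omega> :: "nat \<Rightarrow> complex mat"
    and K :: nat and e :: real and m1 :: real and Ps :: "pauli list list"
  assumes Kk: "K \<le> k" and Ps: "set Ps = low_weight n K" "Ps \<noteq> []"
begin

abbreviation "E \<equiv> training_env n k Obs N \<omega>"

lemma Ps_weight: "i < length Ps \<Longrightarrow> pauli_weight (Ps ! i) \<le> K \<and> length (Ps ! i) = n"
  using nth_mem[of i Ps] Ps(1) by (auto simp: low_weight_def pauli_strings_def)

definition scored :: "nat \<Rightarrow> memory \<Rightarrow> bool" where
  "scored i s \<longleftrightarrow> table n Ps (narr s) \<and> narr s 0 1 = N \<and> narr s 0 3 = length Ps \<and> narr s 1 = (\<lambda>_. 0) \<and>
     narr s 0 4 = i \<and> narr s 0 8 = 0 \<and> rarr s 0 3 = e \<and> rarr s 0 5 = m1 \<and> rarr s 3 = (\<lambda>_. 0) \<and>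
     (\<forall>j<i. rarr s 2 j = score Obs N e \<omega> (Ps ! j) \<and> rarr s 4 j = estimate Obs N e \<omega> (Ps ! j))"

text \<open>\<open>6 * K\<close> pays for loading and clearing the tape, \<open>4 * N\<close> for
  the pass over the samples. As \<open>K \<le> k\<close>, the environment answers the queries with
  true expectation values.\<close>

lemma run_process_string:
  assumes inv: "scored i s" and i: "i < length Ps"
  shows "run E process_string s (6 * K + 4 * N + 13) (scored (Suc i))"
proof -
  let ?P = "Ps ! i" let ?w = "3 * pauli_weight ?P + 1"
  have P: "pauli_weight ?P \<le> K" "length ?P = n" using Ps_weight[OF i] by auto
  have S: "table n Ps (narr s)" "narr s 0 1 = N" "narr s 0 3 = length Ps" "narr s 1 = (\<lambda>_. 0)"
     "narr s 0 4 = i" "narr s 0 8 = 0" "rarr s 0 3 = e" "rarr s 0 5 = m1" "rarr s 3 = (\<lambda>_. 0)"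
    and old: "\<And>j. j < i \<Longrightarrow> rarr s 2 j = score Obs N e \<omega> (Ps ! j) \<and> rarr s 4 j = estimate Obs N e \<omega> (Ps ! j)"
    using inv by (auto simp: scored_def)
  let ?X = "sample_square N \<omega> ?P" and ?Y = "sample_product Obs N \<omega> ?P"
  define A1 where "A1 = (narr s)(0 := (narr s 0)(6 := 0), 1 := tape_of n ?P)"
  define A2 where "A2 = A1(0 := (A1 0)(7 := N))"
  define A3 where "A3 = A2(0 := (A2 0)(6 := 0), 1 := (\<lambda>_. 0))"
  define R2 where "R2 = (rarr s)(0 := (rarr s 0)(6 := ?X, 7 := ?Y))"
  have t0: "table n Ps ((narr s)(0 := (narr s 0)(6 := i)))" using S(1) by (subst table_cong[of _ "narr s"]) auto
  have t2: "table n Ps (A2(0 := (A2 0)(6 := i)))"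
    using S(1) by (subst table_cong[of _ "narr s"]) (auto simp: A2_def A1_def)
  have t3: "table n Ps (A3(0 := (A3 0)(4 := Suc i)))"
    using S(1) by (subst table_cong[of _ "narr s"]) (auto simp: A3_def A2_def A1_def)
  have last: "run E (record_score ;; set_var 4 (NAdd (var 4) (NConst 1))) s3 (4 + Suc 0) (scored (Suc i))"
    if s3: "narr s3 = A3" "rarr s3 = R2" for s3 :: memory
  proof (rule run_Seq[OF run_record_score])
    show "narr s3 0 4 = i" "narr s3 0 1 = N" "rarr s3 0 3 = e" "rarr s3 0 6 = ?X" "rarr s3 0 7 = ?Y"
      using S by (simp_all add: s3 A3_def A2_def A1_def R2_def)
    fix s4 :: memory
    assume s4: "narr s4 = narr s3 \<and> rarr s4 = (rarr s3)(2 := (rarr s3 2)(i := if ?X < e / 12 * real N then -1 else \<bar>?Y\<bar>),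
      4 := (rarr s3 4)(i := if ?X < e / 12 * real N then 0 else ?Y / ?X))"
    have n4: "narr s4 0 4 = i" using s4 S by (simp add: s3 A3_def A2_def A1_def)
    let ?s = "s4\<lparr>narr := (narr s4)(0 := (narr s4 0)(4 := Suc i))\<rparr>"
    have "scored (Suc i) ?s"
      unfolding scored_def
    proof (intro conjI allI impI)
      show "table n Ps (narr ?s)" using t3 s4 s3 by simp
      fix j assume "j < Suc i"
      then show "rarr ?s 2 j = score Obs N e \<omega> (Ps ! j)" "rarr ?s 4 j = estimate Obs N e \<omega> (Ps ! j)"
        using old[of j] s4 s3 by (auto simp: R2_def score_def estimate_def less_Suc_eq)
    qed (use S s4 s3 in \<open>simp_all add: A3_def A2_def A1_def R2_def\<close>)
    then show "run E (set_var 4 (NAdd (var 4) (NConst 1))) s4 (Suc 0) (scored (Suc i))"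
      using n4 by (intro run_NSet) simp
  qed
  have second: "run E (set_var 6 (var 4) ;; walk (NConst 0) ;; record_score ;; set_var 4 (NAdd (var 4) (NConst 1))) s2
      (Suc (?w + (4 + Suc 0))) (scored (Suc i))"
    if s2: "narr s2 = A2" "rarr s2 = R2" for s2 :: memory
  proof (rule run_Seq_NSet, rule run_Seq[OF run_unload[of n Ps _ i]])
    let ?s = "s2\<lparr>narr := (narr s2)(0 := (narr s2 0)(nval s2 (NConst 6) := nval s2 (var 4)))\<rparr>"
    have e: "narr ?s = A2(0 := (A2 0)(6 := i))" using S by (simp add: s2 A2_def A1_def)
    show "table n Ps (narr ?s)" "narr ?s 0 6 = i" "i < length Ps" "narr ?s 1 = tape_of n ?P"
      unfolding e using t2 i by (simp_all add: A2_def A1_def)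
    fix s3 :: memory assume "rarr s3 = rarr ?s \<and> narr s3 = (narr ?s)(0 := (narr ?s 0)(6 := 0), 1 := (\<lambda>_. 0))"
    then have "narr s3 = A3" "rarr s3 = R2" unfolding e by (simp_all add: s2 A3_def)
    then show "run E (record_score ;; set_var 4 (NAdd (var 4) (NConst 1))) s3 (4 + Suc 0) (scored (Suc i))"
      by (rule last)
  qed
  have "run E process_string s (Suc (?w + ((4 * N + 4) + (Suc (?w + (4 + Suc 0)))))) (scored (Suc i))"
    unfolding process_string_def
  proof (rule run_Seq_NSet, rule run_Seq[OF run_load[of n Ps _ i]])
    let ?s = "s\<lparr>narr := (narr s)(0 := (narr s 0)(nval s (NConst 6) := nval s (var 4)))\<rparr>"
    have e: "narr ?s = (narr s)(0 := (narr s 0)(6 := i))" using S by simp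
    show "table n Ps (narr ?s)" "narr ?s 0 6 = i" "i < length Ps" "narr ?s 1 = (\<lambda>_. 0)"
      unfolding e using t0 i S by simp_all
    fix s1 :: memory assume "rarr s1 = rarr ?s \<and> narr s1 = (narr ?s)(0 := (narr ?s 0)(6 := 0), 1 := tape_of n ?P)"
    then have s1: "narr s1 = A1" "rarr s1 = rarr s" unfolding e by (simp_all add: A1_def)
    have tape: "map (\<lambda>i. decode_pauli (narr s1 1 i)) [0..<num_qubits E] = ?P"
      using decode_tape[OF P(2)] by (simp add: s1 A1_def training_env_def)
    have q: "(\<Sum>l<N. pauli_of E l ?P * pauli_of E l ?P) = ?X" "(\<Sum>l<N. pauli_of E l ?P * label_of E l) = ?Y"
      using P(1) Kk by (simp_all add: training_env_def sample_square_def sample_product_def)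
    show "run E (sample_sums ;; set_var 6 (var 4) ;; walk (NConst 0) ;; record_score ;; set_var 4 (NAdd (var 4) (NConst 1))) s1
       ((4 * N + 4) + (Suc (?w + (4 + Suc 0)))) (scored (Suc i))"
    proof (rule run_Seq[OF run_sample_sums[of _ N]])
      show "narr s1 0 1 = N" using S by (simp add: s1 A1_def)
      fix s2 :: memory assume "narr s2 = (narr s1)(0 := (narr s1 0)(7 := N)) \<and>
        rarr s2 = (rarr s1)(0 := (rarr s1 0)(
          6 := \<Sum>l<N. pauli_of E l (map (\<lambda>i. decode_pauli (narr s1 1 i)) [0..<num_qubits E]) * pauli_of E l (map (\<lambda>i. decode_pauli (narr s1 1 i)) [0..<num_qubits E]),
          7 := \<Sum>l<N. pauli_of E l (map (\<lambda>i. decode_pauli (narr s1 1 i)) [0..<num_qubits E]) * label_of E l))"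
      then have "narr s2 = A2" "rarr s2 = R2" unfolding tape q by (simp_all add: A2_def R2_def s1)
      then show "run E (set_var 6 (var 4) ;; walk (NConst 0) ;; record_score ;; set_var 4 (NAdd (var 4) (NConst 1))) s2
          (Suc (?w + (4 + Suc 0))) (scored (Suc i))" by (rule second)
    qed
  qed
  then show ?thesis by (rule run_le) (use P(1) in simp)
qed

lemma run_compute_scores:
  assumes "table n Ps (narr s)" "narr s 0 1 = N" "narr s 0 3 = length Ps" "narr s 1 = (\<lambda>_. 0)"
    "narr s 0 8 = 0" "rarr s 0 3 = e" "rarr s 0 5 = m1" "rarr s 3 = (\<lambda>_. 0)"
  shows "run E compute_scores s (length Ps * (6 * K + 4 * N + 14) + 2) (scored (length Ps))"
proof -
  let ?s = "s\<lparr>narr := (narr s)(0 := (narr s 0)(4 := 0))\<rparr>"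
  have "table n Ps (narr ?s)" using assms(1) by (subst table_cong[of _ "narr s"]) auto
  then have "scored 0 ?s" using assms by (simp add: scored_def)
  then have "run E (While (NLess (var 4) (var 3)) process_string) ?s
     (length Ps * Suc (6 * K + 4 * N + 13) + 1) (scored (length Ps))"
  proof (rule run_For)
    fix i and s' :: memory assume "i < length Ps" "scored i s'"
    then show "bval E s' (NLess (var 4) (var 3)) \<and> run E process_string s' (6 * K + 4 * N + 13) (scored (Suc i))"
      using run_process_string[of i s'] by (auto simp: scored_def[of i])
  qed (simp add: scored_def)
  then have "run E compute_scores s (Suc (length Ps * Suc (6 * K + 4 * N + 13) + 1)) (scored (length Ps))"
    unfolding compute_scores_def by (intro run_Seq_NSet) simp
  then show ?thesis by (rule run_le) simp
qed

end

lemma run_find_best: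
  assumes m: "narr s 0 3 = m"
  shows "run E find_best s (4 * m + 3)
    (\<lambda>s'. rarr s' = rarr s \<and> narr s' = (narr s)(0 := (narr s 0)(9 := argmax (rarr s 2) m, 4 := m)))"
proof -
  define I where "I i s' \<longleftrightarrow> rarr s' = rarr s \<and> narr s' = (narr s)(0 := (narr s 0)(9 := argmax (rarr s 2) i, 4 := i))" for i and s' :: memory
  let ?b = "Cond (RLess (RGet 2 (var 9)) (RGet 2 (var 4))) (set_var 9 (var 4)) Skip ;; set_var 4 (NAdd (var 4) (NConst 1))"
  let ?s = "s\<lparr>narr := (narr s)(0 := (narr s 0)(9 := 0, 4 := 0))\<rparr>"
  have "run E (While (NLess (var 4) (var 3)) ?b) ?s (m * Suc 3 + 1) (I m)"
  proof (rule run_For)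
    show "I 0 ?s" by (simp add: I_def)
    fix i and s' :: memory assume i: "i < m" and inv: "I i s'"
    have r: "rarr s' = rarr s" and nn: "narr s' = (narr s)(0 := (narr s 0)(9 := argmax (rarr s 2) i, 4 := i))"
      using inv by (simp_all add: I_def)
    have "run E (Cond (RLess (RGet 2 (var 9)) (RGet 2 (var 4))) (set_var 9 (var 4)) Skip) s' (Suc (Suc 0))
      (\<lambda>s''. rarr s'' = rarr s \<and> narr s'' 0 4 = i \<and> (narr s'')(0 := (narr s'' 0)(4 := Suc i)) = (narr s)(0 := (narr s 0)(9 := argmax (rarr s 2) (Suc i), 4 := Suc i)))"
      (is "run E _ s' _ ?Q")
    proof (rule run_Cond)
      assume "bval E s' (RLess (RGet 2 (var 9)) (RGet 2 (var 4)))"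
      then have "rarr s 2 (argmax (rarr s 2) i) < rarr s 2 i" by (simp add: r nn)
      then show "run E (set_var 9 (var 4)) s' (Suc 0) ?Q" by (intro run_NSet) (simp add: r nn fun_eq_iff)
    next
      assume "\<not> bval E s' (RLess (RGet 2 (var 9)) (RGet 2 (var 4)))"
      then have "\<not> rarr s 2 (argmax (rarr s 2) i) < rarr s 2 i" by (simp add: r nn)
      then have "run E Skip s' 0 ?Q" by (intro run_Skip) (simp add: r nn)
      then show "run E Skip s' (Suc 0) ?Q" by (rule run_le) simp
    qed
    then have "run E ?b s' (Suc (Suc 0) + Suc 0) (I (Suc i))"
      by (rule run_Seq, intro run_NSet) (simp add: I_def)
    then have "run E ?b s' 3 (I (Suc i))" by (rule run_le) simp
    then show "bval E s' (NLess (var 4) (var 3)) \<and> run E ?b s' 3 (I (Suc i))"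
      using i nn m by simp
  qed (use m in \<open>simp add: I_def\<close>)
  then have "run E find_best s (Suc (Suc (m * Suc 3 + 1))) (I m)"
    unfolding find_best_def by (rule_tac run_Seq_NSet, simp, rule_tac run_Seq_NSet, simp)
  then show ?thesis by (rule run_weaken) (simp_all add: I_def)
qed

lemma argmax_cong:
  assumes "\<And>i. i < m \<Longrightarrow> s i = s' i" "0 < m"
  shows "argmax s m = argmax s' m"
  using assms
proof (induction m)
  case (Suc m)
  show ?case
  proof (cases "m = 0")
    case False
    then have "argmax s m = argmax s' m" using Suc by simp
    moreover have "argmax s' m < m" using False by (intro argmax_less) simp
    ultimately show ?thesis using Suc.prems by simp
  qed simp
qed simp

lemma kept_cong:
  assumes "\<And>i. i < m \<Longrightarrow> s i = s' i" "0 < m"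
  shows "kept s m j = kept s' m j"
proof (induction j)
  case (Suc j)
  then have "argmax (remaining s m j) m = argmax (remaining s' m j) m"
    using assms by (intro argmax_cong) (auto simp: remaining_eq)
  then show ?case using Suc by (simp add: kept_Suc)
qed simp

definition model :: "nat \<Rightarrow> pauli list list \<Rightarrow> (nat \<Rightarrow> real) \<Rightarrow> memory \<Rightarrow> bool" where
  "model n Ps c s \<longleftrightarrow> table n Ps (narr s) \<and> narr s 0 3 = length Ps \<and> narr s 1 = (\<lambda>_. 0) \<and>
     (\<forall>i<length Ps. rarr s 3 i = c i)"

lemma (in training) run_select_largest:
  assumes "scored (length Ps) s" and J: "J = min (length Ps) (nat \<lceil>m1\<rceil>)"
  shows "run E select_largest s (J * (4 * length Ps + 7) + 1) (model n Ps (learned_coefficient Obs N e Ps J \<omega>))"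
proof -
  let ?m = "length Ps" and ?init = "rarr s 2"
  have m: "0 < ?m" using Ps(2) by simp
  have S: "table n Ps (narr s)" "narr s 0 3 = ?m" "narr s 1 = (\<lambda>_. 0)" "narr s 0 8 = 0" "rarr s 0 5 = m1" "rarr s 3 = (\<lambda>_. 0)"
    and sc: "\<And>j. j < ?m \<Longrightarrow> rarr s 2 j = score Obs N e \<omega> (Ps ! j) \<and> rarr s 4 j = estimate Obs N e \<omega> (Ps ! j)"
    using assms(1) by (auto simp: scored_def)
  define I where "I j s' \<longleftrightarrow> table n Ps (narr s') \<and> narr s' 0 3 = ?m \<and> narr s' 1 = (\<lambda>_. 0) \<and> narr s' 0 8 = j \<and>
    rarr s' 0 = rarr s 0 \<and> rarr s' 2 = remaining ?init ?m j \<and> rarr s' 4 = rarr s 4 \<and>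
    rarr s' 3 = (\<lambda>i. if i \<in> kept ?init ?m j then rarr s 4 i else 0)" for j and s' :: memory
  let ?b = "find_best ;; RSet 3 (var 9) (RGet 4 (var 9)) ;; RSet 2 (var 9) (RSub (rnat 0) (rnat 1)) ;;
        set_var 8 (NAdd (var 8) (NConst 1))"
  have "run E select_largest s (J * Suc (4 * ?m + 6) + 1) (I J)"
    unfolding select_largest_def
  proof (rule run_For)
    show "I 0 s" using S by (simp add: I_def)
    fix j and s' :: memory assume j: "j < J" and "I j s'"
    then have inv: "table n Ps (narr s')" "narr s' 0 3 = ?m" "narr s' 1 = (\<lambda>_. 0)" "narr s' 0 8 = j"
      "rarr s' 0 = rarr s 0" "rarr s' 2 = remaining ?init ?m j" "rarr s' 4 = rarr s 4"
      "rarr s' 3 = (\<lambda>i. if i \<in> kept ?init ?m j then rarr s 4 i else 0)" by (simp_all add: I_def)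
    let ?i = "argmax (remaining ?init ?m j) ?m"
    have "run E ?b s' ((4 * ?m + 3) + Suc (Suc (Suc 0))) (I (Suc j))"
    proof (rule run_Seq[OF run_find_best[of s' ?m]])
      fix s1 :: memory assume "rarr s1 = rarr s' \<and> narr s1 = (narr s')(0 := (narr s' 0)(9 := argmax (rarr s' 2) ?m, 4 := ?m))"
      then have r: "rarr s1 = rarr s'" and nn: "narr s1 = (narr s')(0 := (narr s' 0)(9 := ?i, 4 := ?m))" using inv by simp_all
      let ?s = "s1\<lparr>rarr := (rarr s')(3 := (rarr s' 3)(?i := rarr s' 4 ?i), 2 := (rarr s' 2)(?i := -1)),
        narr := (narr s')(0 := (narr s' 0)(9 := ?i, 4 := ?m, 8 := Suc j))\<rparr>"
      have "I (Suc j) ?s"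
        unfolding I_def
      proof (intro conjI)
        show "table n Ps (narr ?s)" using inv(1) by (subst table_cong[of _ "narr s'"]) auto
        show "rarr ?s 3 = (\<lambda>i. if i \<in> kept ?init ?m (Suc j) then rarr s 4 i else 0)"
          using inv by (auto simp: kept_Suc fun_eq_iff)
      qed (use inv in simp_all)
      then show "run E (RSet 3 (var 9) (RGet 4 (var 9)) ;; RSet 2 (var 9) (RSub (rnat 0) (rnat 1)) ;;
        set_var 8 (NAdd (var 8) (NConst 1))) s1 (Suc (Suc (Suc 0))) (I (Suc j))"
        by (rule_tac run_Seq_RSet, simp add: r nn, rule_tac run_Seq_RSet, simp add: r nn, rule_tac run_NSet)
           (simp add: r nn inv(4))
    qed (use inv in simp)
    then have "run E ?b s' (4 * ?m + 6) (I (Suc j))" by (rule run_le) simp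
    moreover have "real j < m1"
    proof -
      have "int j < \<lceil>m1\<rceil>" using j J by linarith
      then show ?thesis by linarith
    qed
    ultimately show "bval E s' (BAnd (NLess (var 8) (var 3)) (RLess (ROfNat (var 8)) (rvar 5))) \<and> run E ?b s' (4 * ?m + 6) (I (Suc j))"
      using j J inv S by simp
  next
    fix s' :: memory assume "I J s'"
    then have "narr s' 0 8 = J" "narr s' 0 3 = ?m" "rarr s' 0 5 = m1" using S by (simp_all add: I_def)
    moreover have "?m \<le> J \<or> m1 \<le> real J" unfolding J by linarith
    ultimately show "\<not> bval E s' (BAnd (NLess (var 8) (var 3)) (RLess (ROfNat (var 8)) (rvar 5)))" by auto
  qed
  then show ?thesis
  proof (rule run_weaken)
    fix s' :: memory assume i: "I J s'"
    \<comment> \<open>The array agrees with the scores only inside the table, and the selection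
      looks only there.\<close>
    have k: "kept ?init ?m J = kept (\<lambda>i. score Obs N e \<omega> (Ps ! i)) ?m J"
      using sc m by (intro kept_cong) auto
    show "model n Ps (learned_coefficient Obs N e Ps J \<omega>) s'"
      unfolding model_def
    proof (intro conjI allI impI)
      fix j assume "j < ?m"
      then show "rarr s' 3 j = learned_coefficient Obs N e Ps J \<omega> j"
        using i sc[of j] by (simp add: I_def learned_coefficient_def k)
    qed (use i in \<open>simp_all add: I_def\<close>)
  qed simp
qed

text \<open>The cutoff weight is the least number of factors \<open>3/2\<close> whose product
  reaches \<open>1 / e\<close>: this is both how the program finds it and how it enters the error
  bound.\<close>

lemma cutoff_weight_power:
  assumes "0 < e" "e \<le> 1"
  shows "i < cutoff_weight e \<Longrightarrow> (3 / 2) ^ i * e < 1" and "1 \<le> (3 / 2) ^ cutoff_weight e * e"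
proof -
  have l: "(3 / 2) ^ i * e < 1 \<longleftrightarrow> real i < log (3 / 2) (1 / e)" for i :: nat
  proof -
    have "(3 / 2) ^ i * e < 1 \<longleftrightarrow> (3 / 2 :: real) powr real i < 1 / e"
      using assms by (simp add: powr_realpow field_simps)
    also have "\<dots> \<longleftrightarrow> real i < log (3 / 2) (1 / e)"
      using assms by (simp add: less_log_iff)
    finally show ?thesis .
  qed
  have c: "cutoff_weight e = nat \<lceil>log (3 / 2) (1 / e)\<rceil>" by (simp add: cutoff_weight_def)
  show "(3 / 2) ^ i * e < 1" if "i < cutoff_weight e"
  proof -
    have "int i < \<lceil>log (3 / 2) (1 / e)\<rceil>" using that c by linarith
    then have "real i < log (3 / 2) (1 / e)" by linarith
    then show ?thesis using l by blast
  qed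
  have "log (3 / 2) (1 / e) \<le> real (cutoff_weight e)" unfolding c by (rule real_nat_ceiling_ge)
  then show "1 \<le> (3 / 2) ^ cutoff_weight e * e" using l[of "cutoff_weight e"] by linarith
qed

lemma run_setup_params:
  fixes s :: memory
  assumes r: "rarr s 0 0 = \<epsilon>" "rarr s 0 1 = \<epsilon>'" and n: "narr s 0 2 = 0"
    and e: "0 < \<epsilon>" "0 < \<epsilon>'" "max \<epsilon> \<epsilon>' \<le> 1"
  defines "q \<equiv> (1 / (\<epsilon> * \<epsilon>')) ^ 25" and "K \<equiv> cutoff_weight (max \<epsilon> \<epsilon>')"
  shows "run E setup_params s (4 * K + 5) (\<lambda>s'. narr s' = (narr s)(0 := (narr s 0)(2 := K)) \<and>
    (\<forall>a. a \<noteq> 0 \<longrightarrow> rarr s' a = rarr s a) \<and> rarr s' 0 3 = max \<epsilon> \<epsilon>' \<and> rarr s' 0 5 = q ^ (K + 1))"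
proof -
  define I where "I i s' \<longleftrightarrow> narr s' = (narr s)(0 := (narr s 0)(2 := i)) \<and> (\<forall>a. a \<noteq> 0 \<longrightarrow> rarr s' a = rarr s a) \<and>
    rarr s' 0 0 = \<epsilon> \<and> rarr s' 0 1 = \<epsilon>' \<and> rarr s' 0 3 = max \<epsilon> \<epsilon>' \<and> rarr s' 0 4 = (3 / 2) ^ i \<and> rarr s' 0 5 = q ^ (i + 1)"
    for i and s' :: memory
  have g: "rval E s' growth = q" if "rarr s' 0 0 = \<epsilon>" "rarr s' 0 1 = \<epsilon>'" for s' :: memory
    using that by (simp add: growth_def rval_rpower q_def)
  let ?b = "set_rvar 4 (RMul (rvar 4) (RDiv (rnat 3) (rnat 2))) ;; set_rvar 5 (RMul (rvar 5) growth) ;;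
        set_var 2 (NAdd (var 2) (NConst 1))"
  let ?w = "While (RLess (RMul (rvar 4) (rvar 3)) (rnat 1)) ?b"
  have loop: "run E ?w s' (K * Suc 3 + 1) (I K)" if "I 0 s'" for s' :: memory
    using that
  proof (rule run_For)
    fix i and s1 :: memory assume i: "i < K" and inv: "I i s1"
    have "run E ?b s1 (Suc (Suc (Suc 0))) (I (Suc i))"
      by (intro run_Seq_RSet run_NSet) (use inv in \<open>simp add: I_def g\<close>)
    then have "run E ?b s1 3 (I (Suc i))" by (rule run_le) simp
    moreover have "(3 / 2) ^ i * max \<epsilon> \<epsilon>' < 1"
      using e i unfolding K_def by (intro cutoff_weight_power(1)) auto
    ultimately show "bval E s1 (RLess (RMul (rvar 4) (rvar 3)) (rnat 1)) \<and> run E ?b s1 3 (I (Suc i))"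
      using inv by (simp add: I_def)
  next
    fix s1 :: memory assume "I K s1"
    moreover have "1 \<le> (3 / 2) ^ K * max \<epsilon> \<epsilon>'"
      using e unfolding K_def by (intro cutoff_weight_power(2)) auto
    ultimately show "\<not> bval E s1 (RLess (RMul (rvar 4) (rvar 3)) (rnat 1))" by (simp add: I_def)
  qed
  have "run E (Cond (RLess (rvar 0) (rvar 1)) (set_rvar 3 (rvar 1)) (set_rvar 3 (rvar 0))) s (Suc (Suc 0))
    (\<lambda>s'. s' = s\<lparr>rarr := (rarr s)(0 := (rarr s 0)(3 := max \<epsilon> \<epsilon>'))\<rparr>)"
    by (rule run_Cond; rule run_RSet) (use r in \<open>simp_all add: max_def\<close>)
  then have "run E setup_params s (Suc (Suc 0) + Suc (Suc (K * Suc 3 + 1))) (I K)"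
    unfolding setup_params_def
  proof (rule run_Seq)
    fix s1 assume s1: "s1 = s\<lparr>rarr := (rarr s)(0 := (rarr s 0)(3 := max \<epsilon> \<epsilon>'))\<rparr>"
    have "narr s = (narr s)(0 := (narr s 0)(2 := 0))" using n by (simp add: fun_eq_iff)
    then show "run E (set_rvar 4 (rnat 1) ;; set_rvar 5 growth ;; ?w) s1 (Suc (Suc (K * Suc 3 + 1))) (I K)"
      using r by (intro run_Seq_RSet loop) (simp add: I_def s1 g)
  qed
  then show ?thesis by (rule run_weaken) (simp_all add: I_def)
qed

section \<open>Verification of the prediction program\<close>

lemma run_add_term:
  fixes s :: memory
  assumes t: "table n Ps (narr s)" and z: "narr s 1 = (\<lambda>_. 0)" and i: "narr s 0 4 = i" "i < length Ps"
    and n: "num_qubits E = n"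
  shows "run E add_term s (6 * pauli_weight (Ps ! i) + 6)
    (\<lambda>s'. table n Ps (narr s') \<and> narr s' 1 = (\<lambda>_. 0) \<and> narr s' 0 3 = narr s 0 3 \<and> narr s' 0 4 = Suc i \<and>
      rarr s' = (rarr s)(0 := (rarr s 0)(6 := rarr s 0 6 + rarr s 3 i * pauli_of E 0 (Ps ! i))))" (is "run E _ s _ ?Q")
proof -
  let ?P = "Ps ! i" let ?w = "3 * pauli_weight ?P + 1"
  define A1 where "A1 = (narr s)(0 := (narr s 0)(6 := 0), 1 := tape_of n ?P)"
  define A2 where "A2 = A1(0 := (A1 0)(6 := 0), 1 := (\<lambda>_. 0))"
  define R1 where "R1 = (rarr s)(0 := (rarr s 0)(6 := rarr s 0 6 + rarr s 3 i * pauli_of E 0 ?P))"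
  have P: "length ?P = n" using t i(2) by (simp add: table_def)
  have t0: "table n Ps ((narr s)(0 := (narr s 0)(6 := i)))" using t by (subst table_cong[of _ "narr s"]) auto
  have t1: "table n Ps (A1(0 := (A1 0)(6 := i)))" using t by (subst table_cong[of _ "narr s"]) (auto simp: A1_def)
  have t2: "table n Ps (A2(0 := (A2 0)(4 := Suc i)))" using t by (subst table_cong[of _ "narr s"]) (auto simp: A2_def A1_def)
  have last: "run E (set_var 4 (NAdd (var 4) (NConst 1))) s3 (Suc 0) ?Q"
    if s3: "narr s3 = A2" "rarr s3 = R1" for s3 :: memory
  proof -
    let ?s = "s3\<lparr>narr := A2(0 := (A2 0)(4 := Suc i))\<rparr>"
    have "?Q ?s" using t2 by (simp add: s3 A2_def A1_def R1_def)
    moreover have "A2 0 4 = i" using i by (simp add: A2_def A1_def)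
    ultimately show ?thesis by (intro run_NSet) (simp add: s3)
  qed
  have second: "run E (set_var 6 (var 4) ;; walk (NConst 0) ;; set_var 4 (NAdd (var 4) (NConst 1))) s2 (Suc (?w + Suc 0)) ?Q"
    if s2: "narr s2 = A1" "rarr s2 = R1" for s2 :: memory
  proof (rule run_Seq_NSet, rule run_Seq[OF run_unload[of n Ps _ i]])
    let ?s = "s2\<lparr>narr := (narr s2)(0 := (narr s2 0)(nval s2 (NConst 6) := nval s2 (var 4)))\<rparr>"
    have e: "narr ?s = A1(0 := (A1 0)(6 := i))" using i by (simp add: s2 A1_def)
    show "table n Ps (narr ?s)" "narr ?s 0 6 = i" "i < length Ps" "narr ?s 1 = tape_of n ?P"
      unfolding e using t1 i by (simp_all add: A1_def)
    fix s3 :: memory assume "rarr s3 = rarr ?s \<and> narr s3 = (narr ?s)(0 := (narr ?s 0)(6 := 0), 1 := (\<lambda>_. 0))"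
    then have "narr s3 = A2" "rarr s3 = R1" unfolding e by (simp_all add: s2 A2_def)
    then show "run E (set_var 4 (NAdd (var 4) (NConst 1))) s3 (Suc 0) ?Q" by (rule last)
  qed
  have "run E add_term s (Suc (?w + Suc (Suc (?w + Suc 0)))) ?Q"
    unfolding add_term_def
  proof (rule run_Seq_NSet, rule run_Seq[OF run_load[of n Ps _ i]])
    let ?s = "s\<lparr>narr := (narr s)(0 := (narr s 0)(nval s (NConst 6) := nval s (var 4)))\<rparr>"
    have e: "narr ?s = (narr s)(0 := (narr s 0)(6 := i))" using i by simp
    show "table n Ps (narr ?s)" "narr ?s 0 6 = i" "i < length Ps" "narr ?s 1 = (\<lambda>_. 0)"
      unfolding e using t0 i z by simp_all
    fix s1 :: memory assume "rarr s1 = rarr ?s \<and> narr s1 = (narr ?s)(0 := (narr ?s 0)(6 := 0), 1 := tape_of n ?P)"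
    then have s1: "narr s1 = A1" "rarr s1 = rarr s" unfolding e by (simp_all add: A1_def)
    have tape: "map (\<lambda>i. decode_pauli (narr s1 1 i)) [0..<num_qubits E] = ?P"
      using decode_tape[OF P] by (simp add: s1 A1_def n)
    let ?u = "s1\<lparr>rarr := (rarr s1)(0 := (rarr s1 0)(nval s1 (NConst 6) :=
      rval E s1 (RAdd (rvar 6) (RMul (RGet 3 (var 4)) (RPauli 1 (NConst 0))))))\<rparr>"
    have "narr s1 0 4 = i" using i by (simp add: s1 A1_def)
    then have "rval E s1 (RAdd (rvar 6) (RMul (RGet 3 (var 4)) (RPauli 1 (NConst 0)))) =
      rarr s 0 6 + rarr s 3 i * pauli_of E 0 ?P"
      by (simp only: rval.simps nval.simps tape s1(2))
    then have "narr ?u = A1" "rarr ?u = R1" by (simp_all add: s1 R1_def del: rval.simps)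
    then show "run E (set_rvar 6 (RAdd (rvar 6) (RMul (RGet 3 (var 4)) (RPauli 1 (NConst 0)))) ;;
       set_var 6 (var 4) ;; walk (NConst 0) ;; set_var 4 (NAdd (var 4) (NConst 1))) s1 (Suc (Suc (?w + Suc 0))) ?Q"
      by (intro run_Seq_RSet second)
  qed
  then show ?thesis by (rule run_le) simp
qed

lemma run_prediction_program:
  fixes s :: memory
  assumes m: "model n Ps c s" and w: "\<And>i. i < length Ps \<Longrightarrow> pauli_weight (Ps ! i) \<le> K" and Kk: "K \<le> k"
  shows "run (prediction_env n k \<rho>) prediction_program s (length Ps * (6 * K + 7) + 4)
    (\<lambda>s'. output_of s' = (\<Sum>i<length Ps. c i * expval (pauli_mat (Ps ! i)) \<rho>))"
proof -
  let ?E = "prediction_env n k \<rho>"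
  define I where "I i s' \<longleftrightarrow> table n Ps (narr s') \<and> narr s' 1 = (\<lambda>_. 0) \<and> narr s' 0 3 = length Ps \<and> narr s' 0 4 = i \<and>
    rarr s' 3 = rarr s 3 \<and> rarr s' 0 6 = (\<Sum>j<i. c j * expval (pauli_mat (Ps ! j)) \<rho>)" for i and s' :: memory
  have c: "rarr s 3 i = c i" if "i < length Ps" for i using m that by (simp add: model_def)
  let ?w = "While (NLess (var 4) (var 3)) add_term"
  have loop: "run ?E ?w s' (length Ps * Suc (6 * K + 6) + 1) (I (length Ps))" if "I 0 s'" for s' :: memory
    using that
  proof (rule run_For)
    fix i and s1 :: memory assume i: "i < length Ps" and inv: "I i s1"
    have p: "pauli_of ?E 0 (Ps ! i) = expval (pauli_mat (Ps ! i)) \<rho>"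
      using w[OF i] Kk by (simp add: prediction_env_def)
    have "run ?E add_term s1 (6 * pauli_weight (Ps ! i) + 6)
      (\<lambda>s'. table n Ps (narr s') \<and> narr s' 1 = (\<lambda>_. 0) \<and> narr s' 0 3 = narr s1 0 3 \<and> narr s' 0 4 = Suc i \<and>
      rarr s' = (rarr s1)(0 := (rarr s1 0)(6 := rarr s1 0 6 + rarr s1 3 i * pauli_of ?E 0 (Ps ! i))))"
      using inv i by (intro run_add_term) (simp_all add: I_def prediction_env_def)
    then have "run ?E add_term s1 (6 * K + 6) (I (Suc i))"
      by (rule run_weaken) (use inv w[OF i] c[OF i] p in \<open>simp_all add: I_def\<close>)
    then show "bval ?E s1 (NLess (var 4) (var 3)) \<and> run ?E add_term s1 (6 * K + 6) (I (Suc i))"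
      using inv i by (simp add: I_def)
  qed (simp add: I_def)
  have "run ?E prediction_program s (Suc (Suc ((length Ps * Suc (6 * K + 6) + 1) + Suc 0)))
    (\<lambda>s'. output_of s' = (\<Sum>i<length Ps. c i * expval (pauli_mat (Ps ! i)) \<rho>))"
    unfolding prediction_program_def
  proof (rule run_Seq_RSet, rule run_Seq_NSet, rule run_Seq[OF loop])
    let ?s = "s\<lparr>rarr := (rarr s)(0 := (rarr s 0)(6 := 0)), narr := (narr s)(0 := (narr s 0)(4 := 0))\<rparr>"
    have "table n Ps (narr ?s)" using m by (subst table_cong[of _ "narr s"]) (auto simp: model_def)
    then have "I 0 ?s" using m by (simp add: I_def model_def)
    then show "I 0 (s\<lparr>rarr := (rarr s)(0 := (rarr s 0)(nval s (NConst 6) := rval ?E s (rnat 0))),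
       narr := (narr (s\<lparr>rarr := (rarr s)(0 := (rarr s 0)(nval s (NConst 6) := rval ?E s (rnat 0)))\<rparr>))
         (0 := (narr (s\<lparr>rarr := (rarr s)(0 := (rarr s 0)(nval s (NConst 6) := rval ?E s (rnat 0)))\<rparr>) 0)
           (nval (s\<lparr>rarr := (rarr s)(0 := (rarr s 0)(nval s (NConst 6) := rval ?E s (rnat 0)))\<rparr>) (NConst 4) :=
            nval (s\<lparr>rarr := (rarr s)(0 := (rarr s 0)(nval s (NConst 6) := rval ?E s (rnat 0)))\<rparr>) (NConst 0)))\<rparr>)"
      by simp
  next
    fix s1 :: memory assume "I (length Ps) s1"
    then show "run ?E (set_rvar 0 (rvar 6)) s1 (Suc 0)
      (\<lambda>s'. output_of s' = (\<Sum>i<length Ps. c i * expval (pauli_mat (Ps ! i)) \<rho>))"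
      by (intro run_RSet) (simp add: I_def output_of_def)
  qed
  then show ?thesis by (rule run_le) simp
qed

text \<open>Covers the case in which training stopped at once and left an empty table.\<close>

lemma run_prediction_program_empty:
  fixes s :: memory
  assumes "narr s 0 3 = 0"
  shows "run E prediction_program s 4 (\<lambda>s'. output_of s' = 0)"
proof -
  let ?s = "s\<lparr>rarr := (rarr s)(0 := (rarr s 0)(6 := 0)), narr := (narr s)(0 := (narr s 0)(4 := 0))\<rparr>"
  have "run E (While (NLess (var 4) (var 3)) add_term) ?s (Suc 0) (\<lambda>s'. s' = ?s)"
    using assms by (intro run_While_False) simp_all
  then have "run E (While (NLess (var 4) (var 3)) add_term ;; set_rvar 0 (rvar 6)) ?s (Suc 0 + Suc 0) (\<lambda>s'. output_of s' = 0)"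
    by (rule run_Seq, intro run_RSet) (simp add: output_of_def)
  then have "run E prediction_program s (Suc (Suc (Suc 0 + Suc 0))) (\<lambda>s'. output_of s' = 0)"
    unfolding prediction_program_def by (intro run_Seq_RSet run_Seq_NSet) simp
  then show ?thesis by (rule run_le) simp
qed

text \<open>
  The table of strings does not depend on the training data; a fixed enumeration \<open>Ps\<close> is what makes
  the learned coefficients measurable functions of the training states.
\<close>

fun data_free_rexp :: "rexp \<Rightarrow> bool" where
  "data_free_rexp (RAdd x y) \<longleftrightarrow> data_free_rexp x \<and> data_free_rexp y"
| "data_free_rexp (RSub x y) \<longleftrightarrow> data_free_rexp x \<and> data_free_rexp y"
| "data_free_rexp (RMul x y) \<longleftrightarrow> data_free_rexp x \<and> data_free_rexp y"
| "data_free_rexp (RDiv x y) \<longleftrightarrow> data_free_rexp x \<and> data_free_rexp y"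
| "data_free_rexp (RLabel i) \<longleftrightarrow> False"
| "data_free_rexp (RPauli a i) \<longleftrightarrow> False"
| "data_free_rexp (ROfNat i) \<longleftrightarrow> True"
| "data_free_rexp (RGet a i) \<longleftrightarrow> True"

fun data_free_bexp :: "bexp \<Rightarrow> bool" where
  "data_free_bexp (RLess x y) \<longleftrightarrow> data_free_rexp x \<and> data_free_rexp y"
| "data_free_bexp (BNot b) \<longleftrightarrow> data_free_bexp b"
| "data_free_bexp (BAnd b c) \<longleftrightarrow> data_free_bexp b \<and> data_free_bexp c"
| "data_free_bexp (NLess i j) \<longleftrightarrow> True"

fun data_free :: "com \<Rightarrow> bool" where
  "data_free (RSet a i x) \<longleftrightarrow> data_free_rexp x"
| "data_free (Seq c d) \<longleftrightarrow> data_free c \<and> data_free d"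
| "data_free (Cond b c d) \<longleftrightarrow> data_free_bexp b \<and> data_free c \<and> data_free d"
| "data_free (While b c) \<longleftrightarrow> data_free_bexp b \<and> data_free c"
| "data_free Skip \<longleftrightarrow> True"
| "data_free (NSet a i j) \<longleftrightarrow> True"

lemma rval_data_free: "data_free_rexp x \<Longrightarrow> rval E s x = rval E' s x"
  by (induction x) auto

lemma bval_data_free: "data_free_bexp b \<Longrightarrow> bval E s b = bval E' s b"
proof (induction b)
  case (RLess x y)
  then show ?case using rval_data_free[of x E s E'] rval_data_free[of y E s E'] by simp
qed auto

lemma exec_data_free: "exec E c s t s' \<Longrightarrow> data_free c \<Longrightarrow> exec E' c s t s'"
proof (induction rule: exec.induct)
  case (RSet a i x s)
  then show ?case using exec.RSet[of E' a i x s] rval_data_free[of x E s E'] by simp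
next
  case (Seq c s t s' d u s'')
  then show ?case by (auto intro: exec.intros)
next
  case (CondTrue s b c t s' d)
  then show ?case using bval_data_free[of b E s E'] exec.CondTrue[of E' s b c t s' d] by simp
next
  case (CondFalse s b d t s' c)
  then show ?case using bval_data_free[of b E s E'] exec.CondFalse[of E' s b d t s' c] by simp
next
  case (WhileFalse s b c)
  then show ?case using bval_data_free[of b E s E'] exec.WhileFalse[of E' s b c] by simp
next
  case (WhileTrue s b c t s' u s'')
  then show ?case using bval_data_free[of b E s E'] exec.WhileTrue[of E' s b c t s' u s''] by simp
qed (auto intro: exec.intros simp del: One_nat_def)

lemma data_free_rpower: "data_free_rexp x \<Longrightarrow> data_free_rexp (rpower x m)"
  by (induction m) simp_all

lemma data_free_setup: "data_free (setup_params ;; enumerate_strings)"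
  by (simp add: setup_params_def enumerate_strings_def append_child_def growth_def data_free_rpower)

lemma run_setup:
  fixes n N :: nat and \<epsilon> \<epsilon>' \<delta> :: real
  assumes e: "0 < \<epsilon>" "0 < \<epsilon>'" "max \<epsilon> \<epsilon>' \<le> 1"
  defines "K \<equiv> cutoff_weight (max \<epsilon> \<epsilon>')"
  defines "m \<equiv> card (low_weight n K)"
  shows "run E (setup_params ;; enumerate_strings) (initial_memory n N \<epsilon> \<epsilon>' \<delta>) ((4 * K + 5) + (12 * m + 2))
    (\<lambda>s. \<exists>Ps. distinct Ps \<and> set Ps = low_weight n K \<and> table n Ps (narr s) \<and> narr s 0 1 = N \<and> narr s 0 3 = length Ps \<and>
      narr s 1 = (\<lambda>_. 0) \<and> narr s 0 8 = 0 \<and> rarr s 0 3 = max \<epsilon> \<epsilon>' \<and>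
      rarr s 0 5 = ((1 / (\<epsilon> * \<epsilon>')) ^ 25) ^ (K + 1) \<and> rarr s 3 = (\<lambda>_. 0))"
    (is "run E _ ?i _ ?Q")
proof -
  have init: "narr ?i 0 0 = n" "narr ?i 0 1 = N" "\<And>j. 2 \<le> j \<Longrightarrow> narr ?i 0 j = 0" "\<And>a. a \<noteq> 0 \<Longrightarrow> narr ?i a = (\<lambda>_. 0)"
    "rarr ?i 0 0 = \<epsilon>" "rarr ?i 0 1 = \<epsilon>'" "rarr ?i 0 2 = \<delta>" "\<And>a. a \<noteq> 0 \<Longrightarrow> rarr ?i a = (\<lambda>_. 0)"
    by (auto simp: initial_memory_def)
  show ?thesis
  proof (rule run_Seq[OF run_setup_params[of _ \<epsilon> \<epsilon>', folded K_def]])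
    fix s1 :: memory
    assume "narr s1 = (narr ?i)(0 := (narr ?i 0)(2 := K)) \<and> (\<forall>a. a \<noteq> 0 \<longrightarrow> rarr s1 a = rarr ?i a) \<and>
      rarr s1 0 3 = max \<epsilon> \<epsilon>' \<and> rarr s1 0 5 = ((1 / (\<epsilon> * \<epsilon>')) ^ 25) ^ (K + 1)"
    then have s1: "narr s1 = (narr ?i)(0 := (narr ?i 0)(2 := K))" "\<And>a. a \<noteq> 0 \<Longrightarrow> rarr s1 a = rarr ?i a"
      "rarr s1 0 3 = max \<epsilon> \<epsilon>'" "rarr s1 0 5 = ((1 / (\<epsilon> * \<epsilon>')) ^ 25) ^ (K + 1)" by auto
    have n1: "narr s1 0 0 = n" "narr s1 0 1 = N" "narr s1 0 2 = K" "\<And>j. 3 \<le> j \<Longrightarrow> narr s1 0 j = 0"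
      "\<And>a. a \<noteq> 0 \<Longrightarrow> narr s1 a = (\<lambda>_. 0)" "rarr s1 3 = (\<lambda>_. 0)"
      using init s1(2)[of 3] by (auto simp: s1(1))
    have "run E enumerate_strings s1 (12 * m + 2) (\<lambda>s'. \<exists>Ps. enum_inv n K s1 Ps s' \<and> set Ps = low_weight n K)"
      unfolding m_def by (rule run_enumerate_strings) (use n1 in \<open>simp_all\<close>)
    then show "run E enumerate_strings s1 (12 * m + 2) ?Q"
    proof (rule run_weaken)
      fix s2 :: memory assume "\<exists>Ps. enum_inv n K s1 Ps s2 \<and> set Ps = low_weight n K"
      then obtain Ps where Ps: "enum_inv n K s1 Ps s2" "set Ps = low_weight n K" by blast
      have f: "narr s2 0 j = narr s1 0 j" if "j \<notin> {3, 4, 5}" for j using Ps(1) that unfolding enum_inv_def by blast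
      have "table n Ps (narr s2)" "narr s2 0 3 = length Ps" "distinct Ps" and r: "rarr s2 = rarr s1" and "narr s2 1 = narr s1 1"
        using Ps(1) unfolding enum_inv_def by blast+
      moreover have "narr s2 0 1 = N" "narr s2 0 8 = 0" using f[of 1] f[of 8] n1(2) n1(4)[of 8] by simp_all
      moreover have "narr s1 1 = (\<lambda>_. 0)" using n1(5)[of 1] by simp
      ultimately show "?Q s2" using Ps(2) unfolding r s1(3,4) n1(6) by metis
    qed simp
  qed (use init e in simp_all)
qed

lemma run_training_program:
  fixes n k N :: nat and \<epsilon> \<epsilon>' \<delta> :: real
  assumes e: "0 < \<epsilon>" "0 < \<epsilon>'" "max \<epsilon> \<epsilon>' \<le> 1" and \<delta>: "\<delta> < 1" and Kk: "cutoff_weight (max \<epsilon> \<epsilon>') \<le> k"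
  defines "K \<equiv> cutoff_weight (max \<epsilon> \<epsilon>')"
  defines "m \<equiv> card (low_weight n K)"
  defines "J \<equiv> min m (nat \<lceil>((1 / (\<epsilon> * \<epsilon>')) ^ 25) ^ (K + 1)\<rceil>)"
  obtains Ps where "distinct Ps" "set Ps = low_weight n K"
    "\<And>\<omega>. run (training_env n k Obs N \<omega>) training_program (initial_memory n N \<epsilon> \<epsilon>' \<delta>)
      (m * (6 * K + 4 * N + 26) + J * (4 * m + 7) + 4 * K + 11)
      (model n Ps (learned_coefficient Obs N (max \<epsilon> \<epsilon>') Ps J \<omega>))"
proof -
  let ?i = "initial_memory n N \<epsilon> \<epsilon>' \<delta>"
  let ?E = "training_env n k Obs N"
  define e' where "e' = max \<epsilon> \<epsilon>'"
  define m1 where "m1 = ((1 / (\<epsilon> * \<epsilon>')) ^ 25) ^ (K + 1)"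
  \<comment> \<open>The setup is run once on dummy states; since it reads no data, the same run
    exists for every \<omega>, and one \<open>Ps\<close> serves all of them.\<close>
  obtain t s Ps where s: "exec (?E (\<lambda>_. 0\<^sub>m 0 0)) (setup_params ;; enumerate_strings) ?i t s" "t \<le> (4 * K + 5) + (12 * m + 2)"
    and d: "distinct Ps" and S: "set Ps = low_weight n K" and tb: "table n Ps (narr s)" "narr s 0 1 = N" "narr s 0 3 = length Ps"
      "narr s 1 = (\<lambda>_. 0)" "narr s 0 8 = 0" "rarr s 0 3 = e'" "rarr s 0 5 = m1" "rarr s 3 = (\<lambda>_. 0)"
    using run_setup[OF e, of "?E (\<lambda>_. 0\<^sub>m 0 0)" n N \<delta>, folded K_def, folded m_def, folded e'_def m1_def]
    unfolding run_def by metis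
  have len: "length Ps = m" using d S by (simp add: m_def distinct_card[symmetric])
  have "replicate n PI \<in> low_weight n K" by (simp add: low_weight_def pauli_strings_def pauli_weight_def)
  then have ne: "Ps \<noteq> []" using S by auto
  have J: "J = min (length Ps) (nat \<lceil>m1\<rceil>)" by (simp add: J_def len m1_def)
  have "run (?E \<omega>) training_program ?i (m * (6 * K + 4 * N + 26) + J * (4 * m + 7) + 4 * K + 11)
    (model n Ps (learned_coefficient Obs N e' Ps J \<omega>))" (is "run _ _ _ _ ?Q") for \<omega>
  proof -
    interpret training n k N Obs \<omega> K e' m1 Ps
      using Kk S ne by unfold_locales (simp_all add: K_def)
    have start: "run (?E \<omega>) (setup_params ;; enumerate_strings) ?i ((4 * K + 5) + (12 * m + 2)) (\<lambda>s'. s' = s)"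
      unfolding run_def using exec_data_free[OF s(1) data_free_setup] s(2) by blast
    have "run (?E \<omega>) (compute_scores ;; select_largest) s
      ((length Ps * (6 * K + 4 * N + 14) + 2) + (J * (4 * length Ps + 7) + 1)) ?Q"
      by (rule run_Seq[OF run_compute_scores[OF tb]], rule run_select_largest) (rule J | assumption)+
    then have "run (?E \<omega>) ((setup_params ;; enumerate_strings) ;; compute_scores ;; select_largest) ?i
      (((4 * K + 5) + (12 * m + 2)) + ((length Ps * (6 * K + 4 * N + 14) + 2) + (J * (4 * length Ps + 7) + 1))) ?Q"
      by (intro run_Seq[OF start]) simp
    then have "run (?E \<omega>) training_program ?i
      (Suc (((4 * K + 5) + (12 * m + 2)) + ((length Ps * (6 * K + 4 * N + 14) + 2) + (J * (4 * length Ps + 7) + 1)))) ?Q"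
      unfolding training_program_def by (rule run_Cond) (use \<delta> in \<open>simp add: initial_memory_def\<close>)
    then show ?thesis by (rule run_le) (simp add: len algebra_simps)
  qed
  with that[OF d S] show thesis unfolding e'_def by blast
qed

section \<open>The discarded coefficients\<close>

text \<open>\<open>676\<close> is \<open>26 * 26\<close> and lies below \<open>(3/2) ^ 17\<close>;
  one factor \<open>676\<close> pays for the rounding in the cutoff weight.\<close>

lemma power_676_cutoff_weight:
  assumes \<epsilon>: "0 < \<epsilon>" "\<epsilon> \<le> 1"
  shows "676 ^ cutoff_weight \<epsilon> \<le> 676 * (1 / \<epsilon>) ^ 17"
proof (cases "cutoff_weight \<epsilon>")
  case 0
  have "1 \<le> (1 / \<epsilon>) ^ 17" using \<epsilon> by (intro one_le_power) simp
  then show ?thesis using 0 by simp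
next
  case (Suc i)
  have "(3 / 2) ^ i * \<epsilon> < 1" using cutoff_weight_power(1)[OF \<epsilon>, of i] Suc by simp
  then have le: "(3 / 2) ^ i \<le> 1 / \<epsilon>" using \<epsilon> by (simp add: field_simps)
  have "(676 :: real) ^ i \<le> ((3 / 2) ^ 17) ^ i" by (intro power_mono) (simp_all add: power_divide)
  also have "\<dots> = ((3 / 2) ^ i) ^ 17" by (simp only: power_mult[symmetric] mult.commute)
  also have "\<dots> \<le> (1 / \<epsilon>) ^ 17" using le by (intro power_mono) simp_all
  finally show ?thesis by (simp add: Suc)
qed

text \<open>The source of the exponent \<open>25\<close>: the power \<open>17\<close> of
  \<open>1 / \<epsilon>\<close> comes from \<open>676 ^ cutoff_weight \<epsilon>\<close>, and
  \<open>8\<close> more absorb the constants \<open>65 * 676\<close> and \<open>36864\<close>, both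
  below \<open>4 ^ 8\<close>, since \<open>1 / \<epsilon> \<ge> 4\<close>.\<close>

lemma kept_count_bound:
  assumes \<epsilon>: "0 < \<epsilon>" "\<epsilon> \<le> 1 / 4" and \<epsilon>': "0 < \<epsilon>'" "\<epsilon>' \<le> 1 / 4"
  shows "36864 / ((max \<epsilon> \<epsilon>')\<^sup>2 * \<epsilon>') * (65 * 676 ^ cutoff_weight \<epsilon> / \<epsilon>') ^ K
    \<le> ((1 / (\<epsilon> * \<epsilon>')) ^ 25) ^ (K + 1)"
proof -
  define u v where "u = 1 / \<epsilon>" and "v = 1 / \<epsilon>'"
  have u: "4 \<le> u" and v: "4 \<le> v" using \<epsilon> \<epsilon>' by (simp_all add: u_def v_def field_simps)
  have u8: "65536 \<le> u ^ 8" using power_mono[OF u, of 8] by simp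
  have v1: "v \<le> v ^ 25" using v self_le_power[of v 25] by simp
  have "65 * 676 ^ cutoff_weight \<epsilon> / \<epsilon>' = 65 * 676 ^ cutoff_weight \<epsilon> * v" by (simp add: v_def)
  also have "\<dots> \<le> (65 * (676 * u ^ 17)) * v"
    using power_676_cutoff_weight[of \<epsilon>] \<epsilon> v by (intro mult_right_mono mult_left_mono) (simp_all add: u_def)
  also have "\<dots> \<le> (u ^ 8 * u ^ 17) * v ^ 25"
  proof (rule mult_mono)
    have "43940 * u ^ 17 \<le> u ^ 8 * u ^ 17" using u8 u by (intro mult_right_mono) simp_all
    then show "65 * (676 * u ^ 17) \<le> u ^ 8 * u ^ 17" by simp
  qed (use u v v1 in simp_all)
  also have "u ^ 8 * u ^ 17 = u ^ 25" by (simp flip: power_add)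
  also have "u ^ 25 * v ^ 25 = (1 / (\<epsilon> * \<epsilon>')) ^ 25" by (simp add: u_def v_def flip: power_mult_distrib)
  finally have G: "65 * 676 ^ cutoff_weight \<epsilon> / \<epsilon>' \<le> (1 / (\<epsilon> * \<epsilon>')) ^ 25" .
  have "1 / max \<epsilon> \<epsilon>' \<le> u" using \<epsilon> \<epsilon>' by (simp add: u_def frac_le)
  then have "(1 / max \<epsilon> \<epsilon>')\<^sup>2 \<le> u\<^sup>2" using \<epsilon> by (intro power_mono) simp_all
  then have "36864 * (1 / max \<epsilon> \<epsilon>')\<^sup>2 * v \<le> u ^ 8 * u\<^sup>2 * v"
    using u8 v by (intro mult_right_mono mult_mono) simp_all
  also have "\<dots> = u ^ 10 * v" by (simp flip: power_add)
  also have "\<dots> \<le> u ^ 25 * v ^ 25" using u v v1 by (intro mult_mono power_increasing) simp_all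
  also have "u ^ 25 * v ^ 25 = (1 / (\<epsilon> * \<epsilon>')) ^ 25" by (simp add: u_def v_def flip: power_mult_distrib)
  finally have "36864 / ((max \<epsilon> \<epsilon>')\<^sup>2 * \<epsilon>') \<le> (1 / (\<epsilon> * \<epsilon>')) ^ 25"
    by (simp add: v_def power_divide)
  from mult_mono[OF this power_mono[OF G, of K]] \<epsilon> \<epsilon>' show ?thesis by simp
qed

lemma powr_interpolation:
  fixes a b s :: real
  assumes "0 < a" "0 < b"
  shows "a\<^sup>2 * (b / a) powr s = a powr (2 - s) * b powr s"
proof -
  have "a\<^sup>2 = a powr 2" using assms by simp
  then show ?thesis using assms by (simp add: powr_divide powr_diff)
qed

text \<open>Balances the two terms of \<open>small_coefficients_bound\<close>. With \<open>l\<close>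
  the power \<open>2 / (k + 1)\<close> of \<open>B / A'\<close> and a threshold
  \<open>\<eta>\<close> proportional to \<open>l\<close>, letters of small influence cost a multiple
  of \<open>A'\<^sup>2 * l\<close>. The bound on the number of remaining strings grows like the
  power \<open>- K\<close> of \<open>l\<close>; because
  \<open>l ^ (k + 1) * A'\<^sup>2 = B\<^sup>2\<close> and \<open>K \<le> k\<close>, their cost is
  again at most a multiple of \<open>A'\<^sup>2 * l\<close>. If \<open>A\<close> exceeds
  \<open>B\<close>, this is the interpolated norm of the statement.\<close>

lemma discarded_coefficients_bound:
  fixes \<alpha> :: "pauli list \<Rightarrow> real" and n :: nat
  assumes \<epsilon>: "0 < \<epsilon>" "\<epsilon> \<le> 1 / 4" and \<epsilon>': "0 < \<epsilon>'" "\<epsilon>' \<le> 1 / 4"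
    and Kk: "K \<le> k" and k: "k = cutoff_weight \<epsilon>" and J: "((1 / (\<epsilon> * \<epsilon>')) ^ 25) ^ (K + 1) \<le> real J"
  defines "e \<equiv> max \<epsilon> \<epsilon>'" and "r \<equiv> 2 * real k / (real k + 1)"
    and "A \<equiv> spectral_norm (truncated_observable n k \<alpha>)" and "B \<equiv> spectral_norm (observable n \<alpha>)"
  shows "(\<Sum>P\<in>{P \<in> low_weight n K. \<bar>\<alpha> P\<bar> \<le> 48 * B / (e * sqrt (real J))}. (\<alpha> P)\<^sup>2)
    \<le> \<epsilon>' / 8 * (B\<^sup>2 + A powr r * B powr (2 - r))" (is "?sum \<le> _")
proof (cases "B = 0")
  case True
  then have "\<alpha> P = 0" if "P \<in> low_weight n K" "\<bar>\<alpha> P\<bar> \<le> 48 * B / (e * sqrt (real J))" for P using that by simp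
  then have "?sum = 0" by (intro sum.neutral) auto
  then show ?thesis using \<epsilon>' by simp
next
  case False
  have d: "0 < dim_col (observable n \<alpha>)" by (simp add: observable_def pauli_combination_def)
  have B: "0 < B" using False spectral_norm_nonneg[OF d] by (simp add: B_def)
  \<comment> \<open>The maximum covers truncations of norm at most \<open>B\<close>, for which
    \<open>l = 1\<close> and the bound is \<open>B\<^sup>2\<close>.\<close>
  define A' where "A' = max A B"
  define l where "l = (B / A') powr (2 - r)"
  \<comment> \<open>\<open>64\<close> comes from \<open>M / \<eta>\<close>; one more copy absorbs
    the summand \<open>1\<close>.\<close>
  define G where "G = 65 * 676 ^ k / \<epsilon>'"
  define \<eta> where "\<eta> = \<epsilon>' * l * A' / (32 * 26 ^ k)"
  define M where "M = 2 * 26 ^ k * A'"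
  define \<tau> where "\<tau> = 48 * B / (e * sqrt (real J))"
  have A': "0 < A'" "B \<le> A'" "A \<le> A'" using B by (auto simp: A'_def)
  have r: "2 - r = 2 / (real k + 1)" by (simp add: r_def field_simps)
  have l: "0 < l" "l \<le> 1" using A' B r by (auto simp: l_def intro!: powr_le1)
  have J0: "0 < real J" using \<epsilon> \<epsilon>' by (intro less_le_trans[OF _ J]) simp
  have e0: "0 < e" using \<epsilon> by (simp add: e_def)
  have lk: "l ^ (k + 1) * A'\<^sup>2 = B\<^sup>2"
  proof -
    have "l ^ (k + 1) = l powr real (k + 1)" using l by (simp only: powr_realpow)
    also have "\<dots> = (B / A') powr ((2 - r) * real (k + 1))" by (simp only: l_def powr_powr)
    also have "(2 - r) * real (k + 1) = 2" unfolding r by (simp add: field_simps)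
    also have "(B / A') powr 2 = (B / A')\<^sup>2" using A' B by simp
    finally show ?thesis using A' by (simp add: power_divide)
  qed
  have \<eta>: "0 < \<eta>" using \<epsilon>' l A' by (simp add: \<eta>_def)
  have \<eta>M: "\<eta> * M = \<epsilon>' / 16 * (A'\<^sup>2 * l)" by (simp add: \<eta>_def M_def field_simps power2_eq_square)
  have ratio: "1 + M / \<eta> \<le> G / l"
  proof -
    have "(26 :: real) ^ k * 26 ^ k = 676 ^ k" by (simp flip: power_mult_distrib)
    then have "M / \<eta> = 64 * 676 ^ k / (\<epsilon>' * l)" using \<epsilon>' l A' by (simp add: \<eta>_def M_def field_simps)
    moreover have "1 \<le> 676 ^ k / (\<epsilon>' * l)"
    proof -
      have "\<epsilon>' * l \<le> 1 * 1" using \<epsilon>' l by (intro mult_mono) simp_all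
      also have "1 * 1 \<le> (676 :: real) ^ k" by simp
      finally show ?thesis using \<epsilon>' l by simp
    qed
    ultimately have "1 + M / \<eta> \<le> 676 ^ k / (\<epsilon>' * l) + 64 * 676 ^ k / (\<epsilon>' * l)" by simp
    then show ?thesis by (simp add: G_def field_simps)
  qed
  have "?sum \<le> \<eta> * M + \<tau>\<^sup>2 * (1 + M / \<eta>) ^ K"
    unfolding \<tau>_def[symmetric]
  proof (rule small_coefficients_bound[OF Kk _ \<eta>])
    show "0 \<le> \<tau>" using B e0 by (simp add: \<tau>_def)
    show "2 * 26 ^ k * spectral_norm (truncated_observable n k \<alpha>) \<le> M"
      using A' by (simp add: M_def A_def)
  qed
  also have "\<tau>\<^sup>2 * (1 + M / \<eta>) ^ K \<le> \<epsilon>' / 16 * (A'\<^sup>2 * l)"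
  proof -
    have "(1 + M / \<eta>) ^ K \<le> (G / l) ^ K"
      using ratio \<eta> A' by (intro power_mono) (simp_all add: M_def)
    then have "\<tau>\<^sup>2 * (1 + M / \<eta>) ^ K \<le> \<tau>\<^sup>2 * (G / l) ^ K" by (intro mult_left_mono) simp_all
    also have "\<dots> = 2304 * G ^ K / (e\<^sup>2 * real J) * (B\<^sup>2 / l ^ K)"
      using J0 by (simp add: \<tau>_def power_divide power_mult_distrib)
    also have "B\<^sup>2 / l ^ K = A'\<^sup>2 * l ^ (k + 1 - K)"
      using l Kk by (simp add: lk[symmetric] power_diff)
    also have "2304 * G ^ K / (e\<^sup>2 * real J) * (A'\<^sup>2 * l ^ (k + 1 - K)) \<le> \<epsilon>' / 16 * (A'\<^sup>2 * l)"
    proof (rule mult_mono)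
      have "36864 / (e\<^sup>2 * \<epsilon>') * G ^ K \<le> real J"
        using kept_count_bound[OF \<epsilon> \<epsilon>', of K] J by (simp add: e_def G_def k)
      then show "2304 * G ^ K / (e\<^sup>2 * real J) \<le> \<epsilon>' / 16"
        using J0 e0 \<epsilon>' by (simp add: field_simps)
      have "l ^ (k + 1 - K) \<le> l ^ 1" using l Kk by (intro power_decreasing) simp_all
      then show "A'\<^sup>2 * l ^ (k + 1 - K) \<le> A'\<^sup>2 * l" by (intro mult_left_mono) simp_all
    qed (use \<epsilon>' l in simp_all)
    finally show ?thesis .
  qed
  also have "\<eta> * M + \<epsilon>' / 16 * (A'\<^sup>2 * l) = \<epsilon>' / 8 * (A'\<^sup>2 * l)" unfolding \<eta>M by simp
  also have "\<dots> \<le> \<epsilon>' / 8 * (B\<^sup>2 + A powr r * B powr (2 - r))"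
  proof (intro mult_left_mono)
    show "A'\<^sup>2 * l \<le> B\<^sup>2 + A powr r * B powr (2 - r)"
    proof (cases "A \<le> B")
      case True
      then show ?thesis using B by (simp add: A'_def l_def)
    next
      case False
      then have "A' = A" "0 < A" using B by (simp_all add: A'_def)
      then show ?thesis using powr_interpolation[of A B "2 - r"] B by (simp add: l_def)
    qed
  qed (use \<epsilon>' in simp)
  finally show ?thesis by simp
qed

section \<open>The error of the learned model\<close>

context invariant_states
begin

lemma expval_observable:
  "\<rho> \<in> space D \<Longrightarrow> expval (observable n \<alpha>) \<rho> = (\<Sum>P\<in>pauli_strings n. \<alpha> P * expval (pauli_mat P) \<rho>)"
  unfolding observable_def using state_carrier by (intro expval_pauli_combination) auto

lemma observable_carrier: "observable n \<alpha> \<in> carrier_mat (2 ^ n) (2 ^ n)"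
  by (simp add: observable_def pauli_combination_def)

lemma expval_observable_le: "\<rho> \<in> space D \<Longrightarrow> \<bar>expval (observable n \<alpha>) \<rho>\<bar> \<le> spectral_norm (observable n \<alpha>)"
  using expval_le_spectral_norm[OF observable_carrier] by (simp add: space_D)

text \<open>All other strings are uncorrelated with \<open>P\<close>, so the correlation with the
  label isolates one coefficient.\<close>

lemma correlation_observable:
  assumes P: "length P = n"
  shows "(LINT \<rho>|D. expval (pauli_mat P) \<rho> * expval (observable n \<alpha>) \<rho>) = \<alpha> P * moment P"
proof -
  have len: "length Q = n" if "Q \<in> pauli_strings n" for Q using that by (simp add: pauli_strings_def)
  have "(LINT \<rho>|D. expval (pauli_mat P) \<rho> * expval (observable n \<alpha>) \<rho>) =
    (LINT \<rho>|D. (\<Sum>Q\<in>pauli_strings n. \<alpha> Q * (expval (pauli_mat P) \<rho> * expval (pauli_mat Q) \<rho>)))"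
    by (intro Bochner_Integration.integral_cong) (simp_all add: expval_observable sum_distrib_left algebra_simps)
  also have "\<dots> = (\<Sum>Q\<in>pauli_strings n. \<alpha> Q * (LINT \<rho>|D. expval (pauli_mat P) \<rho> * expval (pauli_mat Q) \<rho>))"
    using integrable_pauli_mult[OF P len] by (subst Bochner_Integration.integral_sum) simp_all
  also have "\<dots> = (\<Sum>Q\<in>pauli_strings n. if Q = P then \<alpha> P * moment P else 0)"
    using cross_moment_zero[OF P len] by (intro sum.cong) (auto simp: moment_def power2_eq_square)
  finally show ?thesis using P finite_pauli_strings[of n] by (simp add: pauli_strings_def)
qed

text \<open>The tolerance for \<open>sample_product\<close> is in units of the norm of the
  observable, which bounds the labels.\<close>

definition accurate :: "(pauli list \<Rightarrow> real) \<Rightarrow> pauli list set \<Rightarrow> nat \<Rightarrow> real \<Rightarrow> (nat \<Rightarrow> complex mat) \<Rightarrow> bool" where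
  "accurate \<alpha> T N \<gamma> \<omega> \<longleftrightarrow> (\<forall>P\<in>T. \<bar>sample_square N \<omega> P - real N * moment P\<bar> \<le> real N * \<gamma> \<and>
     \<bar>sample_product (observable n \<alpha>) N \<omega> P - real N * (\<alpha> P * moment P)\<bar> \<le> real N * (\<gamma> * spectral_norm (observable n \<alpha>)))"

lemma measurable_samples:
  assumes "length P = n"
  shows "(\<lambda>\<omega>. sample_square N \<omega> P) \<in> borel_measurable (\<Pi>\<^sub>M l\<in>{..<N}. D)"
    and "(\<lambda>\<omega>. sample_product (observable n \<alpha>) N \<omega> P) \<in> borel_measurable (\<Pi>\<^sub>M l\<in>{..<N}. D)"
  unfolding sample_square_def sample_product_def
  using measurable_pauli[OF assms] measurable_expval[OF observable_carrier[of \<alpha>]] by simp_all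

text \<open>A union bound over two deviation events per string, each of probability at most
  \<open>2 * exp (- real N * \<gamma>\<^sup>2 / 2)\<close>.\<close>

lemma prob_accurate:
  assumes T: "T \<subseteq> pauli_strings n" and N: "0 < N" and \<gamma>: "0 \<le> \<gamma>"
  shows "1 - 4 * real (card T) * exp (- real N * \<gamma>\<^sup>2 / 2)
    \<le> measure (\<Pi>\<^sub>M l\<in>{..<N}. D) {\<omega> \<in> space (\<Pi>\<^sub>M l\<in>{..<N}. D). accurate \<alpha> T N \<gamma> \<omega>}"
    and "{\<omega> \<in> space (\<Pi>\<^sub>M l\<in>{..<N}. D). accurate \<alpha> T N \<gamma> \<omega>} \<in> sets (\<Pi>\<^sub>M l\<in>{..<N}. D)"
proof -
  let ?M = "\<Pi>\<^sub>M l\<in>{..<N}. D" and ?O = "observable n \<alpha>"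
  let ?B = "spectral_norm ?O" and ?b = "2 * exp (- real N * \<gamma>\<^sup>2 / 2)"
  interpret P: prob_space ?M by (rule prob_space_PiM) (rule prob_space_axioms)
  have finT: "finite T" by (rule finite_subset[OF T finite_pauli_strings])
  have len: "length P = n" if "P \<in> T" for P using that T by (auto simp: pauli_strings_def)
  have B0: "0 \<le> ?B" by (intro spectral_norm_nonneg) (simp add: observable_def pauli_combination_def)
  define X where "X P = {\<omega> \<in> space ?M. real N * \<gamma> < \<bar>sample_square N \<omega> P - real N * moment P\<bar>}" for P
  define Y where "Y P = {\<omega> \<in> space ?M. real N * (\<gamma> * ?B) < \<bar>sample_product ?O N \<omega> P - real N * (\<alpha> P * moment P)\<bar>}" for P
  have sets: "X P \<in> sets ?M" "Y P \<in> sets ?M" if "P \<in> T" for P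
    unfolding X_def Y_def using measurable_samples[OF len[OF that]] by measurable
  have pX: "P.prob (X P) \<le> ?b" if "P \<in> T" for P
  proof -
    let ?f = "\<lambda>\<rho>. expval (pauli_mat P) \<rho> * expval (pauli_mat P) \<rho>"
    let ?E = "{\<omega> \<in> space ?M. real N * (\<gamma> * 1) \<le> \<bar>(\<Sum>l<N. ?f (\<omega> l)) - real N * expectation ?f\<bar>}"
    note [measurable] = measurable_pauli[OF len[OF that]]
    have "\<bar>?f \<rho>\<bar> \<le> 1" if "\<rho> \<in> space D" for \<rho>
    proof -
      have "\<bar>expval (pauli_mat P) \<rho>\<bar> \<le> 1"
        using that expval_pauli_le[OF len[OF \<open>P \<in> T\<close>]] by (simp add: space_D)
      then show ?thesis unfolding abs_mult by (intro mult_le_one) auto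
    qed
    then have "P.prob ?E \<le> ?b" using N \<gamma> by (intro hoeffding_product) auto
    moreover have "X P \<subseteq> ?E"
      by (auto simp: X_def sample_square_def moment_def power2_eq_square)
    moreover have "?E \<in> sets ?M" by measurable
    ultimately show ?thesis using P.finite_measure_mono order_trans by blast
  qed
  have pY: "P.prob (Y P) \<le> ?b" if "P \<in> T" for P
  proof (cases "?B = 0")
    \<comment> \<open>Hoeffding's inequality needs a positive bound. If the norm is zero, so are the
      labels and the coefficient, and the strict inequality in \<open>Y\<close> never holds.\<close>
    case True
    have "expval ?O (\<omega> l) = 0" if "\<omega> \<in> space ?M" "l < N" for \<omega> l
    proof -
      have "\<omega> l \<in> space D" using that by (auto simp: space_PiM)
      then show ?thesis using expval_observable_le[of "\<omega> l" \<alpha>] True by simp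
    qed
    then have "sample_product ?O N \<omega> P = 0" if "\<omega> \<in> space ?M" for \<omega> using that by (simp add: sample_product_def)
    moreover have "\<alpha> P = 0"
    proof -
      have "(\<alpha> P)\<^sup>2 \<le> (\<Sum>Q\<in>pauli_strings n. (\<alpha> Q)\<^sup>2)"
        using that T finite_pauli_strings by (intro member_le_sum) auto
      also have "\<dots> \<le> 0" using sum_squares_le_spectral[of "pauli_strings n" n \<alpha>] True by (simp add: observable_def)
      finally show ?thesis by simp
    qed
    ultimately have "Y P = {}" by (auto simp: Y_def True)
    then show ?thesis by simp
  next
    case False
    let ?f = "\<lambda>\<rho>. expval (pauli_mat P) \<rho> * expval ?O \<rho>"
    let ?E = "{\<omega> \<in> space ?M. real N * (\<gamma> * ?B) \<le> \<bar>(\<Sum>l<N. ?f (\<omega> l)) - real N * expectation ?f\<bar>}"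
    note [measurable] = measurable_pauli[OF len[OF that]] measurable_expval[OF observable_carrier[of \<alpha>]]
    have "\<bar>?f \<rho>\<bar> \<le> ?B" if "\<rho> \<in> space D" for \<rho>
    proof -
      have "\<bar>?f \<rho>\<bar> \<le> 1 * ?B"
        unfolding abs_mult using that expval_pauli_le[OF len[OF \<open>P \<in> T\<close>]] expval_observable_le[OF that] 
        by (intro mult_mono) (auto simp: space_D)
      then show ?thesis by simp
    qed
    then have "P.prob ?E \<le> ?b" using False B0 N \<gamma> by (intro hoeffding_product) auto
    moreover have "Y P \<subseteq> ?E"
      by (auto simp: Y_def sample_product_def correlation_observable[OF len[OF that]])
    moreover have "?E \<in> sets ?M" by measurable
    ultimately show ?thesis using P.finite_measure_mono order_trans by blast
  qed
  have eq: "{\<omega> \<in> space ?M. accurate \<alpha> T N \<gamma> \<omega>} = space ?M - (\<Union>P\<in>T. X P \<union> Y P)"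
    by (auto simp: accurate_def X_def Y_def not_less)
  have U: "(\<Union>P\<in>T. X P \<union> Y P) \<in> sets ?M" using sets finT by (intro sets.finite_UN sets.Un) auto
  then show "{\<omega> \<in> space ?M. accurate \<alpha> T N \<gamma> \<omega>} \<in> sets ?M" unfolding eq by auto
  have "P.prob (\<Union>P\<in>T. X P \<union> Y P) \<le> (\<Sum>P\<in>T. P.prob (X P \<union> Y P))"
    using sets finT by (intro measure_UNION_le) auto
  also have "\<dots> \<le> (\<Sum>P\<in>T. 2 * ?b)"
  proof (intro sum_mono)
    fix P assume "P \<in> T"
    then have "P.prob (X P \<union> Y P) \<le> P.prob (X P) + P.prob (Y P)" using sets by (intro measure_Un_le) auto
    then show "P.prob (X P \<union> Y P) \<le> 2 * ?b" using pX pY \<open>P \<in> T\<close> by (smt (verit))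
  qed
  finally show "1 - 4 * real (card T) * exp (- real N * \<gamma>\<^sup>2 / 2) \<le> P.prob {\<omega> \<in> space ?M. accurate \<alpha> T N \<gamma> \<omega>}"
    unfolding eq using P.prob_compl[OF U] by simp
qed

definition learned_function ::
  "(pauli list \<Rightarrow> real) \<Rightarrow> nat \<Rightarrow> real \<Rightarrow> pauli list list \<Rightarrow> nat \<Rightarrow> (nat \<Rightarrow> complex mat) \<Rightarrow> complex mat \<Rightarrow> real" where
  "learned_function \<alpha> N e Ps J \<omega> \<rho> =
     (\<Sum>i<length Ps. learned_coefficient (observable n \<alpha>) N e Ps J \<omega> i * expval (pauli_mat (Ps ! i)) \<rho>)"

text \<open>Indexed by strings instead of table positions, as the error formula requires; strings
  outside the table get \<open>0\<close>.\<close>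

definition coefficient_of ::
  "(pauli list \<Rightarrow> real) \<Rightarrow> nat \<Rightarrow> real \<Rightarrow> pauli list list \<Rightarrow> nat \<Rightarrow> (nat \<Rightarrow> complex mat) \<Rightarrow> pauli list \<Rightarrow> real" where
  "coefficient_of \<alpha> N e Ps J \<omega> P =
     (\<Sum>i<length Ps. if Ps ! i = P then learned_coefficient (observable n \<alpha>) N e Ps J \<omega> i else 0)"

text \<open>Orthogonality in the mean turns the error into a finite sum in the coefficients, so its
  measurability in \<omega> follows from that of the coefficients.\<close>

lemma learned_error:
  fixes \<alpha> N e Ps J \<omega>
  assumes Ps: "set Ps \<subseteq> pauli_strings n"
  defines "h \<equiv> learned_function \<alpha> N e Ps J \<omega>"
  shows "integrable D (\<lambda>\<rho>. \<bar>h \<rho> - expval (observable n \<alpha>) \<rho>\<bar>\<^sup>2)"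
    and "(LINT \<rho>|D. \<bar>h \<rho> - expval (observable n \<alpha>) \<rho>\<bar>\<^sup>2) =
      (\<Sum>P\<in>pauli_strings n. (coefficient_of \<alpha> N e Ps J \<omega> P - \<alpha> P)\<^sup>2 * moment P)"
proof -
  let ?c = "coefficient_of \<alpha> N e Ps J \<omega>"
  have "h \<rho> = (\<Sum>P\<in>pauli_strings n. ?c P * expval (pauli_mat P) \<rho>)" for \<rho>
  proof -
    have "(\<Sum>P\<in>pauli_strings n. ?c P * expval (pauli_mat P) \<rho>) = (\<Sum>P\<in>pauli_strings n. \<Sum>i<length Ps.
      if P = Ps ! i then learned_coefficient (observable n \<alpha>) N e Ps J \<omega> i * expval (pauli_mat (Ps ! i)) \<rho> else 0)"
      by (simp add: coefficient_of_def sum_distrib_right if_distrib cong: if_cong) (intro sum.cong refl; auto)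
    also have "\<dots> = (\<Sum>i<length Ps. \<Sum>P\<in>pauli_strings n.
      if P = Ps ! i then learned_coefficient (observable n \<alpha>) N e Ps J \<omega> i * expval (pauli_mat (Ps ! i)) \<rho> else 0)"
      by (rule sum.swap)
    also have "\<dots> = h \<rho>"
      unfolding h_def learned_function_def using Ps nth_mem finite_pauli_strings by (intro sum.cong refl) (auto simp: subset_iff)
    finally show ?thesis ..
  qed
  then have diff: "\<bar>h \<rho> - expval (observable n \<alpha>) \<rho>\<bar>\<^sup>2 = (\<Sum>P\<in>pauli_strings n. (?c P - \<alpha> P) * expval (pauli_mat P) \<rho>)\<^sup>2"
    if "\<rho> \<in> space D" for \<rho>
    using that by (simp add: expval_observable sum_subtractf algebra_simps)
  note sm = second_moment_combination[OF order_refl, of "\<lambda>P. ?c P - \<alpha> P"]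
  show "integrable D (\<lambda>\<rho>. \<bar>h \<rho> - expval (observable n \<alpha>) \<rho>\<bar>\<^sup>2)"
    using sm(1) by (subst Bochner_Integration.integrable_cong[OF refl diff])
  show "(LINT \<rho>|D. \<bar>h \<rho> - expval (observable n \<alpha>) \<rho>\<bar>\<^sup>2) = (\<Sum>P\<in>pauli_strings n. (?c P - \<alpha> P)\<^sup>2 * moment P)"
    using sm(2) by (subst Bochner_Integration.integral_cong[OF refl diff])
qed

lemma measurable_coefficient_of:
  assumes Ps: "set Ps \<subseteq> pauli_strings n"
  shows "(\<lambda>\<omega>. coefficient_of \<alpha> N e Ps J \<omega> P) \<in> borel_measurable (\<Pi>\<^sub>M l\<in>{..<N}. D)"
proof -
  let ?M = "\<Pi>\<^sub>M l\<in>{..<N}. D" and ?O = "observable n \<alpha>"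
  have len: "length (Ps ! i) = n" if "i < length Ps" for i
    using Ps nth_mem[OF that] by (auto simp: pauli_strings_def)
  \<comment> \<open>Outside the table \<open>Ps ! i\<close> is unspecified, so the scores are set to
    \<open>0\<close> there to be measurable at every index; the selection never looks at these
    indices.\<close>
  define s where "s \<omega> i = (if i < length Ps then score ?O N e \<omega> (Ps ! i) else 0)" for \<omega> i
  have ms: "(\<lambda>\<omega>. s \<omega> i) \<in> borel_measurable ?M" for i
  proof (cases "i < length Ps")
    case True
    note [measurable] = measurable_samples[OF len[OF True]]
    show ?thesis using True by (simp add: s_def score_def)
  qed (simp add: s_def)
  have amx: "argmax f m = argmax g m" if "\<And>i. i < m \<Longrightarrow> f i = g i" for f g :: "nat \<Rightarrow> real" and m
    using that
  proof (induction m)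
    case (Suc m)
    then have "argmax f m = argmax g m" by simp
    moreover have "f (argmax g m) = g (argmax g m)"
      using Suc.prems[of "argmax g m"] argmax_less[of m g] by (cases "m = 0") (auto simp: less_Suc_eq)
    ultimately show ?case using Suc.prems[of m] by simp
  qed simp
  have rem: "remaining f m j i = remaining g m j i" if "\<And>i. i < m \<Longrightarrow> f i = g i" "i < m" for f g :: "nat \<Rightarrow> real" and m j i
    using that(2)
  proof (induction j arbitrary: i)
    case (Suc j)
    have "argmax (remaining f m j) m = argmax (remaining g m j) m" by (rule amx) (rule Suc.IH)
    then show ?case using Suc by simp
  qed (use that(1) in simp)
  have kp: "kept (\<lambda>i. score ?O N e \<omega> (Ps ! i)) (length Ps) J = kept (s \<omega>) (length Ps) J" for \<omega>
    unfolding kept_def by (intro image_cong refl amx rem) (simp_all add: s_def)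
  have "(\<lambda>\<omega>. if Ps ! i = P then learned_coefficient ?O N e Ps J \<omega> i else 0) \<in> borel_measurable ?M" if "i < length Ps" for i
  proof -
    note [measurable] = measurable_samples[OF len[OF that]] sets_kept[where s = s and i = i and m = "length Ps" and j = J, OF ms]
    show ?thesis unfolding learned_coefficient_def kp estimate_def by measurable
  qed
  then show ?thesis unfolding coefficient_of_def by (intro borel_measurable_sum) auto
qed

end

lemma cutoff_weight_antimono: "0 < a \<Longrightarrow> a \<le> b \<Longrightarrow> cutoff_weight b \<le> cutoff_weight a"
  unfolding cutoff_weight_def by (intro nat_mono ceiling_mono) (simp add: frac_le)

lemma (in invariant_states) coefficient_of_nth:
  assumes "distinct Ps" "i < length Ps"
  shows "coefficient_of \<alpha> N e Ps J \<omega> (Ps ! i) = learned_coefficient (observable n \<alpha>) N e Ps J \<omega> i"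
proof -
  have "coefficient_of \<alpha> N e Ps J \<omega> (Ps ! i) =
    (\<Sum>j<length Ps. if j = i then learned_coefficient (observable n \<alpha>) N e Ps J \<omega> i else 0)"
    unfolding coefficient_of_def using assms by (intro sum.cong) (auto simp: nth_eq_iff_index_eq)
  then show ?thesis using assms by simp
qed

text \<open>Here \<open>T\<close> consists of the strings of weight at most \<open>K\<close> and
  \<open>S\<close> of the selected ones. Heavier strings have moment at most
  \<open>(2/3) ^ Suc K\<close>, which is at most \<open>2/3 * e\<close> by the choice of
  \<open>K\<close>.\<close>

lemma (in invariant_states) accurate_error:
  fixes \<alpha> :: "pauli list \<Rightarrow> real"
  assumes \<epsilon>: "0 < \<epsilon>" "\<epsilon> \<le> 1 / 4" and \<epsilon>': "0 < \<epsilon>'" "\<epsilon>' \<le> 1 / 4" and k: "k = cutoff_weight \<epsilon>" and N: "0 < N"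
  defines "e \<equiv> max \<epsilon> \<epsilon>'" and "r \<equiv> 2 * real k / (real k + 1)"
  defines "K \<equiv> cutoff_weight e"
  defines "A \<equiv> spectral_norm (truncated_observable n k \<alpha>)" and "B \<equiv> spectral_norm (observable n \<alpha>)"
  assumes Ps: "distinct Ps" "set Ps = low_weight n K"
    and J: "J = min (length Ps) (nat \<lceil>((1 / (\<epsilon> * \<epsilon>')) ^ 25) ^ (K + 1)\<rceil>)"
    and \<gamma>: "0 \<le> \<gamma>" "\<gamma>\<^sup>2 = e\<^sup>2 / (864 * real J)" and acc: "accurate \<alpha> (low_weight n K) N \<gamma> \<omega>"
  shows "(\<Sum>P\<in>pauli_strings n. (coefficient_of \<alpha> N e Ps J \<omega> P - \<alpha> P)\<^sup>2 * moment P)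
    \<le> (\<epsilon> + \<epsilon>') * B\<^sup>2 + \<epsilon>' * A powr r * B powr (2 - r)"
proof -
  let ?T = "low_weight n K" and ?O = "observable n \<alpha>" and ?m1 = "((1 / (\<epsilon> * \<epsilon>')) ^ 25) ^ (K + 1)"
  have e: "0 < e" "e \<le> 1 / 4" and e1: "e \<le> 1" using \<epsilon> \<epsilon>' by (auto simp: e_def)
  have len: "length Ps = card ?T" using Ps by (simp flip: distinct_card)
  have m1: "1 \<le> ?m1" 
  proof -
    have "\<epsilon> * \<epsilon>' \<le> 1 * 1" using \<epsilon> \<epsilon>' by (intro mult_mono) simp_all
    then show ?thesis using \<epsilon> \<epsilon>' by (intro one_le_power) simp
  qed
  have "replicate n PI \<in> ?T" by (simp add: low_weight_def pauli_strings_def pauli_weight_def)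
  then have "Ps \<noteq> []" using Ps by auto
  then have J0: "0 < J" using m1 by (simp add: J)
  have B0: "0 \<le> B" unfolding B_def by (intro spectral_norm_nonneg) (simp add: observable_def pauli_combination_def)
  define sc where "sc = (\<lambda>i. score ?O N e \<omega> (Ps ! i))"
  define I where "I = kept sc (length Ps) J"
  have I: "i < length Ps" if "i \<in> I" for i
    using that kept_less[of "length Ps"] \<open>Ps \<noteq> []\<close> by (auto simp: I_def)
  define S where "S = (!) Ps ` I"
  have inj: "inj_on ((!) Ps) I" using Ps(1) I by (auto intro: inj_on_nth)
  have cS: "card S = card I" by (simp add: S_def card_image[OF inj])
  have mem: "P \<in> ?T \<longleftrightarrow> (\<exists>i<length Ps. P = Ps ! i)" for P unfolding Ps(2)[symmetric] in_set_conv_nth by blast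
  have memS: "Ps ! i \<in> S \<longleftrightarrow> i \<in> I" if "i < length Ps" for i
  proof
    assume "Ps ! i \<in> S"
    then obtain j where j: "j \<in> I" "Ps ! i = Ps ! j" by (auto simp: S_def)
    then show "i \<in> I" using nth_eq_iff_index_eq[OF Ps(1) that I[OF j(1)]] by simp
  qed (simp add: S_def)
  define xh where "xh P = sample_square N \<omega> P / real N" for P
  define yh where "yh P = sample_product ?O N \<omega> P / real N" for P
  have lt: "sample_square N \<omega> P < e / 12 * real N \<longleftrightarrow> \<not> e / 12 \<le> xh P" for P
    using N by (simp add: xh_def field_simps not_le)
  have "(\<Sum>P\<in>pauli_strings n. (coefficient_of \<alpha> N e Ps J \<omega> P - \<alpha> P)\<^sup>2 * moment P) \<le> 7 / 8 * e * B\<^sup>2 +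
     (\<Sum>P\<in>{P \<in> ?T. card S = J \<and> J < card ?T \<and> \<bar>\<alpha> P\<bar> \<le> 48 * B / (e * sqrt (real J))}. (\<alpha> P)\<^sup>2)"
  proof (rule estimation_error_bound[where xh = xh and yh = yh and \<gamma> = \<gamma>])
    show "finite (pauli_strings n)" "?T \<subseteq> pauli_strings n" by (rule finite_pauli_strings, rule low_weight_subset)
    show "0 \<le> moment P" for P by (rule moment_nonneg)
    have ml: "moment P \<le> (2 / 3) ^ pauli_weight P" if "P \<in> pauli_strings n" for P
      using that moment_le by (simp add: pauli_strings_def)
    show "moment P \<le> 1" if "P \<in> pauli_strings n" for P
      using ml[OF that] power_le_one[of "2 / 3 :: real" "pauli_weight P"] by simp
    show "moment P \<le> 2 / 3 * e" if "P \<in> pauli_strings n - ?T" for P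
    proof -
      have w: "Suc K \<le> pauli_weight P" using that by (auto simp: low_weight_def)
      have "1 \<le> (3 / 2) ^ K * e" unfolding K_def using cutoff_weight_power(2)[OF e(1) e1] .
      then have "(2 / 3) ^ K \<le> e" by (simp add: power_divide field_simps)
      moreover have "(2 / 3 :: real) ^ pauli_weight P \<le> (2 / 3) ^ Suc K" using w by (intro power_decreasing) simp_all
      ultimately show ?thesis using ml[of P] that by simp
    qed
    show "(\<Sum>P\<in>pauli_strings n. (\<alpha> P)\<^sup>2) \<le> B\<^sup>2"
      unfolding B_def observable_def by (rule sum_squares_le_spectral) simp
    show "\<bar>xh P - moment P\<bar> \<le> \<gamma>" if "P \<in> ?T" for P
    proof -
      have "\<bar>real N * (xh P - moment P)\<bar> \<le> real N * \<gamma>"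
        using acc that N by (simp add: accurate_def xh_def right_diff_distrib)
      then show ?thesis using N by (simp add: abs_mult)
    qed
    show "\<bar>yh P - \<alpha> P * moment P\<bar> \<le> \<gamma> * B" if "P \<in> ?T" for P
    proof -
      have "\<bar>real N * (yh P - \<alpha> P * moment P)\<bar> \<le> real N * (\<gamma> * B)"
        using acc that N by (simp add: accurate_def yh_def right_diff_distrib B_def)
      then show ?thesis using N by (simp add: abs_mult)
    qed
    show "S \<subseteq> ?T" using I Ps(2) by (auto simp: S_def)
    show "card S \<le> J" unfolding cS I_def by (rule card_kept_le)
    show "coefficient_of \<alpha> N e Ps J \<omega> P = (if P \<in> S \<and> e / 12 \<le> xh P then yh P / xh P else 0)" for P
    proof (cases "P \<in> ?T")
      case True
      then obtain i where i: "i < length Ps" "P = Ps ! i" using mem by auto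
      have "sample_product ?O N \<omega> P / sample_square N \<omega> P = yh P / xh P" using N by (simp add: xh_def yh_def)
      then show ?thesis
        using coefficient_of_nth[OF Ps(1) i(1)] memS[OF i(1)] i lt[of P]
        by (simp add: learned_coefficient_def estimate_def I_def sc_def)
    next
      case False
      then have "coefficient_of \<alpha> N e Ps J \<omega> P = 0" using mem by (auto simp: coefficient_of_def intro!: sum.neutral)
      moreover have "P \<notin> S" using False I mem by (auto simp: S_def)
      ultimately show ?thesis by simp
    qed
    show "card S = J \<and> (\<forall>Q\<in>S. e / 12 \<le> xh Q \<and> \<bar>yh P\<bar> \<le> \<bar>yh Q\<bar>)" if P: "P \<in> ?T - S" "e / 12 \<le> xh P" for P
    proof -
      obtain i where i: "i < length Ps" "P = Ps ! i" using P mem by auto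
      have sc: "sc i = \<bar>sample_product ?O N \<omega> P\<bar>" using lt[of P] P(2) by (simp add: sc_def i(2) score_def)
      have "i \<notin> I" using memS[OF i(1)] P i by simp
      then have d: "card I = J" "\<And>j. j \<in> I \<Longrightarrow> sc i \<le> sc j"
        using kept_dominates[of i "length Ps" sc J] i(1) sc by (auto simp: I_def)
      have "e / 12 \<le> xh (Ps ! j) \<and> \<bar>yh P\<bar> \<le> \<bar>yh (Ps ! j)\<bar>" if "j \<in> I" for j
      proof -
        have ge: "\<bar>sample_product ?O N \<omega> P\<bar> \<le> sc j" using d(2)[OF that] sc by simp
        then have "sc j \<noteq> -1" by linarith
        then have x: "\<not> sample_square N \<omega> (Ps ! j) < e / 12 * real N" by (auto simp: sc_def score_def)
        then have "\<bar>sample_product ?O N \<omega> P\<bar> \<le> \<bar>sample_product ?O N \<omega> (Ps ! j)\<bar>" using ge by (simp add: sc_def score_def)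
        then have "\<bar>yh P\<bar> \<le> \<bar>yh (Ps ! j)\<bar>" using N by (simp add: yh_def divide_right_mono)
        then show ?thesis using x lt[of "Ps ! j"] by simp
      qed
      then show ?thesis using d(1) cS by (auto simp: S_def)
    qed
  qed (use e B0 J0 \<gamma> in simp_all)
  also have "(\<Sum>P\<in>{P \<in> ?T. card S = J \<and> J < card ?T \<and> \<bar>\<alpha> P\<bar> \<le> 48 * B / (e * sqrt (real J))}. (\<alpha> P)\<^sup>2)
    \<le> \<epsilon>' / 8 * (B\<^sup>2 + A powr r * B powr (2 - r))" (is "?sum \<le> ?bound")
  \<comment> \<open>Strings are discarded only if the table is larger than \<open>J\<close>; then
    \<open>J\<close> is at least the power required by
    \<open>discarded_coefficients_bound\<close>.\<close>
  proof (cases "J < card ?T")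
    case True
    then have "J = nat \<lceil>?m1\<rceil>" using J len by (auto simp: min_def split: if_splits)
    then have m: "?m1 \<le> real J" using real_nat_ceiling_ge by simp
    have Kk: "K \<le> k" unfolding K_def k using \<epsilon> by (intro cutoff_weight_antimono) (simp_all add: e_def)
    have "?sum \<le> (\<Sum>P\<in>{P \<in> ?T. \<bar>\<alpha> P\<bar> \<le> 48 * B / (e * sqrt (real J))}. (\<alpha> P)\<^sup>2)"
      using finite_low_weight by (intro sum_mono2) auto
    also have "\<dots> \<le> ?bound"
      using discarded_coefficients_bound[OF \<epsilon> \<epsilon>' Kk k m, of \<alpha> n] by (simp add: e_def A_def B_def r_def)
    finally show ?thesis .
  next
    case False
    then have "?sum = 0" by (intro sum.neutral) auto
    then show ?thesis using \<epsilon>' by simp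
  qed
  also have "7 / 8 * e * B\<^sup>2 + ?bound \<le> (\<epsilon> + \<epsilon>') * B\<^sup>2 + \<epsilon>' * A powr r * B powr (2 - r)"
  proof -
    have "7 / 8 * e + \<epsilon>' / 8 \<le> \<epsilon> + \<epsilon>'" using \<epsilon> \<epsilon>' by (auto simp: e_def max_def)
    then have "(7 / 8 * e + \<epsilon>' / 8) * B\<^sup>2 \<le> (\<epsilon> + \<epsilon>') * B\<^sup>2" by (rule mult_right_mono) simp
    moreover have "\<epsilon>' / 8 * (A powr r * B powr (2 - r)) \<le> \<epsilon>' * (A powr r * B powr (2 - r))"
      using \<epsilon>' by (intro mult_right_mono) simp_all
    ultimately show ?thesis by (simp add: algebra_simps)
  qed
  finally show ?thesis by simp
qed

section \<open>Sample size\<close>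

lemma pauli_weight_Cons: "pauli_weight (p # P) = (if p = PI then 0 else 1) + pauli_weight P"
  by (simp add: pauli_weight_def)

lemma card_weight_eq: "card {P. length P = n \<and> pauli_weight P = j} = 3 ^ j * (n choose j)"
proof (induction n arbitrary: j)
  case 0
  have "{P. length P = 0 \<and> pauli_weight P = j} = (if j = 0 then {[]} else {})"
    by (auto simp: pauli_weight_def)
  then show ?case by (cases j) auto
next
  case (Suc n)
  let ?W = "\<lambda>n j. {P. length P = n \<and> pauli_weight P = j}"
  have fin: "finite (?W n j)" for j
    using finite_pauli_strings[of n] by (rule rev_finite_subset) (auto simp: pauli_strings_def)
  show ?case
  proof (cases j)
    case 0
    have "?W (Suc n) 0 = (#) PI ` ?W n 0"
      by (auto simp: length_Suc_conv pauli_weight_Cons split: if_splits)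
    then show ?thesis using Suc[of 0] 0 by (simp add: card_image)
  next
    case (Suc i)
    let ?A = "\<lambda>p. (#) p ` ?W n i"
    have "?W (Suc n) (Suc i) = (#) PI ` ?W n (Suc i) \<union> (?A PX \<union> (?A PY \<union> ?A PZ))" (is "?L = ?R")
    proof
      show "?L \<subseteq> ?R"
      proof
        fix P assume P: "P \<in> ?L"
        then obtain p Q where pQ: "P = p # Q" "length Q = n" by (auto simp: length_Suc_conv)
        then show "P \<in> ?R" using P by (cases p) (auto simp: pauli_weight_Cons)
      qed
      show "?R \<subseteq> ?L" by (auto simp: pauli_weight_Cons)
    qed
    moreover have "card (?A p) = card (?W n i)" for p by (simp add: card_image)
    moreover have "card ((#) PI ` ?W n (Suc i) \<union> (?A PX \<union> (?A PY \<union> ?A PZ))) =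
      card ((#) PI ` ?W n (Suc i)) + (card (?A PX) + (card (?A PY) + card (?A PZ)))"
      using fin by (subst card_Un_disjoint, simp, simp, blast)+ (rule refl)
    ultimately have "card (?W (Suc n) (Suc i)) = card (?W n (Suc i)) + 3 * card (?W n i)"
      by (simp add: card_image)
    then show ?thesis by (simp add: Suc Suc.IH algebra_simps)
  qed
qed

text \<open>The running time leaves no room for a factor \<open>3 ^ K\<close>, so each
  \<open>3 ^ j\<close> is set against the factorial in the binomial coefficient: the sum of
  \<open>3 ^ j / fact j\<close> is at most \<open>exp 3\<close>, which is below
  \<open>21\<close>.\<close>

lemma card_low_weight_le:
  assumes n: "1 \<le> n"
  shows "real (card (low_weight n K)) \<le> 21 * real n ^ K"
proof -
  have "low_weight n K = (\<Union>j\<le>K. {P. length P = n \<and> pauli_weight P = j})"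
    by (auto simp: low_weight_def pauli_strings_def)
  then have "card (low_weight n K) \<le> (\<Sum>j\<le>K. card {P. length P = n \<and> pauli_weight P = j})"
    by (simp add: card_UN_le)
  then have "real (card (low_weight n K)) \<le> real (\<Sum>j\<le>K. 3 ^ j * (n choose j))"
    unfolding card_weight_eq by (simp only: of_nat_le_iff)
  also have "\<dots> = (\<Sum>j\<le>K. 3 ^ j * real (n choose j))" by simp
  also have "\<dots> \<le> (\<Sum>j\<le>K. real n ^ K * (3 ^ j / fact j))"
  proof (intro sum_mono)
    fix j assume j: "j \<in> {..K}"
    have "real ((n choose j) * fact j) \<le> real (n ^ j)" using binomial_fact_pow[of n j] by (simp only: of_nat_le_iff)
    also have "\<dots> \<le> real n ^ K" using n j by (simp add: power_increasing)
    finally have "real (n choose j) \<le> real n ^ K / fact j" by (simp add: field_simps)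
    then have "3 ^ j * real (n choose j) \<le> 3 ^ j * (real n ^ K / fact j)" by (intro mult_left_mono) simp_all
    then show "3 ^ j * real (n choose j) \<le> real n ^ K * (3 ^ j / fact j)" by (simp add: mult.commute)
  qed
  also have "\<dots> = real n ^ K * (\<Sum>j\<le>K. 3 ^ j / fact j)" by (simp add: sum_distrib_left)
  also have "\<dots> \<le> real n ^ K * 21"
  proof (intro mult_left_mono)
    have "(\<Sum>j\<le>K. 3 ^ j / fact j) \<le> exp (3 :: real)"
      unfolding exp_def using summable_exp[of "3 :: real"]
      by (intro order_trans[OF _ sum_le_suminf[of _ "{..K}"]]) (simp_all add: divide_inverse mult.commute scaleR_conv_of_real)
    also have "exp (3 :: real) = exp 1 ^ 3" by (simp flip: exp_of_nat_mult)
    also have "\<dots> \<le> (272 / 100) ^ 3" using e_less_272 by (intro power_mono) simp_all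
    also have "\<dots> \<le> (21 :: real)" by (simp add: power3_eq_cube)
    finally show "(\<Sum>j\<le>K. 3 ^ j / fact j) \<le> (21 :: real)" .
  qed simp
  finally show ?thesis by (simp add: mult.commute)
qed

text \<open>\<open>ln (3/2)\<close> is at least \<open>1/3\<close>, and the \<open>+ 1\<close> pays
  for rounding up.\<close>

lemma cutoff_weight_le:
  assumes "0 < e" "e \<le> 1"
  shows "real (cutoff_weight e) \<le> 3 * ln (1 / e) + 1"
proof (cases "cutoff_weight e")
  case 0
  then show ?thesis using assms by simp
next
  case (Suc i)
  have "(3 / 2) ^ i * e < 1" using cutoff_weight_power(1)[OF assms, of i] Suc by simp
  then have "(3 / 2) ^ i \<le> 1 / e" using assms by (simp add: field_simps)
  then have "ln ((3 / 2) ^ i) \<le> ln (1 / e)" by (subst ln_le_cancel_iff) (use assms in simp_all)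
  then have "real i * ln (3 / 2) \<le> ln (1 / e)" by (simp add: ln_realpow)
  moreover have "1 / 3 \<le> ln (3 / 2 :: real)" using ln_add_one_self_le_self2[of "-1/3 :: real"] by (simp add: ln_div)
  then have "real i * (1 / 3) \<le> real i * ln (3 / 2)" by (intro mult_left_mono) simp_all
  ultimately show ?thesis using Suc by simp
qed

lemma ln_4_ge: "1 \<le> ln (4 :: real)"
proof -
  have "exp 1 \<le> (4 :: real)" using e_less_272 by simp
  then have "ln (exp 1) \<le> ln (4 :: real)" by (subst ln_le_cancel_iff) simp_all
  then show ?thesis by simp
qed

lemma ln_2_ge: "1 / 2 \<le> ln (2 :: real)"
proof -
  have "ln (4 :: real) = ln (2 ^ 2)" by simp
  also have "\<dots> = 2 * ln 2" by (subst ln_realpow) simp_all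
  finally show ?thesis using ln_4_ge by simp
qed

text \<open>Both terms of the minimum are compared with the required number: the first through the
  cap on \<open>J\<close> by a power of \<open>1/(\<epsilon> \<epsilon>')\<close>, the second
  through the number of strings of weight at most \<open>K\<close>. The factor
  \<open>1728 * (k + 8) / e\<^sup>2\<close> is polynomial in \<open>1/\<epsilon>\<close> and
  disappears in the exponents.\<close>

lemma sample_size_ge:
  assumes n: "2 \<le> n" and \<epsilon>: "0 < \<epsilon>" "\<epsilon> \<le> 1 / 4" and \<epsilon>': "0 < \<epsilon>'" "\<epsilon>' \<le> 1 / 4" and \<delta>: "0 < \<delta>" "\<delta> < 1"
  defines "e \<equiv> max \<epsilon> \<epsilon>'" and "k \<equiv> cutoff_weight \<epsilon>"
  defines "K \<equiv> cutoff_weight e"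
  assumes J: "J = min (card (low_weight n K)) (nat \<lceil>((1 / (\<epsilon> * \<epsilon>')) ^ 25) ^ (K + 1)\<rceil>)"
  shows "ln (real n / \<delta>) * (1728 * real J * (real k + 8) / e\<^sup>2) \<le> real (sample_size 522 60 n \<epsilon> \<epsilon>' \<delta>)"
proof -
  define L L' where "L = ln (1 / \<epsilon>)" and "L' = ln (1 / \<epsilon>')"
  define m1 where "m1 = ((1 / (\<epsilon> * \<epsilon>')) ^ 25) ^ (K + 1)"
  have L: "1 \<le> L" "ln 4 \<le> L" and L': "1 \<le> L'"
  proof -
    have "4 \<le> 1 / \<epsilon>" "4 \<le> 1 / \<epsilon>'" using \<epsilon> \<epsilon>' by (simp_all add: field_simps)
    then have "ln 4 \<le> L" "ln 4 \<le> L'" unfolding L_def L'_def by (simp_all add: \<epsilon> \<epsilon>' ln_ge_iff)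
    then show "1 \<le> L" "ln 4 \<le> L" "1 \<le> L'" using ln_4_ge by simp_all
  qed
  have eL: "exp L = 1 / \<epsilon>" "exp L' = 1 / \<epsilon>'" using \<epsilon> \<epsilon>' by (simp_all add: L_def L'_def)
  have e: "0 < e" "e \<le> 1" "1 / e \<le> exp L" using \<epsilon> \<epsilon>' by (auto simp: e_def eL frac_le)
  have lnn: "1 / 2 \<le> ln (real n)"
  proof -
    have "ln 2 \<le> ln (real n)" using n by simp
    then show ?thesis using ln_2_ge by simp
  qed
  have k: "real k \<le> 4 * L" using cutoff_weight_le[of \<epsilon>] \<epsilon> L by (simp add: k_def L_def)
  have Kk: "K \<le> k" unfolding K_def k_def using \<epsilon> by (intro cutoff_weight_antimono) (simp_all add: e_def)
  \<comment> \<open>As \<open>e\<close> is the larger accuracy, its logarithm is the smaller one;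
    its product with \<open>L + L'\<close> is at most \<open>2 * L * L'\<close>.\<close>
  have K: "real K + 1 \<le> 5 * min L L'"
  proof -
    have "ln (1 / e) = min L L'"
      using \<epsilon> \<epsilon>' by (auto simp: e_def L_def L'_def min_def max_def ln_div)
    then show ?thesis using cutoff_weight_le[OF e(1,2)] L L' by (simp add: K_def)
  qed
  have pow4: "4 ^ i \<le> exp (real i * L)" for i
  proof -
    have "4 ^ i = exp (real i * ln 4)" by (simp add: exp_of_nat_mult)
    also have "\<dots> \<le> exp (real i * L)" using L by (simp add: mult_left_mono)
    finally show ?thesis .
  qed
  have common: "(real k + 8) / e\<^sup>2 \<le> 12 * exp (3 * L)"
  proof -
    have "real k + 8 \<le> 12 * exp L" using k L(1) exp_ge_add_one_self[of L] by linarith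
    moreover have "(1 / e)\<^sup>2 \<le> (exp L)\<^sup>2" using e by (intro power_mono) simp_all
    ultimately have "(real k + 8) * (1 / e)\<^sup>2 \<le> 12 * exp L * (exp L)\<^sup>2" by (intro mult_mono) simp_all
    also have "\<dots> = 12 * exp (3 * L)" by (simp add: power2_eq_square mult_exp_exp)
    finally show ?thesis by (simp add: power_divide)
  qed
  have c0: "0 \<le> (real k + 8) / e\<^sup>2" by simp
  have Q1: "1728 * real J * (real k + 8) / e\<^sup>2 \<le> 2 powr (522 * (L * (ln L + L')))"
  proof -
    have m1: "m1 = exp (25 * (L + L') * real (K + 1))"
    proof -
      have "1 / (\<epsilon> * \<epsilon>') = exp (L + L')" by (simp add: exp_add eL)
      then show ?thesis by (simp only: m1_def exp_of_nat_mult[symmetric] power_mult[symmetric]) (simp add: algebra_simps)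
    qed
    have "0 \<le> 25 * (L + L') * real (K + 1)" using L L' by simp
    then have m1_1: "1 \<le> m1" by (simp add: m1)
    have "real J \<le> real (nat \<lceil>m1\<rceil>)" by (simp add: J m1_def)
    also have "\<dots> \<le> m1 + 1" using m1_1 by linarith
    finally have J2: "real J \<le> 2 * m1" using m1_1 by simp
    have "1728 * real J * ((real k + 8) / e\<^sup>2) \<le> 1728 * (2 * m1) * (12 * exp (3 * L))"
      using J2 common c0 m1_1 by (intro mult_mono) simp_all
    also have "\<dots> \<le> m1 * (4 ^ 8 * exp (3 * L))" using m1_1 by simp
    also have "\<dots> \<le> m1 * (exp (real 8 * L) * exp (3 * L))"
      using pow4[of 8] m1_1 by (intro mult_left_mono mult_right_mono) simp_all
    also have "\<dots> = exp (25 * (L + L') * real (K + 1) + 11 * L)"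
      by (simp add: m1 mult_exp_exp algebra_simps)
    also have "\<dots> \<le> exp (261 * (L * L'))"
    proof -
      have "(L + L') * real (K + 1) \<le> (L + L') * (5 * min L L')" using K L L' by (intro mult_left_mono) simp_all
      also have "\<dots> \<le> 2 * max L L' * (5 * min L L')" using L L' by (intro mult_right_mono) simp_all
      also have "\<dots> = 10 * (L * L')" by (simp add: min_def max_def)
      finally have "(L + L') * real (K + 1) \<le> 10 * (L * L')" .
      moreover have "L * 1 \<le> L * L'" using L L' by (intro mult_left_mono) simp_all
      ultimately have "25 * ((L + L') * real (K + 1)) + 11 * L \<le> 261 * (L * L')" by linarith
      then show ?thesis by (simp only: exp_le_cancel_iff mult.assoc)
    qed
    \<comment> \<open>\<open>261\<close> is \<open>25 * 10 + 11\<close>. Since \<epsilon> is at most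
      \<open>1/4\<close>, \<open>ln L\<close> is nonnegative and may be added;
      \<open>ln 2 \<ge> 1/2\<close>, from the base \<open>2\<close>, doubles the constant.\<close>
    also have "261 * (L * L') \<le> 522 * (L * (ln L + L')) * ln 2"
    proof -
      have "L * L' \<le> L * (ln L + L')" (is "_ \<le> ?y") using L by (intro mult_left_mono) simp_all
      moreover have "(522 * ?y) * (1 / 2) \<le> 522 * ?y * ln 2"
        using L L' ln_2_ge by (intro mult_left_mono) simp_all
      ultimately show ?thesis by linarith
    qed
    then have "exp (261 * (L * L')) \<le> exp (522 * (L * (ln L + L')) * ln 2)" by simp
    finally show ?thesis by (simp add: powr_def)
  qed
  have Q2: "1728 * real J * (real k + 8) / e\<^sup>2 \<le> 2 powr (60 * (L * ln (real n)))"
  proof -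
    have "real J \<le> real (card (low_weight n K))" by (simp add: J)
    also have "\<dots> \<le> 21 * real n ^ K" using n by (intro card_low_weight_le) simp
    finally have "1728 * real J * ((real k + 8) / e\<^sup>2) \<le> 1728 * (21 * real n ^ K) * (12 * exp (3 * L))"
      using common c0 by (intro mult_mono) simp_all
    also have "\<dots> \<le> real n ^ K * (4 ^ 10 * exp (3 * L))" by simp
    also have "\<dots> \<le> real n ^ K * (exp (real 10 * L) * exp (3 * L))"
      using pow4[of 10] by (intro mult_left_mono mult_right_mono) simp_all
    also have "\<dots> = exp (real K * ln (real n) + 13 * L)"
      using n by (simp add: mult_exp_exp exp_add exp_of_nat_mult)
    also have "\<dots> \<le> exp (30 * (L * ln (real n)))"
    proof -
      have "real K * ln (real n) \<le> (4 * L) * ln (real n)"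
        using Kk k lnn by (intro mult_right_mono) simp_all
      moreover have "L * (1 / 2) \<le> L * ln (real n)" using L lnn by (intro mult_left_mono) simp_all
      ultimately show ?thesis by simp
    qed
    also have "30 * (L * ln (real n)) \<le> 60 * (L * ln (real n)) * ln 2"
    proof -
      have "0 \<le> 60 * (L * ln (real n))" using L lnn by simp
      then have "60 * (L * ln (real n)) * (1 / 2) \<le> 60 * (L * ln (real n)) * ln 2"
        using ln_2_ge by (intro mult_left_mono)
      then show ?thesis by simp
    qed
    then have "exp (30 * (L * ln (real n))) \<le> exp (60 * (L * ln (real n)) * ln 2)" by simp
    finally show ?thesis by (simp add: powr_def)
  qed
  have "1 \<le> real n / \<delta>" using n \<delta> by (simp add: field_simps)
  then have "0 \<le> ln (real n / \<delta>)" by simp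
  then have "ln (real n / \<delta>) * (1728 * real J * (real k + 8) / e\<^sup>2) \<le>
    ln (real n / \<delta>) * min (2 powr (522 * (L * (ln L + L')))) (2 powr (60 * (L * ln (real n))))" (is "_ \<le> ?x")
    using Q1 Q2 by (intro mult_left_mono) simp_all
  also have "?x \<le> real (nat \<lceil>?x\<rceil>)" by (rule real_nat_ceiling_ge)
  also have "\<dots> \<le> real (sample_size 522 60 n \<epsilon> \<epsilon>' \<delta>)" by (simp add: sample_size_def L_def L'_def)
  finally show ?thesis .
qed

section \<open>The learning theorem\<close>

text \<open>\<open>4 * 21 * n ^ k\<close> is below \<open>2 ^ 7 * n ^ k\<close>, whose logarithm is
  at most \<open>(k + 7) * ln (n / \<delta>)\<close>; one more unit accounts for \<delta> itself.
  The factor \<open>1728\<close> is \<open>2 * 864\<close>.\<close>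

lemma failure_probability_le:
  assumes n: "2 \<le> n" and \<delta>: "0 < \<delta>" "\<delta> < 1" and c: "0 < c" "c \<le> 21 * real n ^ k" and J: "0 < J" and e: "0 < e"
    and N: "ln (real n / \<delta>) * (1728 * J * (real k + 8) / e\<^sup>2) \<le> real N"
    and \<gamma>: "\<gamma>\<^sup>2 = e\<^sup>2 / (864 * J)"
  shows "4 * c * exp (- real N * \<gamma>\<^sup>2 / 2) \<le> \<delta>"
proof -
  define l where "l = ln (real n / \<delta>)"
  have l: "l = ln (real n) - ln \<delta>" using n \<delta> by (simp add: l_def ln_div)
  have ln2: "ln 2 \<le> ln (real n)" "ln \<delta> \<le> 0" using n \<delta> by simp_all
  have "ln (4 * c) \<le> ln (128 * real n ^ k)" using c by (subst ln_le_cancel_iff) (use n in simp_all)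
  also have "\<dots> = ln (2 ^ 7) + real k * ln (real n)" using n by (simp add: ln_mult ln_realpow)
  also have "ln (2 ^ 7 :: real) = 7 * ln 2" by (subst ln_realpow) simp_all
  also have "7 * ln 2 + real k * ln (real n) \<le> 7 * l + real k * l"
    using ln2 by (intro add_mono mult_left_mono) (simp_all add: l)
  finally have "ln (4 * c) - ln \<delta> \<le> (real k + 8) * l"
    using ln2 ln_2_ge by (simp add: algebra_simps l)
  also have "\<dots> \<le> real N * (e\<^sup>2 / (1728 * J))"
    using N J e by (simp add: l_def field_simps)
  also have "\<dots> = real N * \<gamma>\<^sup>2 / 2" by (simp add: \<gamma>)
  finally have "ln (4 * c) - real N * \<gamma>\<^sup>2 / 2 \<le> ln \<delta>" by simp
  then have "exp (ln (4 * c) - real N * \<gamma>\<^sup>2 / 2) \<le> exp (ln \<delta>)" by (simp only: exp_le_cancel_iff)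
  moreover have "4 * c * exp (- real N * \<gamma>\<^sup>2 / 2) = exp (ln (4 * c) - real N * \<gamma>\<^sup>2 / 2)"
  proof -
    have "4 * c * exp (- real N * \<gamma>\<^sup>2 / 2) = exp (ln (4 * c)) * exp (- real N * \<gamma>\<^sup>2 / 2)" using c by simp
    then show ?thesis unfolding mult_exp_exp by simp
  qed
  ultimately show ?thesis using \<delta> by simp
qed

text \<open>All products are at most \<open>N * m\<close>, because neither the cutoff nor the number
  of kept strings exceeds the sample size. \<open>62\<close> is the sum of the coefficients in the
  training time, and \<open>1302 = 62 * 21\<close>.\<close>

lemma running_time_le:
  fixes m K N J :: nat
  assumes m: "1 \<le> m" "real m \<le> 21 * x" and N: "1 \<le> N" "K \<le> N" "J \<le> N"
  shows "real (m * (6 * K + 4 * N + 26) + J * (4 * m + 7) + 4 * K + 11) \<le> 1302 * (real N * x)"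
    and "real (m * (6 * K + 7) + 4) \<le> 1302 * (real N * x)"
proof -
  have p: "K * m \<le> N * m" "J * m \<le> N * m" "m \<le> N * m" "N \<le> N * m" "1 \<le> N * m" using m N by simp_all
  have "m * (6 * K + 4 * N + 26) + J * (4 * m + 7) + 4 * K + 11 =
     6 * (K * m) + 4 * (N * m) + 26 * m + 4 * (J * m) + 7 * J + 4 * K + 11" by (simp add: algebra_simps)
  also have "\<dots> \<le> 62 * (N * m)" using p N by linarith
  finally have t: "m * (6 * K + 4 * N + 26) + J * (4 * m + 7) + 4 * K + 11 \<le> 62 * (N * m)" .
  have "m * (6 * K + 7) + 4 = 6 * (K * m) + 7 * m + 4" by (simp add: algebra_simps)
  also have "\<dots> \<le> 62 * (N * m)" using p by linarith
  finally have u: "m * (6 * K + 7) + 4 \<le> 62 * (N * m)" .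
  have "real N * real m \<le> real N * (21 * x)" using m by (intro mult_left_mono) simp_all
  then have "real (62 * (N * m)) \<le> 1302 * (real N * x)" by (simp add: mult.left_commute mult.commute)
  then show "real (m * (6 * K + 4 * N + 26) + J * (4 * m + 7) + 4 * K + 11) \<le> 1302 * (real N * x)"
    and "real (m * (6 * K + 7) + 4) \<le> 1302 * (real N * x)"
    using t u by (meson of_nat_le_iff order_trans)+
qed

lemma (in invariant_states) learning_guarantee:
  fixes \<alpha> :: "pauli list \<Rightarrow> real"
  assumes n: "2 \<le> n" and \<epsilon>: "0 < \<epsilon>" "\<epsilon> \<le> 1 / 4" and \<epsilon>': "0 < \<epsilon>'" "\<epsilon>' \<le> 1 / 4" and \<delta>: "0 < \<delta>" "\<delta> < 1"
  defines "k \<equiv> cutoff_weight \<epsilon>" and "N \<equiv> sample_size 522 60 n \<epsilon> \<epsilon>' \<delta>"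
  defines "r \<equiv> 2 * real k / (real k + 1)"
  defines "A \<equiv> spectral_norm (truncated_observable n k \<alpha>)" and "B \<equiv> spectral_norm (observable n \<alpha>)"
  obtains h :: "(nat \<Rightarrow> complex mat) \<Rightarrow> complex mat \<Rightarrow> real" where
    "\<And>\<omega>. learns training_program prediction_program n k N \<epsilon> \<epsilon>' \<delta> (observable n \<alpha>) \<omega> (1302 * (real N * real n ^ k)) (h \<omega>)"
    "1 - \<delta> \<le> measure (\<Pi>\<^sub>M l\<in>{..<N}. D) {\<omega> \<in> space (\<Pi>\<^sub>M l\<in>{..<N}. D).
      integrable D (\<lambda>\<rho>. \<bar>h \<omega> \<rho> - expval (observable n \<alpha>) \<rho>\<bar>\<^sup>2) \<and>
      (LINT \<rho>|D. \<bar>h \<omega> \<rho> - expval (observable n \<alpha>) \<rho>\<bar>\<^sup>2) \<le> (\<epsilon> + \<epsilon>') * B\<^sup>2 + \<epsilon>' * A powr r * B powr (2 - r)}"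
proof -
  let ?O = "observable n \<alpha>" and ?M = "\<Pi>\<^sub>M l\<in>{..<N}. D"
  define e where "e = max \<epsilon> \<epsilon>'"
  define K where "K = cutoff_weight e"
  define m where "m = card (low_weight n K)"
  define J where "J = min m (nat \<lceil>((1 / (\<epsilon> * \<epsilon>')) ^ 25) ^ (K + 1)\<rceil>)"
  define \<gamma> where "\<gamma> = sqrt (e\<^sup>2 / (864 * real J))"
  define bound where "bound = (\<epsilon> + \<epsilon>') * B\<^sup>2 + \<epsilon>' * A powr r * B powr (2 - r)"
  interpret P: prob_space ?M by (rule prob_space_PiM) (rule prob_space_axioms)
  have e: "0 < e" "e \<le> 1 / 4" using \<epsilon> \<epsilon>' by (auto simp: e_def)
  have Kk: "K \<le> k" unfolding K_def k_def using \<epsilon> by (intro cutoff_weight_antimono) (simp_all add: e_def)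
  obtain Ps where Ps: "distinct Ps" "set Ps = low_weight n K"
    and train: "\<And>\<omega>. run (training_env n k ?O N \<omega>) training_program (initial_memory n N \<epsilon> \<epsilon>' \<delta>)
      (m * (6 * K + 4 * N + 26) + J * (4 * m + 7) + 4 * K + 11) (model n Ps (learned_coefficient ?O N e Ps J \<omega>))"
    by (rule run_training_program[OF \<epsilon>(1) \<epsilon>'(1) _ \<delta>(2), of k n ?O N, folded e_def, folded K_def, folded m_def, folded J_def])
      (use e Kk in auto)
  have len: "length Ps = m" using Ps by (simp add: m_def flip: distinct_card)
  have Ps_sub: "set Ps \<subseteq> pauli_strings n" unfolding Ps(2) by (rule low_weight_subset)
  have "replicate n PI \<in> low_weight n K" by (simp add: low_weight_def pauli_strings_def pauli_weight_def)
  then have m1: "1 \<le> m" unfolding m_def using finite_low_weight by (metis One_nat_def Suc_leI card_gt_0_iff empty_iff)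
  have "real m \<le> 21 * real n ^ K" unfolding m_def using n by (intro card_low_weight_le) simp
  also have "\<dots> \<le> 21 * real n ^ k" using n Kk by (intro mult_left_mono power_increasing) simp_all
  finally have m2: "real m \<le> 21 * real n ^ k" .
  have "0 < ((1 / (\<epsilon> * \<epsilon>')) ^ 25) ^ (K + 1)" using \<epsilon> \<epsilon>' by simp
  then have J1: "1 \<le> J" using m1 unfolding J_def by linarith
  have N: "ln (real n / \<delta>) * (1728 * real J * (real k + 8) / e\<^sup>2) \<le> real N"
    unfolding N_def k_def e_def by (rule sample_size_ge[OF n \<epsilon> \<epsilon>' \<delta>]) (simp add: J_def m_def K_def e_def)
  have N1: "1 \<le> N" by (simp add: N_def sample_size_def)
  \<comment> \<open>The sample dominates both \<open>J\<close> and \<open>k\<close>, as the running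
    time needs: selection makes \<open>J\<close> passes over the table.\<close>
  have NJ: "real J * (real k + 8) \<le> real N"
  proof -
    have "2 \<le> real n / \<delta>" using n \<delta> by (simp add: field_simps)
    then have "ln 2 \<le> ln (real n / \<delta>)" by (subst ln_le_cancel_iff) (use n \<delta> in simp_all)
    then have l: "1 / 2 \<le> ln (real n / \<delta>)" using ln_2_ge by simp
    have "e\<^sup>2 \<le> 1" using e by (simp add: power_le_one)
    then have "2 * e\<^sup>2 \<le> 1728" by simp
    then have "2 * (real J * (real k + 8)) \<le> 1728 * real J * (real k + 8) / e\<^sup>2"
      using e mult_right_mono[of "2 * e\<^sup>2" 1728 "real J * (real k + 8)"] by (simp add: field_simps)
    then have "(1 / 2) * (2 * (real J * (real k + 8))) \<le> ln (real n / \<delta>) * (1728 * real J * (real k + 8) / e\<^sup>2)"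
      using l by (intro mult_mono) simp_all
    then show ?thesis using N by simp
  qed
  have "real J * 1 \<le> real J * (real k + 8)" by (intro mult_left_mono) simp_all
  then have JN: "J \<le> N" using NJ by linarith
  have "1 * real k \<le> real J * (real k + 8)" using J1 by (intro mult_mono) simp_all
  then have KN: "K \<le> N" using NJ Kk by linarith
  define h where "h = learned_function \<alpha> N e Ps J"
  show thesis
  proof
    fix \<omega>
    obtain t s where ts: "exec (training_env n k ?O N \<omega>) training_program (initial_memory n N \<epsilon> \<epsilon>' \<delta>) t s"
      "t \<le> m * (6 * K + 4 * N + 26) + J * (4 * m + 7) + 4 * K + 11" "model n Ps (learned_coefficient ?O N e Ps J \<omega>) s"
      using train[of \<omega>] unfolding run_def by blast
    have "\<exists>u s'. exec (prediction_env n k \<rho>) prediction_program s u s' \<and>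
      real u \<le> 1302 * (real N * real n ^ k) \<and> output_of s' = h \<omega> \<rho>" for \<rho>
    proof -
      have "pauli_weight (Ps ! i) \<le> K" if "i < length Ps" for i
        using nth_mem[OF that] Ps(2) by (auto simp: low_weight_def)
      from run_prediction_program[OF ts(3) this Kk, of \<rho>]
      obtain u s' where u: "exec (prediction_env n k \<rho>) prediction_program s u s'" "u \<le> m * (6 * K + 7) + 4"
        "output_of s' = h \<omega> \<rho>"
        unfolding run_def h_def learned_function_def len by blast
      moreover have "real u \<le> real (m * (6 * K + 7) + 4)" using u(2) by (simp only: of_nat_le_iff)
      ultimately show ?thesis using running_time_le(2)[OF m1 m2 N1 KN JN] order_trans by blast
    qed
    moreover have "real t \<le> real (m * (6 * K + 4 * N + 26) + J * (4 * m + 7) + 4 * K + 11)"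
      using ts(2) by (simp only: of_nat_le_iff)
    then have "real t \<le> 1302 * (real N * real n ^ k)"
      using running_time_le(1)[OF m1 m2 N1 KN JN] order_trans by blast
    ultimately show "learns training_program prediction_program n k N \<epsilon> \<epsilon>' \<delta> ?O \<omega> (1302 * (real N * real n ^ k)) (h \<omega>)"
      unfolding learns_def using ts(1) by blast
  next
    let ?err = "\<lambda>\<omega>. \<Sum>P\<in>pauli_strings n. (coefficient_of \<alpha> N e Ps J \<omega> P - \<alpha> P)\<^sup>2 * moment P"
    let ?good = "{\<omega> \<in> space ?M. integrable D (\<lambda>\<rho>. \<bar>h \<omega> \<rho> - expval ?O \<rho>\<bar>\<^sup>2) \<and>
      (LINT \<rho>|D. \<bar>h \<omega> \<rho> - expval ?O \<rho>\<bar>\<^sup>2) \<le> bound}"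
    let ?acc = "{\<omega> \<in> space ?M. accurate \<alpha> (low_weight n K) N \<gamma> \<omega>}"
    have good: "?good = {\<omega> \<in> space ?M. ?err \<omega> \<le> bound}"
      unfolding h_def using learned_error[OF Ps_sub] by simp
    have [measurable]: "(\<lambda>\<omega>. coefficient_of \<alpha> N e Ps J \<omega> P) \<in> borel_measurable ?M" for P
      by (rule measurable_coefficient_of[OF Ps_sub])
    \<comment> \<open>A nonmeasurable event would have measure \<open>0\<close>, so the comparison
      with \<open>?acc\<close> needs this.\<close>
    have meas: "?good \<in> sets ?M" unfolding good by measurable
    have \<gamma>: "0 \<le> \<gamma>" "\<gamma>\<^sup>2 = e\<^sup>2 / (864 * real J)" by (simp_all add: \<gamma>_def)
    have Jd: "J = min (length Ps) (nat \<lceil>((1 / (\<epsilon> * \<epsilon>')) ^ 25) ^ (cutoff_weight (max \<epsilon> \<epsilon>') + 1)\<rceil>)"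
      by (simp add: J_def len K_def e_def)
    have "?err \<omega> \<le> bound" if "accurate \<alpha> (low_weight n K) N \<gamma> \<omega>" for \<omega>
      unfolding bound_def r_def A_def B_def e_def
      by (rule accurate_error[OF \<epsilon> \<epsilon>' k_def[THEN meta_eq_to_obj_eq] _ Ps(1) _ Jd \<gamma>(1)])
        (use N1 Ps(2) \<gamma>(2) that in \<open>simp_all add: K_def e_def\<close>)
    then have sub: "?acc \<subseteq> ?good" unfolding good by auto
    have "4 * real m * exp (- real N * \<gamma>\<^sup>2 / 2) \<le> \<delta>"
      using failure_probability_le[OF n \<delta> _ m2 _ e(1) N \<gamma>(2)] m1 J1 by simp
    then have "1 - \<delta> \<le> 1 - 4 * real (card (low_weight n K)) * exp (- real N * \<gamma>\<^sup>2 / 2)" by (simp add: m_def)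
    also have "\<dots> \<le> P.prob ?acc" using N1 by (intro prob_accurate low_weight_subset \<gamma>(1)) simp
    also have "\<dots> \<le> P.prob ?good" by (rule P.finite_measure_mono[OF sub meas])
    finally show "1 - \<delta> \<le> P.prob {\<omega> \<in> space ?M. integrable D (\<lambda>\<rho>. \<bar>h \<omega> \<rho> - expval ?O \<rho>\<bar>\<^sup>2) \<and>
      (LINT \<rho>|D. \<bar>h \<omega> \<rho> - expval ?O \<rho>\<bar>\<^sup>2) \<le> (\<epsilon> + \<epsilon>') * B\<^sup>2 + \<epsilon>' * A powr r * B powr (2 - r)}"
      unfolding bound_def .
  qed
qed

text \<open>The sample may be a single state here; training ends after one test, and the empty table
  predicts \<open>0\<close> in four steps.\<close>

lemma learns_trivial:
  assumes "1 \<le> n" "1 \<le> N" "1 \<le> \<delta>"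
  shows "learns training_program prediction_program n k N \<epsilon> \<epsilon>' \<delta> Obs \<omega> (1302 * (real N * real n ^ k)) (\<lambda>_. 0)"
proof -
  let ?s = "initial_memory n N \<epsilon> \<epsilon>' \<delta>"
  have "1 * 1 \<le> real N * real n ^ k" using assms by (intro mult_mono one_le_power) simp_all
  then have T: "4 \<le> 1302 * (real N * real n ^ k)" by simp
  have "exec (training_env n k Obs N \<omega>) training_program ?s (1 + 0) ?s"
    unfolding training_program_def using assms
    by (intro exec.CondFalse exec.Skip) (simp add: initial_memory_def)
  moreover have "real (1 + 0) \<le> 1302 * (real N * real n ^ k)" using T by simp
  moreover have "\<exists>u s'. exec (prediction_env n k \<rho>) prediction_program ?s u s' \<and>
      real u \<le> 1302 * (real N * real n ^ k) \<and> output_of s' = 0" for \<rho>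
  proof -
    obtain u s' where u: "exec (prediction_env n k \<rho>) prediction_program ?s u s'" "u \<le> 4" "output_of s' = 0"
      using run_prediction_program_empty[of ?s "prediction_env n k \<rho>"]
      unfolding run_def by (auto simp: initial_memory_def)
    moreover have "real u \<le> 4" using u(2) by simp
    ultimately show ?thesis using T order_trans by blast
  qed
  ultimately show ?thesis unfolding learns_def by blast
qed

theorem theorem4:
  shows "\<exists>(train :: com) (pred :: com) (C1 :: real) (C2 :: real) (C3 :: real).
    C1 > 0 \<and> C2 > 0 \<and> C3 > 0 \<and>
    (\<forall>(n :: nat) (\<epsilon> :: real) (\<epsilon>' :: real) (\<delta> :: real) (\<alpha> :: pauli list \<Rightarrow> real) (D :: complex mat measure).
      n \<ge> 2 \<longrightarrow> 0 < \<epsilon> \<longrightarrow> \<epsilon> \<le> 1 / 4 \<longrightarrow> 0 < \<epsilon>' \<longrightarrow> \<epsilon>' \<le> 1 / 4 \<longrightarrow> 0 < \<delta> \<longrightarrow>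
      state_distribution n D \<longrightarrow> clifford1_invariant n D \<longrightarrow>
      (let k = cutoff_weight \<epsilon>;
           r = 2 * real k / (real k + 1);
           N = sample_size C1 C2 n \<epsilon> \<epsilon>' \<delta>;
           Obs = observable n \<alpha>;
           M = (\<Pi>\<^sub>M l\<in>{..<N}. D)
       in \<exists>h :: (nat \<Rightarrow> complex mat) \<Rightarrow> complex mat \<Rightarrow> real.
            (\<forall>\<omega>\<in>space M.
               learns train pred n k N \<epsilon> \<epsilon>' \<delta> Obs \<omega> (C3 * (real N * real n ^ k)) (h \<omega>)) \<and>
            measure M {\<omega> \<in> space M.
              integrable D (\<lambda>\<rho>. \<bar>h \<omega> \<rho> - expval Obs \<rho>\<bar>\<^sup>2) \<and>
              (LINT \<rho>|D. \<bar>h \<omega> \<rho> - expval Obs \<rho>\<bar>\<^sup>2)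
                \<le> (\<epsilon> + \<epsilon>') * (spectral_norm Obs)\<^sup>2
                  + \<epsilon>' * spectral_norm (truncated_observable n k \<alpha>) powr r
                       * spectral_norm Obs powr (2 - r)}
            \<ge> 1 - \<delta>))"
proof (rule exI[of _ training_program], rule exI[of _ prediction_program], rule exI[of _ 522], rule exI[of _ 60],
    rule exI[of _ 1302], intro conjI allI impI)
  fix n :: nat and \<epsilon> \<epsilon>' \<delta> :: real and \<alpha> :: "pauli list \<Rightarrow> real" and D :: "complex mat measure"
  assume n: "n \<ge> 2" and \<epsilon>: "0 < \<epsilon>" "\<epsilon> \<le> 1 / 4" and \<epsilon>': "0 < \<epsilon>'" "\<epsilon>' \<le> 1 / 4" and \<delta>: "0 < \<delta>"
    and D: "state_distribution n D" "clifford1_invariant n D"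
  interpret invariant_states n D by unfold_locales (fact D)+
  show "let k = cutoff_weight \<epsilon>;
           r = 2 * real k / (real k + 1);
           N = sample_size 522 60 n \<epsilon> \<epsilon>' \<delta>;
           Obs = observable n \<alpha>;
           M = (\<Pi>\<^sub>M l\<in>{..<N}. D)
       in \<exists>h :: (nat \<Rightarrow> complex mat) \<Rightarrow> complex mat \<Rightarrow> real.
            (\<forall>\<omega>\<in>space M.
               learns training_program prediction_program n k N \<epsilon> \<epsilon>' \<delta> Obs \<omega> (1302 * (real N * real n ^ k)) (h \<omega>)) \<and>
            measure M {\<omega> \<in> space M.
              integrable D (\<lambda>\<rho>. \<bar>h \<omega> \<rho> - expval Obs \<rho>\<bar>\<^sup>2) \<and>
              (LINT \<rho>|D. \<bar>h \<omega> \<rho> - expval Obs \<rho>\<bar>\<^sup>2)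
                \<le> (\<epsilon> + \<epsilon>') * (spectral_norm Obs)\<^sup>2
                  + \<epsilon>' * spectral_norm (truncated_observable n k \<alpha>) powr r
                       * spectral_norm Obs powr (2 - r)}
            \<ge> 1 - \<delta>"
  \<comment> \<open>For \<delta> at least \<open>1\<close> any function meets the error bound with
    the required probability, but the programs must still halt in time.\<close>
  proof (cases "\<delta> < 1")
    case True
    show ?thesis
      unfolding Let_def
    proof (rule learning_guarantee[OF n \<epsilon> \<epsilon>' \<delta> True, of \<alpha>], rule exI, rule conjI)
      fix h
      assume "\<And>\<omega>. learns training_program prediction_program n (cutoff_weight \<epsilon>) (sample_size 522 60 n \<epsilon> \<epsilon>' \<delta>) \<epsilon> \<epsilon>' \<delta>
        (observable n \<alpha>) \<omega> (1302 * (real (sample_size 522 60 n \<epsilon> \<epsilon>' \<delta>) * real n ^ cutoff_weight \<epsilon>)) (h \<omega>)"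
      then show "\<forall>\<omega>\<in>space (\<Pi>\<^sub>M l\<in>{..<sample_size 522 60 n \<epsilon> \<epsilon>' \<delta>}. D). learns training_program prediction_program n
        (cutoff_weight \<epsilon>) (sample_size 522 60 n \<epsilon> \<epsilon>' \<delta>) \<epsilon> \<epsilon>' \<delta>
        (observable n \<alpha>) \<omega> (1302 * (real (sample_size 522 60 n \<epsilon> \<epsilon>' \<delta>) * real n ^ cutoff_weight \<epsilon>)) (h \<omega>)" by blast
    qed
  next
    case False
    show ?thesis
      unfolding Let_def
    proof (intro exI[of _ "\<lambda>_ _. 0"] conjI ballI)
      show "learns training_program prediction_program n (cutoff_weight \<epsilon>) (sample_size 522 60 n \<epsilon> \<epsilon>' \<delta>) \<epsilon> \<epsilon>' \<delta> (observable n \<alpha>) \<omega>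
        (1302 * (real (sample_size 522 60 n \<epsilon> \<epsilon>' \<delta>) * real n ^ cutoff_weight \<epsilon>)) (\<lambda>_. 0)" for \<omega>
        using n False by (intro learns_trivial) (simp_all add: sample_size_def)
    qed (use False in \<open>auto intro: order_trans[OF _ measure_nonneg]\<close>)
  qed
qed simp_all

end
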